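(* Let $u$ be a weak solution of $\operatorname{div}\mathcal A(x,u,u_x)=\mathcal B(x,u,u_x)$ in $D$, where $\mathcal A,\mathcal B$ satisfy the structure conditions (S) and the coefficients satisfy the integrability conditions (I) of the context. Then one can redefine $u$ on a set of measure zero so that $u$ is continuous on $D$. Moreover, if $D'\subset D$ is compact, then there exist positive constants $\gamma,K,R$ such that if $x_0\in D'$, $x\in D$ and $0<|x-x_0|<R^2$, then $$|u(x)-u(x_0)|\le K\,\bigl|\log|x-x_0|\bigr|^{-\gamma}.$$
   Context: Let $n\ge 2$, let $D\subset\mathbb R^n$ be bounded, connected and open, and let $r$ satisfy $\frac{n-1}{n}<r<1$. $u_x$ denotes the gradient of $u$. $\mathcal A(x,u,p)\in\mathbb R^n$ and $\mathcal B(x,u,p)\in\mathbb R$ are defined for $x\in D$, $u\in\mathbb R$, $p\in\mathbb R^n$. (S) For all $x,u,p$: $|\mathcal A|\le a|p|^{n-1}+b|u|^{n-1}+e$, $\ |\mathcal B|\le c|p|^{n-1}+d|u|^{n-1}+f$, $\ p\cdot\mathcal A\ge |p|^n-d|u|^n-g$, where $a>0$ is a constant and $b,c,d,e,f,g$ are nonnegative functions of $x\in D$. (I) $b^{n/(n-1)},\,c^n,\,d,\,e^{n/(n-1)},\,f,\,g\in L\log^{(n-1)/r}L(D)$, the space of $V$ with $\int_D|V|\log^{(n-1)/r}(|V|+1)\,dx<\infty$. Weak solution: $u\in W^{1,n}(D)$ and $\int_D \phi_x\cdot\mathcal A(x,u,u_x)+\phi\,\mathcal B(x,u,u_x)\,dx=0$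 for all $\phi\in C_0^\infty(D)$ (it is part of the hypothesis that $\mathcal A(x,u,u_x),\mathcal B(x,u,u_x)$ are measurable and these integrals make sense). *)

theory Defs
  imports "HOL-Analysis.Analysis"
begin

definition partial_deriv :: "'n::finite \<Rightarrow> (real^'n \<Rightarrow> real) \<Rightarrow> real^'n \<Rightarrow> real" where
  "partial_deriv i f x = frechet_derivative f (at x) (axis i 1)"

definition grad :: "(real^'n::finite \<Rightarrow> real) \<Rightarrow> real^'n \<Rightarrow> real^'n" where
  "grad f x = (\<chi> i. partial_deriv i f x)"

text \<open>\<open>Ck k f\<close>: \<open>f\<close> is \<open>k\<close> times continuously differentiable on the whole space.\<close>

fun Ck :: "nat \<Rightarrow> (real^'n::finite \<Rightarrow> real) \<Rightarrow> bool" where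
  "Ck 0 f \<longleftrightarrow> continuous_on UNIV f"
| "Ck (Suc k) f \<longleftrightarrow> (\<forall>x. f differentiable (at x)) \<and> (\<forall>i. Ck k (partial_deriv i f))"

text \<open>The space of smooth functions with compact support in \<open>D\<close>; members are taken to be
  defined on the whole space, vanishing outside their support.\<close>

definition test_functions :: "(real^'n::finite) set \<Rightarrow> (real^'n \<Rightarrow> real) set" where
  "test_functions D = {\<phi>. (\<forall>k. Ck k \<phi>) \<and> compact (closure {x. \<phi> x \<noteq> 0})
                          \<and> closure {x. \<phi> x \<noteq> 0} \<subseteq> D}"

definition Lp_on :: "real \<Rightarrow> (real^'n::finite) set \<Rightarrow> (real^'n \<Rightarrow> 'b::euclidean_space) \<Rightarrow> bool" where
  "Lp_on p D f \<longleftrightarrow> f \<in> borel_measurable (lebesgue_on D)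
                 \<and> integrable (lebesgue_on D) (\<lambda>x. norm (f x) powr p)"

definition locally_integrable_on ::
    "(real^'n::finite) set \<Rightarrow> (real^'n \<Rightarrow> 'b::euclidean_space) \<Rightarrow> bool" where
  "locally_integrable_on D f \<longleftrightarrow> (\<forall>C. compact C \<and> C \<subseteq> D \<longrightarrow> integrable (lebesgue_on C) f)"

definition weak_gradient ::
    "(real^'n::finite) set \<Rightarrow> (real^'n \<Rightarrow> real) \<Rightarrow> (real^'n \<Rightarrow> real^'n) \<Rightarrow> bool" where
  "weak_gradient D u G \<longleftrightarrow> locally_integrable_on D u \<and> locally_integrable_on D G \<and>
     (\<forall>\<phi>\<in>test_functions D. \<forall>i.
        (LINT x|lebesgue_on D. u x * partial_deriv i \<phi> x)
          = - (LINT x|lebesgue_on D. G x $ i * \<phi> x))"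

text \<open>\<open>sobolev_with_gradient p D u G\<close>: \<open>u\<close> is (a representative of an element) in
  \<open>W\<^sup>1\<^sup>,\<^sup>p(D)\<close> and \<open>G\<close> is (a representative of) its weak gradient, which is determined
  up to a null set.\<close>

definition sobolev_with_gradient ::
    "real \<Rightarrow> (real^'n::finite) set \<Rightarrow> (real^'n \<Rightarrow> real) \<Rightarrow> (real^'n \<Rightarrow> real^'n) \<Rightarrow> bool" where
  "sobolev_with_gradient p D u G \<longleftrightarrow> Lp_on p D u \<and> Lp_on p D G \<and> weak_gradient D u G"

definition LlogL :: "real \<Rightarrow> (real^'n::finite) set \<Rightarrow> (real^'n \<Rightarrow> real) set" where
  "LlogL s D = {V. V \<in> borel_measurable (lebesgue_on D)
                   \<and> integrable (lebesgue_on D) (\<lambda>x. \<bar>V x\<bar> * ln (\<bar>V x\<bar> + 1) powr s)}"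

text \<open>Only the values of \<open>A\<close>, \<open>B\<close> and of the coefficients at points of \<open>D\<close> matter.
  The dimension \<open>n\<close> is \<open>CARD('n)\<close>.\<close>

definition structure_conditions ::
    "(real^'n::finite) set \<Rightarrow> (real^'n \<Rightarrow> real \<Rightarrow> real^'n \<Rightarrow> real^'n) \<Rightarrow>
     (real^'n \<Rightarrow> real \<Rightarrow> real^'n \<Rightarrow> real) \<Rightarrow> real \<Rightarrow>
     (real^'n \<Rightarrow> real) \<Rightarrow> (real^'n \<Rightarrow> real) \<Rightarrow> (real^'n \<Rightarrow> real) \<Rightarrow>
     (real^'n \<Rightarrow> real) \<Rightarrow> (real^'n \<Rightarrow> real) \<Rightarrow> (real^'n \<Rightarrow> real) \<Rightarrow> bool" where
  "structure_conditions D A B a b c d e f g \<longleftrightarrow>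
     a > 0 \<and>
     (\<forall>x\<in>D. 0 \<le> b x \<and> 0 \<le> c x \<and> 0 \<le> d x \<and> 0 \<le> e x \<and> 0 \<le> f x \<and> 0 \<le> g x) \<and>
     (\<forall>x\<in>D. \<forall>u p.
        norm (A x u p) \<le> a * norm p ^ (CARD('n) - 1) + b x * \<bar>u\<bar> ^ (CARD('n) - 1) + e x \<and>
        \<bar>B x u p\<bar> \<le> c x * norm p ^ (CARD('n) - 1) + d x * \<bar>u\<bar> ^ (CARD('n) - 1) + f x \<and>
        p \<bullet> A x u p \<ge> norm p ^ CARD('n) - d x * \<bar>u\<bar> ^ CARD('n) - g x)"

definition integrability_conditions ::
    "real \<Rightarrow> (real^'n::finite) set \<Rightarrow>
     (real^'n \<Rightarrow> real) \<Rightarrow> (real^'n \<Rightarrow> real) \<Rightarrow> (real^'n \<Rightarrow> real) \<Rightarrow>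
     (real^'n \<Rightarrow> real) \<Rightarrow> (real^'n \<Rightarrow> real) \<Rightarrow> (real^'n \<Rightarrow> real) \<Rightarrow> bool" where
  "integrability_conditions r D b c d e f g \<longleftrightarrow>
     (let n = real CARD('n); X = LlogL ((n - 1) / r) D in
        (\<lambda>x. b x powr (n / (n - 1))) \<in> X \<and> (\<lambda>x. c x powr n) \<in> X \<and> d \<in> X \<and>
        (\<lambda>x. e x powr (n / (n - 1))) \<in> X \<and> f \<in> X \<and> g \<in> X)"

definition weak_solution ::
    "(real^'n::finite) set \<Rightarrow> (real^'n \<Rightarrow> real \<Rightarrow> real^'n \<Rightarrow> real^'n) \<Rightarrow>
     (real^'n \<Rightarrow> real \<Rightarrow> real^'n \<Rightarrow> real) \<Rightarrow> (real^'n \<Rightarrow> real) \<Rightarrow> bool" where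
  "weak_solution D A B u \<longleftrightarrow>
     (\<exists>G. sobolev_with_gradient (real CARD('n)) D u G \<and>
          (\<lambda>x. A x (u x) (G x)) \<in> borel_measurable (lebesgue_on D) \<and>
          (\<lambda>x. B x (u x) (G x)) \<in> borel_measurable (lebesgue_on D) \<and>
          (\<forall>\<phi>\<in>test_functions D.
             integrable (lebesgue_on D)
               (\<lambda>x. grad \<phi> x \<bullet> A x (u x) (G x) + \<phi> x * B x (u x) (G x)) \<and>
             (LINT x|lebesgue_on D.
                grad \<phi> x \<bullet> A x (u x) (G x) + \<phi> x * B x (u x) (G x)) = 0))"

end

theory Submission
  imports Defs "HOL-Analysis.Analysis" "HOL-Computational_Algebra.Polynomial"
begin

text \<open>
  Write \<open>n = Suc m\<close> for the dimension and fix \<open>m < \<sigma> < m / r\<close>. Everything rests on the weight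
  \<open>L(t) = (1 + log (1/t))\<^sup>\<sigma>\<close>, taken to be \<open>1\<close> for \<open>t \<ge> 1\<close>. Since \<open>\<sigma> > n - 1\<close>, writing \<open>w z - w x\<close> as a line integral
  and applying Hoelder's inequality with weight \<open>t\<^sup>m L(t)\<close> bounds the integral of \<open>|w z - w x|\<^sup>n\<close> over \<open>z\<close> in a
  convex set of diameter \<open>d\<close> by \<open>d\<^sup>n\<close> times that of \<open>|Dw(y)|\<^sup>n L(|y - x| / d)\<close>. This yields
  Poincare inequalities against measures \<open>V dx\<close> whose \<open>L\<close>-potential is small, which is what
  \<open>\<sigma> < (n - 1) / r\<close> gives for the majorant \<open>V\<close> of the coefficients.

  The Caccioppoli inequality, with test function \<open>\<eta> (u - c)\<close> and \<open>c\<close> a mean over the annulus, can then be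
  hole-filled on dyadic cubes, but the zeroth-order terms leave the error \<open>(1 + |c|\<^sup>n)\<close> times the mass of \<open>V\<close>.
  The means drift by at most the energy of neighbouring annuli, and since the masses are summable
  against \<open>k\<^sup>\<sigma>\<^sup>-\<^sup>1\<close>, this error can be absorbed; the outcome is a bound, uniform for \<open>x\<close> in compact sets, on
  the integral of \<open>|Du|\<^sup>n L(|y - x|)\<close>. Inserting it into the kernel inequality, with an exponent
  \<open>\<sigma>' < \<sigma>\<close> there, gains the factor \<open>(log (1/d))\<^sup>\<sigma>\<^sup>'\<^sup>-\<^sup>\<sigma>\<close>, i.e. a logarithmic modulus of continuity off a null set.
\<close>

section \<open>Smooth functions\<close>

text \<open>The exponent n is borderline in dimension n: bounded energy does not control point
  values, and the geometric decay that hole filling would give is spoiled by sources that are only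
  logarithmically integrable, so every estimate carries powers of the logarithm. The condition
  \<open>m < \<sigma>\<close> is exactly the convergence at 0 of the integral of
  \<open>1 / (t * L(t) powr (1 / m))\<close>, and of its discrete form, the sum of
  \<open>k powr (- \<sigma> / m)\<close>; r < 1 makes room for such a \<sigma> below m / r. The
  discrete form also closes the absorption: by Hoelder the drift of the means is at most a tail of
  that sum times the very weighted energy being estimated, and the tail is small if the first scale
  is small. Only smooth test functions are allowed, so u is replaced by smooth approximations; these
  must converge in the V-weighted norm as well, which is a second use of the Poincare inequality
  against V. Cubes replace balls because a cubical annulus is a finite union of boxes, and the
  kernel inequality needs convexity.\<close>

lemma partial_deriv_eq: "(f has_derivative f') (at x) \<Longrightarrow> partial_deriv i f x = f' (axis i 1)"
  by (simp add: partial_deriv_def frechet_derivative_at[symmetric])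

lemma Ck_imp_continuous: "Ck k f \<Longrightarrow> continuous_on UNIV f"
  by (cases k) (auto intro!: continuous_at_imp_continuous_on differentiable_imp_continuous_within)

lemma Ck_Suc_imp: "Ck (Suc k) f \<Longrightarrow> Ck k f"
proof (induction k arbitrary: f)
  case 0 then show ?case using Ck_imp_continuous[of "Suc 0" f] by simp
next
  case (Suc k) then show ?case by simp
qed

lemma has_derivative_partial:
  assumes "(f::real^'n::finite \<Rightarrow> real) differentiable (at x)"
  shows "(f has_derivative (\<lambda>h. \<Sum>i\<in>UNIV. h $ i * partial_deriv i f x)) (at x)"
proof -
  let ?f' = "frechet_derivative f (at x)"
  have d: "(f has_derivative ?f') (at x)" using assms by (simp add: frechet_derivative_works)
  interpret bounded_linear ?f' using d by (rule has_derivative_bounded_linear)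
  have "?f' h = (\<Sum>i\<in>UNIV. h $ i * partial_deriv i f x)" for h
  proof -
    have "h = (\<Sum>i\<in>UNIV. h $ i *\<^sub>R axis i 1)"
      by (metis basis_expansion scalar_mult_eq_scaleR)
    then have "?f' h = ?f' (\<Sum>i\<in>UNIV. h $ i *\<^sub>R axis i 1)" by simp
    also have "\<dots> = (\<Sum>i\<in>UNIV. h $ i * ?f' (axis i 1))" by (simp add: sum scale)
    finally show ?thesis by (simp add: partial_deriv_def)
  qed
  then have "?f' = (\<lambda>h. \<Sum>i\<in>UNIV. h $ i * partial_deriv i f x)" by auto
  then show ?thesis using d by simp
qed

lemma has_derivative_grad:
  assumes "(f::real^'n::finite \<Rightarrow> real) differentiable (at x)"
  shows "(f has_derivative (\<lambda>h. grad f x \<bullet> h)) (at x)"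
  using has_derivative_partial[OF assms]
  by (simp add: grad_def inner_vec_def mult.commute)

lemma grad_component [simp]: "grad f x $ i = partial_deriv i f x"
  by (simp add: grad_def)

lemma Ck_const: "Ck k (\<lambda>x::real^'n::finite. c)"
proof (induction k arbitrary: c)
  case (Suc k)
  have "partial_deriv i (\<lambda>x::real^'n. c) = (\<lambda>x. 0)" for i
    by (rule ext, subst partial_deriv_eq) (auto intro: has_derivative_const)
  then show ?case using Suc by simp
qed simp

lemma partial_deriv_add:
  assumes "f differentiable (at x)" "g differentiable (at x)"
  shows "partial_deriv i (\<lambda>x. f x + g x) x = partial_deriv i f x + partial_deriv i g x"
  using partial_deriv_eq[OF has_derivative_add[OF assms[unfolded frechet_derivative_works]]]
  by (simp add: partial_deriv_def)

lemma partial_deriv_mult: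
  fixes f g :: "real^'n::finite \<Rightarrow> real"
  assumes "f differentiable (at x)" "g differentiable (at x)"
  shows "partial_deriv i (\<lambda>x. f x * g x) x = f x * partial_deriv i g x + partial_deriv i f x * g x"
  using partial_deriv_eq[OF has_derivative_mult[OF assms[unfolded frechet_derivative_works]]]
  by (simp add: partial_deriv_def)

lemma Ck_add: "Ck k f \<Longrightarrow> Ck k g \<Longrightarrow> Ck k (\<lambda>x::real^'n::finite. f x + g x)"
proof (induction k arbitrary: f g)
  case 0 then show ?case by (auto intro: continuous_intros)
next
  case (Suc k)
  have "partial_deriv i (\<lambda>x. f x + g x) = (\<lambda>x. partial_deriv i f x + partial_deriv i g x)" for i
    using Suc.prems by (auto simp: partial_deriv_add)
  then show ?case using Suc by auto
qed

lemma Ck_mult: "Ck k f \<Longrightarrow> Ck k g \<Longrightarrow> Ck k (\<lambda>x::real^'n::finite. f x * g x)"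
proof (induction k arbitrary: f g)
  case 0 then show ?case by (auto intro: continuous_intros)
next
  case (Suc k)
  have "partial_deriv i (\<lambda>x. f x * g x) = (\<lambda>x. f x * partial_deriv i g x + partial_deriv i f x * g x)" for i
    using Suc.prems by (auto simp: partial_deriv_mult)
  moreover have "Ck k (\<lambda>x. f x * partial_deriv i g x + partial_deriv i f x * g x)" for i
    using Suc.prems by (intro Ck_add Suc.IH) (auto intro: Ck_Suc_imp[of k, unfolded Ck.simps])
  ultimately show ?case using Suc.prems by auto
qed

lemma Ck_diff: "Ck k f \<Longrightarrow> Ck k g \<Longrightarrow> Ck k (\<lambda>x::real^'n::finite. f x - g x)"
  using Ck_add[of k f "\<lambda>x. -1 * g x"] Ck_mult[OF Ck_const[of k "-1"], of g] by simp

lemma Ck_prod: "finite I \<Longrightarrow> (\<And>i. i \<in> I \<Longrightarrow> Ck k (f i)) \<Longrightarrow> Ck k (\<lambda>x::real^'n::finite. \<Prod>i\<in>I. f i x)"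
  by (induction rule: finite_induct) (auto intro: Ck_const Ck_mult)

lemma partial_deriv_affine:
  fixes f :: "real^'n::finite \<Rightarrow> real"
  assumes "f differentiable (at (s *\<^sub>R x + b))"
  shows "partial_deriv i (\<lambda>x. f (s *\<^sub>R x + b)) x = s * partial_deriv i f (s *\<^sub>R x + b)"
    and "(\<lambda>x. f (s *\<^sub>R x + b)) differentiable (at x)"
proof -
  let ?f' = "frechet_derivative f (at (s *\<^sub>R x + b))"
  have f: "(f has_derivative ?f') (at (s *\<^sub>R x + b))"
    using assms by (simp add: frechet_derivative_works)
  have g: "((\<lambda>x. s *\<^sub>R x + b) has_derivative (\<lambda>h. s *\<^sub>R h)) (at x)"
    by (auto intro!: derivative_eq_intros)
  have c: "((\<lambda>x. f (s *\<^sub>R x + b)) has_derivative (\<lambda>h. ?f' (s *\<^sub>R h))) (at x)"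
    by (rule has_derivative_compose[OF g f])
  then show "(\<lambda>x. f (s *\<^sub>R x + b)) differentiable (at x)" by (auto simp: differentiable_def)
  show "partial_deriv i (\<lambda>x. f (s *\<^sub>R x + b)) x = s * partial_deriv i f (s *\<^sub>R x + b)"
    using partial_deriv_eq[OF c]
      linear_scale[OF bounded_linear.linear[OF has_derivative_bounded_linear[OF f]]]
    by (simp add: partial_deriv_def)
qed

lemma Ck_affine: "Ck k f \<Longrightarrow> Ck k (\<lambda>x::real^'n::finite. f (s *\<^sub>R x + b))"
proof (induction k arbitrary: f)
  case 0 then show ?case
    by (auto intro!: continuous_on_compose2[of UNIV f] continuous_intros)
next
  case (Suc k)
  have "partial_deriv i (\<lambda>x. f (s *\<^sub>R x + b)) = (\<lambda>x. s * partial_deriv i f (s *\<^sub>R x + b))" for i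
    using Suc.prems by (auto simp: partial_deriv_affine)
  then show ?case using Suc by (auto intro: Ck_mult Ck_const partial_deriv_affine(2))
qed

text \<open>Differentiation only moves the index of the family \<open>F\<close> up by one and
  multiplies by a constant, so the induction on \<open>k\<close> closes when all members
  \<open>F m\<close> are treated together.\<close>

lemma Ck_coord:
  assumes "\<And>k t. (F k has_real_derivative F (Suc k) t) (at t)"
  shows "Ck k (\<lambda>x::real^'n::finite. F m (a + b * x $ i))"
proof (induction k arbitrary: m)
  case 0
  have "continuous_on UNIV (F m)"
    using assms by (auto intro!: continuous_at_imp_continuous_on DERIV_isCont)
  then show ?case by (auto intro!: continuous_on_compose2[of UNIV "F m"] continuous_intros)
next
  case (Suc k)
  have d: "((\<lambda>x::real^'n. F m (a + b * x $ i)) has_derivative (\<lambda>h. (b * h $ i) * F (Suc m) (a + b * x $ i))) (at x)" for x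
    by (rule has_derivative_compose[OF _ assms[of m, THEN has_field_derivative_imp_has_derivative], THEN has_derivative_eq_rhs])
       (auto intro!: derivative_eq_intros bounded_linear_imp_has_derivative bounded_linear_vec_nth simp: fun_eq_iff)
  have "partial_deriv j (\<lambda>x::real^'n. F m (a + b * x $ i)) = (\<lambda>x. (b * axis j 1 $ i) * F (Suc m) (a + b * x $ i))" for j
    by (rule ext) (rule partial_deriv_eq[OF d])
  then show ?case using Suc d by (auto simp: differentiable_def intro!: Ck_mult Ck_const)
qed

section \<open>A smooth bump function built from exp (- 1 / t)\<close>

lemma poly_exp_tendsto_0: "((\<lambda>y::real. poly p y * exp (- y)) \<longlongrightarrow> 0) at_top"
proof -
  have "((\<lambda>y. \<Sum>i\<le>degree p. coeff p i * (y ^ i / exp y)) \<longlongrightarrow> (\<Sum>i\<le>degree p. coeff p i * 0)) at_top"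
    by (intro tendsto_intros tendsto_power_div_exp_0)
  moreover have "(\<lambda>y::real. \<Sum>i\<le>degree p. coeff p i * (y ^ i / exp y)) = (\<lambda>y. poly p y * exp (- y))"
    by (simp add: poly_altdef sum_distrib_right exp_minus divide_inverse mult.assoc)
  ultimately show ?thesis by simp
qed

lemma exp_inverse_smooth:
  obtains F :: "nat \<Rightarrow> real \<Rightarrow> real" where
    "\<And>k t. (F k has_real_derivative F (Suc k) t) (at t)"
    "\<And>t. F 0 t = (if t \<le> 0 then 0 else exp (- (1 / t)))"
proof -
  \<comment> \<open>For t > 0 the k-th derivative is \<open>p k\<close> at 1 / t times exp (- 1 /
    t). Differentiating q(1 / t) exp (- 1 / t) gives the factor 1 / t^2 times (q - q')(1 / t), hence
    the recursion; \<open>[:0,0,1:]\<close> is X^2.\<close>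
  define p :: "nat \<Rightarrow> real poly" where "p = rec_nat 1 (\<lambda>_ q. [:0,0,1:] * (q - pderiv q))"
  have p0: "p 0 = 1" and pS: "p (Suc k) = [:0,0,1:] * (p k - pderiv (p k))" for k
    by (simp_all add: p_def)
  define F where "F = (\<lambda>k t::real. if t \<le> 0 then 0 else poly (p k) (1/t) * exp (- (1/t)))"
  have "(F k has_real_derivative F (Suc k) t) (at t)" for k t
  proof -
    consider "t < 0" | "t = 0" | "t > 0" by linarith
    then show ?thesis
    proof cases
      case 1
      have "((\<lambda>_. 0) has_real_derivative F (Suc k) t) (at t)" using 1 by (simp add: F_def)
      moreover have "eventually (\<lambda>x. x < 0) (nhds t)"
        using 1 by (intro eventually_nhds_in_open[of "{..<0}", simplified]) auto
      then have "eventually (\<lambda>x. 0 = F k x) (nhds t)" by eventually_elim (simp add: F_def)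
      ultimately show ?thesis by (subst (asm) DERIV_cong_ev[OF refl _ refl]) auto
    next
      case 3
      have "((\<lambda>x. poly (p k) (1/x) * exp (- (1/x))) has_real_derivative F (Suc k) t) (at t)"
        using 3 by (auto intro!: derivative_eq_intros DERIV_chain2[OF poly_DERIV]
            simp: F_def pS power2_eq_square field_simps)
      moreover have "eventually (\<lambda>x. x > 0) (nhds t)"
        using 3 by (intro eventually_nhds_in_open[of "{0<..}", simplified]) auto
      then have "eventually (\<lambda>x. poly (p k) (1/x) * exp (- (1/x)) = F k x) (nhds t)"
        by eventually_elim (simp add: F_def)
      ultimately show ?thesis by (subst (asm) DERIV_cong_ev[OF refl _ refl]) auto
    next
      case 2
      \<comment> \<open>The right difference quotient at 0 is again of this form: dividing by x
        multiplies the polynomial by X = \<open>[:0,1:]\<close>.\<close>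
      have "((\<lambda>x. poly ([:0,1:] * p k) (inverse x) * exp (- inverse x)) \<longlongrightarrow> 0) (at_right 0)"
        by (rule filterlim_compose[OF poly_exp_tendsto_0 filterlim_inverse_at_top_right])
      then have "((\<lambda>x. F k x / x) \<longlongrightarrow> 0) (at_right 0)"
        by (rule Lim_transform_eventually)
           (auto simp: eventually_at_right_field F_def field_simps intro!: exI[of _ 1])
      moreover have "((\<lambda>x. F k x / x) \<longlongrightarrow> 0) (at_left 0)"
        by (rule Lim_transform_eventually[OF tendsto_const])
           (auto simp: eventually_at_left_field F_def field_simps intro!: exI[of _ "-1"])
      ultimately have "((\<lambda>x. F k x / x) \<longlongrightarrow> 0) (at 0)"
        by (rule filterlim_split_at[rotated])
      then show ?thesis using 2 by (simp add: has_field_derivative_iff F_def)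
    qed
  qed
  moreover have "F 0 t = (if t \<le> 0 then 0 else exp (- (1 / t)))" for t
    by (simp add: F_def p0)
  ultimately show ?thesis using that by blast
qed

lemma bump_exists:
  obtains \<psi> :: "real^'n::finite \<Rightarrow> real" where
    "\<And>k. Ck k \<psi>" "\<And>x. 0 \<le> \<psi> x" "0 < \<psi> 0" "\<And>x. 1 \<le> norm x \<Longrightarrow> \<psi> x = 0"
proof -
  obtain F :: "nat \<Rightarrow> real \<Rightarrow> real" where
    F: "\<And>k t. (F k has_real_derivative F (Suc k) t) (at t)"
    "\<And>t. F 0 t = (if t \<le> 0 then 0 else exp (- (1 / t)))"
    using exp_inverse_smooth by metis
  let ?N = "real CARD('n)"
  \<comment> \<open>Both factors of index i are nonzero exactly when
    \<open>\<bar>x $ i\<bar> < 1 / ?N\<close>; the cube so described lies in the open unit ball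
    because the Euclidean norm is at most the sum of the coordinates in absolute value.\<close>
  define \<psi> :: "real^'n \<Rightarrow> real" where
    "\<psi> x = (\<Prod>i\<in>UNIV. F 0 (1 + ?N * x $ i) * F 0 (1 + (- ?N) * x $ i))" for x
  have "Ck k \<psi>" for k
    unfolding \<psi>_def by (intro Ck_prod Ck_mult Ck_coord[where F=F] F) auto
  moreover have "0 \<le> \<psi> x" for x unfolding \<psi>_def by (intro prod_nonneg) (auto simp: F)
  moreover have "0 < \<psi> 0" unfolding \<psi>_def by (intro prod_pos) (auto simp: F)
  moreover have "\<psi> x = 0" if "1 \<le> norm x" for x
  proof -
    have "\<exists>i. ?N * \<bar>x $ i\<bar> \<ge> 1"
    proof (rule ccontr)
      assume "\<not> ?thesis"
      then have "\<bar>x $ i\<bar> < 1 / ?N" for i by (simp add: field_simps not_le)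
      then have "(\<Sum>i\<in>UNIV. \<bar>x $ i\<bar>) < (\<Sum>i\<in>(UNIV::'n set). 1 / ?N)"
        by (intro sum_strict_mono) auto
      then show False using norm_le_l1_cart[of x] that by simp
    qed
    then obtain i where "?N * \<bar>x $ i\<bar> \<ge> 1" by blast
    then have "F 0 (1 + ?N * x $ i) * F 0 (1 + (- ?N) * x $ i) = 0"
      by (cases "x $ i \<ge> 0") (auto simp: F)
    then show ?thesis unfolding \<psi>_def by (intro prod_zero) auto
  qed
  ultimately show ?thesis using that by blast
qed

section \<open>Mollification\<close>

text \<open>One of the two terms on the right dominates according to whether x is below or above t
  z. The constants are not sharp, but only natural powers occur and t stays free for absorption
  arguments.\<close>

lemma power_Young:
  fixes x z t :: real
  assumes "0 \<le> x" "0 \<le> z" "0 < t"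
  shows "x * z ^ n \<le> t * z ^ Suc n + x ^ Suc n / t ^ n"
proof (cases "x \<le> t * z")
  case True
  have "x * z ^ n \<le> (t * z) * z ^ n" using True assms by (intro mult_right_mono) auto
  moreover have "0 \<le> x ^ Suc n / t ^ n" using assms by simp
  ultimately show ?thesis by (simp add: algebra_simps)
next
  case False
  then have "z \<le> x / t" using assms by (simp add: field_simps)
  then have "z ^ n \<le> (x / t) ^ n" using assms by (intro power_mono) auto
  then have "x * z ^ n \<le> x * (x / t) ^ n" using assms by (intro mult_left_mono) auto
  moreover have "x * (x / t) ^ n = x ^ Suc n / t ^ n" by (simp add: power_divide)
  moreover have "0 \<le> t * z ^ Suc n" using assms by simp
  ultimately show ?thesis by linarith
qed

lemma nn_integral_Holder:
  fixes \<phi> m :: "'a \<Rightarrow> real"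
  assumes meas[measurable]: "\<phi> \<in> borel_measurable M" "m \<in> borel_measurable M"
    and nonneg: "\<And>x. x \<in> space M \<Longrightarrow> 0 \<le> \<phi> x" "\<And>x. x \<in> space M \<Longrightarrow> 0 \<le> m x"
    and J: "(\<integral>\<^sup>+x. m x \<partial>M) \<le> ennreal J" and "0 < J"
  shows "(\<integral>\<^sup>+x. \<phi> x * m x \<partial>M) ^ Suc n \<le> ennreal (2 ^ Suc n * J ^ n) * (\<integral>\<^sup>+x. \<phi> x ^ Suc n * m x \<partial>M)"
proof (cases "(\<integral>\<^sup>+x. \<phi> x ^ Suc n * m x \<partial>M) = \<infinity>")
  case True
  then show ?thesis using \<open>0 < J\<close> by (simp add: ennreal_mult_top)
next
  case False
  define A where "A = enn2real (\<integral>\<^sup>+x. \<phi> x ^ Suc n * m x \<partial>M)"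
  have A: "(\<integral>\<^sup>+x. \<phi> x ^ Suc n * m x \<partial>M) = ennreal A" "0 \<le> A"
    using False by (simp_all add: A_def less_top)
  have key: "(\<integral>\<^sup>+x. \<phi> x * m x \<partial>M) \<le> ennreal (t * J + A / t ^ n)" if "0 < t" for t
  proof -
    have "(\<integral>\<^sup>+x. \<phi> x * m x \<partial>M) \<le> (\<integral>\<^sup>+x. ennreal t * m x + ennreal (1 / t ^ n) * (\<phi> x ^ Suc n * m x) \<partial>M)"
    proof (rule nn_integral_mono)
      fix x assume x: "x \<in> space M"
      have "\<phi> x * m x \<le> (t + \<phi> x ^ Suc n / t ^ n) * m x"
        using power_Young[of "\<phi> x" 1 t n] nonneg[OF x] that by (intro mult_right_mono) auto
      also have "\<dots> = t * m x + (1 / t ^ n) * (\<phi> x ^ Suc n * m x)" by (simp add: field_simps)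
      finally have "ennreal (\<phi> x * m x) \<le> ennreal (t * m x + (1 / t ^ n) * (\<phi> x ^ Suc n * m x))"
        by (rule ennreal_leI)
      also have "\<dots> = ennreal t * m x + ennreal (1 / t ^ n) * (\<phi> x ^ Suc n * m x)"
        using nonneg[OF x] that
        by (subst ennreal_plus) (auto simp: ennreal_mult simp flip: ennreal_mult)
      finally show "ennreal (\<phi> x * m x) \<le> \<dots>" .
    qed
    also have "\<dots> = ennreal t * (\<integral>\<^sup>+x. m x \<partial>M) + ennreal (1 / t ^ n) * ennreal A"
      by (subst nn_integral_add) (simp_all add: nn_integral_cmult A[unfolded power_Suc])
    also have "\<dots> \<le> ennreal t * ennreal J + ennreal (1 / t ^ n) * ennreal A"
      using J by (intro add_mono mult_left_mono) auto
    also have "\<dots> = ennreal (t * J + A / t ^ n)"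
      using that A \<open>0 < J\<close> by (simp add: ennreal_mult[symmetric] ennreal_plus[symmetric] del: ennreal_plus)
    finally show ?thesis .
  qed
  show ?thesis
  proof (cases "A = 0")
    case True
    have "(\<integral>\<^sup>+x. \<phi> x * m x \<partial>M) \<le> ennreal e" if "0 < e" for e
      using key[of "e / J"] that \<open>0 < J\<close> True by simp
    then have "(\<integral>\<^sup>+x. \<phi> x * m x \<partial>M) = 0"
      by (metis ennreal_le_epsilon add.left_neutral le_zero_eq zero_less_one)
    then show ?thesis by simp
  next
    case False
    \<comment> \<open>This value balances the two terms \<open>t * J\<close> and
      \<open>A / t ^ n\<close>. It would be 0 for A = 0, which is why that case was treated by
      letting t tend to 0.\<close>
    define t where "t = root (Suc n) (A / J)"
    have t: "0 < t" "t ^ Suc n = A / J"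
      using A False \<open>0 < J\<close> real_root_pow_pos2[of "Suc n" "A / J"] by (auto simp: t_def simp del: power_Suc)
    have "A = J * t ^ Suc n" using t \<open>0 < J\<close> by simp
    then have "A / t ^ n = t * J" using t(1) by (simp add: field_simps)
    then have "(\<integral>\<^sup>+x. \<phi> x * m x \<partial>M) \<le> ennreal (2 * t * J)"
      using key[OF t(1)] by (simp add: mult_ac)
    then have "(\<integral>\<^sup>+x. \<phi> x * m x \<partial>M) ^ Suc n \<le> ennreal (2 * t * J) ^ Suc n"
      by (rule power_mono) simp
    also have "\<dots> = ennreal ((2 * t * J) ^ Suc n)" using t \<open>0 < J\<close> by (subst ennreal_power) auto
    also have "(2 * t * J) ^ Suc n = (2 ^ Suc n * J ^ n) * A"
      using t \<open>A = J * t ^ Suc n\<close> by (simp add: power_mult_distrib)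
    finally show ?thesis using A \<open>0 < J\<close> by (simp add: ennreal_mult)
  qed
qed

definition mollifier :: "real \<Rightarrow> (real^'n::finite \<Rightarrow> real) \<Rightarrow> bool" where
  "mollifier r \<psi> \<longleftrightarrow> (\<forall>k. Ck k \<psi>) \<and> (\<forall>x. 0 \<le> \<psi> x) \<and> (\<forall>x. r < norm x \<longrightarrow> \<psi> x = 0)
     \<and> (\<integral>\<^sup>+x. \<psi> x \<partial>lborel) = 1"

lemma Ck_measurable: "Ck k f \<Longrightarrow> f \<in> borel_measurable borel"
  using Ck_imp_continuous borel_measurable_continuous_onI by blast

lemma compact_support_bounded:
  fixes \<psi> :: "real^'n::finite \<Rightarrow> real"
  assumes "continuous_on UNIV \<psi>" "\<And>x. r < norm x \<Longrightarrow> \<psi> x = 0"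
  obtains C where "0 < C" "\<And>x. \<bar>\<psi> x\<bar> \<le> C"
proof -
  have "bounded (\<psi> ` cball 0 r)"
    using assms(1) by (intro compact_imp_bounded compact_continuous_image) (auto intro: continuous_on_subset)
  then obtain C where C: "0 < C" "\<And>x. x \<in> cball 0 r \<Longrightarrow> \<bar>\<psi> x\<bar> \<le> C"
    by (auto simp: bounded_pos)
  have "\<bar>\<psi> x\<bar> \<le> C" for x
    using C assms(2)[of x] by (cases "norm x \<le> r") auto
  then show ?thesis using that C by blast
qed

lemma mollifier_exists:
  assumes "0 < r"
  obtains \<psi> :: "real^'n::finite \<Rightarrow> real" where "mollifier r \<psi>"
proof -
  obtain \<psi> :: "real^'n \<Rightarrow> real" where psi: "\<And>k. Ck k \<psi>" "\<And>x. 0 \<le> \<psi> x" "0 < \<psi> 0"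
    "\<And>x. 1 \<le> norm x \<Longrightarrow> \<psi> x = 0" using bump_exists by metis
  define \<phi> where "\<phi> x = \<psi> ((1/r) *\<^sub>R x + 0)" for x
  have phi: "\<And>k. Ck k \<phi>" unfolding \<phi>_def by (intro Ck_affine psi)
  have cont: "continuous_on UNIV \<phi>" using phi Ck_imp_continuous by blast
  have phi0: "\<phi> x = 0" if "r < norm x" for x
    using that psi(4) assms unfolding \<phi>_def by (auto simp: field_simps)
  have nn: "0 \<le> \<phi> x" for x using psi by (simp add: \<phi>_def)
  obtain C where C: "0 < C" "\<And>x. \<bar>\<phi> x\<bar> \<le> C" using compact_support_bounded[OF cont phi0] by blast
  have m [measurable]: "\<phi> \<in> borel_measurable borel" using phi by (rule Ck_measurable)
  have "(\<integral>\<^sup>+x. \<phi> x \<partial>lborel) \<le> (\<integral>\<^sup>+x. ennreal C * indicator (cball (0::real^'n) r) x \<partial>lborel)"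
  proof (rule nn_integral_mono)
    fix x
    show "ennreal (\<phi> x) \<le> ennreal C * indicator (cball 0 r) x"
      using C(2)[of x] phi0[of x] by (cases "norm x \<le> r") (auto intro!: ennreal_leI)
  qed
  also have "\<dots> < \<infinity>" using emeasure_compact_finite[of "cball (0::real^'n) r"]
    by (subst nn_integral_cmult_indicator) (auto simp: ennreal_mult_less_top)
  finally have fin: "(\<integral>\<^sup>+x. \<phi> x \<partial>lborel) < \<infinity>" .
  have pos: "(\<integral>\<^sup>+x. \<phi> x \<partial>lborel) \<noteq> 0"
  proof
    assume "(\<integral>\<^sup>+x. \<phi> x \<partial>lborel) = 0"
    then have "AE x in lborel. \<phi> x = 0" using nn
      by (subst (asm) nn_integral_0_iff_AE) (auto elim!: eventually_mono simp: antisym)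
    then have e0: "emeasure lborel {x. \<phi> x \<noteq> 0} = 0"
      by (subst (asm) AE_iff_measurable[OF _ refl]) auto
    have "open {x. \<phi> x \<noteq> 0}" using cont
      by (intro open_Collect_neq continuous_on_const) auto
    moreover have "0 \<in> {x. \<phi> x \<noteq> 0}" using psi by (simp add: \<phi>_def)
    ultimately obtain e where "e > 0" "ball 0 e \<subseteq> {x. \<phi> x \<noteq> 0}" by (meson openE)
    then have "emeasure lborel (ball (0::real^'n) e) \<le> 0"
      using e0 emeasure_mono[of "ball 0 e" "{x. \<phi> x \<noteq> 0}" lborel] by auto
    then show False using content_ball_pos[OF \<open>e > 0\<close>, of "0::real^'n"] by (auto simp: measure_def)
  qed
  define I where "I = enn2real (\<integral>\<^sup>+x. \<phi> x \<partial>lborel)"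
  have I: "(\<integral>\<^sup>+x. \<phi> x \<partial>lborel) = ennreal I" "0 < I"
    using fin pos by (auto simp: I_def enn2real_positive_iff less_top zero_less_iff_neq_zero)
  have "mollifier r (\<lambda>x. (1/I) * \<phi> x)"
    unfolding mollifier_def
  proof (intro conjI allI impI)
    show "Ck k (\<lambda>x. (1/I) * \<phi> x)" for k by (intro Ck_mult Ck_const phi)
    have "(\<integral>\<^sup>+x. (1/I) * \<phi> x \<partial>lborel) = ennreal (1/I) * ennreal I"
      using I nn by (subst I(1)[symmetric], subst nn_integral_cmult[symmetric]) (auto simp flip: ennreal_mult)
    then show "(\<integral>\<^sup>+x. (1/I) * \<phi> x \<partial>lborel) = 1" using I by (simp flip: ennreal_mult)
  qed (use nn phi0 I in auto)
  then show ?thesis using that by blast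
qed

section \<open>Convolution with a smooth kernel and its derivatives\<close>

definition conv :: "(real^'n::finite \<Rightarrow> real) \<Rightarrow> (real^'n \<Rightarrow> real) \<Rightarrow> real^'n \<Rightarrow> real" where
  "conv f \<psi> x = (\<integral>y. f y * \<psi> (x - y) \<partial>lborel)"

lemma integrable_conv:
  fixes f \<psi> :: "real^'n::finite \<Rightarrow> real"
  assumes "integrable lborel f" "continuous_on UNIV \<psi>" "\<And>x. \<bar>\<psi> x\<bar> \<le> C"
  shows "integrable lborel (\<lambda>y. f y * \<psi> (x - y))"
proof (rule Bochner_Integration.integrable_bound[where f="\<lambda>y. C * \<bar>f y\<bar>"])
  have [measurable]: "\<psi> \<in> borel_measurable borel" "f \<in> borel_measurable borel"
    using assms by (auto intro: borel_measurable_continuous_onI)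
  show "(\<lambda>y. f y * \<psi> (x - y)) \<in> borel_measurable lborel" by measurable
  show "integrable lborel (\<lambda>y. C * \<bar>f y\<bar>)" using assms by auto
  have "\<bar>f y\<bar> * \<bar>\<psi> (x - y)\<bar> \<le> C * \<bar>f y\<bar>" for y
    using mult_left_mono[OF assms(3)[of "x - y"], of "\<bar>f y\<bar>"] by (simp add: mult.commute)
  moreover have "0 \<le> C" using assms(3)[of 0] by linarith
  ultimately show "AE y in lborel. norm (f y * \<psi> (x - y)) \<le> norm (C * \<bar>f y\<bar>)"
    by (auto simp: abs_mult intro!: AE_I2 order_trans[OF _ abs_ge_self])
qed

text \<open>The gradient is continuous with compact support, hence uniformly continuous, so the
  first-order remainder is uniform in x. This allows the derivative of a convolution to be read off
  from its definition, with the remainder integrated against |f|.\<close>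

lemma compact_support_uniform_derivative:
  fixes \<psi> :: "real^'n::finite \<Rightarrow> real"
  assumes Ck: "Ck 1 \<psi>" and supp: "\<And>x. r < norm x \<Longrightarrow> \<psi> x = 0" and "0 < e"
  obtains \<delta> where "0 < \<delta>"
    "\<And>x h. norm h < \<delta> \<Longrightarrow> \<bar>\<psi> (x + h) - \<psi> x - grad \<psi> x \<bullet> h\<bar> \<le> e * norm h"
proof -
  have diff: "\<psi> differentiable (at x)" for x using Ck by simp
  have cg: "continuous_on UNIV (grad \<psi>)"
    using Ck by (auto simp: grad_def intro!: continuous_on_vec_lambda)
  have g0: "grad \<psi> x = 0" if "r < norm x" for x
  proof -
    have "open {x::real^'n. r < norm x}" by (intro open_Collect_less continuous_intros)
    then have "(\<psi> has_derivative (\<lambda>_. 0)) (at x)"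
      by (rule has_derivative_transform_within_open[OF has_derivative_const]) (use that supp in auto)
    then have "partial_deriv i \<psi> x = 0" for i by (subst partial_deriv_eq) auto
    then show ?thesis by (simp add: vec_eq_iff)
  qed
  have "uniformly_continuous_on (cball 0 (r + 1)) (grad \<psi>)"
    by (intro compact_uniformly_continuous continuous_on_subset[OF cg]) auto
  then obtain d where d: "d > 0" "\<And>x y. x \<in> cball 0 (r+1) \<Longrightarrow> y \<in> cball 0 (r+1) \<Longrightarrow> dist y x < d \<Longrightarrow> dist (grad \<psi> y) (grad \<psi> x) < e"
    unfolding uniformly_continuous_on_def using \<open>0 < e\<close> by meson
  \<comment> \<open>The bound by 1 matters: if one of two points closer than \<delta> leaves the
    ball of radius r + 1, then both have norm above r, where the gradient vanishes.\<close>
  define \<delta> where "\<delta> = min d 1"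
  have gd: "norm (grad \<psi> y - grad \<psi> x) \<le> e" if "norm (y - x) < \<delta>" for x y
  proof (cases "x \<in> cball 0 (r+1) \<and> y \<in> cball 0 (r+1)")
    case True
    then show ?thesis using d(2)[of x y] that by (simp add: \<delta>_def dist_norm)
  next
    case False
    then have "r < norm x \<and> r < norm y"
      using that norm_triangle_ineq2[of x y] norm_triangle_ineq2[of y x]
      by (auto simp: \<delta>_def norm_minus_commute)
    then show ?thesis using g0 \<open>0 < e\<close> by simp
  qed
  show ?thesis
  proof (rule that[of \<delta>])
    show "0 < \<delta>" using d by (simp add: \<delta>_def)
    fix x h :: "real^'n" assume h: "norm h < \<delta>"
    have "norm ((\<psi> (x + h) - grad \<psi> x \<bullet> (x + h)) - (\<psi> x - grad \<psi> x \<bullet> x)) \<le> e * norm ((x + h) - x)"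
    proof (rule differentiable_bound[where S="ball x \<delta>" and f'="\<lambda>y h. (grad \<psi> y - grad \<psi> x) \<bullet> h"])
      show "convex (ball x \<delta>)" by simp
      fix y assume y: "y \<in> ball x \<delta>"
      show "((\<lambda>y. \<psi> y - grad \<psi> x \<bullet> y) has_derivative (\<lambda>h. (grad \<psi> y - grad \<psi> x) \<bullet> h)) (at y within ball x \<delta>)"
        by (rule has_derivative_at_withinI)
          (auto intro!: derivative_eq_intros has_derivative_grad[OF diff] simp: inner_diff_left)
      show "onorm (\<lambda>h. (grad \<psi> y - grad \<psi> x) \<bullet> h) \<le> e"
      proof (rule onorm_le)
        fix h
        have "\<bar>(grad \<psi> y - grad \<psi> x) \<bullet> h\<bar> \<le> norm (grad \<psi> y - grad \<psi> x) * norm h"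
          by (rule Cauchy_Schwarz_ineq2)
        also have "\<dots> \<le> e * norm h" using gd[of y x] y
          by (intro mult_right_mono) (auto simp: dist_norm norm_minus_commute)
        finally show "norm ((grad \<psi> y - grad \<psi> x) \<bullet> h) \<le> e * norm h" by simp
      qed
    qed (use h \<open>0 < \<delta>\<close> in \<open>auto simp: dist_norm\<close>)
    then show "\<bar>\<psi> (x + h) - \<psi> x - grad \<psi> x \<bullet> h\<bar> \<le> e * norm h"
      by (simp add: inner_add_right algebra_simps)
  qed
qed

lemma partial_deriv_support:
  fixes \<psi> :: "real^'n::finite \<Rightarrow> real"
  assumes supp: "\<And>x. r < norm x \<Longrightarrow> \<psi> x = 0" and x: "r < norm x"
  shows "partial_deriv i \<psi> x = 0"
proof -
  have "open {x::real^'n. r < norm x}" by (intro open_Collect_less continuous_intros)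
  then have "(\<psi> has_derivative (\<lambda>_. 0)) (at x)"
    by (rule has_derivative_transform_within_open[OF has_derivative_const]) (use x supp in auto)
  then show ?thesis by (subst partial_deriv_eq) auto
qed

lemma conv_has_derivative:
  fixes f \<psi> :: "real^'n::finite \<Rightarrow> real"
  assumes f: "integrable lborel f" and Ck: "Ck 1 \<psi>" and supp: "\<And>x. r < norm x \<Longrightarrow> \<psi> x = 0"
  shows "(conv f \<psi> has_derivative (\<lambda>h. \<Sum>i\<in>UNIV. h $ i * conv f (partial_deriv i \<psi>) x)) (at x)"
  unfolding has_derivative_at_alt
proof (intro conjI allI impI)
  let ?L = "\<lambda>h. \<Sum>i\<in>UNIV. h $ i * conv f (partial_deriv i \<psi>) x"
  show "bounded_linear ?L"
    by (intro bounded_linear_sum bounded_linear_mult_const bounded_linear_vec_nth)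
  have c: "continuous_on UNIV \<psi>" using Ck_imp_continuous[OF Ck] .
  have cp: "continuous_on UNIV (partial_deriv i \<psi>)" for i using Ck by simp
  obtain C where C: "\<And>x. \<bar>\<psi> x\<bar> \<le> C" using compact_support_bounded[OF c supp] by metis
  have "\<exists>C. \<forall>x. \<bar>partial_deriv i \<psi> x\<bar> \<le> C" for i
    using compact_support_bounded[OF cp, of r i] partial_deriv_support[of r \<psi>, OF supp] by metis
  then obtain Cp where Cp: "\<And>i x. \<bar>partial_deriv i \<psi> x\<bar> \<le> Cp i" by metis
  note int = integrable_conv[OF f c C] and intp = integrable_conv[OF f cp Cp]
  have int_abs: "integrable lborel (\<lambda>y. \<bar>f y\<bar>)" using f by auto
  fix e :: real assume "0 < e"
  define F where "F = (\<integral>y. \<bar>f y\<bar> \<partial>lborel)"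
  have F: "0 \<le> F" by (simp add: F_def)
  define e' where "e' = e / (F + 1)"
  have e': "0 < e'" "e' * F \<le> e" using F \<open>0 < e\<close> by (auto simp: e'_def field_simps)
  obtain \<delta> where \<delta>: "0 < \<delta>"
    "\<And>x h. norm h < \<delta> \<Longrightarrow> \<bar>\<psi> (x + h) - \<psi> x - grad \<psi> x \<bullet> h\<bar> \<le> e' * norm h"
    using compact_support_uniform_derivative[OF Ck supp e'(1)] by blast
  show "\<exists>d>0. \<forall>y. norm (y - x) < d \<longrightarrow>
      norm (conv f \<psi> y - conv f \<psi> x - ?L (y - x)) \<le> e * norm (y - x)"
  proof (intro exI[of _ \<delta>] conjI allI impI \<delta>(1))
    fix z assume z: "norm (z - x) < \<delta>"
    let ?h = "z - x"
    have "?L ?h = (\<integral>y. (\<Sum>i\<in>UNIV. ?h $ i * (f y * partial_deriv i \<psi> (x - y))) \<partial>lborel)"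
      unfolding conv_def by (subst Bochner_Integration.integral_sum) (auto intro!: intp)
    then have "conv f \<psi> z - conv f \<psi> x - ?L ?h =
        (\<integral>y. f y * \<psi> (z - y) - f y * \<psi> (x - y) - (\<Sum>i\<in>UNIV. ?h $ i * (f y * partial_deriv i \<psi> (x - y))) \<partial>lborel)"
      unfolding conv_def using int intp by simp
    also have "norm \<dots> \<le> (\<integral>y. \<bar>f y\<bar> * (e' * norm ?h) \<partial>lborel)"
    proof (rule Bochner_Integration.integral_norm_bound_integral)
      fix y
      have eq: "f y * \<psi> (z - y) - f y * \<psi> (x - y) - (\<Sum>i\<in>UNIV. ?h $ i * (f y * partial_deriv i \<psi> (x - y)))
        = f y * (\<psi> ((x - y) + ?h) - \<psi> (x - y) - grad \<psi> (x - y) \<bullet> ?h)"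
        by (simp add: inner_vec_def right_diff_distrib sum_distrib_left mult_ac)
      show "norm (f y * \<psi> (z - y) - f y * \<psi> (x - y) - (\<Sum>i\<in>UNIV. ?h $ i * (f y * partial_deriv i \<psi> (x - y)))) \<le> \<bar>f y\<bar> * (e' * norm ?h)"
        unfolding eq using \<delta>(2)[OF z, of "x - y"] by (simp add: abs_mult mult_left_mono)
    qed (use int intp int_abs in auto)
    also have "\<dots> = F * (e' * norm ?h)" by (simp add: F_def)
    also have "\<dots> \<le> e * norm ?h" using mult_right_mono[OF e'(2), of "norm ?h"] by (simp add: mult_ac)
    finally show "norm (conv f \<psi> z - conv f \<psi> x - ?L ?h) \<le> e * norm ?h" .
  qed
qed

lemma partial_deriv_conv:
  fixes f \<psi> :: "real^'n::finite \<Rightarrow> real"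
  assumes "integrable lborel f" "Ck 1 \<psi>" "\<And>x. r < norm x \<Longrightarrow> \<psi> x = 0"
  shows "partial_deriv i (conv f \<psi>) x = conv f (partial_deriv i \<psi>) x"
proof -
  have "partial_deriv i (conv f \<psi>) x = (\<Sum>j\<in>UNIV. axis i 1 $ j * conv f (partial_deriv j \<psi>) x)"
    by (rule partial_deriv_eq[OF conv_has_derivative[OF assms]])
  also have "\<dots> = (\<Sum>j\<in>UNIV. if j = i then conv f (partial_deriv j \<psi>) x else 0)"
    by (intro sum.cong) (auto simp: axis_def)
  finally show ?thesis by simp
qed

lemma Ck_conv:
  fixes f \<psi> :: "real^'n::finite \<Rightarrow> real"
  assumes "integrable lborel f" "\<And>k. Ck k \<psi>" "\<And>x. r < norm x \<Longrightarrow> \<psi> x = 0"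
  shows "Ck k (conv f \<psi>)"
  using assms
proof (induction k arbitrary: \<psi>)
  case 0
  have d: "(conv f \<psi>) differentiable (at x)" for x
    using conv_has_derivative[OF 0(1) 0(2)[of 1] 0(3)] by (auto simp: differentiable_def)
  then show ?case by (auto intro!: continuous_at_imp_continuous_on differentiable_imp_continuous_within)
next
  case (Suc k)
  have d: "(conv f \<psi>) differentiable (at x)" for x
    using conv_has_derivative[OF Suc(2) Suc(3)[of 1] Suc(4)] by (auto simp: differentiable_def)
  have p: "partial_deriv i (conv f \<psi>) = conv f (partial_deriv i \<psi>)" for i
    using partial_deriv_conv[OF Suc(2) Suc(3)[of 1] Suc(4)] by auto
  have "Ck k (conv f (partial_deriv i \<psi>))" for i
  proof (rule Suc.IH[OF Suc(2)])
    show "Ck k (partial_deriv i \<psi>)" for k using Suc(3)[of "Suc k"] by simp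
  qed (use partial_deriv_support[of r \<psi>, OF Suc(4)] in auto)
  then show ?case using d p by simp
qed

lemma cball_in_borel [measurable]: "cball x r \<in> sets borel"
  by (simp add: borel_closed)

lemma power_add_le:
  fixes a b :: real
  assumes "0 \<le> a" "0 \<le> b"
  shows "(a + b) ^ n \<le> 2 ^ n * (a ^ n + b ^ n)"
proof -
  have "(a + b) ^ n \<le> (2 * max a b) ^ n" using assms by (intro power_mono) auto
  also have "\<dots> = 2 ^ n * max a b ^ n" by (simp add: power_mult_distrib)
  also have "max a b ^ n \<le> a ^ n + b ^ n" using assms by (auto simp: max_def)
  finally show ?thesis by simp
qed

lemma abs_power_add_le:
  fixes a b :: real
  shows "\<bar>a + b\<bar> ^ n \<le> 2 ^ n * (\<bar>a\<bar> ^ n + \<bar>b\<bar> ^ n)"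
  by (rule order_trans[OF power_mono power_add_le]) auto

lemma nn_integral_lborel_affine:
  fixes f :: "'a::euclidean_space \<Rightarrow> ennreal"
  assumes [measurable]: "f \<in> borel_measurable borel" and c: "c \<noteq> 0"
  shows "(\<integral>\<^sup>+x. f x \<partial>lborel) = ennreal (\<bar>c\<bar> ^ DIM('a)) * (\<integral>\<^sup>+x. f (t + c *\<^sub>R x) \<partial>lborel)"
  by (subst lborel_affine[OF c, of t], subst nn_integral_density)
     (simp_all add: nn_integral_distr nn_integral_cmult)

lemma nn_integral_lborel_reflect:
  fixes f :: "'a::euclidean_space \<Rightarrow> ennreal"
  assumes [measurable]: "f \<in> borel_measurable borel"
  shows "(\<integral>\<^sup>+y. f (x - y) \<partial>lborel) = (\<integral>\<^sup>+y. f y \<partial>lborel)"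
  using nn_integral_lborel_affine[OF assms, of "-1" x] by simp

lemma nn_integral_lborel_translate:
  fixes f :: "'a::euclidean_space \<Rightarrow> ennreal"
  assumes [measurable]: "f \<in> borel_measurable borel"
  shows "(\<integral>\<^sup>+y. f (y - x) \<partial>lborel) = (\<integral>\<^sup>+y. f y \<partial>lborel)"
  using nn_integral_lborel_affine[OF assms, of 1 "-x"] by simp

lemma mollifier_measurable: "mollifier r \<psi> \<Longrightarrow> \<psi> \<in> borel_measurable borel"
  by (auto simp: mollifier_def intro: Ck_measurable)

lemma mollifier_nonneg: "mollifier r \<psi> \<Longrightarrow> 0 \<le> \<psi> x"
  by (simp add: mollifier_def)

lemma mollifier_nn_integral:
  assumes "mollifier r \<psi>" shows "(\<integral>\<^sup>+y. \<psi> (x - y) \<partial>lborel) = 1"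
  using assms nn_integral_lborel_reflect[of "\<lambda>y. ennreal (\<psi> y)" x]
  by (auto simp: mollifier_def Ck_measurable)

lemma mollifier_integral:
  assumes "mollifier r \<psi>"
  shows "integrable lborel (\<lambda>y. \<psi> (x - y))" "(\<integral>y. \<psi> (x - y) \<partial>lborel) = 1"
proof -
  note [measurable] = mollifier_measurable[OF assms]
  note * = mollifier_nn_integral[OF assms, of x] mollifier_nonneg[OF assms]
  show "integrable lborel (\<lambda>y. \<psi> (x - y))"
    using * by (intro integrableI_nonneg) auto
  show "(\<integral>y. \<psi> (x - y) \<partial>lborel) = 1"
    using * by (subst integral_eq_nn_integral) auto
qed

section \<open>Convergence of mollifications in the n-th power norm\<close>

lemma conv_power_le:
  assumes [measurable]: "h \<in> borel_measurable borel" and psi: "mollifier r \<psi>"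
  shows "ennreal (\<bar>conv h \<psi> x\<bar> ^ Suc m)
    \<le> ennreal (2 ^ Suc m) * (\<integral>\<^sup>+y. \<bar>h y\<bar> ^ Suc m * \<psi> (x - y) \<partial>lborel)"
proof -
  note [measurable] = mollifier_measurable[OF psi]
  have "ennreal \<bar>conv h \<psi> x\<bar> \<le> (\<integral>\<^sup>+y. \<bar>h y\<bar> * \<psi> (x - y) \<partial>lborel)"
  \<comment> \<open>Where the integrand is not integrable, the Bochner integral defining
    \<open>conv\<close> has the default value 0 and the bound is trivial.\<close>
  proof (cases "integrable lborel (\<lambda>y. h y * \<psi> (x - y))")
    case True
    then show ?thesis
      using integral_norm_bound_ennreal[OF True] mollifier_nonneg[OF psi]
      by (simp add: conv_def abs_mult)
  qed (simp add: conv_def not_integrable_integral_eq)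
  then have "ennreal \<bar>conv h \<psi> x\<bar> ^ Suc m \<le> (\<integral>\<^sup>+y. \<bar>h y\<bar> * \<psi> (x - y) \<partial>lborel) ^ Suc m"
    by (rule power_mono) simp
  also have "\<dots> \<le> ennreal (2 ^ Suc m * 1 ^ m) * (\<integral>\<^sup>+y. \<bar>h y\<bar> ^ Suc m * \<psi> (x - y) \<partial>lborel)"
    using mollifier_nonneg[OF psi] mollifier_nn_integral[OF psi, of x]
    by (intro nn_integral_Holder) auto
  finally show ?thesis by (subst (asm) ennreal_power) auto
qed

lemma nn_integral_conv_power_le:
  fixes h :: "real^'n::finite \<Rightarrow> real"
  assumes h[measurable]: "h \<in> borel_measurable borel" and psi: "mollifier r \<psi>"
  shows "(\<integral>\<^sup>+x. \<bar>conv h \<psi> x\<bar> ^ Suc m \<partial>lborel) \<le> ennreal (2 ^ Suc m) * (\<integral>\<^sup>+y. \<bar>h y\<bar> ^ Suc m \<partial>lborel)"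
proof -
  note [measurable] = mollifier_measurable[OF psi]
  have "(\<integral>\<^sup>+x. \<bar>conv h \<psi> x\<bar> ^ Suc m \<partial>lborel)
    \<le> (\<integral>\<^sup>+x. ennreal (2 ^ Suc m) * (\<integral>\<^sup>+y. \<bar>h y\<bar> ^ Suc m * \<psi> (x - y) \<partial>lborel) \<partial>lborel)"
    by (intro nn_integral_mono conv_power_le[OF h psi])
  also have "\<dots> = ennreal (2 ^ Suc m) * (\<integral>\<^sup>+x. (\<integral>\<^sup>+y. \<bar>h y\<bar> ^ Suc m * \<psi> (x - y) \<partial>lborel) \<partial>lborel)"
    by (rule nn_integral_cmult) measurable
  also have "(\<integral>\<^sup>+x. (\<integral>\<^sup>+y. \<bar>h y\<bar> ^ Suc m * \<psi> (x - y) \<partial>lborel) \<partial>lborel)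
    = (\<integral>\<^sup>+y. (\<integral>\<^sup>+x. \<bar>h y\<bar> ^ Suc m * \<psi> (x - y) \<partial>lborel) \<partial>lborel)"
    by (rule lborel_pair.Fubini'[symmetric]) measurable
  also have "\<dots> = (\<integral>\<^sup>+y. \<bar>h y\<bar> ^ Suc m \<partial>lborel)"
  proof (rule nn_integral_cong)
    fix y
    have "(\<integral>\<^sup>+x. \<bar>h y\<bar> ^ Suc m * \<psi> (x - y) \<partial>lborel) = \<bar>h y\<bar> ^ Suc m * (\<integral>\<^sup>+x. \<psi> (x - y) \<partial>lborel)"
      using mollifier_nonneg[OF psi] by (subst nn_integral_cmult[symmetric]) (auto simp: ennreal_mult)
    also have "(\<integral>\<^sup>+x. \<psi> (x - y) \<partial>lborel) = 1"
      using psi nn_integral_lborel_translate[of "\<lambda>x. ennreal (\<psi> x)" y] by (simp add: mollifier_def)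
    finally show "(\<integral>\<^sup>+x. \<bar>h y\<bar> ^ Suc m * \<psi> (x - y) \<partial>lborel) = \<bar>h y\<bar> ^ Suc m" by simp
  qed
  finally show ?thesis .
qed

text \<open>Measurability yields continuous functions converging only almost everywhere. Truncating
  the function at a level \<open>k\<close> costs little in the norm by dominated convergence, and
  truncating the approximants at the same level gives them a bounded majorant on the ball, so a
  second dominated convergence applies.\<close>

lemma Lp_approx_continuous:
  fixes f :: "'a::euclidean_space \<Rightarrow> real"
  assumes f[measurable]: "f \<in> borel_measurable borel"
    and fin: "(\<integral>\<^sup>+x. \<bar>f x\<bar> ^ Suc m \<partial>lborel) < \<infinity>" and "0 < e"
  obtains g where "continuous_on UNIV g"
    "(\<integral>\<^sup>+x\<in>cball 0 R. \<bar>f x - g x\<bar> ^ Suc m \<partial>lborel) \<le> ennreal e"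
proof -
  define tr where "tr B t = max (- B) (min B t)" for B t :: real
  have tr_cont: "continuous_on UNIV (tr B)" for B
    unfolding tr_def by (intro continuous_intros)
  have [measurable]: "tr B \<in> borel_measurable borel" for B
    by (rule borel_measurable_continuous_onI[OF tr_cont])
  define e1 where "e1 = e / (2 * 2 ^ Suc m)"
  have e1: "0 < e1" using \<open>0 < e\<close> by (simp add: e1_def)
  have "(\<lambda>k. \<integral>\<^sup>+x. \<bar>f x - tr (real k) (f x)\<bar> ^ Suc m \<partial>lborel) \<longlonglongrightarrow> (\<integral>\<^sup>+x. 0 \<partial>(lborel::'a measure))"
  proof (rule nn_integral_dominated_convergence[where w="\<lambda>x. ennreal (\<bar>f x\<bar> ^ Suc m)"])
    show "AE x in lborel. ennreal (\<bar>f x - tr (real k) (f x)\<bar> ^ Suc m) \<le> ennreal (\<bar>f x\<bar> ^ Suc m)" for k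
      by (intro AE_I2 ennreal_leI power_mono) (auto simp: tr_def)
    show "AE x in lborel. (\<lambda>k. ennreal (\<bar>f x - tr (real k) (f x)\<bar> ^ Suc m)) \<longlonglongrightarrow> 0"
    proof (rule AE_I2)
      fix x
      obtain k0 :: nat where "\<bar>f x\<bar> \<le> k0" using real_arch_simple by blast
      then have "eventually (\<lambda>k. 0 = ennreal (\<bar>f x - tr (real k) (f x)\<bar> ^ Suc m)) sequentially"
        by (intro eventually_sequentiallyI[of k0]) (auto simp: tr_def)
      then show "(\<lambda>k. ennreal (\<bar>f x - tr (real k) (f x)\<bar> ^ Suc m)) \<longlonglongrightarrow> 0"
        by (rule Lim_transform_eventually[OF tendsto_const])
    qed
  qed (use fin in auto)
  then have "eventually (\<lambda>k. (\<integral>\<^sup>+x. \<bar>f x - tr (real k) (f x)\<bar> ^ Suc m \<partial>lborel) < ennreal e1) sequentially"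
    by (rule order_tendstoD(2)) (use e1 in simp)
  then obtain k where k: "(\<integral>\<^sup>+x. \<bar>f x - tr (real k) (f x)\<bar> ^ Suc m \<partial>lborel) < ennreal e1"
    by (auto simp: eventually_sequentially)
  have "f measurable_on UNIV"
    by (rule lebesgue_measurable_imp_measurable_on) (auto intro: measurable_completion)
  then obtain N g where N: "negligible N" and g: "\<And>n. continuous_on UNIV (g n)"
    and lim: "\<And>x. x \<notin> N \<Longrightarrow> (\<lambda>n. g n x) \<longlonglongrightarrow> f x"
    by (auto simp: measurable_on_def)
  have AEN: "AE x in lborel. x \<notin> N"
  proof -
    have "AE x in lebesgue. x \<notin> N" using N by (intro AE_not_in) (simp add: negligible_iff_null_sets)
    then show ?thesis by (simp only: AE_completion_iff)
  qed
  have [measurable]: "g n \<in> borel_measurable borel" for n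
    by (rule borel_measurable_continuous_onI[OF g])
  have "(\<lambda>n. \<integral>\<^sup>+x\<in>cball 0 R. \<bar>tr (real k) (f x) - tr (real k) (g n x)\<bar> ^ Suc m \<partial>lborel) \<longlonglongrightarrow> (\<integral>\<^sup>+x. 0 \<partial>(lborel::'a measure))"
  proof (rule nn_integral_dominated_convergence[where w="\<lambda>x. ennreal ((2 * real k) ^ Suc m) * indicator (cball 0 R) x"])
    show "AE x in lborel. ennreal (\<bar>tr (real k) (f x) - tr (real k) (g n x)\<bar> ^ Suc m) * indicator (cball 0 R) x
        \<le> ennreal ((2 * real k) ^ Suc m) * indicator (cball 0 R) x" for n
      by (intro AE_I2 mult_right_mono ennreal_leI power_mono) (auto simp: tr_def)
    show "AE x in lborel. (\<lambda>n. ennreal (\<bar>tr (real k) (f x) - tr (real k) (g n x)\<bar> ^ Suc m) * indicator (cball 0 R) x) \<longlonglongrightarrow> 0"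
      using AEN
    proof eventually_elim
      case (elim x)
      have "(\<lambda>n. tr (real k) (g n x)) \<longlonglongrightarrow> tr (real k) (f x)"
        using tr_cont by (intro isCont_tendsto_compose[OF _ lim[OF elim]]) (simp add: continuous_on_eq_continuous_at)
      then have "(\<lambda>n. \<bar>tr (real k) (f x) - tr (real k) (g n x)\<bar> ^ Suc m) \<longlonglongrightarrow> \<bar>tr (real k) (f x) - tr (real k) (f x)\<bar> ^ Suc m"
        by (intro tendsto_intros)
      then have "(\<lambda>n. ennreal (\<bar>tr (real k) (f x) - tr (real k) (g n x)\<bar> ^ Suc m)) \<longlonglongrightarrow> ennreal 0"
        by (intro tendsto_ennrealI) simp
      then show ?case by (cases "x \<in> cball 0 R") (simp_all add: indicator_def)
    qed
    show "(\<integral>\<^sup>+x. ennreal ((2 * real k) ^ Suc m) * indicator (cball 0 R) x \<partial>(lborel::'a measure)) < \<infinity>"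
      using emeasure_compact_finite[of "cball (0::'a) R"]
      by (subst nn_integral_cmult_indicator) (auto simp: ennreal_mult_less_top)
  qed measurable
  then have "eventually (\<lambda>n. (\<integral>\<^sup>+x\<in>cball 0 R. \<bar>tr (real k) (f x) - tr (real k) (g n x)\<bar> ^ Suc m \<partial>lborel) < ennreal e1) sequentially"
    by (rule order_tendstoD(2)) (use e1 in simp)
  then obtain n where n: "(\<integral>\<^sup>+x\<in>cball 0 R. \<bar>tr (real k) (f x) - tr (real k) (g n x)\<bar> ^ Suc m \<partial>lborel) < ennreal e1"
    by (auto simp: eventually_sequentially)
  let ?g = "\<lambda>x. tr (real k) (g n x)"
  show ?thesis
  proof (rule that[of ?g])
    show "continuous_on UNIV ?g" by (rule continuous_on_compose2[OF tr_cont g]) auto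
    have "(\<integral>\<^sup>+x\<in>cball 0 R. \<bar>f x - ?g x\<bar> ^ Suc m \<partial>lborel) \<le>
      (\<integral>\<^sup>+x. ennreal (2 ^ Suc m) * (ennreal (\<bar>f x - tr (real k) (f x)\<bar> ^ Suc m)
          + ennreal (\<bar>tr (real k) (f x) - ?g x\<bar> ^ Suc m) * indicator (cball 0 R) x) \<partial>lborel)"
    proof (rule nn_integral_mono)
      fix x
      have "\<bar>f x - ?g x\<bar> ^ Suc m \<le> 2 ^ Suc m * (\<bar>f x - tr (real k) (f x)\<bar> ^ Suc m + \<bar>tr (real k) (f x) - ?g x\<bar> ^ Suc m)"
        using abs_power_add_le[of "f x - tr (real k) (f x)" "tr (real k) (f x) - ?g x" "Suc m"] by simp
      then have "ennreal (\<bar>f x - ?g x\<bar> ^ Suc m) \<le> ennreal (2 ^ Suc m) * (ennreal (\<bar>f x - tr (real k) (f x)\<bar> ^ Suc m) + ennreal (\<bar>tr (real k) (f x) - ?g x\<bar> ^ Suc m))"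
        by (subst ennreal_plus[symmetric], simp, simp, subst ennreal_mult[symmetric], simp, simp) (rule ennreal_leI)
      then show "ennreal (\<bar>f x - ?g x\<bar> ^ Suc m) * indicator (cball 0 R) x \<le> ennreal (2 ^ Suc m) * (ennreal (\<bar>f x - tr (real k) (f x)\<bar> ^ Suc m)
          + ennreal (\<bar>tr (real k) (f x) - ?g x\<bar> ^ Suc m) * indicator (cball 0 R) x)"
        by (cases "x \<in> cball 0 R") auto
    qed
    also have "\<dots> = ennreal (2 ^ Suc m) * ((\<integral>\<^sup>+x. \<bar>f x - tr (real k) (f x)\<bar> ^ Suc m \<partial>lborel) + (\<integral>\<^sup>+x\<in>cball 0 R. \<bar>tr (real k) (f x) - ?g x\<bar> ^ Suc m \<partial>lborel))"
      by (subst nn_integral_cmult, measurable, subst nn_integral_add) auto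
    also have "\<dots> \<le> ennreal (2 ^ Suc m) * (ennreal e1 + ennreal e1)"
      using k n by (intro mult_left_mono add_mono) auto
    also have "\<dots> = ennreal e"
      using e1 by (simp add: ennreal_plus[symmetric] ennreal_mult[symmetric] e1_def del: ennreal_plus)
    finally show "(\<integral>\<^sup>+x\<in>cball 0 R. \<bar>f x - ?g x\<bar> ^ Suc m \<partial>lborel) \<le> ennreal e" .
  qed
qed


lemma integrable_of_power_integrable:
  fixes f :: "'a::euclidean_space \<Rightarrow> real"
  assumes f[measurable]: "f \<in> borel_measurable borel"
    and fin: "(\<integral>\<^sup>+x. \<bar>f x\<bar> ^ Suc m \<partial>lborel) < \<infinity>"
    and supp: "\<And>x. x \<notin> cball 0 R \<Longrightarrow> f x = 0"
  shows "integrable lborel f"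
proof (rule integrableI_bounded)
  have "(\<integral>\<^sup>+x. norm (f x) \<partial>lborel) \<le> (\<integral>\<^sup>+x. ennreal (\<bar>f x\<bar> ^ Suc m) + indicator (cball 0 R) x \<partial>lborel)"
  proof (rule nn_integral_mono)
    fix x
    have "\<bar>f x\<bar> \<le> \<bar>f x\<bar> ^ Suc m + 1"
      using power_Young[of "\<bar>f x\<bar>" 1 1 m] by simp
    then have "ennreal \<bar>f x\<bar> \<le> ennreal (\<bar>f x\<bar> ^ Suc m) + 1"
      by (metis abs_ge_zero ennreal_1 ennreal_leI ennreal_plus zero_le_one zero_le_power)
    then show "ennreal (norm (f x)) \<le> ennreal (\<bar>f x\<bar> ^ Suc m) + indicator (cball 0 R) x"
      using supp[of x] by (cases "x \<in> cball 0 R") auto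
  qed
  also have "\<dots> < \<infinity>"
    using fin emeasure_compact_finite[of "cball (0::'a) R"]
    by (subst nn_integral_add) (auto simp: ennreal_add_less_top less_top)
  finally show "(\<integral>\<^sup>+x. norm (f x) \<partial>lborel) < \<infinity>" .
qed simp

text \<open>Split f into a part \<open>h\<close> of small norm and a continuous part. Mollification
  is bounded on the norm of \<open>h\<close>, uniformly in the mollifier, and moves the continuous
  part uniformly little on the ball.\<close>

lemma conv_tendsto_Lp:
  fixes f :: "real^'n::finite \<Rightarrow> real"
  assumes f[measurable]: "f \<in> borel_measurable borel"
    and fin: "(\<integral>\<^sup>+x. \<bar>f x\<bar> ^ Suc m \<partial>lborel) < \<infinity>"
    and supp: "\<And>x. x \<notin> cball 0 R \<Longrightarrow> f x = 0" and "0 < e"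
  shows "\<exists>r0>0. \<forall>r \<psi>. 0 < r \<and> r < r0 \<and> mollifier r \<psi> \<longrightarrow>
     (\<integral>\<^sup>+x\<in>cball 0 R. \<bar>conv f \<psi> x - f x\<bar> ^ Suc m \<partial>lborel) \<le> ennreal e"
proof -
  define C where "C = (2::real) ^ Suc m"
  have C: "0 < C" by (simp add: C_def)
  define B where "B = enn2real (emeasure lborel (cball (0::real^'n) R))"
  have B: "emeasure lborel (cball (0::real^'n) R) = ennreal B" "0 \<le> B"
    using emeasure_compact_finite[of "cball (0::real^'n) R"] by (auto simp: B_def)
  \<comment> \<open>The denominator is the total factor of \<open>e1\<close> in the final sum: two
    applications of the power of a sum, the bound for convolutions, and the volume \<open>B\<close>
    of the ball.\<close>
  define e1 where "e1 = e / (C * (C * C + C * B + 1))"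
  have den: "0 < C * (C * C + C * B + 1)" using C B by (intro mult_pos_pos add_nonneg_pos) auto
  have e1: "0 < e1" using \<open>0 < e\<close> den by (simp add: e1_def)
  obtain g where g: "continuous_on UNIV g"
    and fg: "(\<integral>\<^sup>+x\<in>cball 0 (R+1). \<bar>f x - g x\<bar> ^ Suc m \<partial>lborel) \<le> ennreal e1"
    by (rule Lp_approx_continuous[OF f fin e1])
  have [measurable]: "g \<in> borel_measurable borel" by (rule borel_measurable_continuous_onI[OF g])
  define e2 where "e2 = min 1 e1"
  have e2: "0 < e2" "e2 ^ Suc m \<le> e1"
  proof -
    show "0 < e2" using e1 by (simp add: e2_def)
    then have "e2 ^ Suc m \<le> e2 ^ 1" by (intro power_decreasing) (auto simp: e2_def)
    then show "e2 ^ Suc m \<le> e1" by (simp add: e2_def)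
  qed
  have "uniformly_continuous_on (cball 0 (R + 1)) g"
    by (intro compact_uniformly_continuous continuous_on_subset[OF g]) auto
  then obtain d where d: "0 < d" "\<And>x y. x \<in> cball 0 (R+1) \<Longrightarrow> y \<in> cball 0 (R+1) \<Longrightarrow> dist y x < d \<Longrightarrow> dist (g y) (g x) < e2"
    unfolding uniformly_continuous_on_def using e2(1) by meson
  \<comment> \<open>The margin of 1 beyond R lets a mollifier of radius below 1 see only points
    where \<open>g'\<close> is \<open>g\<close>, when centred in the ball of radius R.\<close>
  define g' where "g' x = g x * indicator (cball 0 (R+1)) x" for x
  have g'm[measurable]: "g' \<in> borel_measurable borel" unfolding g'_def by measurable
  have intg': "integrable lborel g'"
    using borel_integrable_compact[of "cball 0 (R+1)" g] continuous_on_subset[OF g]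
    by (simp add: g'_def[abs_def] mult.commute)
  define h where "h x = f x - g' x" for x
  have hm[measurable]: "h \<in> borel_measurable borel" unfolding h_def by measurable
  have intf: "integrable lborel f" by (rule integrable_of_power_integrable[OF f fin supp])
  have inth: "integrable lborel h" unfolding h_def using intf intg' by simp
  have hpow: "(\<integral>\<^sup>+x. \<bar>h x\<bar> ^ Suc m \<partial>lborel) \<le> ennreal e1"
  proof -
    have "ennreal (\<bar>h x\<bar> ^ Suc m) = ennreal (\<bar>f x - g x\<bar> ^ Suc m) * indicator (cball 0 (R+1)) x" for x
      using supp[of x] by (cases "x \<in> cball 0 (R+1)") (auto simp: h_def g'_def)
    then show ?thesis using fg by simp
  qed
  show ?thesis
  proof (intro exI[of _ "min 1 d"] conjI allI impI)
    show "0 < min 1 d" using d by simp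
    fix r and \<psi> :: "real^'n \<Rightarrow> real" assume "0 < r \<and> r < min 1 d \<and> mollifier r \<psi>"
    then have r: "0 < r" "r < min 1 d" and psi: "mollifier r \<psi>" by auto
    note [measurable] = mollifier_measurable[OF psi]
    have cpsi: "continuous_on UNIV \<psi>" using psi Ck_imp_continuous by (auto simp: mollifier_def)
    obtain P where P: "\<And>x. \<bar>\<psi> x\<bar> \<le> P"
      using compact_support_bounded[OF cpsi, of r] psi unfolding mollifier_def by metis
    note ic = integrable_conv[OF _ cpsi P]
    have Ckc: "Ck 0 (conv k \<psi>)" if "integrable lborel k" for k
      by (rule Ck_conv[where r=r]) (use that psi in \<open>auto simp: mollifier_def\<close>)
    have [measurable]: "conv h \<psi> \<in> borel_measurable borel" "conv f \<psi> \<in> borel_measurable borel"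
      using Ckc inth intf by (auto intro: borel_measurable_continuous_onI)
    have split: "conv f \<psi> x = conv h \<psi> x + conv g' \<psi> x" for x
      unfolding conv_def using ic[OF inth] ic[OF intg']
      by (subst Bochner_Integration.integral_add[symmetric]) (auto simp: h_def algebra_simps)
    have gclose: "\<bar>conv g' \<psi> x - g x\<bar> \<le> e2" if x: "x \<in> cball 0 R" for x
    proof -
      have "conv g' \<psi> x - g x = (\<integral>y. g' y * \<psi> (x - y) - g x * \<psi> (x - y) \<partial>lborel)"
        using ic[OF intg'] mollifier_integral[OF psi, of x] by (simp add: conv_def)
      also have "norm \<dots> \<le> (\<integral>y. e2 * \<psi> (x - y) \<partial>lborel)"
      proof (rule Bochner_Integration.integral_norm_bound_integral)
        fix y
        show "norm (g' y * \<psi> (x - y) - g x * \<psi> (x - y)) \<le> e2 * \<psi> (x - y)"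
        proof (cases "norm (x - y) \<le> r")
          case True
          have y: "y \<in> cball 0 (R+1)" using x True r norm_triangle_ineq2[of y x]
            by (auto simp: norm_minus_commute)
          then have "\<bar>g' y - g x\<bar> \<le> e2"
            using d(2)[of x y] x True r by (auto simp: g'_def dist_norm norm_minus_commute)
          then have "\<bar>g' y - g x\<bar> * \<psi> (x - y) \<le> e2 * \<psi> (x - y)"
            using mollifier_nonneg[OF psi] by (intro mult_right_mono) auto
          then show ?thesis using mollifier_nonneg[OF psi, of "x - y"]
            by (simp add: left_diff_distrib[symmetric] abs_mult)
        next
          case False then show ?thesis using psi by (simp add: mollifier_def)
        qed
      qed (use ic[OF intg'] mollifier_integral[OF psi, of x] in auto)
      also have "\<dots> = e2" using mollifier_integral[OF psi, of x] by simp
      finally show ?thesis by simp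
    qed
    have pt: "\<bar>conv f \<psi> x - f x\<bar> ^ Suc m \<le> C * (C * \<bar>conv h \<psi> x\<bar> ^ Suc m + C * e1 + \<bar>h x\<bar> ^ Suc m)"
      if x: "x \<in> cball 0 R" for x
    proof -
      have "x \<in> cball 0 (R+1)" using x by auto
      then have "f x = h x + g x" by (simp add: h_def g'_def)
      then have "conv f \<psi> x - f x = (conv h \<psi> x + (conv g' \<psi> x - g x)) + (- h x)" by (simp add: split)
      then have "\<bar>conv f \<psi> x - f x\<bar> ^ Suc m \<le> C * (\<bar>conv h \<psi> x + (conv g' \<psi> x - g x)\<bar> ^ Suc m + \<bar>h x\<bar> ^ Suc m)"
        using abs_power_add_le[of _ "- h x" "Suc m"] by (simp add: C_def)
      also have "\<bar>conv h \<psi> x + (conv g' \<psi> x - g x)\<bar> ^ Suc m \<le> C * (\<bar>conv h \<psi> x\<bar> ^ Suc m + \<bar>conv g' \<psi> x - g x\<bar> ^ Suc m)"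
        unfolding C_def by (rule abs_power_add_le)
      also have "\<bar>conv g' \<psi> x - g x\<bar> ^ Suc m \<le> e2 ^ Suc m" using gclose[OF x] by (intro power_mono) auto
      also have "e2 ^ Suc m \<le> e1" by (rule e2)
      finally show ?thesis using C by (simp add: algebra_simps)
    qed
    have "(\<integral>\<^sup>+x\<in>cball 0 R. \<bar>conv f \<psi> x - f x\<bar> ^ Suc m \<partial>lborel) \<le>
       (\<integral>\<^sup>+x. ennreal C * (ennreal C * ennreal (\<bar>conv h \<psi> x\<bar> ^ Suc m) + (ennreal (C * e1) * indicator (cball 0 R) x + ennreal (\<bar>h x\<bar> ^ Suc m))) \<partial>lborel)"
    proof (rule nn_integral_mono)
      fix x :: "real^'n"
      show "ennreal (\<bar>conv f \<psi> x - f x\<bar> ^ Suc m) * indicator (cball 0 R) x \<le> ennreal C * (ennreal C * ennreal (\<bar>conv h \<psi> x\<bar> ^ Suc m) + (ennreal (C * e1) * indicator (cball 0 R) x + ennreal (\<bar>h x\<bar> ^ Suc m)))"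
      proof (cases "x \<in> cball 0 R")
        case True
        have "ennreal (\<bar>conv f \<psi> x - f x\<bar> ^ Suc m) \<le> ennreal (C * (C * \<bar>conv h \<psi> x\<bar> ^ Suc m + (C * e1 + \<bar>h x\<bar> ^ Suc m)))"
          using pt[OF True] by (intro ennreal_leI) (simp add: add.assoc)
        also have "\<dots> = ennreal C * (ennreal C * ennreal (\<bar>conv h \<psi> x\<bar> ^ Suc m) + (ennreal (C * e1) + ennreal (\<bar>h x\<bar> ^ Suc m)))"
          using C e1 by (simp add: ennreal_mult ennreal_plus del: power_Suc)
        finally show ?thesis using True by simp
      qed simp
    qed
    also have "\<dots> = ennreal C * (ennreal C * (\<integral>\<^sup>+x. ennreal (\<bar>conv h \<psi> x\<bar> ^ Suc m) \<partial>lborel) + (ennreal (C * e1) * ennreal B + (\<integral>\<^sup>+x. ennreal (\<bar>h x\<bar> ^ Suc m) \<partial>lborel)))"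
      by (simp add: nn_integral_cmult nn_integral_add nn_integral_cmult_indicator B del: power_Suc)
    also have "\<dots> \<le> ennreal C * (ennreal C * (ennreal C * ennreal e1) + (ennreal (C * e1) * ennreal B + ennreal e1))"
      using nn_integral_conv_power_le[OF hm psi, of m] hpow
      by (intro mult_left_mono add_mono order_refl) (auto simp: C_def intro: order_trans[OF _ mult_left_mono])
    also have "\<dots> = ennreal (C * (C * C + C * B + 1) * e1)"
      using C B e1 by (simp add: ennreal_plus[symmetric] ennreal_mult[symmetric] algebra_simps del: ennreal_plus)
    also have "\<dots> \<le> ennreal e" using den by (simp add: e1_def)
    finally show "(\<integral>\<^sup>+x\<in>cball 0 R. \<bar>conv f \<psi> x - f x\<bar> ^ Suc m \<partial>lborel) \<le> ennreal e" .
  qed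
qed

section \<open>Weak gradients and smooth approximation\<close>

lemma sum_power_le:
  fixes a :: "'i \<Rightarrow> real"
  assumes "finite I" "\<And>i. i \<in> I \<Longrightarrow> 0 \<le> a i"
  shows "(\<Sum>i\<in>I. a i) ^ Suc n \<le> real (card I) ^ Suc n * (\<Sum>i\<in>I. a i ^ Suc n)"
proof (cases "I = {}")
  case False
  define M where "M = Max (a ` I)"
  have M: "\<And>i. i \<in> I \<Longrightarrow> a i \<le> M" using assms by (simp add: M_def)
  have "M \<in> a ` I" unfolding M_def using assms False by (intro Max_in) auto
  then obtain i where i: "i \<in> I" "M = a i" by auto
  have "(\<Sum>i\<in>I. a i) \<le> real (card I) * M" using sum_bounded_above[of I a M] M by simp
  then have "(\<Sum>i\<in>I. a i) ^ Suc n \<le> (real (card I) * M) ^ Suc n"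
    using assms by (intro power_mono sum_nonneg) auto
  also have "\<dots> = real (card I) ^ Suc n * a i ^ Suc n" by (simp add: power_mult_distrib i)
  also have "\<dots> \<le> real (card I) ^ Suc n * (\<Sum>i\<in>I. a i ^ Suc n)"
    using assms i by (intro mult_left_mono member_le_sum) auto
  finally show ?thesis .
qed simp

lemma norm_power_le_sum:
  fixes x :: "real^'n::finite"
  shows "norm x ^ Suc n \<le> real CARD('n) ^ Suc n * (\<Sum>i\<in>UNIV. \<bar>x $ i\<bar> ^ Suc n)"
proof -
  have "norm x ^ Suc n \<le> (\<Sum>i\<in>UNIV. \<bar>x $ i\<bar>) ^ Suc n"
    by (intro power_mono norm_le_l1_cart) auto
  also have "\<dots> \<le> real CARD('n) ^ Suc n * (\<Sum>i\<in>UNIV. \<bar>x $ i\<bar> ^ Suc n)"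
    by (rule sum_power_le) auto
  finally show ?thesis .
qed

text \<open>The closure, in the first-order Sobolev norm on \<open>K\<close> with exponent n, of
  restrictions of functions smooth on the whole space. After this point weak derivatives no longer
  occur: estimates are proved for smooth functions and passed to the limit, and restriction to
  smaller sets needs no boundary regularity.\<close>

definition sobolev_closure ::
  "(real^'n::finite) set \<Rightarrow> (real^'n \<Rightarrow> real) \<Rightarrow> (real^'n \<Rightarrow> real^'n) \<Rightarrow> bool" where
  "sobolev_closure K f F \<longleftrightarrow> f \<in> borel_measurable borel \<and> F \<in> borel_measurable borel \<and>
    (\<exists>w. (\<forall>j k. Ck k (w j)) \<and>
      (\<lambda>j. \<integral>\<^sup>+x\<in>K. \<bar>w j x - f x\<bar> ^ CARD('n) \<partial>lborel) \<longlonglongrightarrow> 0 \<and>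
      (\<lambda>j. \<integral>\<^sup>+x\<in>K. norm (grad (w j) x - F x) ^ CARD('n) \<partial>lborel) \<longlonglongrightarrow> 0)"

lemma mollifier_test_function:
  assumes "mollifier r \<psi>" "cball x r \<subseteq> D"
  shows "(\<lambda>y. \<psi> (x - y)) \<in> test_functions D"
    "partial_deriv i (\<lambda>y. \<psi> (x - y)) y = - partial_deriv i \<psi> (x - y)"
proof -
  have eq: "(\<lambda>y. \<psi> (x - y)) = (\<lambda>y. \<psi> ((-1) *\<^sub>R y + x))" by (simp add: fun_eq_iff)
  have ck: "Ck k \<psi>" for k using assms by (simp add: mollifier_def)
  have sub: "closure {y. \<psi> (x - y) \<noteq> 0} \<subseteq> cball x r"
    using assms(1) by (intro closure_minimal) (auto simp: mollifier_def dist_norm, metis linorder_not_le)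
  then have "compact (closure {y. \<psi> (x - y) \<noteq> 0})"
    by (meson bounded_cball bounded_subset closed_closure compact_eq_bounded_closed)
  moreover have "Ck k (\<lambda>y. \<psi> (x - y))" for k unfolding eq by (rule Ck_affine[OF ck])
  ultimately show "(\<lambda>y. \<psi> (x - y)) \<in> test_functions D"
    using sub assms(2) by (auto simp: test_functions_def)
  show "partial_deriv i (\<lambda>y. \<psi> (x - y)) y = - partial_deriv i \<psi> (x - y)"
    unfolding eq using partial_deriv_affine(1)[of \<psi> "-1" y x i] ck[of 1] by simp
qed

text \<open>For fixed x the function \<open>\<lambda>y. \<psi> (x - y)\<close> is itself an
  admissible test function once the ball of radius r about x lies in D, and reflection turns the
  minus sign of the weak derivative into a plus.\<close>

lemma partial_deriv_conv_weak:
  fixes u :: "real^'n::finite \<Rightarrow> real"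
  assumes u: "integrable lborel u" and psi: "mollifier r \<psi>" and ball: "cball x r \<subseteq> D"
    and weak: "\<And>\<phi> i. \<phi> \<in> test_functions D \<Longrightarrow>
      (\<integral>x. u x * partial_deriv i \<phi> x \<partial>lborel) = - (\<integral>x. G x $ i * \<phi> x \<partial>lborel)"
  shows "partial_deriv i (conv u \<psi>) x = conv (\<lambda>y. G y $ i) \<psi> x"
proof -
  have "partial_deriv i (conv u \<psi>) x = conv u (partial_deriv i \<psi>) x"
    using psi by (intro partial_deriv_conv[where r=r] u) (auto simp: mollifier_def simp del: Ck.simps)
  also have "\<dots> = - (\<integral>y. u y * partial_deriv i (\<lambda>y. \<psi> (x - y)) y \<partial>lborel)"
    using mollifier_test_function(2)[OF psi ball] by (simp add: conv_def)
  also have "\<dots> = conv (\<lambda>y. G y $ i) \<psi> x"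
    using weak[OF mollifier_test_function(1)[OF psi ball]] by (simp add: conv_def)
  finally show ?thesis .
qed

text \<open>Mollify with a radius below the distance from K to the complement of D. On K the
  derivatives of the mollified u are the mollified components of G, so both convergences come from
  \<open>conv_tendsto_Lp\<close>, the second one component by component.\<close>

lemma weak_gradient_imp_sobolev_closure:
  fixes u :: "real^'n::finite \<Rightarrow> real" and G :: "real^'n \<Rightarrow> real^'n"
  assumes D: "open D" "bounded D"
    and um[measurable]: "u \<in> borel_measurable borel" and Gm[measurable]: "G \<in> borel_measurable borel"
    and ufin: "(\<integral>\<^sup>+x. \<bar>u x\<bar> ^ CARD('n) \<partial>lborel) < \<infinity>" and Gfin: "(\<integral>\<^sup>+x. norm (G x) ^ CARD('n) \<partial>lborel) < \<infinity>"
    and u0: "\<And>x. x \<notin> D \<Longrightarrow> u x = 0" and G0: "\<And>x. x \<notin> D \<Longrightarrow> G x = 0"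
    and weak: "\<And>\<phi> i. \<phi> \<in> test_functions D \<Longrightarrow>
      (\<integral>x. u x * partial_deriv i \<phi> x \<partial>lborel) = - (\<integral>x. G x $ i * \<phi> x \<partial>lborel)"
    and K: "compact K" "K \<subseteq> D"
  shows "sobolev_closure K u G"
proof -
  define m where "m = CARD('n) - 1"
  have m: "CARD('n) = Suc m" by (simp add: m_def)
  obtain R where R: "D \<subseteq> cball 0 R"
    using D(2) by (auto simp: bounded_any_center[of D 0] subset_iff)
  have Kb: "K \<subseteq> cball 0 R" using K R by blast
  have [measurable]: "K \<in> sets borel" using K by (simp add: borel_compact)
  have Gi[measurable]: "(\<lambda>x. G x $ i) \<in> borel_measurable borel" for i
    by (rule measurable_compose[OF Gm borel_measurable_continuous_onI]) (intro continuous_intros)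
  have Gifin: "(\<integral>\<^sup>+x. \<bar>G x $ i\<bar> ^ Suc m \<partial>lborel) < \<infinity>" for i
  proof (rule le_less_trans[OF nn_integral_mono[OF ennreal_leI] Gfin])
    show "\<bar>G x $ i\<bar> ^ Suc m \<le> norm (G x) ^ CARD('n)" for x
      unfolding m by (intro power_mono component_le_norm_cart) auto
  qed
  have su: "\<And>x. x \<notin> cball 0 R \<Longrightarrow> u x = 0" and sG: "\<And>x i. x \<notin> cball 0 R \<Longrightarrow> G x $ i = 0"
    using R u0 G0 by (blast, metis subsetD zero_index)
  have intu: "integrable lborel u"
    by (rule integrable_of_power_integrable[OF um ufin[unfolded m] su])
  obtain \<delta> where delta: "0 < \<delta>" "\<And>x. x \<in> K \<Longrightarrow> cball x \<delta> \<subseteq> D"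
    using compact_subset_open_imp_cball_epsilon_subset[OF K(1) D(1) K(2)] UN_subset_iff by metis
  have "\<exists>w. (\<forall>k. Ck k w) \<and> (\<integral>\<^sup>+x\<in>K. \<bar>w x - u x\<bar> ^ Suc m \<partial>lborel) \<le> ennreal e \<and>
      (\<integral>\<^sup>+x\<in>K. norm (grad w x - G x) ^ Suc m \<partial>lborel) \<le> ennreal (real CARD('n) ^ Suc m * (real CARD('n) * e))"
    if e: "0 < e" for e
  proof -
    obtain r0 where r0: "0 < r0" "\<And>r \<psi>. 0 < r \<Longrightarrow> r < r0 \<Longrightarrow> mollifier r \<psi> \<Longrightarrow>
     (\<integral>\<^sup>+x\<in>cball 0 R. \<bar>conv u \<psi> x - u x\<bar> ^ Suc m \<partial>lborel) \<le> ennreal e"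
      using conv_tendsto_Lp[OF um ufin[unfolded m] su e] by meson
    have "\<forall>i. \<exists>r0>0. \<forall>r \<psi>. 0 < r \<and> r < r0 \<and> mollifier r \<psi> \<longrightarrow>
     (\<integral>\<^sup>+x\<in>cball 0 R. \<bar>conv (\<lambda>x. G x $ i) \<psi> x - G x $ i\<bar> ^ Suc m \<partial>lborel) \<le> ennreal e"
      by (intro allI conv_tendsto_Lp[OF Gi Gifin sG e])
    then obtain r1 where r1: "\<And>i. 0 < r1 i" "\<And>i r \<psi>. 0 < r \<Longrightarrow> r < r1 i \<Longrightarrow> mollifier r \<psi> \<Longrightarrow>
     (\<integral>\<^sup>+x\<in>cball 0 R. \<bar>conv (\<lambda>x. G x $ i) \<psi> x - G x $ i\<bar> ^ Suc m \<partial>lborel) \<le> ennreal e"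
      by (auto dest!: choice)
    \<comment> \<open>One radius serves all requirements: the threshold for u, the thresholds for
      the finitely many components of G, and the room \<delta> around K inside D.\<close>
    define r where "r = min (min r0 \<delta>) (Min (range r1)) / 2"
    have "0 < min (min r0 \<delta>) (Min (range r1))" using r0(1) delta(1) r1(1) by simp
    then have r: "0 < r" "r < r0" "r < \<delta>" "r < Min (range r1)" unfolding r_def by linarith+
    have r4: "r < r1 i" for i using r(4) by simp
    obtain \<psi> :: "real^'n \<Rightarrow> real" where psi: "mollifier r \<psi>" by (rule mollifier_exists[OF r(1)])
    note [measurable] = mollifier_measurable[OF psi]
    have mono: "(\<integral>\<^sup>+x\<in>K. f x \<partial>lborel) \<le> (\<integral>\<^sup>+x\<in>cball 0 R. f x \<partial>lborel)" for f
      using Kb by (intro nn_integral_mono mult_left_mono) (auto simp: indicator_def)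
    have cm[measurable]: "conv (\<lambda>x. G x $ i) \<psi> \<in> borel_measurable borel" for i
      unfolding conv_def by measurable
    have "(\<integral>\<^sup>+x\<in>K. norm (grad (conv u \<psi>) x - G x) ^ Suc m \<partial>lborel) \<le>
      (\<integral>\<^sup>+x\<in>K. ennreal (real CARD('n) ^ Suc m) * (\<Sum>i\<in>UNIV. ennreal (\<bar>conv (\<lambda>x. G x $ i) \<psi> x - G x $ i\<bar> ^ Suc m)) \<partial>lborel)"
    proof (rule nn_integral_mono)
      fix x
      show "ennreal (norm (grad (conv u \<psi>) x - G x) ^ Suc m) * indicator K x
        \<le> ennreal (real CARD('n) ^ Suc m) * (\<Sum>i\<in>UNIV. ennreal (\<bar>conv (\<lambda>x. G x $ i) \<psi> x - G x $ i\<bar> ^ Suc m)) * indicator K x"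
      proof (cases "x \<in> K")
        case True
        then have "cball x r \<subseteq> D" using delta(2)[OF True] r(3) by (meson less_imp_le subset_cball subset_trans)
        note * = partial_deriv_conv_weak[OF intu psi this weak]
        have "norm (grad (conv u \<psi>) x - G x) ^ Suc m \<le> real CARD('n) ^ Suc m * (\<Sum>i\<in>UNIV. \<bar>conv (\<lambda>x. G x $ i) \<psi> x - G x $ i\<bar> ^ Suc m)"
          using norm_power_le_sum[of "grad (conv u \<psi>) x - G x" m] by (simp add: * del: power_Suc)
        then show ?thesis using True
          by (subst sum_ennreal, simp, subst ennreal_mult[symmetric])
             (simp_all add: sum_nonneg ennreal_leI del: power_Suc)
      qed simp
    qed
    also have "\<dots> = ennreal (real CARD('n) ^ Suc m) * (\<Sum>i\<in>UNIV. (\<integral>\<^sup>+x\<in>K. ennreal (\<bar>conv (\<lambda>x. G x $ i) \<psi> x - G x $ i\<bar> ^ Suc m) \<partial>lborel))"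
      by (subst nn_integral_sum[symmetric], measurable, subst nn_integral_cmult[symmetric], measurable)
         (simp only: sum_distrib_right mult.assoc)
    also have "\<dots> \<le> ennreal (real CARD('n) ^ Suc m) * (\<Sum>i\<in>(UNIV::'n set). ennreal e)"
      using r1(2)[OF r(1) r4 psi] by (intro mult_left_mono sum_mono order_trans[OF mono]) auto
    also have "\<dots> = ennreal (real CARD('n) ^ Suc m * (real CARD('n) * e))"
      using e by (subst ennreal_mult) (simp_all add: ennreal_mult ennreal_of_nat_eq_real_of_nat del: power_Suc)
    finally have "(\<integral>\<^sup>+x\<in>K. norm (grad (conv u \<psi>) x - G x) ^ Suc m \<partial>lborel) \<le> ennreal (real CARD('n) ^ Suc m * (real CARD('n) * e))" .
    moreover have "Ck k (conv u \<psi>)" for k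
      using psi by (intro Ck_conv[where r=r] intu) (auto simp: mollifier_def)
    ultimately show ?thesis
      using order_trans[OF mono r0(2)[OF r(1,2) psi]] by blast
  qed
  note approx = this
  define P where "P j w \<longleftrightarrow> (\<forall>k. Ck k w) \<and>
      (\<integral>\<^sup>+x\<in>K. \<bar>w x - u x\<bar> ^ Suc m \<partial>lborel) \<le> ennreal (inverse (real (Suc j))) \<and>
      (\<integral>\<^sup>+x\<in>K. norm (grad w x - G x) ^ Suc m \<partial>lborel) \<le> ennreal (real CARD('n) ^ Suc m * (real CARD('n) * inverse (real (Suc j))))"
    for j w
  have "\<exists>w. P j w" for j unfolding P_def by (rule approx) simp
  then have "\<exists>w. \<forall>j. P j (w j)" by (intro choice allI)
  then obtain w where "\<And>j. P j (w j)" by blast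
  then have w: "\<And>j k. Ck k (w j)"
    "\<And>j. (\<integral>\<^sup>+x\<in>K. \<bar>w j x - u x\<bar> ^ Suc m \<partial>lborel) \<le> ennreal (inverse (real (Suc j)))"
    "\<And>j. (\<integral>\<^sup>+x\<in>K. norm (grad (w j) x - G x) ^ Suc m \<partial>lborel) \<le> ennreal (real CARD('n) ^ Suc m * (real CARD('n) * inverse (real (Suc j))))"
    unfolding P_def by blast+
  have l: "(\<lambda>j. ennreal (c * (d * inverse (real (Suc j))))) \<longlonglongrightarrow> 0" for c d
    using tendsto_ennrealI[OF tendsto_mult_right_zero[OF tendsto_mult_right_zero[OF LIMSEQ_inverse_real_of_nat, of d], of c]] by simp
  show ?thesis
    unfolding sobolev_closure_def m
  proof (intro conjI exI[of _ w] allI w um Gm)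
    show "(\<lambda>j. \<integral>\<^sup>+x\<in>K. \<bar>w j x - u x\<bar> ^ Suc m \<partial>lborel) \<longlonglongrightarrow> 0"
      by (rule tendsto_sandwich[OF _ _ tendsto_const l[of 1 1]]) (use w(2) in auto)
    show "(\<lambda>j. \<integral>\<^sup>+x\<in>K. norm (grad (w j) x - G x) ^ Suc m \<partial>lborel) \<longlonglongrightarrow> 0"
      by (rule tendsto_sandwich[OF _ _ tendsto_const l[of "real CARD('n) ^ Suc m" "real CARD('n)"]]) (use w(3) in auto)
  qed
qed

section \<open>Kernel inequalities with logarithmic weights\<close>

text \<open>The weight L of the overview. At t = 0 the convention 1 / 0 = 0 gives a conventional
  value and not the limit, so \<open>logw_antimono\<close> assumes 0 < t and later comparisons
  exclude the diagonal.\<close>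

definition logw :: "real \<Rightarrow> real \<Rightarrow> real" where
  "logw \<sigma> t = (1 + max 0 (ln (1 / t))) powr \<sigma>"

lemma logw_measurable [measurable]: "logw \<sigma> \<in> borel_measurable borel"
  unfolding logw_def[abs_def] by measurable

lemma logw_ge_1: "0 \<le> \<sigma> \<Longrightarrow> 1 \<le> logw \<sigma> t"
  by (simp add: logw_def ge_one_powr_ge_zero)

lemma logw_nonneg: "0 \<le> logw \<sigma> t"
  by (simp add: logw_def)

lemma logw_antimono: "0 \<le> \<sigma> \<Longrightarrow> 0 < t \<Longrightarrow> t \<le> t' \<Longrightarrow> logw \<sigma> t' \<le> logw \<sigma> t"
  unfolding logw_def by (intro powr_mono2 add_left_mono max.mono) (auto simp: frac_le)

text \<open>The integrand has the antiderivative
  \<open>(1 - ln t) powr (1 - \<kappa>) / (\<kappa> - 1)\<close>, which tends to 0 at 0 because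
  \<kappa> > 1. With \<kappa> = \<sigma> / m this is the place where \<sigma> must exceed n -
  1.\<close>

lemma nn_integral_log_weight:
  assumes "1 < \<kappa>"
  shows "(\<integral>\<^sup>+t\<in>{0<..<1}. ennreal ((1 - ln t) powr (- \<kappa>) / t) \<partial>lborel) \<le> ennreal (1 / (\<kappa> - 1))"
proof -
  let ?F = "\<lambda>t. (1 - ln t) powr (1 - \<kappa>) / (\<kappa> - 1)"
  let ?f = "\<lambda>t. (1 - ln t) powr (- \<kappa>) / t"
  have lim0: "(?F \<longlongrightarrow> 0) (at_right 0)"
  proof -
    have "filterlim (\<lambda>t::real. 1 + - ln t) at_top (at_right 0)"
      by (intro filterlim_tendsto_add_at_top[OF tendsto_const] filterlim_compose[OF filterlim_uminus_at_top_at_bot ln_at_0])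
    then have "((\<lambda>t. (1 - ln t) powr (1 - \<kappa>)) \<longlongrightarrow> 0) (at_right 0)"
      using assms by (intro tendsto_neg_powr) auto
    then show ?thesis using tendsto_divide[OF _ tendsto_const[of "\<kappa> - 1"]] assms by fastforce
  qed
  have lim1: "(?F \<longlongrightarrow> 1 / (\<kappa> - 1)) (at_left 1)"
  proof -
    have "isCont ?F 1" using assms by (intro continuous_intros) auto
    then have "(?F \<longlongrightarrow> ?F 1) (at_left 1)" unfolding isCont_def by (simp only: filterlim_at_split)
    then show ?thesis by simp
  qed
  have "set_integrable lborel (einterval (ereal 0) (ereal 1)) ?f"
    "(LBINT x=ereal 0..ereal 1. ?f x) = 1 / (\<kappa> - 1) - 0"
  proof -
    have D: "DERIV ?F x :> ?f x" if "ereal 0 < ereal x" "ereal x < ereal 1" for x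
    proof -
      have x: "0 < x" "x < 1" using that by auto
      then have p: "0 < 1 - ln x" using ln_less_zero[OF x] by linarith
      have "((\<lambda>t. (1 - ln t) powr (1 - \<kappa>)) has_real_derivative ((1 - \<kappa>) * (1 - ln x) powr (1 - \<kappa> - 1) * (- (1 / x)))) (at x)"
        using x p by (auto intro!: derivative_eq_intros)
      moreover have "(1 - \<kappa>) * (1 - ln x) powr (1 - \<kappa> - 1) * (- (1 / x)) / (\<kappa> - 1) = ?f x"
      proof -
        have *: "(1 - \<kappa>) * q * (- (1 / x)) / (\<kappa> - 1) = q / x" for q
          using x assms by (simp add: divide_simps) (simp add: algebra_simps)
        show ?thesis unfolding * by simp
      qed
      ultimately show ?thesis by (metis DERIV_cdivide)
    qed
    have C: "isCont ?f x" if "ereal 0 < ereal x" "ereal x < ereal 1" for x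
    proof -
      have x: "0 < x" "x < 1" using that by auto
      then have "0 < 1 - ln x" using ln_less_zero[OF x] by linarith
      then show ?thesis using x by (intro continuous_intros) auto
    qed
    show "set_integrable lborel (einterval (ereal 0) (ereal 1)) ?f"
      "(LBINT x=ereal 0..ereal 1. ?f x) = 1 / (\<kappa> - 1) - 0"
      using interval_integral_FTC_nonneg[of "ereal 0" "ereal 1" ?F ?f 0 "1 / (\<kappa> - 1)"] D C lim0 lim1
      by (auto simp: ereal_tendsto_simps)
  qed
  then have i: "set_integrable lborel {0<..<1} ?f" "(LBINT x:{0<..<1}. ?f x) = 1 / (\<kappa> - 1)"
    by (simp_all add: interval_lebesgue_integral_def einterval_eq)
  have "(\<integral>\<^sup>+t\<in>{0<..<1}. ennreal (?f t) \<partial>lborel) = (\<integral>\<^sup>+t. ennreal (indicator {0<..<1} t *\<^sub>R ?f t) \<partial>lborel)"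
    by (intro nn_integral_cong) (auto simp: indicator_def)
  also have "\<dots> = ennreal (1 / (\<kappa> - 1))"
    using i unfolding set_integrable_def set_lebesgue_integral_def
    by (subst nn_integral_eq_integral) (auto simp: indicator_def)
  finally show ?thesis by simp
qed

lemma nn_integral_inverse_power_tail:
  assumes "0 < \<tau>" "0 < N"
  shows "(\<integral>\<^sup>+t. ennreal (1 / t ^ Suc N) * indicator {\<tau>..} t \<partial>lborel) \<le> ennreal (1 / \<tau> ^ N)"
proof -
  have "(\<integral>\<^sup>+t. ennreal (1 / t ^ Suc N) * indicator {\<tau>..} t \<partial>lborel) = ennreal (0 - (- 1 / (real N * \<tau> ^ N)))"
  proof (rule nn_integral_FTC_atLeast)
    fix x assume "\<tau> \<le> x"
    then have x: "0 < x" using assms by simp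
    have "((\<lambda>t. - 1 / (real N * t ^ N)) has_real_derivative - (- 1 * (real N * (real N * x ^ (N - 1)))) / (real N * x ^ N)\<^sup>2) (at x)"
      using x assms by (auto intro!: derivative_eq_intros simp: power2_eq_square)
    moreover have "- (- 1 * (real N * (real N * x ^ (N - 1)))) / (real N * x ^ N)\<^sup>2 = 1 / x ^ Suc N"
    proof -
      have *: "- (- 1 * (c * (c * p))) / (c * (y * p))\<^sup>2 = 1 / (y * (y * p))"
        if "0 < c" "0 < p" "0 < y" for c p y :: real
        using that by (simp add: power2_eq_square field_simps)
      have "x ^ N = x * x ^ (N - 1)" using assms by (cases N) auto
      then show ?thesis using *[of "real N" "x ^ (N - 1)" x] x assms by simp
    qed
    ultimately show "((\<lambda>t. - 1 / (real N * t ^ N)) has_real_derivative 1 / x ^ Suc N) (at x)" by simp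
    show "0 \<le> 1 / x ^ Suc N" using x by simp
  next
    have "filterlim (\<lambda>t::real. real N * t ^ N) at_top at_top"
      using assms by (intro filterlim_tendsto_pos_mult_at_top[OF tendsto_const] filterlim_pow_at_top filterlim_ident) auto
    then have "((\<lambda>t::real. - 1 / (real N * t ^ N)) \<longlongrightarrow> 0) at_top"
      by (intro tendsto_divide_0[OF tendsto_const] filterlim_at_top_imp_at_infinity)
    then show "((\<lambda>t::real. - 1 / (real N * t ^ N)) \<longlongrightarrow> 0) at_top" .
  qed auto
  also have "\<dots> \<le> ennreal (1 / \<tau> ^ N)"
    using assms by (intro ennreal_leI) (auto simp: field_simps)
  finally show ?thesis .
qed

text \<open>The derivative along the segment is integrated and the integrand split as \<phi> times a
  density \<mu> of finite mass; Hoelder then produces the weight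
  \<open>(1 / \<mu>) ^ m\<close>.\<close>

lemma segment_power_bound:
  fixes w :: "real^'n::finite \<Rightarrow> real"
  assumes w: "Ck 1 w" and m: "0 < m" and \<sigma>: "real m < \<sigma>"
  defines "C \<equiv> 2 ^ Suc m * (1 / (\<sigma> / m - 1)) ^ m"
  shows "ennreal (\<bar>w z - w x\<bar> ^ Suc m) \<le> ennreal C *
    (\<integral>\<^sup>+t\<in>{0<..<1}. ennreal (norm (grad w (x + t *\<^sub>R (z - x))) ^ Suc m * norm (z - x) ^ Suc m * (t ^ m * logw \<sigma> t)) \<partial>lborel)"
proof -
  define k where "k t = grad w (x + t *\<^sub>R (z - x)) \<bullet> (z - x)" for t
  have diff: "w differentiable (at y)" for y using w by simp
  have cg: "continuous_on UNIV (grad w)"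
    using w by (auto simp: grad_def intro!: continuous_on_vec_lambda)
  have ck: "continuous_on UNIV k"
    unfolding k_def by (intro continuous_intros continuous_on_compose2[OF cg]) auto
  then have ick: "isCont k t" for t by (simp add: continuous_on_eq_continuous_at)
  have [measurable]: "k \<in> borel_measurable borel" by (rule borel_measurable_continuous_onI[OF ck])
  have dk: "((\<lambda>t. w (x + t *\<^sub>R (z - x))) has_real_derivative k t) (at t)" for t
  proof -
    have "((\<lambda>t. x + t *\<^sub>R (z - x)) has_derivative (\<lambda>h. h *\<^sub>R (z - x))) (at t)"
      by (auto intro!: derivative_eq_intros)
    from has_derivative_compose[OF this has_derivative_grad[OF diff]]
    show ?thesis by (simp add: has_field_derivative_def k_def mult_commute_abs)
  qed
  have I: "(\<integral>t. k t * indicator {0..1} t \<partial>lborel) = w z - w x"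
    using integral_FTC_Icc_real[of 0 1 "\<lambda>t. w (x + t *\<^sub>R (z - x))" k] dk ick by simp
  have int: "integrable lborel (\<lambda>t. k t * indicator {0..1} t)"
    using borel_integrable_atLeastAtMost[of 0 1 k] ick by (auto simp: mult.commute indicator_def if_distrib cong: if_cong)
  define \<kappa> where "\<kappa> = \<sigma> / m"
  have \<kappa>: "1 < \<kappa>" using \<sigma> m by (simp add: \<kappa>_def)
  \<comment> \<open>Chosen such that \<open>(1 / \<mu> t) ^ m\<close> equals
    \<open>t ^ m * logw \<sigma> t\<close> on the open unit interval, while the mass of \<mu> is
    still at most \<open>1 / (\<kappa> - 1)\<close>.\<close>
  define \<mu> where "\<mu> t = (if 0 < t \<and> t < 1 then (1 - ln t) powr (- \<kappa>) / t else 0)" for t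
  define \<phi> where "\<phi> t = (if 0 < t \<and> t < 1 then \<bar>k t\<bar> / \<mu> t else 0)" for t
  have [measurable]: "\<mu> \<in> borel_measurable borel" unfolding \<mu>_def by measurable
  have [measurable]: "\<phi> \<in> borel_measurable borel" unfolding \<phi>_def by measurable
  have \<mu>pos: "0 < \<mu> t" if "0 < t" "t < 1" for t
  proof -
    have "0 < 1 - ln t" using ln_less_zero[OF that] by linarith
    then show ?thesis using that by (simp add: \<mu>_def)
  qed
  have \<mu>nn: "0 \<le> \<mu> t" for t by (simp add: \<mu>_def)
  have \<phi>nn: "0 \<le> \<phi> t" for t using \<mu>nn by (simp add: \<phi>_def)
  have J: "(\<integral>\<^sup>+t. \<mu> t \<partial>lborel) \<le> ennreal (1 / (\<kappa> - 1))"
  proof -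
    have "(\<integral>\<^sup>+t. \<mu> t \<partial>lborel) = (\<integral>\<^sup>+t\<in>{0<..<1}. ennreal ((1 - ln t) powr (- \<kappa>) / t) \<partial>lborel)"
      by (intro nn_integral_cong) (auto simp: \<mu>_def indicator_def)
    then show ?thesis using nn_integral_log_weight[OF \<kappa>] by simp
  qed
  have "ennreal \<bar>w z - w x\<bar> \<le> (\<integral>\<^sup>+t. norm (k t * indicator {0..1} t) \<partial>lborel)"
    using integral_norm_bound_ennreal[OF int] by (simp add: I)
  also have "\<dots> = (\<integral>\<^sup>+t. \<phi> t * \<mu> t \<partial>lborel)"
  proof (rule nn_integral_cong_AE)
    have "AE t in lborel. t \<noteq> 0 \<and> t \<noteq> (1::real)" by (auto intro: AE_lborel_singleton)
    then show "AE t in lborel. ennreal (norm (k t * indicator {0..1} t)) = ennreal (\<phi> t * \<mu> t)"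
    proof eventually_elim
      case (elim t)
      then show ?case using \<mu>pos[of t] by (auto simp: \<phi>_def indicator_def)
    qed
  qed
  finally have "ennreal \<bar>w z - w x\<bar> ^ Suc m \<le> (\<integral>\<^sup>+t. \<phi> t * \<mu> t \<partial>lborel) ^ Suc m"
    by (rule power_mono) simp
  also have "\<dots> \<le> ennreal C * (\<integral>\<^sup>+t. \<phi> t ^ Suc m * \<mu> t \<partial>lborel)"
    unfolding C_def using J \<kappa> \<mu>nn \<phi>nn
    by (intro nn_integral_Holder) (auto simp: \<kappa>_def)
  finally have A: "ennreal (\<bar>w z - w x\<bar> ^ Suc m) \<le> ennreal C * (\<integral>\<^sup>+t. \<phi> t ^ Suc m * \<mu> t \<partial>lborel)"
    by (subst (asm) ennreal_power) auto
  have B: "(\<integral>\<^sup>+t. \<phi> t ^ Suc m * \<mu> t \<partial>lborel) \<le>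
    (\<integral>\<^sup>+t\<in>{0<..<1}. ennreal (norm (grad w (x + t *\<^sub>R (z - x))) ^ Suc m * norm (z - x) ^ Suc m * (t ^ m * logw \<sigma> t)) \<partial>lborel)"
  proof (rule nn_integral_mono)
    fix t :: real
    show "ennreal (\<phi> t ^ Suc m * \<mu> t) \<le> ennreal (norm (grad w (x + t *\<^sub>R (z - x))) ^ Suc m * norm (z - x) ^ Suc m * (t ^ m * logw \<sigma> t)) * indicator {0<..<1} t"
    proof (cases "0 < t \<and> t < 1")
      case True
      then have "ln t < 0" by simp
      then have lp: "0 < 1 - ln t" "max 0 (ln (1/t)) = - ln t" using True by (linarith, simp add: ln_div)
      have mu: "1 / \<mu> t = t * (1 - ln t) powr \<kappa>"
        using True lp by (simp add: \<mu>_def powr_minus field_simps)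
      have "((1 - ln t) powr \<kappa>) ^ m = (1 - ln t) powr \<sigma>"
        using lp m by (subst powr_realpow[symmetric]) (auto simp: powr_powr \<kappa>_def)
      then have mum: "(1 / \<mu> t) ^ m = t ^ m * logw \<sigma> t"
        unfolding mu logw_def lp(2) by (simp add: power_mult_distrib)
      have "\<phi> t ^ Suc m * \<mu> t = \<bar>k t\<bar> ^ Suc m * (1 / \<mu> t) ^ m"
        using True \<mu>pos[of t] by (simp add: \<phi>_def field_simps)
      also have "\<dots> \<le> (norm (grad w (x + t *\<^sub>R (z - x))) * norm (z - x)) ^ Suc m * (t ^ m * logw \<sigma> t)"
        unfolding mum k_def using True logw_nonneg[of \<sigma> t]
        by (intro mult_right_mono power_mono Cauchy_Schwarz_ineq2) auto
      finally show ?thesis using True by (auto simp: power_mult_distrib simp del: power_Suc intro!: ennreal_leI)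
    qed (auto simp: \<phi>_def)
  qed
  show ?thesis by (rule order_trans[OF A mult_left_mono[OF B]]) simp
qed

text \<open>Integrate the segment bound over z and, for fixed t, substitute y = x + t (z - x), which
  stays in Q by convexity. The Jacobian and the power of |z - x| leave
  \<open>norm (y - x) ^ Suc m / t ^ Suc (Suc m)\<close>, and |z - x| \<le> d restricts t to values
  at least |y - x| / d. Integrating in t from there exactly cancels the power of |y - x| and leaves
  \<open>d ^ Suc m\<close>.\<close>

lemma convex_kernel_bound:
  fixes w :: "real^'n::finite \<Rightarrow> real"
  assumes w: "Ck 1 w" and N: "CARD('n) = Suc m" and m: "0 < m" and \<sigma>: "real m < \<sigma>"
    and Q: "convex Q" and Qm[measurable]: "Q \<in> sets borel" and x: "x \<in> Q"
    and d: "0 < d" "\<And>x y. x \<in> Q \<Longrightarrow> y \<in> Q \<Longrightarrow> norm (x - y) \<le> d"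
  defines "C \<equiv> 2 ^ Suc m * (1 / (\<sigma> / m - 1)) ^ m"
  shows "(\<integral>\<^sup>+z\<in>Q. \<bar>w z - w x\<bar> ^ Suc m \<partial>lborel) \<le>
    ennreal (C * d ^ Suc m) * (\<integral>\<^sup>+y\<in>Q. norm (grad w y) ^ Suc m * logw \<sigma> (norm (y - x) / d) \<partial>lborel)"
proof -
  define g where "g y = norm (grad w y) ^ Suc m" for y
  have gnn: "0 \<le> g y" for y by (simp add: g_def)
  have "continuous_on UNIV (grad w)"
    using w by (auto simp: grad_def intro!: continuous_on_vec_lambda)
  then have "continuous_on UNIV g" unfolding g_def by (intro continuous_intros)
  then have [measurable]: "g \<in> borel_measurable borel" by (rule borel_measurable_continuous_onI)
  have C: "0 \<le> C" using \<sigma> m by (simp add: C_def)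
  have \<sigma>0: "0 \<le> \<sigma>" using \<sigma> by linarith
  note ln = logw_nonneg
  have "(\<integral>\<^sup>+z\<in>Q. \<bar>w z - w x\<bar> ^ Suc m \<partial>lborel) \<le> (\<integral>\<^sup>+z. ennreal C *
    (\<integral>\<^sup>+t. ennreal (g (x + t *\<^sub>R (z - x)) * norm (z - x) ^ Suc m * (t ^ m * logw \<sigma> t)) * indicator {0<..<1} t * indicator Q z \<partial>lborel) \<partial>lborel)"
  proof (rule nn_integral_mono)
    fix z
    show "ennreal (\<bar>w z - w x\<bar> ^ Suc m) * indicator Q z \<le> ennreal C *
    (\<integral>\<^sup>+t. ennreal (g (x + t *\<^sub>R (z - x)) * norm (z - x) ^ Suc m * (t ^ m * logw \<sigma> t)) * indicator {0<..<1} t * indicator Q z \<partial>lborel)"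
      using segment_power_bound[OF w m \<sigma>, of z x] by (cases "z \<in> Q") (auto simp: g_def C_def)
  qed
  also have "\<dots> = ennreal C * (\<integral>\<^sup>+z. (\<integral>\<^sup>+t. ennreal (g (x + t *\<^sub>R (z - x)) * norm (z - x) ^ Suc m * (t ^ m * logw \<sigma> t)) * indicator {0<..<1} t * indicator Q z \<partial>lborel) \<partial>lborel)"
    by (rule nn_integral_cmult) measurable
  also have "(\<integral>\<^sup>+z. (\<integral>\<^sup>+t. ennreal (g (x + t *\<^sub>R (z - x)) * norm (z - x) ^ Suc m * (t ^ m * logw \<sigma> t)) * indicator {0<..<1} t * indicator Q z \<partial>lborel) \<partial>lborel)
    = (\<integral>\<^sup>+t. (\<integral>\<^sup>+z. ennreal (g (x + t *\<^sub>R (z - x)) * norm (z - x) ^ Suc m * (t ^ m * logw \<sigma> t)) * indicator {0<..<1} t * indicator Q z \<partial>lborel) \<partial>lborel)"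
    by (rule lborel_pair.Fubini') measurable
  also have "\<dots> \<le> (\<integral>\<^sup>+t. (\<integral>\<^sup>+y. ennreal (g y * norm (y - x) ^ Suc m * (1 / t ^ Suc (Suc m) * logw \<sigma> t)) * indicator {t. 0 < t \<and> t < 1 \<and> norm (y - x) \<le> t * d} t * indicator Q y \<partial>lborel) \<partial>lborel)"
  proof (rule nn_integral_mono)
    fix t :: real
    show "(\<integral>\<^sup>+z. ennreal (g (x + t *\<^sub>R (z - x)) * norm (z - x) ^ Suc m * (t ^ m * logw \<sigma> t)) * indicator {0<..<1} t * indicator Q z \<partial>lborel)
      \<le> (\<integral>\<^sup>+y. ennreal (g y * norm (y - x) ^ Suc m * (1 / t ^ Suc (Suc m) * logw \<sigma> t)) * indicator {t. 0 < t \<and> t < 1 \<and> norm (y - x) \<le> t * d} t * indicator Q y \<partial>lborel)"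
    proof (cases "0 < t \<and> t < 1")
      case True
      \<comment> \<open>The indicators are kept inside so that the affine change of variables
        applies to a function on the whole space.\<close>
      define f where "f z = ennreal (g (x + t *\<^sub>R (z - x)) * norm (z - x) ^ Suc m * (t ^ m * logw \<sigma> t)) * indicator {0<..<1} t * indicator Q z" for z
      have [measurable]: "f \<in> borel_measurable borel" unfolding f_def by measurable
      have "(\<integral>\<^sup>+z. f z \<partial>lborel) = ennreal ((1/t) ^ Suc m) * (\<integral>\<^sup>+y. f ((x - (1/t) *\<^sub>R x) + (1/t) *\<^sub>R y) \<partial>lborel)"
        using True nn_integral_lborel_affine[of f "1/t" "x - (1/t) *\<^sub>R x"] by (simp add: N)
      also have "\<dots> = (\<integral>\<^sup>+y. ennreal ((1/t) ^ Suc m) * f ((x - (1/t) *\<^sub>R x) + (1/t) *\<^sub>R y) \<partial>lborel)"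
        by (rule nn_integral_cmult[symmetric]) measurable
      also have "\<dots> \<le> (\<integral>\<^sup>+y. ennreal (g y * norm (y - x) ^ Suc m * (1 / t ^ Suc (Suc m) * logw \<sigma> t)) * indicator {t. 0 < t \<and> t < 1 \<and> norm (y - x) \<le> t * d} t * indicator Q y \<partial>lborel)"
      proof (rule nn_integral_mono)
        fix y
        let ?z = "(x - (1/t) *\<^sub>R x) + (1/t) *\<^sub>R y"
        have z1: "x + t *\<^sub>R (?z - x) = y" using True by (simp add: algebra_simps)
        have "?z - x = (1/t) *\<^sub>R (y - x)" by (simp add: algebra_simps)
        then have z2: "norm (?z - x) = norm (y - x) / t" using True by simp
        show "ennreal ((1/t) ^ Suc m) * f ?z \<le> ennreal (g y * norm (y - x) ^ Suc m * (1 / t ^ Suc (Suc m) * logw \<sigma> t)) * indicator {t. 0 < t \<and> t < 1 \<and> norm (y - x) \<le> t * d} t * indicator Q y"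
        proof (cases "?z \<in> Q")
          case zQ: True
          have "(1 - t) *\<^sub>R x + t *\<^sub>R ?z \<in> Q" using Q x zQ True by (intro convexD) auto
          moreover have "(1 - t) *\<^sub>R x + t *\<^sub>R ?z = y" using z1 by (simp add: algebra_simps)
          ultimately have yQ: "y \<in> Q" by simp
          have "norm (?z - x) \<le> d" by (rule d(2)[OF zQ x])
          then have yd: "norm (y - x) \<le> t * d" unfolding z2 using True by (simp add: field_simps)
          have "(1/t) ^ Suc m * (g y * (norm (y - x) / t) ^ Suc m * (t ^ m * logw \<sigma> t)) = g y * norm (y - x) ^ Suc m * (1 / t ^ Suc (Suc m) * logw \<sigma> t)"
            using True by (simp add: field_simps power_divide)
          then have "ennreal ((1/t) ^ Suc m) * f ?z = ennreal (g y * norm (y - x) ^ Suc m * (1 / t ^ Suc (Suc m) * logw \<sigma> t))"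
            unfolding f_def z1 z2 using zQ True gnn[of y] ln[of \<sigma> t] by (simp add: ennreal_mult[symmetric] del: power_Suc)
          then show ?thesis using yQ yd True by simp
        qed (simp add: f_def)
      qed
      finally show ?thesis unfolding f_def .
    qed auto
  qed
  also have "\<dots> = (\<integral>\<^sup>+y. (\<integral>\<^sup>+t. ennreal (g y * norm (y - x) ^ Suc m * (1 / t ^ Suc (Suc m) * logw \<sigma> t)) * indicator {t. 0 < t \<and> t < 1 \<and> norm (y - x) \<le> t * d} t * indicator Q y \<partial>lborel) \<partial>lborel)"
    by (rule lborel_pair.Fubini') measurable
  also have "\<dots> \<le> (\<integral>\<^sup>+y. ennreal (d ^ Suc m) * (ennreal (g y * logw \<sigma> (norm (y - x) / d)) * indicator Q y) \<partial>lborel)"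
  proof (rule nn_integral_mono)
    fix y
    show "(\<integral>\<^sup>+t. ennreal (g y * norm (y - x) ^ Suc m * (1 / t ^ Suc (Suc m) * logw \<sigma> t)) * indicator {t. 0 < t \<and> t < 1 \<and> norm (y - x) \<le> t * d} t * indicator Q y \<partial>lborel)
      \<le> ennreal (d ^ Suc m) * (ennreal (g y * logw \<sigma> (norm (y - x) / d)) * indicator Q y)"
    proof (cases "y \<in> Q \<and> y \<noteq> x")
      case True
      \<comment> \<open>The smallest t for which y can lie on a segment of length at most d from x.
        As L decreases, its value at \<tau> bounds it on the whole range of t.\<close>
      define \<tau> where "\<tau> = norm (y - x) / d"
      have \<tau>: "0 < \<tau>" using True d by (simp add: \<tau>_def)
      let ?c = "g y * norm (y - x) ^ Suc m * logw \<sigma> \<tau>"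
      have "(\<integral>\<^sup>+t. ennreal (g y * norm (y - x) ^ Suc m * (1 / t ^ Suc (Suc m) * logw \<sigma> t)) * indicator {t. 0 < t \<and> t < 1 \<and> norm (y - x) \<le> t * d} t * indicator Q y \<partial>lborel)
        \<le> (\<integral>\<^sup>+t. ennreal ?c * (ennreal (1 / t ^ Suc (Suc m)) * indicator {\<tau>..} t) \<partial>lborel)"
      proof (rule nn_integral_mono)
        fix t :: real
        show "ennreal (g y * norm (y - x) ^ Suc m * (1 / t ^ Suc (Suc m) * logw \<sigma> t)) * indicator {t. 0 < t \<and> t < 1 \<and> norm (y - x) \<le> t * d} t * indicator Q y
          \<le> ennreal ?c * (ennreal (1 / t ^ Suc (Suc m)) * indicator {\<tau>..} t)"
        proof (cases "0 < t \<and> t < 1 \<and> norm (y - x) \<le> t * d")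
          case t: True
          then have \<tau>t: "\<tau> \<le> t" using d by (simp add: \<tau>_def field_simps)
          have "g y * norm (y - x) ^ Suc m * (1 / t ^ Suc (Suc m) * logw \<sigma> t) \<le> g y * norm (y - x) ^ Suc m * (1 / t ^ Suc (Suc m) * logw \<sigma> \<tau>)"
            using t gnn[of y] logw_antimono[OF \<sigma>0 \<tau> \<tau>t] by (intro mult_left_mono) auto
          also have "\<dots> = ?c * (1 / t ^ Suc (Suc m))" by simp
          finally have "ennreal (g y * norm (y - x) ^ Suc m * (1 / t ^ Suc (Suc m) * logw \<sigma> t)) \<le> ennreal (?c * (1 / t ^ Suc (Suc m)))"
            by (rule ennreal_leI)
          also have "\<dots> = ennreal ?c * ennreal (1 / t ^ Suc (Suc m))"
            using t gnn[of y] ln[of \<sigma> \<tau>] by (subst ennreal_mult) auto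
          finally show ?thesis using t \<tau>t True by simp
        qed simp
      qed
      also have "\<dots> = ennreal ?c * (\<integral>\<^sup>+t. ennreal (1 / t ^ Suc (Suc m)) * indicator {\<tau>..} t \<partial>lborel)"
        by (rule nn_integral_cmult) measurable
      also have "\<dots> \<le> ennreal ?c * ennreal (1 / \<tau> ^ Suc m)"
        by (intro mult_left_mono nn_integral_inverse_power_tail \<tau>) auto
      also have "\<dots> = ennreal (?c * (1 / \<tau> ^ Suc m))"
        using \<tau> gnn[of y] ln[of \<sigma> \<tau>] by (subst ennreal_mult) auto
      also have "?c * (1 / \<tau> ^ Suc m) = d ^ Suc m * (g y * logw \<sigma> \<tau>)"
        using True d by (simp add: \<tau>_def power_divide field_simps)
      finally show ?thesis using True d gnn[of y] ln[of \<sigma> \<tau>] by (simp add: \<tau>_def ennreal_mult)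
    next
      case False
      then show ?thesis by auto
    qed
  qed
  also have "\<dots> = ennreal (d ^ Suc m) * (\<integral>\<^sup>+y\<in>Q. g y * logw \<sigma> (norm (y - x) / d) \<partial>lborel)"
    by (rule nn_integral_cmult) measurable
  finally show ?thesis
    using C d by (simp add: g_def ennreal_mult mult.assoc mult_left_mono del: power_Suc)
qed

text \<open>The constant \<open>C\<close> of \<open>convex_kernel_bound\<close>;
  \<open>1 / (\<sigma> / m - 1)\<close> is the mass of the logarithmic density in Hoelder's
  inequality, and it blows up as \<sigma> approaches m.\<close>

definition kernel_const :: "nat \<Rightarrow> real \<Rightarrow> real" where
  "kernel_const m \<sigma> = 2 ^ Suc m * (1 / (\<sigma> / m - 1)) ^ m"

lemma kernel_const_pos: "0 < m \<Longrightarrow> real m < \<sigma> \<Longrightarrow> 0 < kernel_const m \<sigma>"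
  by (simp add: kernel_const_def)

section \<open>From smooth functions to the Sobolev closure\<close>

lemma sobolev_closure_AE:
  fixes f :: "real^'n::finite \<Rightarrow> real"
  assumes sc: "sobolev_closure Q f F" and Q[measurable]: "Q \<in> sets borel"
  shows "\<exists>w. (\<forall>j k. Ck k (w j)) \<and>
    (\<lambda>j. \<integral>\<^sup>+x\<in>Q. norm (grad (w j) x - F x) ^ CARD('n) \<partial>lborel) \<longlonglongrightarrow> 0 \<and>
    (AE x in lborel. x \<in> Q \<longrightarrow> (\<lambda>j. w j x) \<longlonglongrightarrow> f x)"
proof -
  have fm[measurable]: "f \<in> borel_measurable borel" using sc by (simp add: sobolev_closure_def)
  obtain w where w: "\<And>j k. Ck k (w j)"
    "(\<lambda>j. \<integral>\<^sup>+x\<in>Q. \<bar>w j x - f x\<bar> ^ CARD('n) \<partial>lborel) \<longlonglongrightarrow> 0"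
    "(\<lambda>j. \<integral>\<^sup>+x\<in>Q. norm (grad (w j) x - F x) ^ CARD('n) \<partial>lborel) \<longlonglongrightarrow> 0"
    using sc unfolding sobolev_closure_def by blast
  have [measurable]: "w j \<in> borel_measurable borel" for j using w(1) Ck_measurable by blast
  define v where "v j x = \<bar>w j x - f x\<bar> ^ CARD('n) * indicator Q x" for j x
  have [measurable]: "v j \<in> borel_measurable borel" for j unfolding v_def by measurable
  have vnn: "0 \<le> v j x" for j x by (simp add: v_def)
  have veq: "(\<integral>\<^sup>+x. v j x \<partial>lborel) = (\<integral>\<^sup>+x\<in>Q. \<bar>w j x - f x\<bar> ^ CARD('n) \<partial>lborel)" for j
    by (intro nn_integral_cong) (auto simp: v_def indicator_def)
  have lim: "(\<lambda>j. \<integral>\<^sup>+x. v j x \<partial>lborel) \<longlonglongrightarrow> 0" unfolding veq by (rule w(2))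
  \<comment> \<open>The first few integrals may be infinite; the sequence is shifted by
    \<open>n0\<close> so that every member is integrable before a subsequence converging almost
    everywhere is taken.\<close>
  then have "eventually (\<lambda>j. (\<integral>\<^sup>+x. v j x \<partial>lborel) < 1) sequentially"
    by (rule order_tendstoD(2)) simp
  then obtain n0 where n0: "\<And>j. n0 \<le> j \<Longrightarrow> (\<integral>\<^sup>+x. v j x \<partial>lborel) < 1"
    by (auto simp: eventually_sequentially)
  have int: "integrable lborel (v (j + n0))" for j
    using n0[of "j + n0"] vnn
    by (intro integrableI_nonneg) (auto intro: order.strict_trans[OF _ ennreal_one_less_top])
  have "(\<lambda>j. \<integral>\<^sup>+x. v (j + n0) x \<partial>lborel) \<longlonglongrightarrow> 0" by (rule LIMSEQ_ignore_initial_segment[OF lim])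
  then have "(\<lambda>j. ennreal (\<integral>x. v (j + n0) x \<partial>lborel)) \<longlonglongrightarrow> ennreal 0"
    using int vnn by (simp add: nn_integral_eq_integral)
  then have "(\<lambda>j. \<integral>x. v (j + n0) x \<partial>lborel) \<longlonglongrightarrow> 0"
    using vnn by (subst (asm) tendsto_ennreal_iff) auto
  then have "(\<lambda>j. \<integral>x. norm (v (j + n0) x) \<partial>lborel) \<longlonglongrightarrow> 0"
    using vnn by simp
  from tendsto_L1_AE_subseq[OF int this] obtain r where r: "strict_mono r"
    "AE x in lborel. (\<lambda>j. v (r j + n0) x) \<longlonglongrightarrow> 0" by blast
  have r': "strict_mono (\<lambda>j. r j + n0)" using r(1) by (simp add: strict_mono_def)
  show ?thesis
  proof (intro exI[of _ "\<lambda>j. w (r j + n0)"] conjI allI)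
    show "Ck k (w (r j + n0))" for j k by (rule w)
    show "(\<lambda>j. \<integral>\<^sup>+x\<in>Q. norm (grad (w (r j + n0)) x - F x) ^ CARD('n) \<partial>lborel) \<longlonglongrightarrow> 0"
      using LIMSEQ_subseq_LIMSEQ[OF w(3) r'] by (simp add: o_def)
    show "AE x in lborel. x \<in> Q \<longrightarrow> (\<lambda>j. w (r j + n0) x) \<longlonglongrightarrow> f x"
      using r(2)
    proof eventually_elim
      case (elim x)
      show ?case
      proof
        assume "x \<in> Q"
        then have "(\<lambda>j. \<bar>w (r j + n0) x - f x\<bar> ^ CARD('n)) \<longlonglongrightarrow> 0"
          using elim by (simp add: v_def)
        then have "(\<lambda>j. \<bar>w (r j + n0) x - f x\<bar>) \<longlonglongrightarrow> 0"
          by (subst (asm) power_tendsto_0_iff) auto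
        then show "(\<lambda>j. w (r j + n0) x) \<longlonglongrightarrow> f x"
          by (simp add: tendsto_rabs_zero_iff LIM_zero_iff)
      qed
    qed
  qed
qed

text \<open>The coefficient of \<open>a ^ n\<close> tends to 1 as \<tau> tends to 0, so a limit
  argument in which b tends to 0 first loses nothing in the constant.\<close>

lemma power_add_split:
  fixes a b \<tau> :: real
  assumes "0 \<le> a" "0 \<le> b" "0 < \<tau>"
  shows "(a + b) ^ n \<le> (1 + \<tau>) ^ n * a ^ n + (1 + 1 / \<tau>) ^ n * b ^ n"
proof (cases "b \<le> \<tau> * a")
  case True
  then have "(a + b) ^ n \<le> ((1 + \<tau>) * a) ^ n" using assms by (intro power_mono) (auto simp: algebra_simps)
  moreover have "0 \<le> (1 + 1 / \<tau>) ^ n * b ^ n" using assms by auto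
  ultimately show ?thesis by (simp add: power_mult_distrib)
next
  case False
  then have "(a + b) ^ n \<le> ((1 + 1 / \<tau>) * b) ^ n" using assms by (intro power_mono) (auto simp: field_simps)
  moreover have "0 \<le> (1 + \<tau>) ^ n * a ^ n" using assms by auto
  ultimately show ?thesis by (simp add: power_mult_distrib)
qed

text \<open>For smooth functions the kernel bound is integrated against V, and Fubini turns the
  weight into the potential \<open>W\<close> of V. In the limit the left side is handled by Fatou
  and the right side by \<open>power_add_split\<close>; the bound \<open>w0\<close> on the potential
  is needed there only to control the weighted error of the gradients by the unweighted one.\<close>

lemma sobolev_kernel_bound:
  fixes f V :: "real^'n::finite \<Rightarrow> real" and W :: "real^'n \<Rightarrow> ennreal"
  assumes sc: "sobolev_closure Q f F" and N: "CARD('n) = Suc m" and m: "0 < m" and \<sigma>: "real m < \<sigma>"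
    and Q: "convex Q" and Qm[measurable]: "Q \<in> sets borel"
    and d: "0 < d" "\<And>x y. x \<in> Q \<Longrightarrow> y \<in> Q \<Longrightarrow> norm (x - y) \<le> d"
    and Vm[measurable]: "V \<in> borel_measurable borel" and V0: "\<And>x. 0 \<le> V x"
    and W_def: "\<And>y. W y = (\<integral>\<^sup>+x\<in>Q. ennreal (V x * logw \<sigma> (norm (y - x) / d)) \<partial>lborel)"
    and W: "\<And>y. y \<in> Q \<Longrightarrow> W y \<le> ennreal w0" and w0: "0 \<le> w0"
  shows "(\<integral>\<^sup>+x\<in>Q. (\<integral>\<^sup>+z\<in>Q. ennreal (V x * \<bar>f z - f x\<bar> ^ Suc m) \<partial>lborel) \<partial>lborel)
    \<le> ennreal (kernel_const m \<sigma> * d ^ Suc m) * (\<integral>\<^sup>+y\<in>Q. norm (F y) ^ Suc m * W y \<partial>lborel)"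
proof -
  let ?C = "kernel_const m \<sigma> * d ^ Suc m"
  have C: "0 < ?C" using kernel_const_pos[OF m \<sigma>] d by simp
  have fm[measurable]: "f \<in> borel_measurable borel" "F \<in> borel_measurable borel"
    using sc by (simp_all add: sobolev_closure_def)
  have [measurable]: "W \<in> borel_measurable borel" unfolding W_def by measurable
  obtain w where w: "\<And>j k. Ck k (w j)"
    "(\<lambda>j. \<integral>\<^sup>+x\<in>Q. norm (grad (w j) x - F x) ^ CARD('n) \<partial>lborel) \<longlonglongrightarrow> 0"
    "AE x in lborel. x \<in> Q \<longrightarrow> (\<lambda>j. w j x) \<longlonglongrightarrow> f x"
    using sobolev_closure_AE[OF sc Qm] by blast
  have [measurable]: "w j \<in> borel_measurable borel" for j using w(1) Ck_measurable by blast
  have cg: "continuous_on UNIV (grad (w j))" for j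
    using w(1)[of 1 j] by (auto simp: grad_def intro!: continuous_on_vec_lambda)
  have [measurable]: "grad (w j) \<in> borel_measurable borel" for j
    by (rule borel_measurable_continuous_onI[OF cg])
  define L where "L j = (\<integral>\<^sup>+x\<in>Q. (\<integral>\<^sup>+z\<in>Q. ennreal (V x * \<bar>w j z - w j x\<bar> ^ Suc m) \<partial>lborel) \<partial>lborel)" for j
  define I where "I = (\<integral>\<^sup>+y\<in>Q. norm (F y) ^ Suc m * W y \<partial>lborel)"
  define E where "E j = (\<integral>\<^sup>+x\<in>Q. norm (grad (w j) x - F x) ^ Suc m \<partial>lborel)" for j
  have E0: "E \<longlonglongrightarrow> 0" using w(2) unfolding E_def N .
  have L1: "L j \<le> ennreal ?C * (\<integral>\<^sup>+y\<in>Q. norm (grad (w j) y) ^ Suc m * W y \<partial>lborel)" for j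
  proof -
    have "L j \<le> (\<integral>\<^sup>+x\<in>Q. ennreal ?C * (\<integral>\<^sup>+y\<in>Q. ennreal (V x * (norm (grad (w j) y) ^ Suc m * logw \<sigma> (norm (y - x) / d))) \<partial>lborel) \<partial>lborel)"
      unfolding L_def
    proof (rule nn_integral_mono)
      fix x
      have *: "(\<integral>\<^sup>+z\<in>Q. ennreal (V x * g z) \<partial>lborel) = ennreal (V x) * (\<integral>\<^sup>+z\<in>Q. ennreal (g z) \<partial>lborel)"
        if [measurable]: "g \<in> borel_measurable borel" and "\<And>z. 0 \<le> g z" for g
      proof -
        have "(\<integral>\<^sup>+z\<in>Q. ennreal (V x * g z) \<partial>lborel) = (\<integral>\<^sup>+z. ennreal (V x) * (ennreal (g z) * indicator Q z) \<partial>lborel)"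
          using that V0[of x] by (intro nn_integral_cong) (simp add: ennreal_mult mult.assoc)
        also have "\<dots> = ennreal (V x) * (\<integral>\<^sup>+z\<in>Q. ennreal (g z) \<partial>lborel)"
          by (rule nn_integral_cmult) measurable
        finally show ?thesis .
      qed
      show "(\<integral>\<^sup>+z\<in>Q. ennreal (V x * \<bar>w j z - w j x\<bar> ^ Suc m) \<partial>lborel) * indicator Q x
        \<le> ennreal ?C * (\<integral>\<^sup>+y\<in>Q. ennreal (V x * (norm (grad (w j) y) ^ Suc m * logw \<sigma> (norm (y - x) / d))) \<partial>lborel) * indicator Q x"
      proof (cases "x \<in> Q")
        case True
        have "(\<integral>\<^sup>+z\<in>Q. \<bar>w j z - w j x\<bar> ^ Suc m \<partial>lborel) \<le>
          ennreal ?C * (\<integral>\<^sup>+y\<in>Q. norm (grad (w j) y) ^ Suc m * logw \<sigma> (norm (y - x) / d) \<partial>lborel)"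
          unfolding kernel_const_def by (rule convex_kernel_bound[OF w(1) N m \<sigma> Q Qm True d])
        from mult_left_mono[OF this, of "ennreal (V x)"] show ?thesis
          using True by (subst (1 2) *) (simp_all add: logw_nonneg mult_ac del: power_Suc)
      qed simp
    qed
    also have "\<dots> = ennreal ?C * (\<integral>\<^sup>+x. (\<integral>\<^sup>+y. ennreal (V x * (norm (grad (w j) y) ^ Suc m * logw \<sigma> (norm (y - x) / d))) * indicator Q y * indicator Q x \<partial>lborel) \<partial>lborel)"
    proof -
      have "(\<integral>\<^sup>+y. ennreal (V x * (norm (grad (w j) y) ^ Suc m * logw \<sigma> (norm (y - x) / d))) * indicator Q y * indicator Q x \<partial>lborel)
        = (\<integral>\<^sup>+y. ennreal (V x * (norm (grad (w j) y) ^ Suc m * logw \<sigma> (norm (y - x) / d))) * indicator Q y \<partial>lborel) * indicator Q x" for x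
        by (rule nn_integral_multc) measurable
      then show ?thesis by (subst nn_integral_cmult[symmetric], measurable) (simp only: mult.assoc)
    qed
    also have "(\<integral>\<^sup>+x. (\<integral>\<^sup>+y. ennreal (V x * (norm (grad (w j) y) ^ Suc m * logw \<sigma> (norm (y - x) / d))) * indicator Q y * indicator Q x \<partial>lborel) \<partial>lborel)
       = (\<integral>\<^sup>+y. (\<integral>\<^sup>+x. ennreal (V x * (norm (grad (w j) y) ^ Suc m * logw \<sigma> (norm (y - x) / d))) * indicator Q y * indicator Q x \<partial>lborel) \<partial>lborel)"
      by (rule lborel_pair.Fubini') measurable
    also have "\<dots> = (\<integral>\<^sup>+y\<in>Q. norm (grad (w j) y) ^ Suc m * W y \<partial>lborel)"
    proof (rule nn_integral_cong)
      fix y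
      have "ennreal (V x * (norm (grad (w j) y) ^ Suc m * logw \<sigma> (norm (y - x) / d))) * indicator Q y * indicator Q x
         = ennreal (norm (grad (w j) y) ^ Suc m) * indicator Q y * (ennreal (V x * logw \<sigma> (norm (y - x) / d)) * indicator Q x)" for x
        using V0[of x] logw_nonneg[of \<sigma> "norm (y - x) / d"] by (simp add: ennreal_mult mult_ac del: power_Suc)
      then show "(\<integral>\<^sup>+x. ennreal (V x * (norm (grad (w j) y) ^ Suc m * logw \<sigma> (norm (y - x) / d))) * indicator Q y * indicator Q x \<partial>lborel)
        = ennreal (norm (grad (w j) y) ^ Suc m) * W y * indicator Q y"
        by (simp only:) (subst nn_integral_cmult, measurable, simp only: W_def mult_ac)
    qed
    finally show ?thesis .
  qed
  have L2: "L j \<le> ennreal ?C * (ennreal ((1 + \<tau>) ^ Suc m) * I + ennreal ((1 + 1 / \<tau>) ^ Suc m * w0) * E j)" if \<tau>: "0 < \<tau>" for \<tau> j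
  proof -
    have "(\<integral>\<^sup>+y\<in>Q. norm (grad (w j) y) ^ Suc m * W y \<partial>lborel) \<le>
      (\<integral>\<^sup>+y. ennreal ((1 + \<tau>) ^ Suc m) * (norm (F y) ^ Suc m * W y * indicator Q y)
          + ennreal ((1 + 1 / \<tau>) ^ Suc m * w0) * (ennreal (norm (grad (w j) y - F y) ^ Suc m) * indicator Q y) \<partial>lborel)"
    proof (rule nn_integral_mono)
      fix y
      show "ennreal (norm (grad (w j) y) ^ Suc m) * W y * indicator Q y \<le> ennreal ((1 + \<tau>) ^ Suc m) * (norm (F y) ^ Suc m * W y * indicator Q y)
          + ennreal ((1 + 1 / \<tau>) ^ Suc m * w0) * (ennreal (norm (grad (w j) y - F y) ^ Suc m) * indicator Q y)"
      proof (cases "y \<in> Q")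
        case True
        have "norm (grad (w j) y) \<le> norm (F y) + norm (grad (w j) y - F y)"
          using norm_triangle_ineq[of "F y" "grad (w j) y - F y"] by simp
        then have "norm (grad (w j) y) ^ Suc m \<le> (norm (F y) + norm (grad (w j) y - F y)) ^ Suc m" by (intro power_mono) auto
        also have "\<dots> \<le> (1 + \<tau>) ^ Suc m * norm (F y) ^ Suc m + (1 + 1 / \<tau>) ^ Suc m * norm (grad (w j) y - F y) ^ Suc m"
          using \<tau> by (intro power_add_split) auto
        finally have "ennreal (norm (grad (w j) y) ^ Suc m) \<le> ennreal ((1 + \<tau>) ^ Suc m * norm (F y) ^ Suc m + (1 + 1 / \<tau>) ^ Suc m * norm (grad (w j) y - F y) ^ Suc m)"
          by (rule ennreal_leI)
        also have "\<dots> = ennreal ((1 + \<tau>) ^ Suc m) * ennreal (norm (F y) ^ Suc m) + ennreal ((1 + 1 / \<tau>) ^ Suc m) * ennreal (norm (grad (w j) y - F y) ^ Suc m)"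
          using \<tau> by (subst ennreal_plus) (auto simp: ennreal_mult simp del: power_Suc)
        finally have "ennreal (norm (grad (w j) y) ^ Suc m) * W y \<le>
          (ennreal ((1 + \<tau>) ^ Suc m) * ennreal (norm (F y) ^ Suc m) + ennreal ((1 + 1 / \<tau>) ^ Suc m) * ennreal (norm (grad (w j) y - F y) ^ Suc m)) * W y"
          by (rule mult_right_mono) simp
        also have "\<dots> = ennreal ((1 + \<tau>) ^ Suc m) * (ennreal (norm (F y) ^ Suc m) * W y) + ennreal ((1 + 1 / \<tau>) ^ Suc m) * ennreal (norm (grad (w j) y - F y) ^ Suc m) * W y"
          by (simp add: distrib_right mult.assoc)
        also have "\<dots> \<le> ennreal ((1 + \<tau>) ^ Suc m) * (ennreal (norm (F y) ^ Suc m) * W y) + ennreal ((1 + 1 / \<tau>) ^ Suc m) * ennreal (norm (grad (w j) y - F y) ^ Suc m) * ennreal w0"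
          using W[OF True] by (intro add_left_mono mult_left_mono) auto
        finally show ?thesis using True \<tau> w0 by (simp add: ennreal_mult mult_ac del: power_Suc)
      qed simp
    qed
    also have "\<dots> = ennreal ((1 + \<tau>) ^ Suc m) * I + ennreal ((1 + 1 / \<tau>) ^ Suc m * w0) * E j"
      unfolding I_def E_def by (simp add: nn_integral_add nn_integral_cmult del: power_Suc)
    finally show ?thesis by (intro order_trans[OF L1 mult_left_mono]) auto
  qed
  have fat: "(\<integral>\<^sup>+x\<in>Q. (\<integral>\<^sup>+z\<in>Q. ennreal (V x * \<bar>f z - f x\<bar> ^ Suc m) \<partial>lborel) \<partial>lborel) \<le> liminf L"
  proof -
    have inner: "(\<integral>\<^sup>+z\<in>Q. ennreal (V x * \<bar>f z - f x\<bar> ^ Suc m) \<partial>lborel) \<le> liminf (\<lambda>j. \<integral>\<^sup>+z\<in>Q. ennreal (V x * \<bar>w j z - w j x\<bar> ^ Suc m) \<partial>lborel)"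
      if x: "(\<lambda>j. w j x) \<longlonglongrightarrow> f x" for x
    proof -
      have "(\<integral>\<^sup>+z\<in>Q. ennreal (V x * \<bar>f z - f x\<bar> ^ Suc m) \<partial>lborel) \<le> (\<integral>\<^sup>+z. liminf (\<lambda>j. ennreal (V x * \<bar>w j z - w j x\<bar> ^ Suc m) * indicator Q z) \<partial>lborel)"
      proof (rule nn_integral_mono_AE)
        show "AE z in lborel. ennreal (V x * \<bar>f z - f x\<bar> ^ Suc m) * indicator Q z \<le> liminf (\<lambda>j. ennreal (V x * \<bar>w j z - w j x\<bar> ^ Suc m) * indicator Q z)"
          using w(3)
        proof eventually_elim
          case (elim z)
          show ?case
          proof (cases "z \<in> Q")
            case True
            then have z: "(\<lambda>j. w j z) \<longlonglongrightarrow> f z" using elim by simp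
            have "(\<lambda>j. ennreal (V x * \<bar>w j z - w j x\<bar> ^ Suc m)) \<longlonglongrightarrow> ennreal (V x * \<bar>f z - f x\<bar> ^ Suc m)"
              by (intro tendsto_ennrealI tendsto_intros z x)
            then show ?thesis using True by (simp add: lim_imp_Liminf del: power_Suc)
          qed simp
        qed
      qed
      also have "\<dots> \<le> liminf (\<lambda>j. \<integral>\<^sup>+z\<in>Q. ennreal (V x * \<bar>w j z - w j x\<bar> ^ Suc m) \<partial>lborel)"
        by (rule nn_integral_liminf) measurable
      finally show ?thesis .
    qed
    have "(\<integral>\<^sup>+x\<in>Q. (\<integral>\<^sup>+z\<in>Q. ennreal (V x * \<bar>f z - f x\<bar> ^ Suc m) \<partial>lborel) \<partial>lborel) \<le>
      (\<integral>\<^sup>+x. liminf (\<lambda>j. (\<integral>\<^sup>+z\<in>Q. ennreal (V x * \<bar>w j z - w j x\<bar> ^ Suc m) \<partial>lborel) * indicator Q x) \<partial>lborel)"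
    proof (rule nn_integral_mono_AE)
      show "AE x in lborel. (\<integral>\<^sup>+z\<in>Q. ennreal (V x * \<bar>f z - f x\<bar> ^ Suc m) \<partial>lborel) * indicator Q x \<le> liminf (\<lambda>j. (\<integral>\<^sup>+z\<in>Q. ennreal (V x * \<bar>w j z - w j x\<bar> ^ Suc m) \<partial>lborel) * indicator Q x)"
        using w(3)
      proof eventually_elim
        case (elim x)
        then show ?case using inner[of x] by (cases "x \<in> Q") auto
      qed
    qed
    also have "\<dots> \<le> liminf L"
      unfolding L_def by (rule nn_integral_liminf) measurable
    finally show ?thesis .
  qed
  have step: "liminf L \<le> ennreal ?C * (ennreal ((1 + \<tau>) ^ Suc m) * I)" if \<tau>: "0 < \<tau>" for \<tau>
  proof -
    have "(\<lambda>j. ennreal ?C * (ennreal ((1 + \<tau>) ^ Suc m) * I + ennreal ((1 + 1 / \<tau>) ^ Suc m * w0) * E j)) \<longlonglongrightarrow>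
      ennreal ?C * (ennreal ((1 + \<tau>) ^ Suc m) * I + ennreal ((1 + 1 / \<tau>) ^ Suc m * w0) * 0)"
      by (intro ennreal_tendsto_cmult tendsto_add tendsto_const E0) auto
    from lim_imp_Liminf[OF _ this] have "liminf (\<lambda>j. ennreal ?C * (ennreal ((1 + \<tau>) ^ Suc m) * I + ennreal ((1 + 1 / \<tau>) ^ Suc m * w0) * E j))
       = ennreal ?C * (ennreal ((1 + \<tau>) ^ Suc m) * I)" by simp
    moreover have "liminf L \<le> liminf (\<lambda>j. ennreal ?C * (ennreal ((1 + \<tau>) ^ Suc m) * I + ennreal ((1 + 1 / \<tau>) ^ Suc m * w0) * E j))"
      using L2[OF \<tau>] by (intro Liminf_mono) auto
    ultimately show ?thesis by simp
  qed
  have "liminf L \<le> ennreal ?C * I"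
  \<comment> \<open>Multiplication by a fixed extended real passes to limits only for a finite
    factor, so the infinite case is separated before \<tau> tends to 0.\<close>
  proof (cases "I = \<infinity>")
    case True
    have "ennreal ?C \<noteq> 0" using C by (metis ennreal_eq_0_iff not_le)
    then have "ennreal ?C * I = top" using True by (simp only: ennreal_mult_eq_top_iff infinity_ennreal_def) simp
    then show ?thesis by simp
  next
    case False
    have t0: "(\<lambda>j. inverse (real (Suc j))) \<longlonglongrightarrow> 0" by (rule LIMSEQ_inverse_real_of_nat)
    have "(\<lambda>j. (1 + inverse (real (Suc j))) ^ Suc m) \<longlonglongrightarrow> (1 + 0) ^ Suc m"
      by (intro tendsto_intros t0)
    then have "(\<lambda>j. ennreal ((1 + inverse (real (Suc j))) ^ Suc m)) \<longlonglongrightarrow> ennreal ((1 + 0) ^ Suc m)" by (rule tendsto_ennrealI)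
    then have "(\<lambda>j. I * ennreal ((1 + inverse (real (Suc j))) ^ Suc m)) \<longlonglongrightarrow> I * ennreal ((1 + 0) ^ Suc m)"
      by (rule ennreal_tendsto_cmult[rotated]) (use False in \<open>simp add: less_top\<close>)
    then have "(\<lambda>j. ennreal ?C * (I * ennreal ((1 + inverse (real (Suc j))) ^ Suc m))) \<longlonglongrightarrow> ennreal ?C * (I * ennreal ((1 + 0) ^ Suc m))"
      by (rule ennreal_tendsto_cmult[rotated]) simp
    then have "liminf L \<le> ennreal ?C * (I * ennreal ((1 + 0) ^ Suc m))"
      by (rule tendsto_lowerbound) (auto intro!: eventuallyI simp: mult.commute[of I] simp del: power_Suc of_nat_Suc intro: step)
    then show ?thesis by simp
  qed
  then show ?thesis using fat unfolding I_def by (rule order_trans[rotated])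
qed

lemma nn_integral_first_moment:
  assumes [measurable]: "Q \<in> sets M" "h \<in> borel_measurable M"
    and q: "emeasure M Q = ennreal q" "0 < q" and A: "(\<integral>\<^sup>+z\<in>Q. h z \<partial>M) \<le> ennreal A" "0 \<le> A"
  shows "\<exists>z\<in>Q. h z \<le> ennreal (A / q)"
proof (rule ccontr)
  assume "\<not> ?thesis"
  then have less: "\<And>z. z \<in> Q \<Longrightarrow> ennreal (A / q) < h z" by auto
  have fin: "(\<integral>\<^sup>+z\<in>Q. ennreal (A / q) \<partial>M) = ennreal A"
    using q A by (subst nn_integral_cmult_indicator) (auto simp: ennreal_mult[symmetric])
  have "(\<integral>\<^sup>+z\<in>Q. ennreal (A / q) \<partial>M) < (\<integral>\<^sup>+z\<in>Q. h z \<partial>M)"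
  proof (rule nn_integral_less)
    show "AE z in M. ennreal (A / q) * indicator Q z \<le> h z * indicator Q z"
      using less by (intro AE_I2) (auto simp: indicator_def less_imp_le)
    show "\<not> (AE z in M. h z * indicator Q z \<le> ennreal (A / q) * indicator Q z)"
    proof
      assume "AE z in M. h z * indicator Q z \<le> ennreal (A / q) * indicator Q z"
      then have "AE z in M. z \<notin> Q"
        by eventually_elim (use less in \<open>fastforce simp: indicator_def not_le[symmetric] split: if_splits\<close>)
      moreover have "{x \<in> space M. \<not> x \<notin> Q} = Q" using sets.sets_into_space[OF assms(1)] by auto
      ultimately have "emeasure M Q = 0" by (subst (asm) AE_iff_measurable[OF assms(1)]) auto
      then show False using q by simp
    qed
  qed (use fin in auto)
  then show False using A(1) fin by simp
qed

text \<open>The constant is a value f z at a suitable point z: by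
  \<open>sobolev_kernel_bound\<close> the mean over z of the weighted deviation from f z is bounded,
  so some z does at least as well. Two weights are treated together because one constant has to
  serve both.\<close>

lemma sobolev_poincare:
  fixes f V1 V2 :: "real^'n::finite \<Rightarrow> real"
  assumes sc: "sobolev_closure Q f F" and N: "CARD('n) = Suc m" and m: "0 < m" and \<sigma>: "real m < \<sigma>"
    and Q: "convex Q" and Qm[measurable]: "Q \<in> sets borel"
    and d: "0 < d" "\<And>x y. x \<in> Q \<Longrightarrow> y \<in> Q \<Longrightarrow> norm (x - y) \<le> d"
    and V1m[measurable]: "V1 \<in> borel_measurable borel" and V10: "\<And>x. 0 \<le> V1 x"
    and W1: "\<And>y. y \<in> Q \<Longrightarrow> (\<integral>\<^sup>+x\<in>Q. ennreal (V1 x * logw \<sigma> (norm (y - x) / d)) \<partial>lborel) \<le> ennreal w1" and w1: "0 < w1"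
    and V2m[measurable]: "V2 \<in> borel_measurable borel" and V20: "\<And>x. 0 \<le> V2 x"
    and W2: "\<And>y. y \<in> Q \<Longrightarrow> (\<integral>\<^sup>+x\<in>Q. ennreal (V2 x * logw \<sigma> (norm (y - x) / d)) \<partial>lborel) \<le> ennreal w2" and w2: "0 < w2"
    and q: "emeasure lborel Q = ennreal q" "0 < q"
    and E: "(\<integral>\<^sup>+y\<in>Q. norm (F y) ^ Suc m \<partial>lborel) \<le> ennreal E" "0 \<le> E"
  shows "\<exists>c. (\<integral>\<^sup>+x\<in>Q. ennreal (V1 x * \<bar>f x - c\<bar> ^ Suc m) \<partial>lborel) \<le> ennreal (2 * kernel_const m \<sigma> * d ^ Suc m / q * w1 * E)
    \<and> (\<integral>\<^sup>+x\<in>Q. ennreal (V2 x * \<bar>f x - c\<bar> ^ Suc m) \<partial>lborel) \<le> ennreal (2 * kernel_const m \<sigma> * d ^ Suc m / q * w2 * E)"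
proof -
  let ?C = "kernel_const m \<sigma> * d ^ Suc m"
  have C: "0 < ?C" using kernel_const_pos[OF m \<sigma>] d by simp
  have fm[measurable]: "f \<in> borel_measurable borel" "F \<in> borel_measurable borel"
    using sc by (simp_all add: sobolev_closure_def)
  \<comment> \<open>Normalising each weight by its own potential bound gives a sum with potential at
    most 2 that dominates both weights up to the factors \<open>w1\<close> and
    \<open>w2\<close>.\<close>
  define V where "V x = V1 x / w1 + V2 x / w2" for x
  have V0: "0 \<le> V x" for x using V10 V20 w1 w2 by (simp add: V_def)
  have Vm[measurable]: "V \<in> borel_measurable borel" unfolding V_def by measurable
  define W where "W y = (\<integral>\<^sup>+x\<in>Q. ennreal (V x * logw \<sigma> (norm (y - x) / d)) \<partial>lborel)" for y
  have [measurable]: "W \<in> borel_measurable borel" unfolding W_def by measurable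
  have W: "W y \<le> ennreal 2" if y: "y \<in> Q" for y
  proof -
    have "W y = (\<integral>\<^sup>+x. ennreal (1 / w1) * (ennreal (V1 x * logw \<sigma> (norm (y - x) / d)) * indicator Q x)
        + ennreal (1 / w2) * (ennreal (V2 x * logw \<sigma> (norm (y - x) / d)) * indicator Q x) \<partial>lborel)"
      unfolding W_def
    proof (rule nn_integral_cong)
      fix x
      let ?l = "logw \<sigma> (norm (y - x) / d)"
      have "V x * ?l = 1 / w1 * (V1 x * ?l) + 1 / w2 * (V2 x * ?l)" by (simp add: V_def algebra_simps)
      then have "ennreal (V x * ?l) = ennreal (1 / w1) * ennreal (V1 x * ?l) + ennreal (1 / w2) * ennreal (V2 x * ?l)"
        using V10[of x] V20[of x] w1 w2 logw_nonneg[of \<sigma> "norm (y - x) / d"] by (simp add: ennreal_plus ennreal_mult[symmetric])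
      then show "ennreal (V x * ?l) * indicator Q x = ennreal (1 / w1) * (ennreal (V1 x * ?l) * indicator Q x)
        + ennreal (1 / w2) * (ennreal (V2 x * ?l) * indicator Q x)" by (cases "x \<in> Q") auto
    qed
    also have "\<dots> = ennreal (1 / w1) * (\<integral>\<^sup>+x\<in>Q. ennreal (V1 x * logw \<sigma> (norm (y - x) / d)) \<partial>lborel)
      + ennreal (1 / w2) * (\<integral>\<^sup>+x\<in>Q. ennreal (V2 x * logw \<sigma> (norm (y - x) / d)) \<partial>lborel)"
      by (simp add: nn_integral_add nn_integral_cmult)
    also have "\<dots> \<le> ennreal (1 / w1) * ennreal w1 + ennreal (1 / w2) * ennreal w2"
      by (intro add_mono mult_left_mono W1 W2 y) auto
    also have "\<dots> = ennreal 2" using w1 w2 by (simp add: ennreal_mult[symmetric] flip: ennreal_1 ennreal_plus)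
    finally show ?thesis .
  qed
  define h where "h z = (\<integral>\<^sup>+x\<in>Q. ennreal (V x * \<bar>f z - f x\<bar> ^ Suc m) \<partial>lborel)" for z
  have [measurable]: "h \<in> borel_measurable borel" unfolding h_def by measurable
  have "(\<integral>\<^sup>+z\<in>Q. h z \<partial>lborel) = (\<integral>\<^sup>+z. (\<integral>\<^sup>+x. ennreal (V x * \<bar>f z - f x\<bar> ^ Suc m) * indicator Q x * indicator Q z \<partial>lborel) \<partial>lborel)"
    unfolding h_def by (intro nn_integral_cong nn_integral_multc[symmetric]) measurable
  also have "\<dots> = (\<integral>\<^sup>+x. (\<integral>\<^sup>+z. ennreal (V x * \<bar>f z - f x\<bar> ^ Suc m) * indicator Q x * indicator Q z \<partial>lborel) \<partial>lborel)"
    by (rule lborel_pair.Fubini') measurable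
  also have "\<dots> = (\<integral>\<^sup>+x. (\<integral>\<^sup>+z\<in>Q. ennreal (V x * \<bar>f z - f x\<bar> ^ Suc m) \<partial>lborel) * indicator Q x \<partial>lborel)"
    by (subst nn_integral_multc[symmetric]) (auto simp: mult_ac intro!: nn_integral_cong)
  also have "\<dots> \<le> ennreal ?C * (\<integral>\<^sup>+y\<in>Q. norm (F y) ^ Suc m * W y \<partial>lborel)"
    by (rule sobolev_kernel_bound[OF sc N m \<sigma> Q Qm d Vm V0 W_def W]) auto
  also have "\<dots> \<le> ennreal ?C * (\<integral>\<^sup>+y. ennreal 2 * (norm (F y) ^ Suc m * indicator Q y) \<partial>lborel)"
  proof (intro mult_left_mono nn_integral_mono)
    fix y
    show "ennreal (norm (F y) ^ Suc m) * W y * indicator Q y \<le> ennreal 2 * ennreal (norm (F y) ^ Suc m * indicator Q y)"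
      using mult_left_mono[OF W[of y], of "ennreal (norm (F y) ^ Suc m)"]
      by (cases "y \<in> Q") (auto simp: mult_ac simp del: power_Suc)
  qed simp
  also have "(\<integral>\<^sup>+y. ennreal 2 * (norm (F y) ^ Suc m * indicator Q y) \<partial>lborel) = ennreal 2 * (\<integral>\<^sup>+y\<in>Q. norm (F y) ^ Suc m \<partial>lborel)"
    by (subst nn_integral_cmult[symmetric]) (auto intro!: nn_integral_cong simp: indicator_def)
  also have "ennreal ?C * (ennreal 2 * (\<integral>\<^sup>+y\<in>Q. norm (F y) ^ Suc m \<partial>lborel)) \<le> ennreal ?C * (ennreal 2 * ennreal E)"
    by (intro mult_left_mono E) auto
  also have "\<dots> = ennreal (2 * ?C * E)"
  proof -
    have "ennreal 2 * ennreal E = ennreal (2 * E)" using E by (intro ennreal_mult[symmetric]) auto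
    moreover have "ennreal ?C * ennreal (2 * E) = ennreal (?C * (2 * E))"
      using C E by (intro ennreal_mult[symmetric]) auto
    ultimately show ?thesis by (simp only: mult_ac)
  qed
  finally have "(\<integral>\<^sup>+z\<in>Q. h z \<partial>lborel) \<le> ennreal (2 * ?C * E)" .
  then have "\<exists>z\<in>Q. h z \<le> ennreal (2 * ?C * E / q)"
    using q E C by (intro nn_integral_first_moment) auto
  then obtain z where z: "h z \<le> ennreal (2 * ?C * E / q)" by blast
  have bd: "(\<integral>\<^sup>+x\<in>Q. ennreal (V' x * \<bar>f x - f z\<bar> ^ Suc m) \<partial>lborel) \<le> ennreal (2 * kernel_const m \<sigma> * d ^ Suc m / q * w * E)"
    if w: "0 < w" and le: "\<And>x. V' x \<le> w * V x" for V' w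
  proof -
    have "(\<integral>\<^sup>+x\<in>Q. ennreal (V' x * \<bar>f x - f z\<bar> ^ Suc m) \<partial>lborel) \<le> (\<integral>\<^sup>+x. ennreal w * (ennreal (V x * \<bar>f z - f x\<bar> ^ Suc m) * indicator Q x) \<partial>lborel)"
    proof (rule nn_integral_mono)
      fix x
      have "V' x * \<bar>f x - f z\<bar> ^ Suc m \<le> (w * V x) * \<bar>f x - f z\<bar> ^ Suc m" by (intro mult_right_mono le) auto
      also have "\<dots> = w * (V x * \<bar>f z - f x\<bar> ^ Suc m)" by (simp add: abs_minus_commute)
      finally have "ennreal (V' x * \<bar>f x - f z\<bar> ^ Suc m) \<le> ennreal w * ennreal (V x * \<bar>f z - f x\<bar> ^ Suc m)"
        using w V0[of x] by (subst ennreal_mult[symmetric]) (auto intro: ennreal_leI)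
      then show "ennreal (V' x * \<bar>f x - f z\<bar> ^ Suc m) * indicator Q x \<le> ennreal w * (ennreal (V x * \<bar>f z - f x\<bar> ^ Suc m) * indicator Q x)"
        by (cases "x \<in> Q") auto
    qed
    also have "\<dots> = ennreal w * h z" unfolding h_def by (rule nn_integral_cmult) measurable
    also have "\<dots> \<le> ennreal w * ennreal (2 * ?C * E / q)" by (intro mult_left_mono z) auto
    also have "\<dots> = ennreal (w * (2 * ?C * E / q))"
      using w C E q by (intro ennreal_mult[symmetric]) auto
    finally show ?thesis by (simp add: mult_ac)
  qed
  show ?thesis
  proof (intro exI[of _ "f z"] conjI bd w1 w2)
    show "V1 x \<le> w1 * V x" "V2 x \<le> w2 * V x" for x
      using V10[of x] V20[of x] w1 w2 by (auto simp: V_def field_simps)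
  qed
qed

section \<open>Potentials of the logarithmic weight\<close>

lemma nn_integral_norm_powr:
  assumes "0 < a" "a < real DIM('a)"
  shows "\<exists>I0>0. \<forall>\<rho>>0. \<forall>y::'a::euclidean_space.
    (\<integral>\<^sup>+x\<in>cball y \<rho>. ennreal (norm (x - y) powr (- a)) \<partial>lborel) \<le> ennreal (I0 * \<rho> powr (real DIM('a) - a))"
proof -
  let ?N = "real DIM('a)"
  let ?v = "unit_ball_vol ?N"
  have v: "0 < ?v" by simp
  \<comment> \<open>The ratio of the geometric series over dyadic shells: halving the radius
    multiplies the volume by 2 to the power -N and the integrand by 2 to the power a.\<close>
  define s where "s = (2::real) powr (- (?N - a))"
  have s: "0 < s" "s < 1" using assms by (auto simp: s_def powr_less_one)
  define I0 where "I0 = ?v * 2 powr a / (1 - s)"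
  have "(\<integral>\<^sup>+x\<in>cball y \<rho>. ennreal (norm (x - y) powr (- a)) \<partial>lborel) \<le> ennreal (I0 * \<rho> powr (?N - a))"
    if \<rho>: "0 < \<rho>" for \<rho> and y :: 'a
  proof -
    define F where "F k x = ennreal ((\<rho> / 2 ^ Suc k) powr (- a)) * indicator (cball y (\<rho> / 2 ^ k)) x" for k and x :: 'a
    have [measurable]: "F k \<in> borel_measurable borel" for k unfolding F_def by measurable
    have "(\<integral>\<^sup>+x\<in>cball y \<rho>. ennreal (norm (x - y) powr (- a)) \<partial>lborel) \<le> (\<integral>\<^sup>+x. (\<Sum>k. F k x) \<partial>lborel)"
    proof (rule nn_integral_mono)
      fix x
      show "ennreal (norm (x - y) powr (- a)) * indicator (cball y \<rho>) x \<le> (\<Sum>k. F k x)"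
      proof (cases "x \<in> cball y \<rho> \<and> x \<noteq> y")
        case True
        let ?t = "norm (x - y)"
        have t: "0 < ?t" "?t \<le> \<rho>" using True by (auto simp: dist_norm norm_minus_commute)
        obtain n0 where "(1/2) ^ n0 < ?t / \<rho>" using real_arch_pow_inv[of "?t / \<rho>" "1/2"] t \<rho> by auto
        then have ex: "\<rho> / 2 ^ n0 < ?t" using \<rho> by (simp add: field_simps power_one_over)
        \<comment> \<open>The least such n is positive since |x - y| \<le> \<rho>, and its
          predecessor is the index of the shell that contains x.\<close>
        define n where "n = (LEAST n. \<rho> / 2 ^ n < ?t)"
        have n: "\<rho> / 2 ^ n < ?t" unfolding n_def by (rule LeastI[of "\<lambda>n. \<rho> / 2 ^ n < ?t" n0, OF ex])
        have "n \<noteq> 0" using n t by (auto intro: ccontr)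
        then obtain k where k: "n = Suc k" by (cases n) auto
        have "\<not> \<rho> / 2 ^ k < ?t" using not_less_Least[of k "\<lambda>n. \<rho> / 2 ^ n < ?t"] k by (simp add: n_def)
        then have in_k: "x \<in> cball y (\<rho> / 2 ^ k)" by (simp add: dist_norm norm_minus_commute)
        have "?t powr (- a) \<le> (\<rho> / 2 ^ Suc k) powr (- a)"
        proof (rule powr_mono2')
          show "0 < \<rho> / 2 ^ Suc k" using \<rho> by (intro divide_pos_pos) auto
        qed (use n k assms in auto)
        then have "ennreal (?t powr (- a)) \<le> F k x" using in_k by (simp add: F_def ennreal_leI)
        also have "\<dots> \<le> (\<Sum>k. F k x)" using sum_le_suminf[of "\<lambda>k. F k x" "{k}"] by simp
        finally show ?thesis using True by simp
      qed auto
    qed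
    also have "\<dots> = (\<Sum>k. \<integral>\<^sup>+x. F k x \<partial>lborel)" by (rule nn_integral_suminf) measurable
    also have "\<dots> = (\<Sum>k. ennreal (?v * 2 powr a * \<rho> powr (?N - a) * s ^ k))"
    proof (rule suminf_cong)
      fix k
      have "(\<integral>\<^sup>+x. F k x \<partial>lborel) = ennreal ((\<rho> / 2 ^ Suc k) powr (- a)) * ennreal (?v * (\<rho> / 2 ^ k) ^ DIM('a))"
        unfolding F_def using \<rho> by (subst nn_integral_cmult_indicator) (auto simp: emeasure_cball)
      also have "\<dots> = ennreal ((\<rho> / 2 ^ Suc k) powr (- a) * (?v * (\<rho> / 2 ^ k) ^ DIM('a)))"
        using \<rho> v by (intro ennreal_mult[symmetric]) auto
      also have "(\<rho> / 2 ^ Suc k) powr (- a) * (?v * (\<rho> / 2 ^ k) ^ DIM('a)) = ?v * 2 powr a * \<rho> powr (?N - a) * s ^ k"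
      proof -
        let ?r = "\<rho> / 2 ^ k"
        have r: "0 < ?r" using \<rho> by simp
        have "(\<rho> / 2 ^ Suc k) powr (- a) = (?r / 2) powr (- a)" by (simp add: mult.commute)
        also have "\<dots> = ?r powr (- a) * 2 powr a" using r by (subst powr_divide) (auto simp: powr_minus divide_inverse)
        finally have "(\<rho> / 2 ^ Suc k) powr (- a) * (?v * ?r ^ DIM('a)) = ?v * 2 powr a * (?r powr (- a) * ?r powr ?N)"
          using r by (simp add: powr_realpow)
        also have "?r powr (- a) * ?r powr ?N = ?r powr (?N - a)" by (simp add: powr_add[symmetric])
        also have "\<dots> = \<rho> powr (?N - a) / (2 ^ k) powr (?N - a)" using \<rho> by (simp add: powr_divide)
        also have "(2 ^ k :: real) powr (?N - a) = (2 powr (?N - a)) ^ k"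
          by (simp add: powr_realpow[symmetric] powr_powr mult.commute)
        also have "\<rho> powr (?N - a) / (2 powr (?N - a)) ^ k = \<rho> powr (?N - a) * s ^ k"
        proof -
          have "s = inverse (2 powr (?N - a))" unfolding s_def by (rule powr_minus)
          then show ?thesis by (simp add: power_inverse divide_inverse)
        qed
        finally show ?thesis by simp
      qed
      finally show "(\<integral>\<^sup>+x. F k x \<partial>lborel) = ennreal (?v * 2 powr a * \<rho> powr (?N - a) * s ^ k)" .
    qed
    also have "\<dots> = ennreal (\<Sum>k. ?v * 2 powr a * \<rho> powr (?N - a) * s ^ k)"
      using s v by (intro suminf_ennreal2 summable_mult summable_geometric) auto
    also have "(\<Sum>k. ?v * 2 powr a * \<rho> powr (?N - a) * s ^ k) = I0 * \<rho> powr (?N - a)"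
      using s by (subst suminf_mult) (auto simp: suminf_geometric summable_geometric I0_def)
    finally show ?thesis .
  qed
  moreover have "0 < I0" using s v by (simp add: I0_def)
  ultimately show ?thesis by blast
qed

lemma logw_le_powr:
  assumes "0 < \<sigma>" "0 < \<beta>"
  shows "\<exists>C>0. \<forall>t. 0 < t \<and> t \<le> 1 \<longrightarrow> logw \<sigma> t \<le> C * t powr (- \<beta>)"
proof (intro exI[of _ "(1 + \<sigma> / \<beta>) powr \<sigma>"] conjI allI impI)
  have "0 < 1 + \<sigma> / \<beta>" using assms by (intro add_pos_pos) auto
  then show "0 < (1 + \<sigma> / \<beta>) powr \<sigma>" by simp
  fix t :: real assume t: "0 < t \<and> t \<le> 1"
  \<comment> \<open>With this exponent the bound of the logarithm by a power, raised to the power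
    \<sigma>, gives exactly \<open>t powr (- \<beta>)\<close>.\<close>
  define \<delta> where "\<delta> = \<beta> / \<sigma>"
  have \<delta>: "0 < \<delta>" using assms by (simp add: \<delta>_def)
  have "ln (1 / t) \<le> (1 / t) powr \<delta> / \<delta>" using t \<delta> by (intro ln_powr_bound) auto
  moreover have "0 \<le> ln (1 / t)" using t by simp
  moreover have "1 \<le> (1 / t) powr \<delta>" using t \<delta> by (intro ge_one_powr_ge_zero) auto
  ultimately have "1 + max 0 (ln (1 / t)) \<le> (1 + 1 / \<delta>) * (1 / t) powr \<delta>" by (simp add: distrib_right)
  then have "logw \<sigma> t \<le> ((1 + 1 / \<delta>) * (1 / t) powr \<delta>) powr \<sigma>"
    unfolding logw_def using assms by (intro powr_mono2) auto
  also have "\<dots> = (1 + \<sigma> / \<beta>) powr \<sigma> * ((1 / t) powr \<delta>) powr \<sigma>"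
    using \<delta> t assms by (subst powr_mult) (auto simp: \<delta>_def)
  also have "((1 / t) powr \<delta>) powr \<sigma> = t powr (- \<beta>)"
  proof -
    have "((1 / t) powr \<delta>) powr \<sigma> = (1 / t) powr \<beta>" using assms by (simp add: powr_powr \<delta>_def)
    also have "\<dots> = t powr (- \<beta>)" by (simp add: powr_divide powr_minus_divide)
    finally show ?thesis .
  qed
  finally show "logw \<sigma> t \<le> (1 + \<sigma> / \<beta>) powr \<sigma> * t powr (- \<beta>)" .
qed

lemma nn_integral_logw_ball:
  assumes "0 < \<sigma>"
  shows "\<exists>b>0. \<forall>d>0. \<forall>y::'a::euclidean_space.
    (\<integral>\<^sup>+x\<in>cball y d. ennreal (logw \<sigma> (norm (y - x) / d)) \<partial>lborel) \<le> ennreal (b * d ^ DIM('a))"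
proof -
  \<comment> \<open>The exponent 1/2 is integrable in every dimension, as the dimension is at least
    1.\<close>
  obtain C where C: "0 < C" "\<And>t. 0 < t \<Longrightarrow> t \<le> 1 \<Longrightarrow> logw \<sigma> t \<le> C * t powr (- (1/2))"
    using logw_le_powr[OF assms, of "1/2"] by auto
  have "1 \<le> real DIM('a)" by (simp add: Suc_leI)
  then obtain I0 where I0: "0 < I0" "\<And>\<rho> y. 0 < \<rho> \<Longrightarrow>
    (\<integral>\<^sup>+x\<in>cball (y::'a) \<rho>. ennreal (norm (x - y) powr (- (1/2))) \<partial>lborel) \<le> ennreal (I0 * \<rho> powr (real DIM('a) - 1/2))"
  proof -
    have "\<exists>I0>0. \<forall>\<rho>>0. \<forall>y::'a.
      (\<integral>\<^sup>+x\<in>cball y \<rho>. ennreal (norm (x - y) powr (- (1/2))) \<partial>lborel) \<le> ennreal (I0 * \<rho> powr (real DIM('a) - 1/2))"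
      by (rule nn_integral_norm_powr) (use \<open>1 \<le> real DIM('a)\<close> in linarith)+
    then show ?thesis using that by blast
  qed
  have "(\<integral>\<^sup>+x\<in>cball y d. ennreal (logw \<sigma> (norm (y - x) / d)) \<partial>lborel) \<le> ennreal (C * I0 * d ^ DIM('a))"
    if d: "0 < d" for d and y :: 'a
  proof -
    have "(\<integral>\<^sup>+x\<in>cball y d. ennreal (logw \<sigma> (norm (y - x) / d)) \<partial>lborel)
      \<le> (\<integral>\<^sup>+x. ennreal (C * d powr (1/2)) * (ennreal (norm (x - y) powr (- (1/2))) * indicator (cball y d) x) \<partial>lborel)"
    proof (rule nn_integral_mono_AE)
      have "AE x in lborel. x \<noteq> y" by (rule AE_lborel_singleton)
      then show "AE x in lborel. ennreal (logw \<sigma> (norm (y - x) / d)) * indicator (cball y d) x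
          \<le> ennreal (C * d powr (1/2)) * (ennreal (norm (x - y) powr (- (1/2))) * indicator (cball y d) x)"
      proof eventually_elim
        case (elim x)
        show ?case
        proof (cases "x \<in> cball y d")
          case True
          then have "logw \<sigma> (norm (y - x) / d) \<le> C * (norm (y - x) / d) powr (- (1/2))"
            using d elim by (intro C(2)) (auto simp: dist_norm)
          also have "(norm (y - x) / d) powr (- (1/2)) = norm (y - x) powr (- (1/2)) / d powr (- (1/2))"
            by (rule powr_divide)
          also have "d powr (- (1/2)) = 1 / d powr (1/2)" by (rule powr_minus_divide)
          finally have "logw \<sigma> (norm (y - x) / d) \<le> C * d powr (1/2) * norm (x - y) powr (- (1/2))"
            unfolding norm_minus_commute[of y x] by (simp add: mult_ac)
          then have "ennreal (logw \<sigma> (norm (y - x) / d)) \<le> ennreal (C * d powr (1/2) * norm (x - y) powr (- (1/2)))"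
            by (rule ennreal_leI)
          also have "\<dots> = ennreal (C * d powr (1/2)) * ennreal (norm (x - y) powr (- (1/2)))"
            using C by (intro ennreal_mult) auto
          finally show ?thesis using True by simp
        qed simp
      qed
    qed
    also have "\<dots> = ennreal (C * d powr (1/2)) * (\<integral>\<^sup>+x\<in>cball y d. ennreal (norm (x - y) powr (- (1/2))) \<partial>lborel)"
      by (rule nn_integral_cmult) measurable
    also have "\<dots> \<le> ennreal (C * d powr (1/2)) * ennreal (I0 * d powr (real DIM('a) - 1/2))"
      by (intro mult_left_mono I0 d) auto
    also have "\<dots> = ennreal (C * I0 * (d powr (1/2) * d powr (real DIM('a) - 1/2)))"
      using C I0 d by (subst ennreal_mult[symmetric]) (auto simp: mult_ac)
    also have "d powr (1/2) * d powr (real DIM('a) - 1/2) = d ^ DIM('a)"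
      using d by (simp add: powr_add[symmetric] powr_realpow)
    finally show ?thesis .
  qed
  then show ?thesis using C I0 by (intro exI[of _ "C * I0"]) auto
qed

text \<open>Compare V x with t to the power -N/2, where t = |y - x|. If V is smaller, the integrand
  is below an integrable power of t, whose integral over a small ball is small. If V is larger, then
  ln (1 / t) is at most 2 ln V, so L with exponent s is controlled by ln (V + 1) to the power s, and
  the spare exponent s - \<sigma> yields a negative power of the logarithm of 1 / \<rho>. Neither
  bound depends on y.\<close>

lemma LlogL_kernel_small:
  fixes V :: "'a::euclidean_space \<Rightarrow> real"
  assumes [measurable]: "V \<in> borel_measurable borel" "D \<in> sets borel"
    and V1: "\<And>x. x \<in> D \<Longrightarrow> 1 \<le> V x" and \<sigma>: "0 < \<sigma>" "\<sigma> < s"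
    and T: "(\<integral>\<^sup>+x\<in>D. ennreal (V x * ln (V x + 1) powr s) \<partial>lborel) < \<infinity>" and e: "0 < e"
  shows "\<exists>\<rho>. 0 < \<rho> \<and> \<rho> < 1 \<and> (\<forall>y. (\<integral>\<^sup>+x\<in>D \<inter> cball y \<rho>. ennreal (V x * logw \<sigma> (norm (y - x))) \<partial>lborel) \<le> ennreal e)"
proof -
  let ?N = "real DIM('a)"
  have N: "1 \<le> ?N" by (simp add: Suc_leI)
  \<comment> \<open>N/4 for the logarithm and N/2 for V add up to 3N/4, still below the
    dimension.\<close>
  obtain C where C: "0 < C" "\<And>t. 0 < t \<Longrightarrow> t \<le> 1 \<Longrightarrow> logw \<sigma> t \<le> C * t powr (- (?N / 4))"
    using logw_le_powr[OF \<sigma>(1), of "?N / 4"] N by auto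
  obtain I0 where I0: "0 < I0" "\<And>\<rho> y. 0 < \<rho> \<Longrightarrow>
    (\<integral>\<^sup>+x\<in>cball (y::'a) \<rho>. ennreal (norm (x - y) powr (- (3 * ?N / 4))) \<partial>lborel) \<le> ennreal (I0 * \<rho> powr (?N - 3 * ?N / 4))"
  proof -
    have "\<exists>I0>0. \<forall>\<rho>>0. \<forall>y::'a.
      (\<integral>\<^sup>+x\<in>cball y \<rho>. ennreal (norm (x - y) powr (- (3 * ?N / 4))) \<partial>lborel) \<le> ennreal (I0 * \<rho> powr (?N - 3 * ?N / 4))"
      by (rule nn_integral_norm_powr) (use N in linarith)+
    then show ?thesis using that by blast
  qed
  define T0 where "T0 = enn2real (\<integral>\<^sup>+x\<in>D. ennreal (V x * ln (V x + 1) powr s) \<partial>lborel)"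
  have T0: "(\<integral>\<^sup>+x\<in>D. ennreal (V x * ln (V x + 1) powr s) \<partial>lborel) = ennreal T0" "0 \<le> T0"
    using T by (auto simp: T0_def)
  \<comment> \<open>The summand 1 / ln 2 comes from bounding 1 by a multiple of ln (V + 1), using V
    \<ge> 1, and the summand 2 from the bound of ln (1 / t) by 2 ln V.\<close>
  define c where "c = (1 / ln 2 + 2 :: real)"
  have ln2: "0 < ln (2::real)" by simp
  have c: "1 \<le> c" using ln2 by (simp add: c_def)
  define R where "R \<rho> = C * (I0 * \<rho> powr (?N - 3 * ?N / 4)) + c powr s * (1 + ln (1 / \<rho>)) powr (- (s - \<sigma>)) * T0" for \<rho> :: real
  have bound: "(\<integral>\<^sup>+x\<in>D \<inter> cball y \<rho>. ennreal (V x * logw \<sigma> (norm (y - x))) \<partial>lborel) \<le> ennreal (R \<rho>)"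
    if \<rho>: "0 < \<rho>" "\<rho> < 1" for \<rho> y
  proof -
    let ?k = "c powr s * (1 + ln (1 / \<rho>)) powr (- (s - \<sigma>))"
    have lr: "0 < ln (1 / \<rho>)" using \<rho> by simp
    have pt: "V x * logw \<sigma> t \<le> C * t powr (- (3 * ?N / 4)) + ?k * (V x * ln (V x + 1) powr s)"
      if x: "x \<in> D" and t: "0 < t" "t \<le> \<rho>" for x t
    proof (cases "V x \<le> t powr (- (?N / 2))")
      case True
      have "V x * logw \<sigma> t \<le> t powr (- (?N / 2)) * (C * t powr (- (?N / 4)))"
        using True C(2)[of t] t \<rho> V1[OF x] by (intro mult_mono) (auto simp: logw_nonneg)
      also have "\<dots> = C * t powr (- (3 * ?N / 4))" by (simp add: powr_add[symmetric])
      finally show ?thesis using V1[OF x] by (smt (verit) mult_nonneg_nonneg powr_ge_zero)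
    next
      case False
      have Vx: "1 \<le> V x" by (rule V1[OF x])
      have "ln (t powr (- (?N / 2))) \<le> ln (V x)" using False t Vx by (subst ln_le_cancel_iff) auto
      then have "?N / 2 * ln (1 / t) \<le> ln (V x)" using t by (simp add: ln_powr ln_div)
      moreover have lt: "0 \<le> ln (1 / t)" using t \<rho> by simp
      then have "ln (1 / t) * (1 / 2) \<le> ?N / 2 * ln (1 / t)" using mult_right_mono[OF N lt] by simp
      ultimately have l1: "ln (1 / t) \<le> 2 * ln (V x)" by simp
      have l2: "ln (V x) \<le> ln (V x + 1)" using Vx by simp
      have l3: "ln 2 \<le> ln (V x + 1)" using Vx by simp
      then have l4: "1 \<le> (1 / ln 2) * ln (V x + 1)" using ln2 by (simp add: field_simps)
      have l5: "1 + max 0 (ln (1 / t)) \<le> c * ln (V x + 1)"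
      proof -
        have "1 + ln (1 / t) \<le> (1 / ln 2) * ln (V x + 1) + 2 * ln (V x + 1)" using l1 l2 l4 by linarith
        then show ?thesis unfolding c_def distrib_right using lt by simp
      qed
      have le: "1 + ln (1 / \<rho>) \<le> 1 + max 0 (ln (1 / t))"
        using t \<rho> by (auto simp: frac_le intro!: max.coboundedI2)
      let ?L = "1 + max 0 (ln (1 / t))"
      have "logw \<sigma> t = ?L powr s * ?L powr (- (s - \<sigma>))"
        by (simp add: logw_def powr_add[symmetric])
      also have "\<dots> \<le> (c * ln (V x + 1)) powr s * (1 + ln (1 / \<rho>)) powr (- (s - \<sigma>))"
        using l5 le lr \<sigma> by (intro mult_mono powr_mono2 powr_mono2') auto
      also have "\<dots> = ?k * ln (V x + 1) powr s"
        using c l3 ln2 by (subst powr_mult) auto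
      finally have "V x * logw \<sigma> t \<le> V x * (?k * ln (V x + 1) powr s)" using Vx by (intro mult_left_mono) auto
      moreover have "0 \<le> C * t powr (- (3 * ?N / 4))" using C by simp
      ultimately show ?thesis by (simp add: mult_ac)
    qed
    have "(\<integral>\<^sup>+x\<in>D \<inter> cball y \<rho>. ennreal (V x * logw \<sigma> (norm (y - x))) \<partial>lborel) \<le>
      (\<integral>\<^sup>+x. ennreal C * (ennreal (norm (x - y) powr (- (3 * ?N / 4))) * indicator (cball y \<rho>) x)
        + ennreal ?k * (ennreal (V x * ln (V x + 1) powr s) * indicator D x) \<partial>lborel)"
    proof (rule nn_integral_mono_AE)
      have "AE x in lborel. x \<noteq> y" by (rule AE_lborel_singleton)
      then show "AE x in lborel. ennreal (V x * logw \<sigma> (norm (y - x))) * indicator (D \<inter> cball y \<rho>) x \<le>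
         ennreal C * (ennreal (norm (x - y) powr (- (3 * ?N / 4))) * indicator (cball y \<rho>) x)
        + ennreal ?k * (ennreal (V x * ln (V x + 1) powr s) * indicator D x)"
      proof eventually_elim
        case (elim x)
        show ?case
        proof (cases "x \<in> D \<inter> cball y \<rho>")
          case True
          then have xD: "x \<in> D" by simp
          have "V x * logw \<sigma> (norm (y - x)) \<le> C * norm (y - x) powr (- (3 * ?N / 4)) + ?k * (V x * ln (V x + 1) powr s)"
            using True elim by (intro pt) (auto simp: dist_norm)
          then have "ennreal (V x * logw \<sigma> (norm (y - x))) \<le> ennreal (C * norm (y - x) powr (- (3 * ?N / 4)) + ?k * (V x * ln (V x + 1) powr s))"
            by (rule ennreal_leI)
          also have "\<dots> = ennreal C * ennreal (norm (y - x) powr (- (3 * ?N / 4))) + ennreal ?k * ennreal (V x * ln (V x + 1) powr s)"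
            using C V1[OF xD] by (simp add: ennreal_plus ennreal_mult)
          finally show ?thesis using True by (simp add: norm_minus_commute)
        qed simp
      qed
    qed
    also have "\<dots> = ennreal C * (\<integral>\<^sup>+x\<in>cball y \<rho>. ennreal (norm (x - y) powr (- (3 * ?N / 4))) \<partial>lborel) + ennreal ?k * ennreal T0"
      by (subst nn_integral_add) (auto simp: nn_integral_cmult T0)
    also have "\<dots> \<le> ennreal C * ennreal (I0 * \<rho> powr (?N - 3 * ?N / 4)) + ennreal ?k * ennreal T0"
      by (intro add_mono mult_left_mono I0 \<rho>) auto
    also have "\<dots> = ennreal (R \<rho>)"
      unfolding R_def using C I0 T0 by (subst ennreal_plus) (auto simp: ennreal_mult)
    finally show ?thesis .
  qed
  have "(R \<longlongrightarrow> C * (I0 * 0) + c powr s * 0 * T0) (at_right 0)"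
    unfolding R_def
  proof (intro tendsto_intros)
    have id0: "((\<lambda>x::real. x) \<longlongrightarrow> 0) (at_right 0)" by (rule tendsto_ident_at)
    have "((\<lambda>\<rho>::real. \<rho> powr (?N - 3 * ?N / 4)) \<longlongrightarrow> 0 powr (?N - 3 * ?N / 4)) (at_right 0)"
      using N by (intro tendsto_powr'[OF id0 tendsto_const])
        (auto simp: eventually_at_right_field intro!: exI[of _ 1])
    then show "((\<lambda>\<rho>::real. \<rho> powr (?N - 3 * ?N / 4)) \<longlongrightarrow> 0) (at_right 0)" by simp
    have "filterlim (\<lambda>\<rho>::real. 1 + ln (inverse \<rho>)) at_top (at_right 0)"
      by (intro filterlim_tendsto_add_at_top[OF tendsto_const] filterlim_compose[OF ln_at_top filterlim_inverse_at_top_right])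
    then show "((\<lambda>\<rho>. (1 + ln (1 / \<rho>)) powr (- (s - \<sigma>))) \<longlongrightarrow> 0) (at_right 0)"
      using \<sigma> by (intro tendsto_neg_powr) (auto simp: inverse_eq_divide)
  qed
  then have "eventually (\<lambda>\<rho>. R \<rho> < e) (at_right 0)"
    using e by (intro order_tendstoD(2)) auto
  moreover have "eventually (\<lambda>\<rho>::real. 0 < \<rho> \<and> \<rho> < 1) (at_right 0)"
    by (auto simp: eventually_at_right_field intro!: exI[of _ 1])
  ultimately have "eventually (\<lambda>\<rho>. R \<rho> < e \<and> 0 < \<rho> \<and> \<rho> < 1) (at_right 0)" by eventually_elim auto
  then obtain \<rho> where "R \<rho> < e" "0 < \<rho>" "\<rho> < 1"
    using eventually_happens[of _ "at_right (0::real)"] by (auto simp: trivial_limit_at_right_real)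
  then show ?thesis
    by (intro exI[of _ \<rho>] conjI allI order_trans[OF bound ennreal_leI]) auto
qed

section \<open>Poincare inequalities on cubes and annuli\<close>

definition bx :: "('n \<Rightarrow> real) \<Rightarrow> ('n \<Rightarrow> real) \<Rightarrow> (real^'n::finite) set" where
  "bx lo hi = {y. \<forall>k. lo k \<le> y $ k \<and> y $ k \<le> hi k}"

lemma bx_eq_cbox: "bx lo hi = cbox (\<chi> k. lo k) (\<chi> k. hi k)"
  by (auto simp: bx_def mem_box_cart)

lemma bx_in_borel [measurable]: "bx lo hi \<in> sets borel"
  by (simp add: bx_eq_cbox)

lemma bx_convex: "convex (bx lo hi)" and bx_compact: "compact (bx lo hi)"
  by (simp_all add: bx_eq_cbox)

lemma emeasure_bx:
  assumes "\<And>k. lo k \<le> hi k"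
  shows "emeasure lborel (bx lo hi :: (real^'n::finite) set) = ennreal (\<Prod>k\<in>UNIV. hi k - lo k)"
proof -
  have ne: "bx lo hi \<noteq> ({} :: (real^'n) set)"
    using assms by (auto simp: bx_def intro!: exI[of _ "\<chi> k. lo k"])
  have "emeasure lborel (bx lo hi :: (real^'n) set) = ennreal (measure lborel (bx lo hi :: (real^'n) set))"
    unfolding bx_eq_cbox
    by (rule emeasure_eq_ennreal_measure) (use emeasure_lborel_cbox_finite in \<open>auto simp: less_top[symmetric]\<close>)
  also have "measure lborel (bx lo hi :: (real^'n) set) = (\<Prod>k\<in>UNIV. hi k - lo k)"
    using ne unfolding bx_eq_cbox by (subst content_cbox_cart) auto
  finally show ?thesis .
qed

lemma emeasure_bx_ge:
  assumes "0 \<le> l" "\<And>k. l \<le> hi k - lo k"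
  shows "ennreal (l ^ CARD('n)) \<le> emeasure lborel (bx lo hi :: (real^'n::finite) set)"
proof -
  have le: "lo k \<le> hi k" for k using assms(1) assms(2)[of k] by linarith
  have "l ^ CARD('n) = (\<Prod>k\<in>(UNIV::'n set). l)" by simp
  also have "\<dots> \<le> (\<Prod>k\<in>UNIV. hi k - lo k)" using assms by (intro prod_mono) auto
  finally show ?thesis by (subst emeasure_bx[OF le]) (rule ennreal_leI)
qed

text \<open>Balls of the maximum norm: their annuli are finite unions of boxes, to which the
  inequalities for convex sets apply.\<close>

definition cube :: "real^'n::finite \<Rightarrow> real \<Rightarrow> (real^'n) set" where
  "cube x r = bx (\<lambda>k. x $ k - r) (\<lambda>k. x $ k + r)"

text \<open>The two pieces of the annulus in \<open>cube x r\<close> on which the \<open>i\<close>-th coordinate stays away from that of \<open>x\<close>;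
  \<open>s\<close> selects the sign. They are convex, and overlap enough for the means of a function on them to be chained.\<close>

definition slab :: "real^'n::finite \<Rightarrow> real \<Rightarrow> 'n \<Rightarrow> bool \<Rightarrow> (real^'n) set" where
  "slab x r i s = bx (\<lambda>k. if k = i \<and> s then x $ k + r / 4 else x $ k - r)
                    (\<lambda>k. if k = i \<and> \<not> s then x $ k - r / 4 else x $ k + r)"

text \<open>The hole is the open cube of a quarter of the radius. The ratio 4 rather than 2 makes
  the annuli of radii r and r / 2 overlap, so that means on consecutive dyadic scales can be
  compared.\<close>

definition annulus :: "real^'n::finite \<Rightarrow> real \<Rightarrow> (real^'n) set" where
  "annulus x r = {y \<in> cube x r. \<exists>i. r / 4 \<le> \<bar>y $ i - x $ i\<bar>}"

lemma mem_cube: "y \<in> cube x r \<longleftrightarrow> (\<forall>k. \<bar>y $ k - x $ k\<bar> \<le> r)"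
  by (auto simp: cube_def bx_def abs_le_iff algebra_simps)

lemma slab_subset_annulus: "0 \<le> r \<Longrightarrow> slab x r i s \<subseteq> annulus x r"
proof
  fix y assume r: "0 \<le> r" and y: "y \<in> slab x r i s"
  have "\<bar>y $ k - x $ k\<bar> \<le> r" for k
    using y r by (auto simp: slab_def bx_def abs_le_iff split: if_splits dest!: spec[of _ k])
  moreover have "r / 4 \<le> \<bar>y $ i - x $ i\<bar>"
    using y r by (auto simp: slab_def bx_def split: if_splits dest!: spec[of _ i])
  ultimately show "y \<in> annulus x r" by (auto simp: annulus_def mem_cube)
qed

lemma annulus_eq_Union:
  assumes "0 \<le> r"
  shows "annulus x r = (\<Union>p\<in>UNIV. slab x r (fst p) (snd p))"
proof (intro subset_antisym subsetI)
  fix y assume "y \<in> annulus x r"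
  then obtain i where y: "y \<in> cube x r" "r / 4 \<le> \<bar>y $ i - x $ i\<bar>" by (auto simp: annulus_def)
  have "\<And>k. x $ k - r \<le> y $ k \<and> y $ k \<le> x $ k + r"
    using y(1) by (auto simp: cube_def bx_def)
  then have "y \<in> slab x r i (x $ i \<le> y $ i)"
    using y(2) by (auto simp: slab_def bx_def abs_if split: if_splits)
  then show "y \<in> (\<Union>p\<in>UNIV. slab x r (fst p) (snd p))" by force
qed (use slab_subset_annulus[OF assms] in blast)

lemma cube_in_borel [measurable]: "cube x r \<in> sets borel"
  and slab_in_borel [measurable]: "slab x r i s \<in> sets borel"
  by (simp_all add: cube_def slab_def bx_in_borel)

lemma annulus_in_borel [measurable]: "0 \<le> r \<Longrightarrow> annulus x r \<in> sets borel"
  by (subst annulus_eq_Union) auto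

lemma cube_norm_le:
  fixes x :: "real^'n::finite"
  assumes "y \<in> cube x r" "z \<in> cube x r"
  shows "norm (y - z) \<le> 2 * r * real CARD('n)"
proof -
  have "\<bar>y $ k - z $ k\<bar> \<le> 2 * r" for k
    using assms[unfolded mem_cube, THEN spec[of _ k]] by linarith
  then have "(\<Sum>k\<in>UNIV. \<bar>(y - z) $ k\<bar>) \<le> (\<Sum>k\<in>(UNIV::'n set). 2 * r)" by (intro sum_mono) simp
  then show ?thesis using norm_le_l1_cart[of "y - z"] by (simp add: mult_ac)
qed

lemma emeasure_cube:
  fixes x :: "real^'n::finite"
  assumes "0 \<le> r" shows "emeasure lborel (cube x r) = ennreal ((2 * r) ^ CARD('n))"
  unfolding cube_def using assms by (subst emeasure_bx) auto

lemma emeasure_le_cube: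
  fixes x :: "real^'n::finite"
  assumes "S \<subseteq> cube x r" "0 \<le> r"
  shows "emeasure lborel S \<le> ennreal ((2 * r) ^ CARD('n))"
  using emeasure_mono[OF assms(1), of lborel] emeasure_cube[OF assms(2), of x] by simp

lemma sobolev_closure_mono: "sobolev_closure K f F \<Longrightarrow> K' \<subseteq> K \<Longrightarrow> sobolev_closure K' f F"
proof -
  assume a: "sobolev_closure K f F" and s: "K' \<subseteq> K"
  obtain w where w: "\<And>j k. Ck k (w j)"
    "(\<lambda>j. \<integral>\<^sup>+x\<in>K. \<bar>w j x - f x\<bar> ^ CARD('a) \<partial>lborel) \<longlonglongrightarrow> 0"
    "(\<lambda>j. \<integral>\<^sup>+x\<in>K. norm (grad (w j) x - F x) ^ CARD('a) \<partial>lborel) \<longlonglongrightarrow> 0"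
    using a unfolding sobolev_closure_def by blast
  have mono: "(\<integral>\<^sup>+x\<in>K'. h x \<partial>lborel) \<le> (\<integral>\<^sup>+x\<in>K. h x \<partial>lborel)" for h
    using s by (intro nn_integral_mono mult_left_mono) (auto simp: indicator_def)
  have "(\<lambda>j. \<integral>\<^sup>+x\<in>K'. \<bar>w j x - f x\<bar> ^ CARD('a) \<partial>lborel) \<longlonglongrightarrow> 0"
    by (rule tendsto_sandwich[OF _ _ tendsto_const w(2)]) (auto intro: always_eventually mono)
  moreover have "(\<lambda>j. \<integral>\<^sup>+x\<in>K'. norm (grad (w j) x - F x) ^ CARD('a) \<partial>lborel) \<longlonglongrightarrow> 0"
    by (rule tendsto_sandwich[OF _ _ tendsto_const w(3)]) (auto intro: always_eventually mono)
  ultimately show ?thesis using a w(1) unfolding sobolev_closure_def by blast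
qed

text \<open>On the common part P both constants are close to f in the mean, hence close to each
  other; integrating over P divides the sum of the two errors by the measure of P.\<close>

lemma const_power_le:
  fixes f :: "'a \<Rightarrow> real"
  assumes [measurable]: "f \<in> borel_measurable M" "P \<in> sets M" "Q1 \<in> sets M" "Q2 \<in> sets M"
    and P: "P \<subseteq> Q1" "P \<subseteq> Q2" and p: "ennreal p \<le> emeasure M P" "0 < p"
    and A1: "(\<integral>\<^sup>+x\<in>Q1. ennreal (\<bar>f x - c1\<bar> ^ n) \<partial>M) \<le> ennreal A1" "0 \<le> A1"
    and A2: "(\<integral>\<^sup>+x\<in>Q2. ennreal (\<bar>f x - c2\<bar> ^ n) \<partial>M) \<le> ennreal A2" "0 \<le> A2"
  shows "\<bar>c1 - c2\<bar> ^ n \<le> 2 ^ n * (A1 + A2) / p"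
proof -
  have "ennreal (\<bar>c1 - c2\<bar> ^ n * p) \<le> ennreal (\<bar>c1 - c2\<bar> ^ n) * emeasure M P"
    using p by (subst ennreal_mult) (auto intro: mult_left_mono)
  also have "\<dots> = (\<integral>\<^sup>+x\<in>P. ennreal (\<bar>c1 - c2\<bar> ^ n) \<partial>M)"
    by (subst nn_integral_cmult_indicator) auto
  also have "\<dots> \<le> (\<integral>\<^sup>+x. ennreal (2 ^ n) * (ennreal (\<bar>f x - c1\<bar> ^ n) * indicator Q1 x + ennreal (\<bar>f x - c2\<bar> ^ n) * indicator Q2 x) \<partial>M)"
  proof (rule nn_integral_mono)
    fix x
    have "\<bar>c1 - c2\<bar> ^ n \<le> 2 ^ n * (\<bar>c1 - f x\<bar> ^ n + \<bar>f x - c2\<bar> ^ n)"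
      using abs_power_add_le[of "c1 - f x" "f x - c2" n] by simp
    then have "ennreal (\<bar>c1 - c2\<bar> ^ n) \<le> ennreal (2 ^ n * (\<bar>f x - c1\<bar> ^ n + \<bar>f x - c2\<bar> ^ n))"
      by (intro ennreal_leI) (simp add: abs_minus_commute)
    also have "\<dots> = ennreal (2 ^ n) * (ennreal (\<bar>f x - c1\<bar> ^ n) + ennreal (\<bar>f x - c2\<bar> ^ n))"
      by (subst ennreal_mult) (auto simp: ennreal_plus)
    finally show "ennreal (\<bar>c1 - c2\<bar> ^ n) * indicator P x \<le> ennreal (2 ^ n) * (ennreal (\<bar>f x - c1\<bar> ^ n) * indicator Q1 x + ennreal (\<bar>f x - c2\<bar> ^ n) * indicator Q2 x)"
      using subsetD[OF P(1), of x] subsetD[OF P(2), of x] by (cases "x \<in> P") simp_all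
  qed
  also have "\<dots> = ennreal (2 ^ n) * ((\<integral>\<^sup>+x\<in>Q1. ennreal (\<bar>f x - c1\<bar> ^ n) \<partial>M) + (\<integral>\<^sup>+x\<in>Q2. ennreal (\<bar>f x - c2\<bar> ^ n) \<partial>M))"
    by (subst nn_integral_cmult, measurable, subst nn_integral_add) auto
  also have "\<dots> \<le> ennreal (2 ^ n) * (ennreal A1 + ennreal A2)"
    by (intro mult_left_mono add_mono A1 A2) auto
  also have "\<dots> = ennreal (2 ^ n * (A1 + A2))"
    using A1 A2 by (subst ennreal_mult) (auto simp: ennreal_plus)
  finally have "\<bar>c1 - c2\<bar> ^ n * p \<le> 2 ^ n * (A1 + A2)"
    using A1 A2 by (subst (asm) ennreal_le_iff) auto
  then show ?thesis using p by (simp add: field_simps)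
qed

lemma recenter_power_le:
  fixes f V :: "'a \<Rightarrow> real"
  assumes [measurable]: "f \<in> borel_measurable M" "Q \<in> sets M" "V \<in> borel_measurable M" and V: "\<And>x. x \<in> Q \<Longrightarrow> 0 \<le> V x"
    and A: "(\<integral>\<^sup>+x\<in>Q. ennreal (V x * \<bar>f x - c\<bar> ^ n) \<partial>M) \<le> ennreal A" "0 \<le> A"
    and v: "(\<integral>\<^sup>+x\<in>Q. ennreal (V x) \<partial>M) \<le> ennreal v" "0 \<le> v"
  shows "(\<integral>\<^sup>+x\<in>Q. ennreal (V x * \<bar>f x - c'\<bar> ^ n) \<partial>M) \<le> ennreal (2 ^ n * (A + \<bar>c - c'\<bar> ^ n * v))"
proof -
  have "(\<integral>\<^sup>+x\<in>Q. ennreal (V x * \<bar>f x - c'\<bar> ^ n) \<partial>M) \<le>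
    (\<integral>\<^sup>+x. ennreal (2 ^ n) * (ennreal (V x * \<bar>f x - c\<bar> ^ n) * indicator Q x + ennreal (\<bar>c - c'\<bar> ^ n) * (ennreal (V x) * indicator Q x)) \<partial>M)"
  proof (rule nn_integral_mono)
    fix x
    show "ennreal (V x * \<bar>f x - c'\<bar> ^ n) * indicator Q x \<le> ennreal (2 ^ n) * (ennreal (V x * \<bar>f x - c\<bar> ^ n) * indicator Q x + ennreal (\<bar>c - c'\<bar> ^ n) * (ennreal (V x) * indicator Q x))"
    proof (cases "x \<in> Q")
      case True
      have "V x * \<bar>f x - c'\<bar> ^ n \<le> V x * (2 ^ n * (\<bar>f x - c\<bar> ^ n + \<bar>c - c'\<bar> ^ n))"
        using abs_power_add_le[of "f x - c" "c - c'" n] V[OF True] by (intro mult_left_mono) auto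
      also have "\<dots> = 2 ^ n * (V x * \<bar>f x - c\<bar> ^ n + \<bar>c - c'\<bar> ^ n * V x)" by (simp add: algebra_simps)
      finally have "ennreal (V x * \<bar>f x - c'\<bar> ^ n) \<le> ennreal \<dots>" by (rule ennreal_leI)
      also have "\<dots> = ennreal (2 ^ n) * (ennreal (V x * \<bar>f x - c\<bar> ^ n) + ennreal (\<bar>c - c'\<bar> ^ n) * ennreal (V x))"
        using V[OF True] by (subst ennreal_mult) (auto simp: ennreal_plus ennreal_mult)
      finally show ?thesis using True by simp
    qed simp
  qed
  also have "\<dots> = ennreal (2 ^ n) * ((\<integral>\<^sup>+x\<in>Q. ennreal (V x * \<bar>f x - c\<bar> ^ n) \<partial>M) + ennreal (\<bar>c - c'\<bar> ^ n) * (\<integral>\<^sup>+x\<in>Q. ennreal (V x) \<partial>M))"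
    by (subst nn_integral_cmult, measurable, subst nn_integral_add) (auto simp: nn_integral_cmult)
  also have "\<dots> \<le> ennreal (2 ^ n) * (ennreal A + ennreal (\<bar>c - c'\<bar> ^ n) * ennreal v)"
    by (intro mult_left_mono add_mono A v) auto
  also have "\<dots> = ennreal (2 ^ n * (A + \<bar>c - c'\<bar> ^ n * v))"
    using A v by (subst ennreal_mult) (auto simp: ennreal_plus ennreal_mult)
  finally show ?thesis .
qed

text \<open>The unweighted case of \<open>sobolev_poincare\<close>, made uniform: since S has volume
  at least that of a fixed fraction of the surrounding cube, the constant depends on the dimension
  only and the estimate scales like \<open>r ^ Suc m\<close>.\<close>

lemma convex_poincare:
  assumes N: "CARD('n::finite) = Suc m" and m: "0 < m"
  shows "\<exists>K>0. \<forall>S x r (f :: real^'n \<Rightarrow> real) F E q. convex S \<and> S \<in> sets borel \<and> S \<subseteq> cube x r \<and> 0 < r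
     \<and> emeasure lborel S = ennreal q \<and> (r / 4) ^ Suc m \<le> q \<and> sobolev_closure S f F \<and> 0 \<le> E
     \<and> (\<integral>\<^sup>+y\<in>S. norm (F y) ^ Suc m \<partial>lborel) \<le> ennreal E \<longrightarrow>
     (\<exists>c. (\<integral>\<^sup>+y\<in>S. ennreal (\<bar>f y - c\<bar> ^ Suc m) \<partial>lborel) \<le> ennreal (K * r ^ Suc m * E))"
proof -
  let ?N = "real (Suc m)"
  \<comment> \<open>For the constant weight 1 any exponent above m is admissible; the choice only
    affects K.\<close>
  define \<sigma> where "\<sigma> = real m + 1"
  have \<sigma>: "real m < \<sigma>" "0 < \<sigma>" by (auto simp: \<sigma>_def)
  obtain b where b: "0 < b" "\<And>d y. 0 < d \<Longrightarrow>
    (\<integral>\<^sup>+x\<in>cball (y::real^'n) d. ennreal (logw \<sigma> (norm (y - x) / d)) \<partial>lborel) \<le> ennreal (b * d ^ Suc m)"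
    using nn_integral_logw_ball[OF \<sigma>(2), where 'a="real^'n"] by (auto simp: N)
  note kp = kernel_const_pos[OF m \<sigma>(1)]
  define K where "K = 2 * kernel_const m \<sigma> * (2 * ?N) ^ Suc m * 4 ^ Suc m * (b * (2 * ?N) ^ Suc m)"
  have K: "0 < K" using kp b by (simp add: K_def)
  have "\<exists>c. (\<integral>\<^sup>+y\<in>S. ennreal (\<bar>f y - c\<bar> ^ Suc m) \<partial>lborel) \<le> ennreal (K * r ^ Suc m * E)"
    if S: "convex S" "S \<in> sets borel" "S \<subseteq> cube x r" and r: "0 < r" and q: "emeasure lborel S = ennreal q" "(r / 4) ^ Suc m \<le> q"
      and sc: "sobolev_closure S f F" and E: "(\<integral>\<^sup>+y\<in>S. norm (F y) ^ Suc m \<partial>lborel) \<le> ennreal E" "0 \<le> E"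
    for S x r and f :: "real^'n \<Rightarrow> real" and F E q
  proof -
    note [measurable] = S(2)
    define d where "d = 2 * r * ?N"
    have d: "0 < d" using r by (simp add: d_def)
    have dS: "norm (y - z) \<le> d" if "y \<in> S" "z \<in> S" for y z
      using cube_norm_le[of y x r z] that S(3) by (auto simp: d_def N)
    have q0: "0 < (r / 4) ^ Suc m" using r by simp
    then have q1: "0 < q" using q(2) by linarith
    have w: "0 < b * d ^ Suc m" using b d by simp
    have W: "(\<integral>\<^sup>+x\<in>S. ennreal (1 * logw \<sigma> (norm (y - x) / d)) \<partial>lborel) \<le> ennreal (b * d ^ Suc m)" if y: "y \<in> S" for y
    proof -
      have "S \<subseteq> cball y d" using dS[OF y] by (auto simp: dist_norm)
      then have "(\<integral>\<^sup>+x\<in>S. ennreal (1 * logw \<sigma> (norm (y - x) / d)) \<partial>lborel) \<le> (\<integral>\<^sup>+x\<in>cball y d. ennreal (logw \<sigma> (norm (y - x) / d)) \<partial>lborel)"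
        by (intro nn_integral_mono) (auto simp: indicator_def)
      then show ?thesis using b(2)[OF d, of y] by (rule order_trans)
    qed
    have "\<exists>c. (\<integral>\<^sup>+x\<in>S. ennreal (1 * \<bar>f x - c\<bar> ^ Suc m) \<partial>lborel) \<le> ennreal (2 * kernel_const m \<sigma> * d ^ Suc m / q * (b * d ^ Suc m) * E)
       \<and> (\<integral>\<^sup>+x\<in>S. ennreal (1 * \<bar>f x - c\<bar> ^ Suc m) \<partial>lborel) \<le> ennreal (2 * kernel_const m \<sigma> * d ^ Suc m / q * (b * d ^ Suc m) * E)"
      by (rule sobolev_poincare[OF sc N m \<sigma>(1) S(1,2) d dS _ _ W w _ _ W w q(1) q1 E]) auto
    then obtain c where c: "(\<integral>\<^sup>+x\<in>S. ennreal (\<bar>f x - c\<bar> ^ Suc m) \<partial>lborel) \<le> ennreal (2 * kernel_const m \<sigma> * d ^ Suc m / q * (b * d ^ Suc m) * E)"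
      by auto
    have "2 * kernel_const m \<sigma> * d ^ Suc m / q * (b * d ^ Suc m) * E \<le> 2 * kernel_const m \<sigma> * d ^ Suc m / (r / 4) ^ Suc m * (b * d ^ Suc m) * E"
      using kp d b E(2) q(2) q0 q1 by (intro mult_right_mono divide_left_mono mult_nonneg_nonneg mult_pos_pos) auto
    also have "\<dots> = K * r ^ Suc m * E"
    proof -
      have "d ^ Suc m = (2 * ?N) ^ Suc m * r ^ Suc m" by (simp add: d_def power_mult_distrib[symmetric] mult_ac del: power_Suc)
      moreover have "(r / 4) ^ Suc m = r ^ Suc m / 4 ^ Suc m" by (rule power_divide)
      moreover have "a * (p * R) / (R / q) * (b * (p * R)) * E = a * p * q * (b * p) * R * E" if "R \<noteq> 0" for a p q R :: real
        using that by simp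
      ultimately show ?thesis using r unfolding K_def by simp
    qed
    finally show ?thesis using c by (intro exI[of _ c]) (auto intro: order_trans ennreal_leI)
  qed
  note main = this
  show ?thesis
    by (rule exI[of _ K], rule conjI[OF K], intro allI impI, elim conjE, rule main; assumption)
qed

lemma slab_overlap:
  fixes x :: "real^'n::finite"
  assumes "i \<noteq> j" "0 < r"
  shows "\<exists>P. P \<in> sets borel \<and> P \<subseteq> slab x r i s \<and> P \<subseteq> slab x r j t \<and>
    ennreal ((r / 4) ^ CARD('n)) \<le> emeasure lborel P"
proof -
  let ?lo = "\<lambda>k. if k = i \<and> s \<or> k = j \<and> t then x $ k + r / 4 else x $ k - r"
  let ?hi = "\<lambda>k. if k = i \<and> \<not> s \<or> k = j \<and> \<not> t then x $ k - r / 4 else x $ k + r"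
  have "bx ?lo ?hi \<subseteq> slab x r i s"
  proof
    fix y :: "real^'n" assume y: "y \<in> bx ?lo ?hi"
    have "?lo k \<le> y $ k \<and> y $ k \<le> ?hi k" for k using y by (simp add: bx_def)
    note * = this
    show "y \<in> slab x r i s"
      unfolding slab_def bx_def
    proof (intro CollectI allI)
      fix k
      show "(if k = i \<and> s then x $ k + r / 4 else x $ k - r) \<le> y $ k \<and> y $ k \<le> (if k = i \<and> \<not> s then x $ k - r / 4 else x $ k + r)"
        using *[of k] assms by (auto split: if_splits)
    qed
  qed
  moreover have "bx ?lo ?hi \<subseteq> slab x r j t"
  proof
    fix y :: "real^'n" assume y: "y \<in> bx ?lo ?hi"
    have "?lo k \<le> y $ k \<and> y $ k \<le> ?hi k" for k using y by (simp add: bx_def)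
    note * = this
    show "y \<in> slab x r j t"
      unfolding slab_def bx_def
    proof (intro CollectI allI)
      fix k
      show "(if k = j \<and> t then x $ k + r / 4 else x $ k - r) \<le> y $ k \<and> y $ k \<le> (if k = j \<and> \<not> t then x $ k - r / 4 else x $ k + r)"
        using *[of k] assms by (auto split: if_splits)
    qed
  qed
  moreover have "ennreal ((r / 4) ^ CARD('n)) \<le> emeasure lborel (bx ?lo ?hi :: (real^'n) set)"
    using assms by (intro emeasure_bx_ge) auto
  ultimately show ?thesis by (intro exI[of _ "bx ?lo ?hi"] conjI bx_in_borel)
qed

lemma emeasure_slab_ge:
  fixes x :: "real^'n::finite"
  assumes "0 < r"
  shows "ennreal ((r / 4) ^ CARD('n)) \<le> emeasure lborel (slab x r i s)"
  unfolding slab_def using assms by (intro emeasure_bx_ge) auto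

lemma annulus_overlap:
  fixes x :: "real^'n::finite"
  assumes "0 < r"
  shows "\<exists>P. P \<in> sets borel \<and> P \<subseteq> annulus x r \<and> P \<subseteq> annulus x (r / 2) \<and>
    ennreal ((r / 4) ^ CARD('n)) \<le> emeasure lborel P"
proof -
  obtain i :: 'n where True by simp
  \<comment> \<open>In coordinate i this box runs from r / 4 to r / 2 from the centre: far enough
    out for the larger annulus and inside the smaller one. All its sides are at least r / 4.\<close>
  let ?lo = "\<lambda>k. if k = i then x $ k + r / 4 else x $ k - r / 2"
  let ?hi = "\<lambda>k. x $ k + r / 2"
  have *: "\<bar>y $ k - x $ k\<bar> \<le> r / 2 \<and> r / 4 \<le> y $ i - x $ i" if y: "y \<in> bx ?lo ?hi" for y k
  proof -
    have "?lo k \<le> y $ k \<and> y $ k \<le> ?hi k" for k using y by (simp add: bx_def)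
    from this[of k] this[of i] have "y $ k - x $ k \<le> r / 2" "- (y $ k - x $ k) \<le> r / 2" "r / 4 \<le> y $ i - x $ i"
      using assms by (cases "k = i"; simp)+
    then show ?thesis by (simp only: abs_le_iff simp_thms)
  qed
  have "bx ?lo ?hi \<subseteq> annulus x r"
  proof
    fix y assume y: "y \<in> bx ?lo ?hi"
    have "\<bar>y $ k - x $ k\<bar> \<le> r" for k using *[OF y, of k] assms by linarith
    moreover have "r / 4 \<le> \<bar>y $ i - x $ i\<bar>" using *[OF y, of i] by linarith
    ultimately show "y \<in> annulus x r" unfolding annulus_def mem_cube by blast
  qed
  moreover have "bx ?lo ?hi \<subseteq> annulus x (r / 2)"
  proof
    fix y assume y: "y \<in> bx ?lo ?hi"
    have "r / 2 / 4 \<le> \<bar>y $ i - x $ i\<bar>" using *[OF y, of i] assms by linarith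
    then show "y \<in> annulus x (r / 2)" using *[OF y] unfolding annulus_def mem_cube by blast
  qed
  moreover have "ennreal ((r / 4) ^ CARD('n)) \<le> emeasure lborel (bx ?lo ?hi :: (real^'n) set)"
    using assms by (intro emeasure_bx_ge) auto
  ultimately show ?thesis by (intro exI[of _ "bx ?lo ?hi"]) auto
qed

text \<open>The annulus is not convex, so each slab first gets its own constant. Slabs of different
  coordinates overlap and their constants can be compared; opposite slabs are disjoint and are
  joined through a slab of another coordinate, which exists because the dimension is at least
  2.\<close>

lemma annulus_poincare:
  assumes N: "CARD('n::finite) = Suc m" and m: "0 < m"
  shows "\<exists>K>0. \<forall>x r (f :: real^'n \<Rightarrow> real) F E. 0 < r \<and> sobolev_closure (annulus x r) f F \<and> 0 \<le> E
     \<and> (\<integral>\<^sup>+y\<in>annulus x r. norm (F y) ^ Suc m \<partial>lborel) \<le> ennreal E \<longrightarrow>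
     (\<exists>c. (\<integral>\<^sup>+y\<in>annulus x r. ennreal (\<bar>f y - c\<bar> ^ Suc m) \<partial>lborel) \<le> ennreal (K * r ^ Suc m * E))"
proof -
  obtain K where K: "0 < K" "\<And>S x r (f :: real^'n \<Rightarrow> real) F E q. convex S \<Longrightarrow> S \<in> sets borel \<Longrightarrow> S \<subseteq> cube x r \<Longrightarrow> 0 < r
     \<Longrightarrow> emeasure lborel S = ennreal q \<Longrightarrow> (r / 4) ^ Suc m \<le> q \<Longrightarrow> sobolev_closure S f F \<Longrightarrow> 0 \<le> E
     \<Longrightarrow> (\<integral>\<^sup>+y\<in>S. norm (F y) ^ Suc m \<partial>lborel) \<le> ennreal E \<Longrightarrow>
     \<exists>c. (\<integral>\<^sup>+y\<in>S. ennreal (\<bar>f y - c\<bar> ^ Suc m) \<partial>lborel) \<le> ennreal (K * r ^ Suc m * E)"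
    using convex_poincare[OF N m] by meson
  \<comment> \<open>\<open>K2\<close> compares overlapping slabs, \<open>K3\<close> any slab with
    the reference slab, \<open>K4\<close> is the estimate on one slab with the common constant, and
    \<open>K5\<close> sums over the slabs.\<close>
  define K2 where "K2 = 2 ^ Suc m * (2 * K) * 4 ^ Suc m"
  define K3 where "K3 = 2 ^ Suc m * (2 * K2)"
  define K4 where "K4 = 2 ^ Suc m * (K + K3 * 2 ^ Suc m)"
  define K5 where "K5 = real (card (UNIV :: ('n \<times> bool) set)) * K4"
  have pos: "0 < K2" "0 < K3" "0 < K4" using K(1) by (simp_all add: K2_def K3_def K4_def add_pos_pos)
  have K5: "0 < K5" using pos by (simp add: K5_def card_gt_0_iff)
  have "\<exists>c. (\<integral>\<^sup>+y\<in>annulus x r. ennreal (\<bar>f y - c\<bar> ^ Suc m) \<partial>lborel) \<le> ennreal (K5 * r ^ Suc m * E)"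
    if r: "0 < r" and sc: "sobolev_closure (annulus x r) f F" and E: "0 \<le> E"
      "(\<integral>\<^sup>+y\<in>annulus x r. norm (F y) ^ Suc m \<partial>lborel) \<le> ennreal E" for x r E and f :: "real^'n \<Rightarrow> real" and F
  proof -
    have fm[measurable]: "f \<in> borel_measurable borel" using sc by (simp add: sobolev_closure_def)
    let ?A = "K * r ^ Suc m * E"
    have A: "0 \<le> ?A" using K r E by simp
    have "\<exists>c. (\<integral>\<^sup>+y\<in>slab x r i s. ennreal (\<bar>f y - c\<bar> ^ Suc m) \<partial>lborel) \<le> ennreal ?A" for i s
    proof -
      have sub: "slab x r i s \<subseteq> annulus x r" using r by (intro slab_subset_annulus) simp
      have subc: "slab x r i s \<subseteq> cube x r" using sub by (auto simp: annulus_def)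
      have "emeasure lborel (slab x r i s) \<le> ennreal ((2 * r) ^ CARD('n))" using emeasure_le_cube[OF subc] r by simp
      then have "emeasure lborel (slab x r i s) < \<infinity>" by (rule le_less_trans) simp
      then have q: "emeasure lborel (slab x r i s) = ennreal (measure lborel (slab x r i s))"
        by (intro emeasure_eq_ennreal_measure) auto
      have "ennreal ((r / 4) ^ CARD('n)) \<le> ennreal (measure lborel (slab x r i s))"
        using emeasure_slab_ge[OF r, of x i s] q by simp
      then have q2: "(r / 4) ^ Suc m \<le> measure lborel (slab x r i s)" by (subst (asm) ennreal_le_iff) (auto simp: N)
      have "(\<integral>\<^sup>+y\<in>slab x r i s. norm (F y) ^ Suc m \<partial>lborel) \<le> (\<integral>\<^sup>+y\<in>annulus x r. norm (F y) ^ Suc m \<partial>lborel)"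
        using sub by (intro nn_integral_mono) (auto simp: indicator_def)
      then have "(\<integral>\<^sup>+y\<in>slab x r i s. norm (F y) ^ Suc m \<partial>lborel) \<le> ennreal E" using E(2) by (rule order_trans)
      then show ?thesis
        using K(2)[OF _ slab_in_borel subc r q q2 sobolev_closure_mono[OF sc sub] E(1)]
        by (simp add: slab_def bx_convex del: power_Suc)
    qed
    then have "\<exists>c. \<forall>p. (\<integral>\<^sup>+y\<in>slab x r (fst p) (snd p). ennreal (\<bar>f y - c p\<bar> ^ Suc m) \<partial>lborel) \<le> ennreal ?A"
      by (intro choice allI)
    then obtain c where "\<forall>p. (\<integral>\<^sup>+y\<in>slab x r (fst p) (snd p). ennreal (\<bar>f y - c p\<bar> ^ Suc m) \<partial>lborel) \<le> ennreal ?A" by blast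
    then have c: "(\<integral>\<^sup>+y\<in>slab x r i s. ennreal (\<bar>f y - c (i, s)\<bar> ^ Suc m) \<partial>lborel) \<le> ennreal ?A" for i s
      using spec[of _ "(i, s)"] by fastforce
    have adj: "\<bar>c (i, s) - c (j, t)\<bar> ^ Suc m \<le> K2 * E" if ij: "i \<noteq> j" for i j s t
    proof -
      obtain P where P: "P \<in> sets borel" "P \<subseteq> slab x r i s" "P \<subseteq> slab x r j t" "ennreal ((r / 4) ^ CARD('n)) \<le> emeasure lborel P"
        using slab_overlap[OF ij r] by meson
      have "\<bar>c (i, s) - c (j, t)\<bar> ^ Suc m \<le> 2 ^ Suc m * (?A + ?A) / (r / 4) ^ Suc m"
        using P r A by (intro const_power_le[OF _ _ _ _ P(2,3) _ _ c _ c]) (auto simp: N)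
      also have "\<dots> = K2 * E" using r by (simp add: K2_def power_divide)
      finally show ?thesis .
    qed
    obtain i0 :: 'n where True by simp
    have "\<exists>j. j \<noteq> i0"
    proof (rule ccontr)
      assume "\<not> ?thesis"
      then have "(UNIV::'n set) = {i0}" by auto
      then have "CARD('n) = 1" by (metis card_1_singleton_iff One_nat_def)
      then show False using N m by simp
    qed
    then obtain j0 where j0: "j0 \<noteq> i0" by blast
    let ?c = "c (i0, True)"
    have all: "\<bar>c (i, s) - ?c\<bar> ^ Suc m \<le> K3 * E" for i s
    proof (cases "i = i0")
      case False
      have "K2 * E \<le> K3 * E"       proof (intro mult_right_mono E)
        have "1 \<le> 2 ^ Suc m * (2::real)" using one_le_power[of "2::real" "Suc m"] by simp
        then have "1 * K2 \<le> (2 ^ Suc m * 2) * K2" using pos by (intro mult_right_mono) auto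
        then show "K2 \<le> K3" by (simp add: K3_def)
      qed
      then show ?thesis using adj[OF False, of s True] by linarith
    next
      case True
      have "\<bar>c (i, s) - ?c\<bar> ^ Suc m \<le> 2 ^ Suc m * (\<bar>c (i, s) - c (j0, True)\<bar> ^ Suc m + \<bar>c (j0, True) - ?c\<bar> ^ Suc m)"
        using abs_power_add_le[of "c (i, s) - c (j0, True)" "c (j0, True) - ?c" "Suc m"] by simp
      also have "\<dots> \<le> 2 ^ Suc m * (K2 * E + K2 * E)"
        using adj[of i j0 s True] adj[of j0 i0 True True] j0 True by (intro mult_left_mono add_mono) auto
      finally show ?thesis by (simp add: K3_def mult_ac)
    qed
    have slabb: "(\<integral>\<^sup>+y\<in>slab x r i s. ennreal (\<bar>f y - ?c\<bar> ^ Suc m) \<partial>lborel) \<le> ennreal (K4 * r ^ Suc m * E)" for i s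
    proof -
      have subc: "slab x r i s \<subseteq> cube x r" using slab_subset_annulus[of r x i s] r by (auto simp: annulus_def)
      have v: "(\<integral>\<^sup>+y\<in>slab x r i s. ennreal 1 \<partial>lborel) \<le> ennreal ((2 * r) ^ Suc m)"
        using emeasure_le_cube[OF subc] r by (simp add: N nn_integral_indicator)
      have c': "(\<integral>\<^sup>+y\<in>slab x r i s. ennreal (1 * \<bar>f y - c (i, s)\<bar> ^ Suc m) \<partial>lborel) \<le> ennreal ?A" using c by simp
      have "(\<integral>\<^sup>+y\<in>slab x r i s. ennreal (1 * \<bar>f y - ?c\<bar> ^ Suc m) \<partial>lborel) \<le>
         ennreal (2 ^ Suc m * (?A + \<bar>c (i, s) - ?c\<bar> ^ Suc m * (2 * r) ^ Suc m))"
        using r by (intro recenter_power_le[OF _ _ _ _ c' A v]) auto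
      also have "\<dots> \<le> ennreal (2 ^ Suc m * (?A + K3 * E * (2 * r) ^ Suc m))"
        using all[of i s] r by (intro ennreal_leI mult_left_mono add_left_mono mult_right_mono) auto
      also have "2 ^ Suc m * (?A + K3 * E * (2 * r) ^ Suc m) = K4 * r ^ Suc m * E"
        by (simp add: K4_def power_mult_distrib algebra_simps)
      finally show ?thesis by simp
    qed
    have "(\<integral>\<^sup>+y\<in>annulus x r. ennreal (\<bar>f y - ?c\<bar> ^ Suc m) \<partial>lborel) \<le>
      (\<integral>\<^sup>+y. (\<Sum>p\<in>UNIV. ennreal (\<bar>f y - ?c\<bar> ^ Suc m) * indicator (slab x r (fst p) (snd p)) y) \<partial>lborel)"
    proof (rule nn_integral_mono)
      fix y
      show "ennreal (\<bar>f y - ?c\<bar> ^ Suc m) * indicator (annulus x r) y \<le> (\<Sum>p\<in>UNIV. ennreal (\<bar>f y - ?c\<bar> ^ Suc m) * indicator (slab x r (fst p) (snd p)) y)"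
      proof (cases "y \<in> annulus x r")
        case True
        then obtain p where p: "y \<in> slab x r (fst p) (snd p)" using annulus_eq_Union[of r x] r by auto
        have "ennreal (\<bar>f y - ?c\<bar> ^ Suc m) * indicator (slab x r (fst p) (snd p)) y \<le> (\<Sum>p\<in>UNIV. ennreal (\<bar>f y - ?c\<bar> ^ Suc m) * indicator (slab x r (fst p) (snd p)) y)"
          by (rule member_le_sum) auto
        then show ?thesis using p True by simp
      qed simp
    qed
    also have "\<dots> = (\<Sum>p\<in>UNIV. \<integral>\<^sup>+y\<in>slab x r (fst p) (snd p). ennreal (\<bar>f y - ?c\<bar> ^ Suc m) \<partial>lborel)"
      by (rule nn_integral_sum) measurable
    also have "\<dots> \<le> (\<Sum>p\<in>(UNIV :: ('n \<times> bool) set). ennreal (K4 * r ^ Suc m * E))"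
      by (intro sum_mono slabb)
    also have "\<dots> = ennreal (\<Sum>p\<in>(UNIV :: ('n \<times> bool) set). K4 * r ^ Suc m * E)"
      using pos r E by (intro sum_ennreal) auto
    also have "(\<Sum>p\<in>(UNIV :: ('n \<times> bool) set). K4 * r ^ Suc m * E) = K5 * r ^ Suc m * E"
      by (simp add: K5_def)
    finally show ?thesis by blast
  qed
  note main = this
  show ?thesis
    by (rule exI[of _ K5], rule conjI[OF K5], intro allI impI, elim conjE, rule main; assumption)
qed

text \<open>One constant has to do two jobs. Near the cutoff it must be controlled by the energy of
  the annulus alone, or else hole filling fails; against V it must work on the whole cube, with the
  small factor w. It is chosen on the annulus and compared with the constant from
  \<open>sobolev_poincare\<close> on the cube, for the weights V and 1, through
  \<open>const_power_le\<close> on the annulus.\<close>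

lemma cube_annulus_constant:
  assumes N: "CARD('n::finite) = Suc m" and m: "0 < m" and \<sigma>: "real m < \<sigma>"
  shows "\<exists>K>0. \<forall>x r (f :: real^'n \<Rightarrow> real) F V w E Ea. 0 < r \<and> sobolev_closure (cube x r) f F
     \<and> V \<in> borel_measurable borel \<and> (\<forall>y. 0 \<le> V y) \<and> 0 < w
     \<and> (\<forall>y\<in>cube x r. (\<integral>\<^sup>+z\<in>cube x r. ennreal (V z * logw \<sigma> (norm (y - z) / (2 * r * real (Suc m)))) \<partial>lborel) \<le> ennreal w)
     \<and> (\<integral>\<^sup>+y\<in>cube x r. norm (F y) ^ Suc m \<partial>lborel) \<le> ennreal E
     \<and> (\<integral>\<^sup>+y\<in>annulus x r. norm (F y) ^ Suc m \<partial>lborel) \<le> ennreal Ea \<and> 0 \<le> Ea \<and> Ea \<le> E \<longrightarrow>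
     (\<exists>c. (\<integral>\<^sup>+y\<in>annulus x r. ennreal (\<bar>f y - c\<bar> ^ Suc m) \<partial>lborel) \<le> ennreal (K * r ^ Suc m * Ea) \<and>
          (\<integral>\<^sup>+y\<in>cube x r. ennreal (V y * \<bar>f y - c\<bar> ^ Suc m) \<partial>lborel) \<le> ennreal (K * w * E))"
proof -
  obtain K1 where K1: "0 < K1" "\<And>x r (f :: real^'n \<Rightarrow> real) F E. 0 < r \<Longrightarrow> sobolev_closure (annulus x r) f F \<Longrightarrow> 0 \<le> E
     \<Longrightarrow> (\<integral>\<^sup>+y\<in>annulus x r. norm (F y) ^ Suc m \<partial>lborel) \<le> ennreal E \<Longrightarrow>
     \<exists>c. (\<integral>\<^sup>+y\<in>annulus x r. ennreal (\<bar>f y - c\<bar> ^ Suc m) \<partial>lborel) \<le> ennreal (K1 * r ^ Suc m * E)"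
    using annulus_poincare[OF N m] by meson
  have \<sigma>0: "0 < \<sigma>" using \<sigma> by linarith
  obtain b where b: "0 < b" "\<And>d y. 0 < d \<Longrightarrow>
    (\<integral>\<^sup>+x\<in>cball (y::real^'n) d. ennreal (logw \<sigma> (norm (y - x) / d)) \<partial>lborel) \<le> ennreal (b * d ^ Suc m)"
    using nn_integral_logw_ball[OF \<sigma>0, where 'a="real^'n"] by (auto simp: N)
  note kp = kernel_const_pos[OF m \<sigma>]
  let ?N = "real (Suc m)"
  define K2 where "K2 = 2 * kernel_const m \<sigma> * ?N ^ Suc m"
  define K3 where "K3 = K2 * b * (2 * ?N) ^ Suc m"
  define K4 where "K4 = 2 ^ Suc m * (K1 + K3) * 4 ^ Suc m"
  define K where "K = K1 + 2 ^ Suc m * (K2 + K4)"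
  have pos: "0 < K2" "0 < K3" "0 < K4" using kp b K1 by (simp_all add: K2_def K3_def K4_def add_pos_pos)
  have K: "0 < K" "K1 \<le> K" "2 ^ Suc m * (K2 + K4) \<le> K"
    using pos K1 by (auto simp: K_def intro!: add_pos_pos)
  have "\<exists>c. (\<integral>\<^sup>+y\<in>annulus x r. ennreal (\<bar>f y - c\<bar> ^ Suc m) \<partial>lborel) \<le> ennreal (K * r ^ Suc m * Ea) \<and>
          (\<integral>\<^sup>+y\<in>cube x r. ennreal (V y * \<bar>f y - c\<bar> ^ Suc m) \<partial>lborel) \<le> ennreal (K * w * E)"
    if r: "0 < r" and sc: "sobolev_closure (cube x r) f F" and Vm[measurable]: "V \<in> borel_measurable borel"
     and V0: "\<forall>y. 0 \<le> V y" and w: "0 < w"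
     and W: "\<forall>y\<in>cube x r. (\<integral>\<^sup>+z\<in>cube x r. ennreal (V z * logw \<sigma> (norm (y - z) / (2 * r * ?N))) \<partial>lborel) \<le> ennreal w"
     and E: "(\<integral>\<^sup>+y\<in>cube x r. norm (F y) ^ Suc m \<partial>lborel) \<le> ennreal E"
     and Ea: "(\<integral>\<^sup>+y\<in>annulus x r. norm (F y) ^ Suc m \<partial>lborel) \<le> ennreal Ea" "0 \<le> Ea" "Ea \<le> E"
    for x r and f :: "real^'n \<Rightarrow> real" and F V w E Ea
  proof -
    have fm[measurable]: "f \<in> borel_measurable borel" using sc by (simp add: sobolev_closure_def)
    have am[measurable]: "annulus x r \<in> sets borel" using r by simp
    have E0: "0 \<le> E" using Ea by linarith
    let ?d = "2 * r * ?N"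
    have d: "0 < ?d" using r by simp
    have sub: "annulus x r \<subseteq> cube x r" by (auto simp: annulus_def)
    obtain c where c: "(\<integral>\<^sup>+y\<in>annulus x r. ennreal (\<bar>f y - c\<bar> ^ Suc m) \<partial>lborel) \<le> ennreal (K1 * r ^ Suc m * Ea)"
      using K1(2)[OF r sobolev_closure_mono[OF sc sub] Ea(2,1)] by blast
    have W2: "(\<integral>\<^sup>+z\<in>cube x r. ennreal (1 * logw \<sigma> (norm (y - z) / ?d)) \<partial>lborel) \<le> ennreal (b * ?d ^ Suc m)" if y: "y \<in> cube x r" for y
    proof -
      have "cube x r \<subseteq> cball y ?d" using cube_norm_le[OF y] by (auto simp: dist_norm N)
      then have "(\<integral>\<^sup>+z\<in>cube x r. ennreal (1 * logw \<sigma> (norm (y - z) / ?d)) \<partial>lborel) \<le> (\<integral>\<^sup>+z\<in>cball y ?d. ennreal (logw \<sigma> (norm (y - z) / ?d)) \<partial>lborel)"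
        by (intro nn_integral_mono) (auto simp: indicator_def)
      then show ?thesis using b(2)[OF d, of y] by (rule order_trans)
    qed
    have q: "emeasure lborel (cube x r) = ennreal ((2 * r) ^ Suc m)" using emeasure_cube[of r x] r by (simp add: N)
    have q0: "0 < (2 * r) ^ Suc m" using r by simp
    have dd: "norm (y - z) \<le> ?d" if "y \<in> cube x r" "z \<in> cube x r" for y z
      using cube_norm_le[OF that] by (simp add: N)
    have cv: "convex (cube x r)" by (simp add: cube_def bx_convex)
    have bd: "0 < b * ?d ^ Suc m" using b(1) zero_less_power[OF d] by (rule mult_pos_pos)
    obtain co where co: "(\<integral>\<^sup>+y\<in>cube x r. ennreal (V y * \<bar>f y - co\<bar> ^ Suc m) \<partial>lborel) \<le> ennreal (2 * kernel_const m \<sigma> * ?d ^ Suc m / (2 * r) ^ Suc m * w * E)"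
      "(\<integral>\<^sup>+y\<in>cube x r. ennreal (1 * \<bar>f y - co\<bar> ^ Suc m) \<partial>lborel) \<le> ennreal (2 * kernel_const m \<sigma> * ?d ^ Suc m / (2 * r) ^ Suc m * (b * ?d ^ Suc m) * E)"
      using sobolev_poincare[OF sc N m \<sigma> cv cube_in_borel d dd Vm _ _ w _ _ W2 bd q q0 E E0] V0 W by auto
    have e1: "2 * kernel_const m \<sigma> * ?d ^ Suc m / (2 * r) ^ Suc m = K2"
      using r by (simp add: K2_def power_mult_distrib[of "2 * r"] del: power_Suc)
    have e2: "K2 * (b * ?d ^ Suc m) * E = K3 * r ^ Suc m * E"
    proof -
      have "?d ^ Suc m = (2 * ?N) ^ Suc m * r ^ Suc m"
        by (simp only: power_mult_distrib[symmetric] mult_ac)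
      then show ?thesis by (simp only: K3_def mult_ac)
    qed
    have co1: "(\<integral>\<^sup>+y\<in>cube x r. ennreal (V y * \<bar>f y - co\<bar> ^ Suc m) \<partial>lborel) \<le> ennreal (K2 * w * E)"
      using co(1) unfolding e1 .
    have co2: "(\<integral>\<^sup>+y\<in>cube x r. ennreal (\<bar>f y - co\<bar> ^ Suc m) \<partial>lborel) \<le> ennreal (K3 * r ^ Suc m * E)"
      using co(2) unfolding e1 e2 by simp
    obtain i :: 'n where True by simp
    have ae: "ennreal ((r / 4) ^ Suc m) \<le> emeasure lborel (annulus x r)"
      using emeasure_slab_ge[OF r, of x i True] emeasure_mono[OF slab_subset_annulus[of r x i True], of lborel] r
      by (auto simp: N intro: order_trans)
    have "\<bar>co - c\<bar> ^ Suc m \<le> 2 ^ Suc m * (K3 * r ^ Suc m * E + K1 * r ^ Suc m * Ea) / (r / 4) ^ Suc m"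
      using r E0 Ea pos K1 by (intro const_power_le[OF _ _ _ _ sub subset_refl ae _ co2 _ c]) auto
    also have "\<dots> \<le> 2 ^ Suc m * (K3 * r ^ Suc m * E + K1 * r ^ Suc m * E) / (r / 4) ^ Suc m"
      using r Ea K1 by (intro divide_right_mono mult_left_mono add_left_mono) auto
    also have "\<dots> = K4 * E" using r by (simp add: K4_def power_divide field_simps)
    finally have cc: "\<bar>co - c\<bar> ^ Suc m \<le> K4 * E" .
    have xin: "x \<in> cube x r" using r by (simp add: mem_cube)
    have "(\<integral>\<^sup>+y\<in>cube x r. ennreal (V y) \<partial>lborel) \<le> (\<integral>\<^sup>+z\<in>cube x r. ennreal (V z * logw \<sigma> (norm (x - z) / ?d)) \<partial>lborel)"
    proof (intro nn_integral_mono mult_right_mono ennreal_leI)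
      show "V z \<le> V z * logw \<sigma> (norm (x - z) / ?d)" for z
        using mult_left_mono[OF logw_ge_1[of \<sigma> "norm (x - z) / ?d"], of "V z"] \<sigma>0 V0 by simp
    qed auto
    also have "\<dots> \<le> ennreal w" using W xin by blast
    finally have Vw: "(\<integral>\<^sup>+y\<in>cube x r. ennreal (V y) \<partial>lborel) \<le> ennreal w" .
    have "(\<integral>\<^sup>+y\<in>cube x r. ennreal (V y * \<bar>f y - c\<bar> ^ Suc m) \<partial>lborel) \<le> ennreal (2 ^ Suc m * (K2 * w * E + \<bar>co - c\<bar> ^ Suc m * w))"
      using V0 pos w E0 by (intro recenter_power_le[OF _ _ _ _ co1 _ Vw]) auto
    also have "\<dots> \<le> ennreal (K * w * E)"
    proof (rule ennreal_leI)
      have "2 ^ Suc m * (K2 * w * E + \<bar>co - c\<bar> ^ Suc m * w) \<le> 2 ^ Suc m * (K2 * w * E + K4 * E * w)"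
        using cc w by (intro mult_left_mono add_left_mono mult_right_mono) auto
      also have "\<dots> = (2 ^ Suc m * (K2 + K4)) * (w * E)" by (simp add: algebra_simps)
      also have "\<dots> \<le> K * (w * E)" using K w E0 by (intro mult_right_mono) auto
      finally show "2 ^ Suc m * (K2 * w * E + \<bar>co - c\<bar> ^ Suc m * w) \<le> K * w * E" by (simp add: mult_ac)
    qed
    finally have "(\<integral>\<^sup>+y\<in>cube x r. ennreal (V y * \<bar>f y - c\<bar> ^ Suc m) \<partial>lborel) \<le> ennreal (K * w * E)" .
    moreover have "K1 * r ^ Suc m * Ea \<le> K * r ^ Suc m * Ea"
      using K r Ea by (intro mult_right_mono) auto
    then have "(\<integral>\<^sup>+y\<in>annulus x r. ennreal (\<bar>f y - c\<bar> ^ Suc m) \<partial>lborel) \<le> ennreal (K * r ^ Suc m * Ea)"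
      using c by (meson ennreal_leI order_trans)
    ultimately show ?thesis by blast
  qed
  note main = this
  show ?thesis
    by (rule exI[of _ K], rule conjI[OF K(1)], intro allI impI, elim conjE, rule main; assumption)
qed

lemma cube_closed: "closed (cube x r)" and cube_compact: "compact (cube x r)" and cube_convex: "convex (cube x r)"
  by (simp_all add: cube_def bx_compact compact_imp_closed bx_convex)

section \<open>The Caccioppoli inequality\<close>

lemma grad_eq_0_open:
  assumes "open S" "x \<in> S" "\<And>y. y \<in> S \<Longrightarrow> f y = c"
  shows "grad f x = 0"
proof -
  have "(f has_derivative (\<lambda>_. 0)) (at x)"
    by (rule has_derivative_transform_within_open[OF has_derivative_const assms(1,2)]) (use assms(3) in auto)
  then have "partial_deriv i f x = 0" for i by (subst partial_deriv_eq) auto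
  then show ?thesis by (simp add: vec_eq_iff)
qed

text \<open>Mollifying the indicator of the cube of radius 5/8 with radius 1/4 gives a function that
  is 1 on the cube of radius 3/8 and 0 outside that of radius 7/8. Both lie strictly between 1/4 and
  1, so the gradient vanishes off the annulus and the support is compactly inside the cube; the
  general case follows by scaling.\<close>

lemma cutoff_exists:
  "\<exists>C>0. \<forall>(x::real^'n::finite) r. 0 < r \<longrightarrow> (\<exists>\<eta>. (\<forall>k. Ck k \<eta>) \<and> (\<forall>y. 0 \<le> \<eta> y \<and> \<eta> y \<le> 1)
     \<and> (\<forall>y\<in>cube x (r / 4). \<eta> y = 1) \<and> (\<forall>y. y \<notin> cube x (7 / 8 * r) \<longrightarrow> \<eta> y = 0)
     \<and> (\<forall>y. norm (grad \<eta> y) \<le> C / r) \<and> (\<forall>y. y \<notin> annulus x r \<longrightarrow> grad \<eta> y = 0))"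
proof -
  obtain \<psi> :: "real^'n \<Rightarrow> real" where psi: "mollifier (1/4) \<psi>" by (rule mollifier_exists[of "1/4"]) simp
  note [measurable] = mollifier_measurable[OF psi]
  let ?f = "indicator (cube (0::real^'n) (5/8)) :: real^'n \<Rightarrow> real"
  have fin: "emeasure lborel (cube (0::real^'n) (5/8)) < \<infinity>"
    using emeasure_cube[of "5/8" "0::real^'n"] by simp
  have intf: "integrable lborel ?f" using fin by (intro integrable_real_indicator) auto
  define \<eta> where "\<eta> = conv ?f \<psi>"
  have ck: "Ck k \<eta>" for k
    unfolding \<eta>_def using psi by (intro Ck_conv[where r="1/4"] intf) (auto simp: mollifier_def)
  have eta_eq: "\<eta> y = (\<integral>z. ?f z * \<psi> (y - z) \<partial>lborel)" for y by (simp add: \<eta>_def conv_def)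
  have psi0: "\<psi> z = 0" if nz: "\<not> (\<forall>k. \<bar>z $ k\<bar> \<le> 1/4)" for z
  proof -
    obtain k where "1/4 < \<bar>z $ k\<bar>" using nz by (auto simp: not_le)
    then have "1/4 < norm z" using component_le_norm_cart[of z k] by linarith
    then show ?thesis using psi by (simp add: mollifier_def)
  qed
  have int1: "integrable lborel (\<lambda>z. \<psi> (y - z))" "(\<integral>z. \<psi> (y - z) \<partial>lborel) = 1" for y
    using mollifier_integral[OF psi] by auto
  have int2: "integrable lborel (\<lambda>z. ?f z * \<psi> (y - z))" for y
    by (rule Bochner_Integration.integrable_bound[OF int1(1)[of y]]) (auto simp: indicator_def)
  have nn: "0 \<le> \<eta> y" for y
    unfolding eta_eq using mollifier_nonneg[OF psi] by (intro integral_nonneg_AE) auto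
  have le1: "\<eta> y \<le> 1" for y
    unfolding eta_eq int1(2)[of y, symmetric]
    using mollifier_nonneg[OF psi] by (intro integral_mono int1 int2) (auto simp: indicator_def)
  have one: "\<eta> y = 1" if y: "\<And>k. \<bar>y $ k\<bar> \<le> 3/8" for y
  proof -
    have "?f z * \<psi> (y - z) = \<psi> (y - z)" for z
    proof (cases "\<forall>k. \<bar>(y - z) $ k\<bar> \<le> 1/4")
      case True
      have "\<bar>z $ k - 0 $ k\<bar> \<le> 5/8" for k
      proof -
        have "\<bar>y $ k - z $ k\<bar> \<le> 1/4" using True by simp
        then show ?thesis using y[of k] unfolding zero_index by linarith
      qed
      then have "z \<in> cube 0 (5/8)" unfolding mem_cube by blast
      then show ?thesis by simp
    next
      case False
      then show ?thesis using psi0[OF False] by simp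
    qed
    then show ?thesis unfolding eta_eq int1(2)[of y, symmetric] by presburger
  qed
  have zero: "\<eta> y = 0" if y: "y \<notin> cube 0 (7/8)" for y
  proof -
    obtain k where k: "7/8 < \<bar>y $ k\<bar>" using y by (auto simp: mem_cube not_le)
    have "?f z * \<psi> (y - z) = 0" for z
    proof (cases "z \<in> cube 0 (5/8)")
      case True
      then have "\<bar>z $ k\<bar> \<le> 5/8" by (simp add: mem_cube)
      then have "\<not> \<bar>(y - z) $ k\<bar> \<le> 1/4" using k unfolding vector_minus_component by linarith
      then show ?thesis using psi0[of "y - z"] by auto
    qed simp
    then have "(\<lambda>z. ?f z * \<psi> (y - z)) = (\<lambda>_. 0)" by (intro ext)
    then show ?thesis unfolding eta_eq by (simp only: integral_zero)
  qed
  have zero': "\<eta> y = 0" if "real CARD('n) < norm y" for y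
  proof (rule zero)
    show "y \<notin> cube 0 (7/8)"
    proof
      assume "y \<in> cube 0 (7/8)"
      then have yk: "\<bar>y $ k - 0 $ k\<bar> \<le> 7/8" for k unfolding mem_cube by blast
      have "\<bar>y $ k\<bar> \<le> 1" for k using yk[of k] by simp
      then have "(\<Sum>k\<in>UNIV. \<bar>y $ k\<bar>) \<le> real CARD('n) * 1" by (intro sum_bounded_above) auto
      then show False using norm_le_l1_cart[of y] that by linarith
    qed
  qed
  have cp: "continuous_on UNIV (partial_deriv i \<eta>)" for i using ck[of 1] by simp
  have "\<exists>C. \<forall>x. \<bar>partial_deriv i \<eta> x\<bar> \<le> C" for i
    using compact_support_bounded[OF cp, of "real CARD('n)" i] partial_deriv_support[of "real CARD('n)" \<eta>, OF zero'] by metis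
  then obtain B where B: "\<And>i x. \<bar>partial_deriv i \<eta> x\<bar> \<le> B i" by metis
  define C where "C = 1 + (\<Sum>i\<in>UNIV. \<bar>B i\<bar>)"
  have C: "0 < C" unfolding C_def by (intro add_pos_nonneg sum_nonneg) auto
  have gb: "norm (grad \<eta> y) \<le> C" for y
  proof -
    have "norm (grad \<eta> y) \<le> (\<Sum>i\<in>UNIV. \<bar>partial_deriv i \<eta> y\<bar>)" using norm_le_l1_cart[of "grad \<eta> y"] by simp
    also have "\<dots> \<le> (\<Sum>i\<in>UNIV. \<bar>B i\<bar>)" by (intro sum_mono) (meson B abs_ge_self order_trans)
    finally show ?thesis by (simp add: C_def)
  qed
  have "\<exists>\<eta>. (\<forall>k. Ck k \<eta>) \<and> (\<forall>y. 0 \<le> \<eta> y \<and> \<eta> y \<le> 1)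
     \<and> (\<forall>y\<in>cube x (r / 4). \<eta> y = 1) \<and> (\<forall>y. y \<notin> cube x (7 / 8 * r) \<longrightarrow> \<eta> y = 0)
     \<and> (\<forall>y. norm (grad \<eta> y) \<le> C / r) \<and> (\<forall>y. y \<notin> annulus x r \<longrightarrow> grad \<eta> y = 0)" if r: "0 < r" for x :: "real^'n" and r
  proof -
    define \<theta> where "\<theta> y = \<eta> ((1/r) *\<^sub>R y + (- (1/r) *\<^sub>R x))" for y
    let ?s = "\<lambda>y. (1/r) *\<^sub>R y + (- (1/r) *\<^sub>R x)"
    have comp: "\<bar>?s y $ k\<bar> = \<bar>y $ k - x $ k\<bar> / r" for y k
    proof -
      have "?s y $ k = (y $ k - x $ k) / r" by (simp add: field_simps diff_divide_distrib)
      then show ?thesis using r by simp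
    qed
    have d: "\<eta> differentiable (at z)" for z using ck[of 1] by simp
    have th1: "\<theta> y = 1" if "\<And>k. \<bar>y $ k - x $ k\<bar> \<le> 3/8 * r" for y
      unfolding \<theta>_def
    proof (rule one)
      fix k show "\<bar>?s y $ k\<bar> \<le> 3/8" unfolding comp using that[of k] r by (simp add: field_simps)
    qed
    have th0: "\<theta> y = 0" if y: "y \<notin> cube x (7/8 * r)" for y
      unfolding \<theta>_def
    proof (rule zero)
      obtain k where "7/8 * r < \<bar>y $ k - x $ k\<bar>" using y by (auto simp: mem_cube not_le)
      then have "7/8 < \<bar>?s y $ k\<bar>" unfolding comp using r by (simp add: field_simps)
      then show "?s y \<notin> cube 0 (7/8)" unfolding mem_cube by (metis diff_zero linorder_not_le zero_index)
    qed
    show ?thesis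
    proof (intro exI[of _ \<theta>] conjI allI ballI impI)
      show "Ck k \<theta>" for k unfolding \<theta>_def by (rule Ck_affine[OF ck])
      show "0 \<le> \<theta> y" "\<theta> y \<le> 1" for y unfolding \<theta>_def using nn le1 by auto
      show "\<theta> y = 1" if "y \<in> cube x (r / 4)" for y
      proof (rule th1)
        fix k
        have "\<bar>y $ k - x $ k\<bar> \<le> r / 4" using that unfolding mem_cube by blast
        then show "\<bar>y $ k - x $ k\<bar> \<le> 3/8 * r" using r by simp
      qed
      show "\<theta> y = 0" if "y \<notin> cube x (7/8 * r)" for y using that by (rule th0)
      have "grad \<theta> y = (1/r) *\<^sub>R grad \<eta> (?s y)" for y
        unfolding \<theta>_def using partial_deriv_affine(1)[OF d, where s="1/r" and x=y and b="- (1/r) *\<^sub>R x"] by (simp add: vec_eq_iff)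
      then show "norm (grad \<theta> y) \<le> C / r" for y using gb[of "?s y"] r by (simp add: divide_right_mono)
      show "grad \<theta> y = 0" if y: "y \<notin> annulus x r" for y
      proof (cases "y \<in> cube x r")
        case False
        have "cube x (7/8 * r) \<subseteq> cube x r"
        proof
          fix z assume z: "z \<in> cube x (7/8 * r)"
          have "\<bar>z $ k - x $ k\<bar> \<le> r" for k
          proof -
            have "\<bar>z $ k - x $ k\<bar> \<le> 7/8 * r" using z unfolding mem_cube by blast
            then show ?thesis using r by simp
          qed
          then show "z \<in> cube x r" unfolding mem_cube by blast
        qed
        then have "y \<in> - cube x (7/8 * r)" using False by blast
        then show ?thesis using th0 by (intro grad_eq_0_open[of "- cube x (7/8 * r)" y \<theta> 0]) (auto simp: cube_closed open_Compl)
      next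
        case True
        then have yk: "\<bar>y $ k - x $ k\<bar> < r / 4" for k using y by (auto simp: annulus_def not_le)
        let ?S = "\<Inter>k\<in>UNIV. {z. \<bar>z $ k - x $ k\<bar> < 3/8 * r}"
        have "open ?S" by (intro open_INT finite ballI open_Collect_less continuous_intros)
        moreover have "y \<in> ?S"
        proof (intro INT_I CollectI)
          fix k show "\<bar>y $ k - x $ k\<bar> < 3/8 * r" using yk[of k] r by simp
        qed
        moreover have "\<theta> z = 1" if "z \<in> ?S" for z
          using that by (intro th1) (auto simp: less_imp_le)
        ultimately show ?thesis by (rule grad_eq_0_open)
      qed
    qed
  qed
  then show ?thesis using C by (intro exI[of _ C]) simp
qed

lemma grad_diff:
  fixes f g :: "real^'n::finite \<Rightarrow> real"
  assumes "f differentiable (at x)" "g differentiable (at x)"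
  shows "grad (\<lambda>x. f x - g x) x = grad f x - grad g x"
  using partial_deriv_eq[OF has_derivative_diff[OF assms[unfolded frechet_derivative_works]]]
  by (simp add: vec_eq_iff partial_deriv_def)

lemma sobolev_closure_diff_smooth:
  fixes f :: "real^'n::finite \<Rightarrow> real"
  assumes sc: "sobolev_closure K f F" and v: "\<And>k. Ck k v"
  shows "sobolev_closure K (\<lambda>x. f x - v x) (\<lambda>x. F x - grad v x)"
proof -
  obtain w where w: "\<And>j k. Ck k (w j)"
    "(\<lambda>j. \<integral>\<^sup>+x\<in>K. \<bar>w j x - f x\<bar> ^ CARD('n) \<partial>lborel) \<longlonglongrightarrow> 0"
    "(\<lambda>j. \<integral>\<^sup>+x\<in>K. norm (grad (w j) x - F x) ^ CARD('n) \<partial>lborel) \<longlonglongrightarrow> 0"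
    using sc unfolding sobolev_closure_def by blast
  have vm[measurable]: "v \<in> borel_measurable borel" using Ck_measurable[OF v] .
  have [measurable]: "f \<in> borel_measurable borel" "F \<in> borel_measurable borel"
    using sc by (auto simp: sobolev_closure_def)
  have "continuous_on UNIV (grad v)"
    using v[of 1] by (auto simp: grad_def intro!: continuous_on_vec_lambda)
  then have [measurable]: "grad v \<in> borel_measurable borel" by (rule borel_measurable_continuous_onI)
  have d: "w j differentiable (at x)" "v differentiable (at x)" for j x
    using w(1)[of 1 j] v[of 1] by auto
  show ?thesis
    unfolding sobolev_closure_def
  proof (intro conjI exI[of _ "\<lambda>j x. w j x - v x"] allI)
    show "Ck k (\<lambda>x. w j x - v x)" for j k by (intro Ck_diff w v)
    show "(\<lambda>j. \<integral>\<^sup>+x\<in>K. \<bar>w j x - v x - (f x - v x)\<bar> ^ CARD('n) \<partial>lborel) \<longlonglongrightarrow> 0" using w(2) by simp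
    show "(\<lambda>j. \<integral>\<^sup>+x\<in>K. norm (grad (\<lambda>x. w j x - v x) x - (F x - grad v x)) ^ CARD('n) \<partial>lborel) \<longlonglongrightarrow> 0"
      using w(3) by (simp add: grad_diff d)
  qed measurable
qed

text \<open>The defining sequence converges for Lebesgue measure only. Applied to the difference f -
  v, which is again in the closure, \<open>cube_annulus_constant\<close> bounds the V-weighted
  deviation from a constant by the gradient error, and the unweighted norm of the difference bounds
  that constant.\<close>

lemma sobolev_closure_weighted:
  fixes f V :: "real^'n::finite \<Rightarrow> real"
  assumes N: "CARD('n) = Suc m" and m: "0 < m" and \<sigma>: "real m < \<sigma>" and r: "0 < r"
    and sc: "sobolev_closure (cube x r) f F"
    and Vm[measurable]: "V \<in> borel_measurable borel" and V0: "\<And>y. 0 \<le> V y"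
    and W: "\<And>y. y \<in> cube x r \<Longrightarrow> (\<integral>\<^sup>+z\<in>cube x r. ennreal (V z * logw \<sigma> (norm (y - z) / (2 * r * real (Suc m)))) \<partial>lborel) \<le> ennreal w"
    and w0: "0 < w"
  shows "\<exists>v. (\<forall>j k. Ck k (v j)) \<and>
    (\<lambda>j. \<integral>\<^sup>+y\<in>cube x r. norm (grad (v j) y - F y) ^ Suc m \<partial>lborel) \<longlonglongrightarrow> 0 \<and>
    (\<lambda>j. \<integral>\<^sup>+y\<in>cube x r. ennreal (V y * \<bar>v j y - f y\<bar> ^ Suc m) \<partial>lborel) \<longlonglongrightarrow> 0"
proof -
  let ?Q = "cube x r"
  have fm[measurable]: "f \<in> borel_measurable borel" "F \<in> borel_measurable borel"
    using sc by (auto simp: sobolev_closure_def)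
  obtain v where v: "\<And>j k. Ck k (v j)"
    "(\<lambda>j. \<integral>\<^sup>+x\<in>?Q. \<bar>v j x - f x\<bar> ^ CARD('n) \<partial>lborel) \<longlonglongrightarrow> 0"
    "(\<lambda>j. \<integral>\<^sup>+x\<in>?Q. norm (grad (v j) x - F x) ^ CARD('n) \<partial>lborel) \<longlonglongrightarrow> 0"
    using sc unfolding sobolev_closure_def by blast
  have vm[measurable]: "v j \<in> borel_measurable borel" for j using Ck_measurable[OF v(1)] .
  define a where "a j = (\<integral>\<^sup>+x\<in>?Q. \<bar>v j x - f x\<bar> ^ Suc m \<partial>lborel)" for j
  define e where "e j = (\<integral>\<^sup>+x\<in>?Q. norm (grad (v j) x - F x) ^ Suc m \<partial>lborel)" for j
  have lim: "a \<longlonglongrightarrow> 0" "e \<longlonglongrightarrow> 0" using v(2,3) unfolding a_def[abs_def] e_def[abs_def] N by auto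
  \<comment> \<open>The errors may be infinite for early indices, and the estimate below needs them
    as real numbers.\<close>
  have "eventually (\<lambda>j. a j < 1) sequentially" "eventually (\<lambda>j. e j < 1) sequentially"
    using order_tendstoD(2)[OF lim(1), of 1] order_tendstoD(2)[OF lim(2), of 1] by auto
  then have ev: "eventually (\<lambda>j. a j < \<infinity> \<and> e j < \<infinity>) sequentially"
    by eventually_elim (auto intro: less_trans)
  obtain K where K0: "0 < K" and K': "\<forall>x r (f :: real^'n \<Rightarrow> real) F V w E Ea. 0 < r \<and> sobolev_closure (cube x r) f F
     \<and> V \<in> borel_measurable borel \<and> (\<forall>y. 0 \<le> V y) \<and> 0 < w
     \<and> (\<forall>y\<in>cube x r. (\<integral>\<^sup>+z\<in>cube x r. ennreal (V z * logw \<sigma> (norm (y - z) / (2 * r * real (Suc m)))) \<partial>lborel) \<le> ennreal w)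
     \<and> (\<integral>\<^sup>+y\<in>cube x r. norm (F y) ^ Suc m \<partial>lborel) \<le> ennreal E
     \<and> (\<integral>\<^sup>+y\<in>annulus x r. norm (F y) ^ Suc m \<partial>lborel) \<le> ennreal Ea \<and> 0 \<le> Ea \<and> Ea \<le> E \<longrightarrow>
     (\<exists>c. (\<integral>\<^sup>+y\<in>annulus x r. ennreal (\<bar>f y - c\<bar> ^ Suc m) \<partial>lborel) \<le> ennreal (K * r ^ Suc m * Ea) \<and>
          (\<integral>\<^sup>+y\<in>cube x r. ennreal (V y * \<bar>f y - c\<bar> ^ Suc m) \<partial>lborel) \<le> ennreal (K * w * E))"
    using cube_annulus_constant[OF N m \<sigma>] by (elim exE conjE)
  note K = K0 K'[rule_format]
  have sub: "annulus x r \<subseteq> ?Q" by (auto simp: annulus_def)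
  have am[measurable]: "annulus x r \<in> sets borel" using r by simp
  have \<sigma>0: "0 \<le> \<sigma>" using \<sigma> by linarith
  obtain i :: 'n where True by simp
  have ae: "ennreal ((r / 4) ^ Suc m) \<le> emeasure lborel (annulus x r)"
    using emeasure_slab_ge[OF r, of x i True] emeasure_mono[OF slab_subset_annulus[of r x i True], of lborel] r
    by (auto simp: N intro: order_trans)
  have xin: "x \<in> ?Q" using r by (simp add: mem_cube)
  have "(\<integral>\<^sup>+y\<in>?Q. ennreal (V y) \<partial>lborel) \<le> (\<integral>\<^sup>+z\<in>?Q. ennreal (V z * logw \<sigma> (norm (x - z) / (2 * r * real (Suc m)))) \<partial>lborel)"
  proof (intro nn_integral_mono mult_right_mono ennreal_leI)
    show "V z \<le> V z * logw \<sigma> (norm (x - z) / (2 * r * real (Suc m)))" for z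
      using mult_left_mono[OF logw_ge_1[OF \<sigma>0, of "norm (x - z) / (2 * r * real (Suc m))"], of "V z"] V0 by simp
  qed auto
  also have "\<dots> \<le> ennreal w" using W xin by blast
  finally have Vw: "(\<integral>\<^sup>+y\<in>?Q. ennreal (V y) \<partial>lborel) \<le> ennreal w" .
  define c1 where "c1 = 2 ^ Suc m * (w * (2 ^ Suc m / (r / 4) ^ Suc m))"
  define c2 where "c2 = 2 ^ Suc m * (K * w + (2 ^ Suc m * (K * r ^ Suc m) / (r / 4) ^ Suc m) * w)"
  have c12: "0 \<le> c1" "0 \<le> c2" using w0 r K(1) by (auto simp: c1_def c2_def)
  have est: "(\<integral>\<^sup>+y\<in>?Q. ennreal (V y * \<bar>v j y - f y\<bar> ^ Suc m) \<partial>lborel) \<le> ennreal c1 * a j + ennreal c2 * e j"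
    if fin: "a j < \<infinity> \<and> e j < \<infinity>" for j
  proof -
    let ?g = "\<lambda>y. f y - v j y" and ?H = "\<lambda>y. F y - grad (v j) y"
    obtain ar er where ar: "a j = ennreal ar" "0 \<le> ar" and er: "e j = ennreal er" "0 \<le> er"
      using fin by (metis less_top_ennreal infinity_ennreal_def)
    have eH: "(\<integral>\<^sup>+y\<in>?Q. norm (?H y) ^ Suc m \<partial>lborel) \<le> ennreal er"
      using er by (simp add: e_def norm_minus_commute)
    have "(\<integral>\<^sup>+y\<in>annulus x r. norm (?H y) ^ Suc m \<partial>lborel) \<le> (\<integral>\<^sup>+y\<in>?Q. norm (?H y) ^ Suc m \<partial>lborel)"
      using sub by (intro nn_integral_mono) (auto simp: indicator_def)
    then have eA: "(\<integral>\<^sup>+y\<in>annulus x r. norm (?H y) ^ Suc m \<partial>lborel) \<le> ennreal er" using eH by (rule order_trans)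
    obtain c where c: "(\<integral>\<^sup>+y\<in>annulus x r. ennreal (\<bar>?g y - c\<bar> ^ Suc m) \<partial>lborel) \<le> ennreal (K * r ^ Suc m * er)"
      "(\<integral>\<^sup>+y\<in>?Q. ennreal (V y * \<bar>?g y - c\<bar> ^ Suc m) \<partial>lborel) \<le> ennreal (K * w * er)"
      using K(2)[of r x ?g ?H V w er er] r sobolev_closure_diff_smooth[OF sc v(1)] V0 W w0 eH eA er by auto
    have a0: "(\<integral>\<^sup>+y\<in>?Q. ennreal (\<bar>?g y - 0\<bar> ^ Suc m) \<partial>lborel) \<le> ennreal ar"
      using ar by (simp add: a_def abs_minus_commute)
    have "\<bar>c - 0\<bar> ^ Suc m \<le> 2 ^ Suc m * (K * r ^ Suc m * er + ar) / (r / 4) ^ Suc m"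
      using r K er ar by (intro const_power_le[OF _ _ _ _ subset_refl sub ae _ c(1) _ a0]) auto
    then have cc: "\<bar>c - 0\<bar> ^ Suc m * w \<le> (2 ^ Suc m * (K * r ^ Suc m * er + ar) / (r / 4) ^ Suc m) * w"
      using w0 by (intro mult_right_mono) auto
    have "(\<integral>\<^sup>+y\<in>?Q. ennreal (V y * \<bar>?g y - 0\<bar> ^ Suc m) \<partial>lborel) \<le> ennreal (2 ^ Suc m * (K * w * er + \<bar>c - 0\<bar> ^ Suc m * w))"
      using V0 w0 K er by (intro recenter_power_le[OF _ _ _ _ c(2) _ Vw]) auto
    also have "\<dots> \<le> ennreal (2 ^ Suc m * (K * w * er + (2 ^ Suc m * (K * r ^ Suc m * er + ar) / (r / 4) ^ Suc m) * w))"
      by (intro ennreal_leI mult_left_mono add_left_mono cc) auto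
    also have "2 ^ Suc m * (K * w * er + (2 ^ Suc m * (K * r ^ Suc m * er + ar) / (r / 4) ^ Suc m) * w) = c1 * ar + c2 * er"
      by (simp add: c1_def c2_def algebra_simps add_divide_distrib)
    also have "ennreal (c1 * ar + c2 * er) = ennreal c1 * a j + ennreal c2 * e j"
      using ar er c12 by (simp add: ennreal_plus ennreal_mult)
    finally show ?thesis by (simp add: abs_minus_commute)
  qed
  have "(\<lambda>j. ennreal c1 * a j + ennreal c2 * e j) \<longlonglongrightarrow> ennreal c1 * 0 + ennreal c2 * 0"
    by (intro tendsto_add ennreal_tendsto_cmult lim) auto
  then have z: "(\<lambda>j. ennreal c1 * a j + ennreal c2 * e j) \<longlonglongrightarrow> 0" by simp
  have "(\<lambda>j. \<integral>\<^sup>+y\<in>?Q. ennreal (V y * \<bar>v j y - f y\<bar> ^ Suc m) \<partial>lborel) \<longlonglongrightarrow> 0"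
    by (rule tendsto_sandwich[OF _ _ tendsto_const z]) (use ev est in \<open>auto elim!: eventually_mono simp del: power_Suc\<close>)
  then show ?thesis using v(1) lim(2) unfolding e_def by blast
qed

section \<open>The energy inequality\<close>

lemma energy_majorant:
  fixes g u U V :: real
  assumes "0 \<le> g" "0 \<le> U" "U ^ n = V"
  shows "(g + U * (\<bar>u\<bar> + 1)) ^ n \<le> 4 ^ n * (g ^ n + V * (\<bar>u\<bar> ^ n + 1))"
proof -
  have "(g + U * (\<bar>u\<bar> + 1)) ^ n \<le> 2 ^ n * (g ^ n + (U * (\<bar>u\<bar> + 1)) ^ n)"
    using assms by (intro power_add_le) auto
  also have "(U * (\<bar>u\<bar> + 1)) ^ n \<le> V * (2 ^ n * (\<bar>u\<bar> ^ n + 1 ^ n))"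
    unfolding power_mult_distrib assms(3)[symmetric] using assms
    by (intro mult_left_mono power_add_le) auto
  also have "2 ^ n * (g ^ n + V * (2 ^ n * (\<bar>u\<bar> ^ n + 1 ^ n))) \<le> 2 ^ n * (2 ^ n * g ^ n + V * (2 ^ n * (\<bar>u\<bar> ^ n + 1 ^ n)))"
  proof (intro mult_left_mono add_right_mono)
    show "g ^ n \<le> 2 ^ n * g ^ n" using mult_right_mono[of 1 "2 ^ n" "g ^ n"] assms(1) by simp
  qed auto
  also have "\<dots> = (2 ^ n * 2 ^ n) * (g ^ n + V * (\<bar>u\<bar> ^ n + 1))" by (simp add: algebra_simps)
  also have "(2::real) ^ n * 2 ^ n = 4 ^ n" by (simp flip: power_mult_distrib)
  finally show ?thesis by simp
qed

text \<open>The integrand of the Caccioppoli inequality for the admissible test function \<open>\<eta> (v - c)\<close>, where \<open>v\<close> is a smooth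
  approximation of \<open>u\<close>, \<open>H\<close> and \<open>e\<close> are the gradients of \<open>v\<close> and \<open>\<eta>\<close>, and \<open>\<xi>\<close> is the indicator of the annulus. The last
  line vanishes as \<open>v\<close> tends to \<open>u\<close>, after which \<open>\<tau>\<close> tends to \<open>0\<close>.\<close>

lemma energy_pointwise:
  fixes G H a e :: "'a::real_inner" and u v c \<eta> b V U r \<tau> \<xi> Ca Ce :: real and m :: nat
  defines "Z \<equiv> norm G + U * (\<bar>u\<bar> + 1)" and "P \<equiv> V * (\<bar>u\<bar> ^ Suc m + 1)" and "K \<equiv> Ce * Ca / r + 3"
  assumes \<eta>: "0 \<le> \<eta>" "\<eta> \<le> 1" and U: "1 \<le> U" "U ^ Suc m = V" and pos: "0 < r" "0 < \<tau>" "0 \<le> Ca" "0 \<le> Ce"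
    and \<xi>: "\<xi> = 0 \<or> \<xi> = 1" and e: "norm e \<le> \<xi> * (Ce / r)"
    and a: "norm a \<le> Ca * Z ^ m" and b: "\<bar>b\<bar> \<le> 3 * U * Z ^ m"
    and Ga: "norm G ^ Suc m - V * \<bar>u\<bar> ^ Suc m - V \<le> G \<bullet> a"
  shows "1 / 2 * (\<eta> * norm G ^ Suc m) \<le> ((\<eta> *\<^sub>R H + (v - c) *\<^sub>R e) \<bullet> a + \<eta> * (v - c) * b)
    + (2 + 4 ^ Suc m) * P + 4 ^ Suc m * (\<xi> * norm G ^ Suc m) + (Ce * Ca / r) ^ Suc m * (\<xi> * \<bar>u - c\<bar> ^ Suc m)
    + 3 ^ Suc m * (2 * 4 ^ Suc m) ^ m * (V * \<bar>u - c\<bar> ^ Suc m) + 2 * \<tau> * 4 ^ Suc m * (norm G ^ Suc m + P)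
    + Ca ^ Suc m / \<tau> ^ m * norm (H - G) ^ Suc m + K ^ Suc m / \<tau> ^ m * (V * \<bar>v - u\<bar> ^ Suc m)"
proof -
  let ?g = "norm G ^ Suc m"
  let ?c = "Ce * Ca / r"
  have c0: "0 \<le> ?c" using pos by simp
  have Z0: "0 \<le> Z" unfolding Z_def using U by simp
  have V0: "0 \<le> V" using U by (metis order_trans zero_le_one zero_le_power)
  have P0: "0 \<le> P" unfolding P_def using V0 by simp
  have chi: "0 \<le> \<xi>" "\<xi> \<le> 1" using \<xi> by auto
  have ZN: "Z ^ Suc m \<le> 4 ^ Suc m * (?g + P)"
    unfolding Z_def P_def using U by (intro energy_majorant) auto
  let ?I = "(\<eta> *\<^sub>R H + (v - c) *\<^sub>R e) \<bullet> a + \<eta> * (v - c) * b"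
  \<comment> \<open>The tested integrand solved for \<eta> (G \<bullet> a), the only term bounded
    below by the energy density. The other three are errors: replacing G by H, the cutoff gradient,
    and the lower-order term b.\<close>
  have eq: "\<eta> * (G \<bullet> a) = ?I - \<eta> * ((H - G) \<bullet> a) - (v - c) * (e \<bullet> a) - \<eta> * (v - c) * b"
    by (simp add: inner_add_left inner_diff_left algebra_simps)
  have t1: "- (\<eta> * ((H - G) \<bullet> a)) \<le> \<tau> * Z ^ Suc m + Ca ^ Suc m / \<tau> ^ m * norm (H - G) ^ Suc m"
  proof -
    have "- (\<eta> * ((H - G) \<bullet> a)) \<le> \<bar>\<eta> * ((H - G) \<bullet> a)\<bar>" by (rule abs_le_D2[OF order_refl])
    also have "\<dots> = \<eta> * \<bar>(H - G) \<bullet> a\<bar>" using \<eta> by (simp add: abs_mult)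
    also have "\<dots> \<le> 1 * (norm (H - G) * norm a)"
      using \<eta> Cauchy_Schwarz_ineq2[of "H - G" a] by (intro mult_mono) auto
    also have "\<dots> \<le> 1 * (norm (H - G) * (Ca * Z ^ m))" by (intro mult_left_mono a) auto
    also have "\<dots> = (Ca * norm (H - G)) * Z ^ m" by simp
    also have "\<dots> \<le> \<tau> * Z ^ Suc m + (Ca * norm (H - G)) ^ Suc m / \<tau> ^ m"
      using pos Z0 by (intro power_Young) auto
    finally show ?thesis by (simp add: power_mult_distrib mult_ac)
  qed
  have tri: "\<bar>v - c\<bar> \<le> \<bar>v - u\<bar> + \<bar>u - c\<bar>" by linarith
  have t2: "- ((v - c) * (e \<bullet> a)) \<le> \<bar>v - u\<bar> * (?c * Z ^ m) + \<xi> * (?c * \<bar>u - c\<bar> * Z ^ m)"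
  proof -
    have ea: "\<bar>e \<bullet> a\<bar> \<le> \<xi> * (?c * Z ^ m)"
    proof -
      have "\<bar>e \<bullet> a\<bar> \<le> norm e * norm a" by (rule Cauchy_Schwarz_ineq2)
      also have "\<dots> \<le> (\<xi> * (Ce / r)) * (Ca * Z ^ m)"
        using e a chi pos by (intro mult_mono) auto
      finally show ?thesis by (simp add: mult_ac)
    qed
    have "- ((v - c) * (e \<bullet> a)) \<le> \<bar>(v - c) * (e \<bullet> a)\<bar>" by (rule abs_le_D2[OF order_refl])
    also have "\<dots> = \<bar>v - c\<bar> * \<bar>e \<bullet> a\<bar>" by (simp add: abs_mult)
    also have "\<dots> \<le> (\<bar>v - u\<bar> + \<bar>u - c\<bar>) * (\<xi> * (?c * Z ^ m))" using tri ea by (intro mult_mono) auto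
    also have "\<dots> = \<xi> * (\<bar>v - u\<bar> * (?c * Z ^ m)) + \<xi> * (?c * \<bar>u - c\<bar> * Z ^ m)" by (simp add: algebra_simps add_divide_distrib)
    also have "\<xi> * (\<bar>v - u\<bar> * (?c * Z ^ m)) \<le> 1 * (\<bar>v - u\<bar> * (?c * Z ^ m))"
      using chi c0 Z0 by (intro mult_right_mono mult_nonneg_nonneg) auto
    finally show ?thesis by simp
  qed
  have t3: "- (\<eta> * (v - c) * b) \<le> \<bar>v - u\<bar> * (3 * U * Z ^ m) + \<eta> * (3 * U * \<bar>u - c\<bar> * Z ^ m)"
  proof -
    have "- (\<eta> * (v - c) * b) \<le> \<bar>\<eta> * (v - c) * b\<bar>" by (rule abs_le_D2[OF order_refl])
    also have "\<dots> = \<eta> * \<bar>v - c\<bar> * \<bar>b\<bar>" using \<eta> by (simp add: abs_mult)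
    also have "\<dots> \<le> \<eta> * (\<bar>v - u\<bar> + \<bar>u - c\<bar>) * (3 * U * Z ^ m)"
      using \<eta> tri b by (intro mult_mono) auto
    also have "\<dots> = \<eta> * (\<bar>v - u\<bar> * (3 * U * Z ^ m)) + \<eta> * (3 * U * \<bar>u - c\<bar> * Z ^ m)" by (simp add: algebra_simps add_divide_distrib)
    also have "\<eta> * (\<bar>v - u\<bar> * (3 * U * Z ^ m)) \<le> 1 * (\<bar>v - u\<bar> * (3 * U * Z ^ m))"
      using \<eta> U Z0 by (intro mult_right_mono mult_nonneg_nonneg) auto
    finally show ?thesis by simp
  qed
  \<comment> \<open>All terms containing v - u use the free parameter \<tau>: their remainders may
    be large, since they vanish with v - u before \<tau> is sent to 0.\<close>
  have t4: "\<bar>v - u\<bar> * (?c * Z ^ m) + \<bar>v - u\<bar> * (3 * U * Z ^ m) \<le> \<tau> * Z ^ Suc m + K ^ Suc m / \<tau> ^ m * (V * \<bar>v - u\<bar> ^ Suc m)"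
  proof -
    have "?c + 3 * U \<le> K * U"
    proof -
      have "?c * 1 \<le> ?c * U" using U c0 by (intro mult_left_mono) auto
      then show ?thesis by (simp add: K_def distrib_right)
    qed
    then have "(?c + 3 * U) * (\<bar>v - u\<bar> * Z ^ m) \<le> (K * U) * (\<bar>v - u\<bar> * Z ^ m)"
      using Z0 by (intro mult_right_mono) auto
    then have "\<bar>v - u\<bar> * (?c * Z ^ m) + \<bar>v - u\<bar> * (3 * U * Z ^ m) \<le> (K * U * \<bar>v - u\<bar>) * Z ^ m"
      by (simp add: algebra_simps add_divide_distrib)
    also have "\<dots> \<le> \<tau> * Z ^ Suc m + (K * U * \<bar>v - u\<bar>) ^ Suc m / \<tau> ^ m"
      using pos Z0 U c0 by (intro power_Young) (auto simp: K_def)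
    also have "(K * U * \<bar>v - u\<bar>) ^ Suc m / \<tau> ^ m = K ^ Suc m / \<tau> ^ m * (V * \<bar>v - u\<bar> ^ Suc m)"
      unfolding power_mult_distrib U(2) by simp
    finally show ?thesis .
  qed
  \<comment> \<open>Young's parameter is 1 here: this loses the full energy density, but only on the
    annulus, and that is what hole filling tolerates.\<close>
  have t5: "\<xi> * (?c * \<bar>u - c\<bar> * Z ^ m) \<le> 4 ^ Suc m * (\<xi> * ?g) + 4 ^ Suc m * P + ?c ^ Suc m * (\<xi> * \<bar>u - c\<bar> ^ Suc m)"
  proof -
    have "(?c * \<bar>u - c\<bar>) * Z ^ m \<le> 1 * Z ^ Suc m + (?c * \<bar>u - c\<bar>) ^ Suc m / 1 ^ m"
      using Z0 c0 by (intro power_Young mult_nonneg_nonneg) auto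
    also have "\<dots> = Z ^ Suc m + ?c ^ Suc m * \<bar>u - c\<bar> ^ Suc m" unfolding power_mult_distrib by (simp del: power_Suc)
    also have "\<dots> \<le> 4 ^ Suc m * (?g + P) + ?c ^ Suc m * \<bar>u - c\<bar> ^ Suc m" by (intro add_right_mono ZN)
    finally have "\<xi> * (?c * \<bar>u - c\<bar> * Z ^ m) \<le> \<xi> * (4 ^ Suc m * (?g + P) + ?c ^ Suc m * \<bar>u - c\<bar> ^ Suc m)"
      using chi by (intro mult_left_mono) auto
    also have "\<dots> = 4 ^ Suc m * (\<xi> * ?g) + \<xi> * (4 ^ Suc m * P) + ?c ^ Suc m * (\<xi> * \<bar>u - c\<bar> ^ Suc m)"
      by (simp add: algebra_simps add_divide_distrib)
    also have "\<xi> * (4 ^ Suc m * P) \<le> 1 * (4 ^ Suc m * P)" using chi P0 by (intro mult_right_mono) auto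
    finally show ?thesis by simp
  qed
  have t6: "\<eta> * (3 * U * \<bar>u - c\<bar> * Z ^ m) \<le> 1 / 2 * (\<eta> * ?g) + P / 2 + 3 ^ Suc m * (2 * 4 ^ Suc m) ^ m * (V * \<bar>u - c\<bar> ^ Suc m)"
  proof -
    \<comment> \<open>Chosen so that t times \<open>4 ^ Suc m\<close> is 1/2: half of \<eta> times
      the energy density is absorbed into the left side, which explains the factor 1/2
      there.\<close>
    define t where "t = 1 / (2 * 4 ^ Suc m :: real)"
    have t: "0 < t" by (simp add: t_def)
    let ?X = "3 ^ Suc m * (2 * 4 ^ Suc m) ^ m * (V * \<bar>u - c\<bar> ^ Suc m)"
    have X0: "0 \<le> ?X" using V0 by simp
    have "(3 * U * \<bar>u - c\<bar>) * Z ^ m \<le> t * Z ^ Suc m + (3 * U * \<bar>u - c\<bar>) ^ Suc m / t ^ m"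
      using t Z0 U by (intro power_Young) auto
    also have "(3 * U * \<bar>u - c\<bar>) ^ Suc m / t ^ m = ?X"
    proof -
      have "1 / t ^ m = (2 * 4 ^ Suc m) ^ m" by (simp add: t_def power_one_over)
      then have "z / t ^ m = z * (2 * 4 ^ Suc m) ^ m" for z by (metis divide_inverse inverse_eq_divide)
      then show ?thesis unfolding power_mult_distrib[of "3 * U"] power_mult_distrib[of 3] U(2) by (simp only: mult_ac)
    qed
    also have "t * Z ^ Suc m \<le> t * (4 ^ Suc m * (?g + P))" using t by (intro mult_left_mono ZN) auto
    also have "t * (4 ^ Suc m * (?g + P)) = (?g + P) / 2" by (simp add: t_def)
    finally have "\<eta> * (3 * U * \<bar>u - c\<bar> * Z ^ m) \<le> \<eta> * ((?g + P) / 2 + ?X)" using \<eta> by (intro mult_left_mono) auto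
    also have "\<dots> = 1 / 2 * (\<eta> * ?g) + \<eta> * (P / 2) + \<eta> * ?X" by (simp add: algebra_simps add_divide_distrib)
    also have "\<dots> \<le> 1 / 2 * (\<eta> * ?g) + 1 * (P / 2) + 1 * ?X"
      using \<eta> P0 X0 by (intro add_mono mult_right_mono order_refl) auto
    finally show ?thesis by simp
  qed
  have "\<eta> * (?g - V * \<bar>u\<bar> ^ Suc m - V) \<le> \<eta> * (G \<bullet> a)" using Ga \<eta> by (intro mult_left_mono) auto
  then have "\<eta> * ?g \<le> \<eta> * (G \<bullet> a) + \<eta> * P" by (simp add: P_def algebra_simps)
  also have "\<eta> * P \<le> 1 * P" using \<eta> P0 by (intro mult_right_mono) auto
  finally have main: "\<eta> * ?g \<le> \<eta> * (G \<bullet> a) + P" by simp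
  have "2 * (\<tau> * Z ^ Suc m) \<le> 2 * (\<tau> * (4 ^ Suc m * (?g + P)))" using pos ZN by (intro mult_left_mono) auto
  then have zz: "2 * (\<tau> * Z ^ Suc m) \<le> 2 * \<tau> * 4 ^ Suc m * (?g + P)" by (simp only: mult.assoc)
  have P2: "P + 4 ^ Suc m * P + P / 2 \<le> (2 + 4 ^ Suc m) * P" using P0 by (simp add: distrib_right)
  show ?thesis using main eq t1 t2 t3 t4 t5 t6 zz P2 by linarith
qed

lemma nn_integral_le_imp_integrable:
  fixes f :: "'a \<Rightarrow> real"
  assumes [measurable]: "f \<in> borel_measurable M" "S \<in> sets M" and f: "\<And>x. x \<in> S \<Longrightarrow> 0 \<le> f x"
    and B: "(\<integral>\<^sup>+x\<in>S. ennreal (f x) \<partial>M) \<le> ennreal B" "0 \<le> B"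
  shows "integrable M (\<lambda>x. f x * indicator S x)" "(\<integral>x. f x * indicator S x \<partial>M) \<le> B"
proof -
  have eq: "(\<integral>\<^sup>+x. ennreal (f x * indicator S x) \<partial>M) = (\<integral>\<^sup>+x\<in>S. ennreal (f x) \<partial>M)"
    by (intro nn_integral_cong) (auto simp: indicator_def)
  have nn: "0 \<le> f x * indicator S x" for x using f[of x] by (auto simp: indicator_def)
  show i: "integrable M (\<lambda>x. f x * indicator S x)"
    using B eq nn by (intro integrableI_nonneg) (auto intro: le_less_trans)
  have "ennreal (\<integral>x. f x * indicator S x \<partial>M) \<le> ennreal B"
    using B(1) nn_integral_eq_integral[OF i] nn eq by simp
  then show "(\<integral>x. f x * indicator S x \<partial>M) \<le> B" using B by simp
qed

text \<open>The natural test function \<eta> (u - c) is not smooth, so u is replaced by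
  approximations v from \<open>sobolev_closure_weighted\<close>. The pointwise inequality is
  integrated, the tested integral vanishes, and the terms depending on v and \<tau> are made smaller
  than any \<epsilon>.\<close>

lemma caccioppoli:
  fixes u V U b \<eta> :: "real^'n::finite \<Rightarrow> real" and G a :: "real^'n \<Rightarrow> real^'n"
  defines "Z \<equiv> \<lambda>y. norm (G y) + U y * (\<bar>u y\<bar> + 1)"
  assumes N: "CARD('n) = Suc m" and m: "0 < m" and \<sigma>: "real m < \<sigma>" and r: "0 < r"
    and QD: "cube x r \<subseteq> D" and sc: "sobolev_closure (cube x r) u G"
    and Vm[measurable]: "V \<in> borel_measurable borel" and V0: "\<And>y. 0 \<le> V y"
    and U: "\<And>y. y \<in> D \<Longrightarrow> 1 \<le> U y" "\<And>y. U y ^ Suc m = V y"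
    and W: "\<And>y. y \<in> cube x r \<Longrightarrow> (\<integral>\<^sup>+z\<in>cube x r. ennreal (V z * logw \<sigma> (norm (y - z) / (2 * r * real (Suc m)))) \<partial>lborel) \<le> ennreal w"
    and w0: "0 < w" and C0: "0 \<le> Ca" "0 \<le> Ce"
    and struct: "AE y in lborel. y \<in> D \<longrightarrow> norm (a y) \<le> Ca * Z y ^ m \<and> \<bar>b y\<bar> \<le> 3 * U y * Z y ^ m \<and>
       norm (G y) ^ Suc m - V y * \<bar>u y\<bar> ^ Suc m - V y \<le> G y \<bullet> a y"
    and weak: "\<And>\<phi>. \<phi> \<in> test_functions D \<Longrightarrow> integrable lborel (\<lambda>y. grad \<phi> y \<bullet> a y + \<phi> y * b y) \<and>
       (\<integral>y. grad \<phi> y \<bullet> a y + \<phi> y * b y \<partial>lborel) = 0"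
    and \<eta>: "\<And>k. Ck k \<eta>" "\<And>y. 0 \<le> \<eta> y" "\<And>y. \<eta> y \<le> 1" "\<And>y. y \<in> cube x (r / 4) \<Longrightarrow> \<eta> y = 1"
      "\<And>y. y \<notin> cube x (7 / 8 * r) \<Longrightarrow> \<eta> y = 0" "\<And>y. norm (grad \<eta> y) \<le> Ce / r" "\<And>y. y \<notin> annulus x r \<Longrightarrow> grad \<eta> y = 0"
    and E: "(\<integral>\<^sup>+y\<in>cube x r. norm (G y) ^ Suc m \<partial>lborel) \<le> ennreal E" "0 \<le> E"
    and Ea: "(\<integral>\<^sup>+y\<in>annulus x r. norm (G y) ^ Suc m \<partial>lborel) \<le> ennreal Ea" "0 \<le> Ea"
    and X: "(\<integral>\<^sup>+y\<in>annulus x r. ennreal (\<bar>u y - c\<bar> ^ Suc m) \<partial>lborel) \<le> ennreal X" "0 \<le> X"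
    and Y: "(\<integral>\<^sup>+y\<in>cube x r. ennreal (V y * (\<bar>u y\<bar> ^ Suc m + 1)) \<partial>lborel) \<le> ennreal Y" "0 \<le> Y"
    and T: "(\<integral>\<^sup>+y\<in>cube x r. ennreal (V y * \<bar>u y - c\<bar> ^ Suc m) \<partial>lborel) \<le> ennreal T" "0 \<le> T"
  shows "(\<integral>\<^sup>+y\<in>cube x (r / 4). norm (G y) ^ Suc m \<partial>lborel) \<le>
    ennreal (2 * ((2 + 4 ^ Suc m) * Y + 4 ^ Suc m * Ea + (Ce * Ca / r) ^ Suc m * X + 3 ^ Suc m * (2 * 4 ^ Suc m) ^ m * T))"
proof -
  let ?Q = "cube x r" and ?A = "annulus x r"
  let ?R = "(2 + 4 ^ Suc m) * Y + 4 ^ Suc m * Ea + (Ce * Ca / r) ^ Suc m * X + 3 ^ Suc m * (2 * 4 ^ Suc m) ^ m * T"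
  have fm[measurable]: "u \<in> borel_measurable borel" "G \<in> borel_measurable borel"
    using sc by (auto simp: sobolev_closure_def)
  have am[measurable]: "?A \<in> sets borel" using r by simp
  have AQ: "?A \<subseteq> ?Q" by (auto simp: annulus_def)
  have sub78: "cube x (7 / 8 * r) \<subseteq> ?Q"
  proof
    fix z assume z: "z \<in> cube x (7/8 * r)"
    have "\<bar>z $ k - x $ k\<bar> \<le> r" for k
    proof -
      have "\<bar>z $ k - x $ k\<bar> \<le> 7/8 * r" using z unfolding mem_cube by blast
      then show ?thesis using r by simp
    qed
    then show "z \<in> ?Q" unfolding mem_cube by blast
  qed
  have em[measurable]: "\<eta> \<in> borel_measurable borel" using Ck_measurable[OF \<eta>(1)] .
  obtain v where v: "\<And>j k. Ck k (v j)"
    "(\<lambda>j. \<integral>\<^sup>+y\<in>?Q. norm (grad (v j) y - G y) ^ Suc m \<partial>lborel) \<longlonglongrightarrow> 0"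
    "(\<lambda>j. \<integral>\<^sup>+y\<in>?Q. ennreal (V y * \<bar>v j y - u y\<bar> ^ Suc m) \<partial>lborel) \<longlonglongrightarrow> 0"
    using sobolev_closure_weighted[OF N m \<sigma> r sc Vm V0 W w0] by blast
  have vm[measurable]: "v j \<in> borel_measurable borel" for j using Ck_measurable[OF v(1)] .
  have "continuous_on UNIV (grad (v j))" for j
    using v(1)[of 1 j] by (auto simp: grad_def intro!: continuous_on_vec_lambda)
  then have gm[measurable]: "grad (v j) \<in> borel_measurable borel" for j by (intro borel_measurable_continuous_onI)
  define p1 where "p1 y = norm (G y) ^ Suc m * indicator ?Q y" for y
  define p2 where "p2 y = V y * (\<bar>u y\<bar> ^ Suc m + 1) * indicator ?Q y" for y
  define p3 where "p3 y = norm (G y) ^ Suc m * indicator ?A y" for y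
  define p4 where "p4 y = \<bar>u y - c\<bar> ^ Suc m * indicator ?A y" for y
  define p5 where "p5 y = V y * \<bar>u y - c\<bar> ^ Suc m * indicator ?Q y" for y
  have p1: "integrable lborel p1" "(\<integral>y. p1 y \<partial>lborel) \<le> E"
    unfolding p1_def using E by (intro nn_integral_le_imp_integrable; auto)+
  have p2: "integrable lborel p2" "(\<integral>y. p2 y \<partial>lborel) \<le> Y"
    unfolding p2_def using Y V0 by (intro nn_integral_le_imp_integrable; auto)+
  have p3: "integrable lborel p3" "(\<integral>y. p3 y \<partial>lborel) \<le> Ea"
    unfolding p3_def using Ea by (intro nn_integral_le_imp_integrable; auto)+
  have p4: "integrable lborel p4" "(\<integral>y. p4 y \<partial>lborel) \<le> X"
    unfolding p4_def using X by (intro nn_integral_le_imp_integrable; auto)+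
  have p5: "integrable lborel p5" "(\<integral>y. p5 y \<partial>lborel) \<le> T"
    unfolding p5_def using T V0 by (intro nn_integral_le_imp_integrable; auto)+
  define L where "L y = \<eta> y * norm (G y) ^ Suc m" for y
  have Lm[measurable]: "L \<in> borel_measurable borel" unfolding L_def by measurable
  have L0: "0 \<le> L y" for y using \<eta>(2) by (simp add: L_def)
  have Lp1: "L y \<le> p1 y" for y
  proof (cases "y \<in> ?Q")
    case True
    have "\<eta> y * norm (G y) ^ Suc m \<le> 1 * norm (G y) ^ Suc m" using \<eta>(3) by (intro mult_right_mono) auto
    then show ?thesis using True by (simp add: L_def p1_def)
  next
    case False
    then have "y \<notin> cube x (7/8 * r)" using sub78 by blast
    then show ?thesis using \<eta>(5)[of y] by (simp add: L_def p1_def)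
  qed
  have Lint: "integrable lborel L"
  proof (rule Bochner_Integration.integrable_bound[OF p1(1)])
    show "AE y in lborel. norm (L y) \<le> norm (p1 y)"
    proof (rule AE_I2)
      fix y show "norm (L y) \<le> norm (p1 y)" using L0[of y] Lp1[of y] by simp
    qed
  qed simp
  define K where "K = Ce * Ca / r + 3"
  have K0: "0 \<le> K" using C0 r by (simp add: K_def)
  \<comment> \<open>Here \<delta> bounds both approximation errors of a single v, taken far enough
    in the sequence for this \<delta>.\<close>
  have step: "1 / 2 * (\<integral>y. L y \<partial>lborel) \<le> ?R + 2 * \<tau> * 4 ^ Suc m * (E + Y) + (Ca ^ Suc m / \<tau> ^ m + K ^ Suc m / \<tau> ^ m) * \<delta>"
    if \<tau>: "0 < \<tau>" and \<delta>: "0 < \<delta>" for \<tau> \<delta>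
  proof -
    have "eventually (\<lambda>j. (\<integral>\<^sup>+y\<in>?Q. norm (grad (v j) y - G y) ^ Suc m \<partial>lborel) < ennreal \<delta> \<and>
        (\<integral>\<^sup>+y\<in>?Q. ennreal (V y * \<bar>v j y - u y\<bar> ^ Suc m) \<partial>lborel) < ennreal \<delta>) sequentially"
      using \<delta> by (intro eventually_conj order_tendstoD(2)[OF v(2)] order_tendstoD(2)[OF v(3)]) auto
    then obtain j where "(\<integral>\<^sup>+y\<in>?Q. norm (grad (v j) y - G y) ^ Suc m \<partial>lborel) < ennreal \<delta> \<and>
        (\<integral>\<^sup>+y\<in>?Q. ennreal (V y * \<bar>v j y - u y\<bar> ^ Suc m) \<partial>lborel) < ennreal \<delta>"
      unfolding eventually_sequentially by blast
    then have j: "(\<integral>\<^sup>+y\<in>?Q. norm (grad (v j) y - G y) ^ Suc m \<partial>lborel) \<le> ennreal \<delta>"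
        "(\<integral>\<^sup>+y\<in>?Q. ennreal (V y * \<bar>v j y - u y\<bar> ^ Suc m) \<partial>lborel) \<le> ennreal \<delta>"
      by (auto simp: less_imp_le simp del: power_Suc)
    define p6 where "p6 y = norm (grad (v j) y - G y) ^ Suc m * indicator ?Q y" for y
    define p7 where "p7 y = V y * \<bar>v j y - u y\<bar> ^ Suc m * indicator ?Q y" for y
    have p6: "integrable lborel p6" "(\<integral>y. p6 y \<partial>lborel) \<le> \<delta>"
      unfolding p6_def by (rule nn_integral_le_imp_integrable[where B=\<delta>]; use j(1) \<delta> in auto)+
    have p7: "integrable lborel p7" "(\<integral>y. p7 y \<partial>lborel) \<le> \<delta>"
      unfolding p7_def by (rule nn_integral_le_imp_integrable[where B=\<delta>]; use j(2) \<delta> V0 in auto)+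
    define \<phi> where "\<phi> y = \<eta> y * (v j y - c)" for y
    have ck: "Ck k \<phi>" for k unfolding \<phi>_def by (intro Ck_mult Ck_diff \<eta>(1) v(1) Ck_const)
    have gphi: "grad \<phi> y = \<eta> y *\<^sub>R grad (v j) y + (v j y - c) *\<^sub>R grad \<eta> y" for y
    proof -
      have d: "\<eta> differentiable (at y)" "v j differentiable (at y)" using \<eta>(1)[of 1] v(1)[of 1 j] by auto
      have d2: "(\<lambda>y. v j y - c) differentiable (at y)" using d by (intro differentiable_diff differentiable_const)
      have pd: "partial_deriv i (\<lambda>y. v j y - c) y = partial_deriv i (v j) y" for i
        using grad_diff[OF d(2) differentiable_const[of c]] grad_eq_0_open[of UNIV y "\<lambda>_. c" c]
        by (auto simp: vec_eq_iff)
      show ?thesis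
        unfolding \<phi>_def by (simp add: vec_eq_iff partial_deriv_mult[OF d(1) d2] pd)
    qed
    \<comment> \<open>The cutoff vanishes outside a closed cube strictly inside the one of radius r,
      hence the closure of the support stays in D.\<close>
    have sup: "closure {y. \<phi> y \<noteq> 0} \<subseteq> cube x (7 / 8 * r)"
      using \<eta>(5) by (intro closure_minimal cube_closed) (auto simp: \<phi>_def)
    then have "compact (closure {y. \<phi> y \<noteq> 0})"
      by (meson bounded_subset closed_closure compact_eq_bounded_closed cube_compact)
    then have tf: "\<phi> \<in> test_functions D" using ck sup sub78 QD by (auto simp: test_functions_def)
    define I where "I y = grad \<phi> y \<bullet> a y + \<phi> y * b y" for y
    have I: "integrable lborel I" "(\<integral>y. I y \<partial>lborel) = 0"
      using weak[OF tf] unfolding I_def[abs_def] by auto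
    define S where "S y = I y + (2 + 4 ^ Suc m) * p2 y + 4 ^ Suc m * p3 y + (Ce * Ca / r) ^ Suc m * p4 y
        + 3 ^ Suc m * (2 * 4 ^ Suc m) ^ m * p5 y + 2 * \<tau> * 4 ^ Suc m * (p1 y + p2 y)
        + Ca ^ Suc m / \<tau> ^ m * p6 y + K ^ Suc m / \<tau> ^ m * p7 y" for y
    have Sint: "integrable lborel S"
      unfolding S_def using I(1) p1(1) p2(1) p3(1) p4(1) p5(1) p6(1) p7(1) by simp
    have "AE y in lborel. 1 / 2 * L y \<le> S y"
      using struct
    proof eventually_elim
      case (elim y)
      show ?case
      proof (cases "y \<in> ?Q")
        case True
        then have yD: "y \<in> D" using QD by auto
        have e: "norm (grad \<eta> y) \<le> indicator ?A y * (Ce / r)"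
          using \<eta>(6)[of y] \<eta>(7)[of y] by (cases "y \<in> ?A") auto
        have chi: "indicator ?A y = (0::real) \<or> indicator ?A y = (1::real)" by (auto simp: indicator_def)
        have s: "norm (a y) \<le> Ca * (norm (G y) + U y * (\<bar>u y\<bar> + 1)) ^ m"
          "\<bar>b y\<bar> \<le> 3 * U y * (norm (G y) + U y * (\<bar>u y\<bar> + 1)) ^ m"
          "norm (G y) ^ Suc m - V y * \<bar>u y\<bar> ^ Suc m - V y \<le> G y \<bullet> a y"
          using elim yD by (simp_all add: Z_def)
        show ?thesis
          using energy_pointwise[OF \<eta>(2,3) U(1)[OF yD] U(2) r \<tau> C0 chi e s, where H="grad (v j) y" and v="v j y" and c=c] True
          unfolding S_def I_def gphi p1_def p2_def p3_def p4_def p5_def p6_def p7_def L_def K_def \<phi>_def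
          by (simp add: mult_ac del: power_Suc)
      next
        case False
        then have yA: "y \<notin> ?A" "y \<notin> cube x (7/8 * r)" using AQ sub78 by auto
        have "\<eta> y = 0" "grad \<eta> y = 0" using \<eta>(5)[OF yA(2)] \<eta>(7)[OF yA(1)] by auto
        then show ?thesis using False yA
          by (simp add: S_def I_def gphi L_def p1_def p2_def p3_def p4_def p5_def p6_def p7_def \<phi>_def)
      qed
    qed
    then have "(\<integral>y. 1 / 2 * L y \<partial>lborel) \<le> (\<integral>y. S y \<partial>lborel)"
      using Lint Sint by (intro integral_mono_AE) auto
    also have "\<dots> = (2 + 4 ^ Suc m) * (\<integral>y. p2 y \<partial>lborel) + 4 ^ Suc m * (\<integral>y. p3 y \<partial>lborel) + (Ce * Ca / r) ^ Suc m * (\<integral>y. p4 y \<partial>lborel)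
        + 3 ^ Suc m * (2 * 4 ^ Suc m) ^ m * (\<integral>y. p5 y \<partial>lborel) + 2 * \<tau> * 4 ^ Suc m * ((\<integral>y. p1 y \<partial>lborel) + (\<integral>y. p2 y \<partial>lborel))
        + Ca ^ Suc m / \<tau> ^ m * (\<integral>y. p6 y \<partial>lborel) + K ^ Suc m / \<tau> ^ m * (\<integral>y. p7 y \<partial>lborel)"
      unfolding S_def using I p1(1) p2(1) p3(1) p4(1) p5(1) p6(1) p7(1) by (simp del: power_Suc)
    also have "\<dots> \<le> (2 + 4 ^ Suc m) * Y + 4 ^ Suc m * Ea + (Ce * Ca / r) ^ Suc m * X
        + 3 ^ Suc m * (2 * 4 ^ Suc m) ^ m * T + 2 * \<tau> * 4 ^ Suc m * (E + Y)
        + Ca ^ Suc m / \<tau> ^ m * \<delta> + K ^ Suc m / \<tau> ^ m * \<delta>"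
      using p1(2) p2(2) p3(2) p4(2) p5(2) p6(2) p7(2) \<tau> C0 r K0
      by (intro add_mono mult_left_mono) auto
    finally show ?thesis by (simp add: distrib_right add.assoc del: power_Suc)
  qed
  have "1 / 2 * (\<integral>y. L y \<partial>lborel) \<le> ?R"
  proof (rule field_le_epsilon)
    fix \<epsilon> :: real assume \<epsilon>: "0 < \<epsilon>"
    \<comment> \<open>First \<tau> makes its own error at most \<epsilon> / 2, then \<delta> is
      chosen depending on \<tau>, as the factor \<kappa> of \<delta> grows with negative powers of
      \<tau>. The added 1 keeps the denominators positive.\<close>
    define \<tau> where "\<tau> = \<epsilon> / 2 / (2 * 4 ^ Suc m * (E + Y) + 1)"
    have den: "0 < 2 * 4 ^ Suc m * (E + Y) + 1" using E Y by (intro add_nonneg_pos) auto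
    have \<tau>: "0 < \<tau>" using \<epsilon> den by (simp add: \<tau>_def)
    have "2 * \<tau> * 4 ^ Suc m * (E + Y) = \<tau> * (2 * 4 ^ Suc m * (E + Y))" by simp
    also have "\<dots> \<le> \<tau> * (2 * 4 ^ Suc m * (E + Y) + 1)" using \<tau> by (intro mult_left_mono) auto
    also have "\<dots> = \<epsilon> / 2" unfolding \<tau>_def
    proof -
      have gen: "z / M * M = z" if "0 < M" for z M :: real using that by simp
      show "\<epsilon> / 2 / (2 * 4 ^ Suc m * (E + Y) + 1) * (2 * 4 ^ Suc m * (E + Y) + 1) = \<epsilon> / 2" by (rule gen[OF den])
    qed
    finally have s1: "2 * \<tau> * 4 ^ Suc m * (E + Y) \<le> \<epsilon> / 2" .
    define \<kappa> where "\<kappa> = Ca ^ Suc m / \<tau> ^ m + K ^ Suc m / \<tau> ^ m"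
    have \<kappa>: "0 \<le> \<kappa>" using C0 K0 \<tau> by (simp add: \<kappa>_def)
    define \<delta> where "\<delta> = \<epsilon> / 2 / (\<kappa> + 1)"
    have \<delta>: "0 < \<delta>" using \<epsilon> \<kappa> by (simp add: \<delta>_def)
    have "\<kappa> * \<delta> \<le> (\<kappa> + 1) * \<delta>" using \<delta> by (intro mult_right_mono) auto
    also have "\<dots> = \<epsilon> / 2" unfolding \<delta>_def
    proof -
      have gen: "M * (z / M) = z" if "0 < M" for z M :: real using that by simp
      show "(\<kappa> + 1) * (\<epsilon> / 2 / (\<kappa> + 1)) = \<epsilon> / 2" by (rule gen) (use \<kappa> in simp)
    qed
    finally have s2: "\<kappa> * \<delta> \<le> \<epsilon> / 2" .
    show "1 / 2 * (\<integral>y. L y \<partial>lborel) \<le> ?R + \<epsilon>"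
      using step[OF \<tau> \<delta>] s1 s2 unfolding \<kappa>_def by linarith
  qed
  moreover have "1 / 2 * p \<le> q \<Longrightarrow> p \<le> 2 * q" for p q :: real by simp
  ultimately have fin: "(\<integral>y. L y \<partial>lborel) \<le> 2 * ?R" by blast
  have "(\<integral>\<^sup>+y\<in>cube x (r / 4). norm (G y) ^ Suc m \<partial>lborel) \<le> (\<integral>\<^sup>+y. L y \<partial>lborel)"
    using \<eta>(4) by (intro nn_integral_mono) (auto simp: indicator_def L_def)
  also have "\<dots> = ennreal (\<integral>y. L y \<partial>lborel)" using L0 by (intro nn_integral_eq_integral Lint) auto
  also have "\<dots> \<le> ennreal (2 * ?R)" by (rule ennreal_leI[OF fin])
  finally show ?thesis .
qed

section \<open>Absorption along dyadic scales\<close>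

text \<open>\<open>nn_integral_Holder\<close> for counting measure on the first n indices, with d /
  \<mu> as the function and \<mu> as the density.\<close>

lemma sum_Holder:
  fixes d \<mu> :: "nat \<Rightarrow> real"
  assumes "\<And>i. 0 \<le> d i" "\<And>i. 0 < \<mu> i" "(\<Sum>i<n. \<mu> i) \<le> J" "0 < J"
  shows "(\<Sum>i<n. d i) ^ Suc m \<le> 2 ^ Suc m * J ^ m * (\<Sum>i<n. d i ^ Suc m * (1 / \<mu> i) ^ m)"
proof -
  let ?M = "count_space {..<n}"
  have int: "(\<integral>\<^sup>+i. ennreal (f i) \<partial>?M) = ennreal (\<Sum>i<n. f i)" if "\<And>i. 0 \<le> f i" for f :: "nat \<Rightarrow> real"
    using that by (simp add: nn_integral_count_space_finite)
  have mu: "0 \<le> \<mu> i" for i using assms(2)[of i] by simp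
  have "(\<integral>\<^sup>+i. ennreal (d i / \<mu> i * \<mu> i) \<partial>?M) ^ Suc m \<le> ennreal (2 ^ Suc m * J ^ m) * (\<integral>\<^sup>+i. ennreal ((d i / \<mu> i) ^ Suc m * \<mu> i) \<partial>?M)"
    using assms(1,4) mu int[OF mu] assms(3) by (intro nn_integral_Holder) (auto intro!: divide_nonneg_nonneg ennreal_leI)
  moreover have "(d i / \<mu> i) ^ Suc m * \<mu> i = d i ^ Suc m * (1 / \<mu> i) ^ m" for i
    using assms(2)[of i] by (simp add: field_simps)
  moreover have "d i / \<mu> i * \<mu> i = d i" for i using assms(2)[of i] by simp
  ultimately have "ennreal (\<Sum>i<n. d i) ^ Suc m \<le> ennreal (2 ^ Suc m * J ^ m) * ennreal (\<Sum>i<n. d i ^ Suc m * (1 / \<mu> i) ^ m)"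
    using int[of d] int[of "\<lambda>i. d i ^ Suc m * (1 / \<mu> i) ^ m"] assms(1) mu by (simp del: power_Suc)
  then have "ennreal ((\<Sum>i<n. d i) ^ Suc m) \<le> ennreal (2 ^ Suc m * J ^ m * (\<Sum>i<n. d i ^ Suc m * (1 / \<mu> i) ^ m))"
    using assms mu by (subst (asm) ennreal_power, simp add: sum_nonneg) (subst ennreal_mult, auto simp: sum_nonneg)
  then show ?thesis
    using assms mu by (subst (asm) ennreal_le_iff) (auto intro!: mult_nonneg_nonneg sum_nonneg)
qed

lemma powr_diff_le:
  fixes a :: real
  assumes "1 \<le> \<sigma>" "0 < a"
  shows "(a + 1) powr \<sigma> - a powr \<sigma> \<le> \<sigma> * (a + 1) powr (\<sigma> - 1)"
proof -
  have "\<exists>z. a < z \<and> z < a + 1 \<and> (a + 1) powr \<sigma> - a powr \<sigma> = (a + 1 - a) * (\<sigma> * z powr (\<sigma> - 1))"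
    using assms by (intro MVT2) (auto intro!: derivative_eq_intros)
  then obtain z where z: "a < z" "z < a + 1" "(a + 1) powr \<sigma> - a powr \<sigma> = \<sigma> * z powr (\<sigma> - 1)" by auto
  have "z powr (\<sigma> - 1) \<le> (a + 1) powr (\<sigma> - 1)" using z assms by (intro powr_mono2) auto
  then show ?thesis using z(3) assms by (simp add: mult_left_mono)
qed

text \<open>Summation by parts: the increments of \<open>k powr \<sigma>\<close> are at most
  \<sigma> times \<open>k powr (\<sigma> - 1)\<close> at the upper end, so energy losses weighted
  with exponent \<sigma> are controlled by energies weighted with exponent \<sigma> - 1.\<close>

lemma abel_weighted:
  fixes E :: "nat \<Rightarrow> real"
  assumes "\<And>k. 0 \<le> E k" "1 \<le> \<sigma>" "0 < k0"
  shows "(\<Sum>k<n. (E k - E (Suc k)) * real (k + k0) powr \<sigma>) + E n * real (n + k0) powr \<sigma>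
    \<le> E 0 * real k0 powr \<sigma> + \<sigma> * (\<Sum>k\<le>n. real (k + k0) powr (\<sigma> - 1) * E k)"
proof (induction n)
  case 0
  then show ?case using assms by simp
next
  case (Suc n)
  let ?q = "\<lambda>k. real (k + k0)"
  have "?q (Suc n) powr \<sigma> - ?q n powr \<sigma> \<le> \<sigma> * ?q (Suc n) powr (\<sigma> - 1)"
    using powr_diff_le[of \<sigma> "?q n"] assms by (simp add: add_ac)
  from mult_left_mono[OF this assms(1)[of "Suc n"]]
  have "E (Suc n) * (?q (Suc n) powr \<sigma> - ?q n powr \<sigma>) \<le> \<sigma> * (?q (Suc n) powr (\<sigma> - 1) * E (Suc n))"
    by (simp add: mult_ac)
  then show ?case using Suc by (simp add: algebra_simps del: of_nat_add of_nat_Suc add_Suc)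
qed

text \<open>\<open>E k\<close>, \<open>c k\<close> and \<open>v k\<close> stand for the energy, the mean over the annulus and the mass of the coefficients at scale
  \<open>2\<^sup>-\<^sup>(\<^sup>k\<^sup>+\<^sup>k\<^sup>0\<^sup>)\<close>. Both \<open>k1\<close> and \<open>M\<close> are independent of these sequences, hence later of the centre of the cubes.\<close>

lemma discrete_absorption:
  fixes \<theta> B P \<sigma> :: real
  assumes \<theta>: "0 < \<theta>" "\<theta> < 1" and B: "0 \<le> B" and P: "0 \<le> P" and m: "0 < m" and \<sigma>: "real m < \<sigma>"
  shows "\<exists>k1>0. \<forall>k0\<ge>k1. \<forall>Es cs. \<exists>M. \<forall>E c v.
    (\<forall>k. 0 \<le> E k) \<and> (\<forall>k. E (Suc k) \<le> E k) \<and> E 0 \<le> Es \<and> \<bar>c 0\<bar> \<le> cs \<and> (\<forall>k. 0 \<le> v k) \<and>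
    (\<forall>k. E (k + 2) \<le> \<theta> * E k + (1 + \<bar>c k\<bar> ^ Suc m) * v k) \<and>
    (\<forall>k. \<bar>c k - c (Suc k)\<bar> ^ Suc m \<le> B * (E k - E (k + 2) + (E (k + 1) - E (k + 3)))) \<and>
    (\<forall>n. (\<Sum>k\<le>n. real (k + k0) powr (\<sigma> - 1) * v k) \<le> P) \<longrightarrow>
    (\<forall>n. (\<Sum>k<n. (E k - E (Suc k)) * real (k + k0) powr \<sigma>) \<le> M)"
proof -
  have \<sigma>1: "1 < \<sigma>" using m \<sigma> by linarith
  define \<kappa> where "\<kappa> = \<sigma> / real m"
  have \<kappa>: "1 < \<kappa>" using m \<sigma> by (simp add: \<kappa>_def)
  \<comment> \<open>Halfway between \<theta> and 1, to leave room for the ratio of the weights two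
    scales apart, which exceeds 1 but tends to 1 for large \<open>k0\<close>.\<close>
  define \<theta>1 where "\<theta>1 = (1 + \<theta>) / 2"
  have \<theta>1: "0 < 1 - \<theta>1" "\<theta> < \<theta>1" "0 < \<theta>1" using \<theta> by (auto simp: \<theta>1_def)
  \<comment> \<open>The factor of the power of the means in the bound \<open>S_rec\<close>
    below.\<close>
  define A where "A = 2 * P / (1 - \<theta>1)"
  have A: "0 \<le> A" using P \<theta>1 by (simp add: A_def)
  define H where "H = A * (4 ^ Suc m * (4 * B * \<sigma>))"
  have H: "0 \<le> H" using A B \<sigma>1 by (simp add: H_def)
  \<comment> \<open>\<open>H\<close> is the feedback coefficient by which the weighted sum
    \<open>S\<close> reappears in its own bound through the means. The size \<open>j0\<close> of the
    tail below makes \<open>H * j0\<close> at most 1/2, so that S can be absorbed.\<close>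
  define j0 where "j0 = min 1 (1 / (2 * H + 1))"
  have j0: "0 < j0" "j0 \<le> 1" "H * j0 \<le> 1 / 2"
  proof -
    show "0 < j0" "j0 \<le> 1" using H by (auto simp: j0_def)
    have "H * j0 \<le> H * (1 / (2 * H + 1))" using H by (intro mult_left_mono) (auto simp: j0_def)
    also have "\<dots> \<le> 1 / 2" using H by (simp add: field_simps)
    finally show "H * j0 \<le> 1 / 2" .
  qed
  have sm: "summable (\<lambda>i. real i powr (- \<kappa>))" using \<kappa> by (subst summable_real_powr_iff) simp
  from suminf_exist_split[OF j0(1) this] obtain ka where ka: "\<And>k. ka \<le> k \<Longrightarrow> norm (\<Sum>i. real (i + k) powr (- \<kappa>)) < j0" by blast
  have "((\<lambda>k. (1 + 2 / real k) powr (\<sigma> - 1)) \<longlongrightarrow> (1 + 0) powr (\<sigma> - 1)) sequentially"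
    by (intro tendsto_intros tendsto_divide_0[OF tendsto_const] filterlim_at_top_imp_at_infinity filterlim_real_sequentially) auto
  then have tl: "(\<lambda>k. (1 + 2 / real k) powr (\<sigma> - 1)) \<longlonglongrightarrow> 1" by simp
  have "eventually (\<lambda>k. (1 + 2 / real k) powr (\<sigma> - 1) < min 2 (\<theta>1 / \<theta>)) sequentially"
    using \<theta> \<theta>1 by (intro order_tendstoD(2)[OF tl]) auto
  then obtain kb where kb: "\<And>k. kb \<le> k \<Longrightarrow> (1 + 2 / real k) powr (\<sigma> - 1) < min 2 (\<theta>1 / \<theta>)"
    by (auto simp: eventually_sequentially)
  define k1 where "k1 = Suc (max ka kb)"
  have "\<exists>M. \<forall>E c v.
    (\<forall>k. 0 \<le> E k) \<and> (\<forall>k. E (Suc k) \<le> E k) \<and> E 0 \<le> Es \<and> \<bar>c 0\<bar> \<le> cs \<and> (\<forall>k. 0 \<le> v k) \<and>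
    (\<forall>k. E (k + 2) \<le> \<theta> * E k + (1 + \<bar>c k\<bar> ^ Suc m) * v k) \<and>
    (\<forall>k. \<bar>c k - c (Suc k)\<bar> ^ Suc m \<le> B * (E k - E (k + 2) + (E (k + 1) - E (k + 3)))) \<and>
    (\<forall>n. (\<Sum>k\<le>n. real (k + k0) powr (\<sigma> - 1) * v k) \<le> P) \<longrightarrow>
    (\<forall>n. (\<Sum>k<n. (E k - E (Suc k)) * real (k + k0) powr \<sigma>) \<le> M)" if k0: "k1 \<le> k0" for k0 Es cs
  proof -
    let ?q = "\<lambda>k. real (k + k0)"
    have k00: "0 < k0" "ka \<le> k0" "kb \<le> k0" using k0 by (auto simp: k1_def)
    have q0: "0 < ?q k" for k using k00 by simp
    define a where "a = (2 * ?q 1 powr (\<sigma> - 1) * Es + 2 * P) / (1 - \<theta>1)"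
    define M where "M = Es * real k0 powr \<sigma> + \<sigma> * (2 * (a + A * (2 ^ Suc m * cs ^ Suc m) + A * (4 ^ Suc m * (4 * B * (Es * real k0 powr \<sigma>)))))"
    have "(\<Sum>k<n. (E k - E (Suc k)) * real (k + k0) powr \<sigma>) \<le> M"
      if E0: "\<And>k. 0 \<le> E k" and dec: "\<And>k. E (Suc k) \<le> E k" and Es: "E 0 \<le> Es" and cs: "\<bar>c 0\<bar> \<le> cs" and v0: "\<And>k. 0 \<le> v k"
       and hole: "\<And>k. E (k + 2) \<le> \<theta> * E k + (1 + \<bar>c k\<bar> ^ Suc m) * v k"
       and chain: "\<And>k. \<bar>c k - c (Suc k)\<bar> ^ Suc m \<le> B * (E k - E (k + 2) + (E (k + 1) - E (k + 3)))"
       and vP: "\<And>n. (\<Sum>k\<le>n. real (k + k0) powr (\<sigma> - 1) * v k) \<le> P"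
      for E c v n
    proof -
      \<comment> \<open>\<open>S\<close> carries the energies with exponent \<sigma> - 1 and is the
        quantity to be bounded; \<open>D\<close> carries the energy losses with exponent \<sigma>
        and is the quantity of the conclusion.\<close>
      define S where "S n = (\<Sum>k\<le>n. ?q k powr (\<sigma> - 1) * E k)" for n
      define D where "D n = (\<Sum>k<n. (E k - E (Suc k)) * ?q k powr \<sigma>)" for n
      have cs0: "0 \<le> cs" and Es0: "0 \<le> Es" using cs Es E0[of 0] by auto
      have DS: "D n \<le> Es * real k0 powr \<sigma> + \<sigma> * S n" for n
      proof -
        have "D n + E n * ?q n powr \<sigma> \<le> E 0 * real k0 powr \<sigma> + \<sigma> * S n"
          unfolding D_def S_def using abel_weighted[where E=E and \<sigma>=\<sigma> and n=n, OF E0 _ k00(1)] \<sigma>1 by simp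
        moreover have "0 \<le> E n * ?q n powr \<sigma>" using E0 by simp
        moreover have "E 0 * real k0 powr \<sigma> \<le> Es * real k0 powr \<sigma>" using Es by (intro mult_right_mono) auto
        ultimately show ?thesis by linarith
      qed
      have qq: "?q (k + 2) powr (\<sigma> - 1) \<le> (1 + 2 / real k0) powr (\<sigma> - 1) * ?q k powr (\<sigma> - 1)" for k
      proof -
        have "?q (k + 2) \<le> (1 + 2 / real k0) * ?q k" using k00(1) by (simp add: field_simps)
        then have "?q (k + 2) powr (\<sigma> - 1) \<le> ((1 + 2 / real k0) * ?q k) powr (\<sigma> - 1)" using \<sigma>1 by (intro powr_mono2) auto
        then show ?thesis by (simp add: powr_mult)
      qed
      \<comment> \<open>Multiply the hole-filling inequality by the weight at index k + 2 and sum.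
        The energies return with factor \<theta>1 < 1 and, being a finite sum, can be moved to the
        left; the sources contribute at most a multiple of P as long as the means are bounded by
        \<open>C\<close>.\<close>
      have S_rec: "S (n + 2) \<le> a + A * C ^ Suc m" if C: "\<And>k. k \<le> n \<Longrightarrow> \<bar>c k\<bar> \<le> C" for n C
      proof -
        have C0: "0 \<le> C" using C[of 0] by linarith
        have S_split: "S (n + 2) = ?q 0 powr (\<sigma> - 1) * E 0 + ?q 1 powr (\<sigma> - 1) * E 1 + (\<Sum>k\<le>n. ?q (k + 2) powr (\<sigma> - 1) * E (k + 2))"
        proof -
          have "(\<Sum>k\<le>n + 2. f k) = f 0 + f 1 + (\<Sum>k\<le>n. f (k + 2))" for f :: "nat \<Rightarrow> real"
            by (induction n) (simp_all add: numeral_2_eq_2)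
          from this[of "\<lambda>k. ?q k powr (\<sigma> - 1) * E k"] show ?thesis unfolding S_def .
        qed
        have b1: "?q 0 powr (\<sigma> - 1) * E 0 \<le> ?q 1 powr (\<sigma> - 1) * Es"
          using Es E0 \<sigma>1 by (intro mult_mono powr_mono2) auto
        have "E 1 \<le> Es" using dec[of 0] Es by simp
        then have b2: "?q 1 powr (\<sigma> - 1) * E 1 \<le> ?q 1 powr (\<sigma> - 1) * Es" by (intro mult_left_mono) auto
        have b3: "?q (k + 2) powr (\<sigma> - 1) * E (k + 2) \<le> \<theta>1 * (?q k powr (\<sigma> - 1) * E k) + 2 * (1 + C ^ Suc m) * (?q k powr (\<sigma> - 1) * v k)" if "k \<le> n" for k
        proof -
          let ?f = "(1 + 2 / real k0) powr (\<sigma> - 1)"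
          let ?p = "?q k powr (\<sigma> - 1)"
          have f: "?f \<le> 2" "?f * \<theta> \<le> \<theta>1" using kb[OF k00(3)] \<theta> by (auto simp: field_simps)
          have "\<bar>c k\<bar> ^ Suc m \<le> C ^ Suc m" using C[OF that] by (intro power_mono) auto
          then have "(1 + \<bar>c k\<bar> ^ Suc m) * v k \<le> (1 + C ^ Suc m) * v k" using v0 by (intro mult_right_mono) auto
          then have "E (k + 2) \<le> \<theta> * E k + (1 + C ^ Suc m) * v k" using hole[of k] by linarith
          then have "?q (k + 2) powr (\<sigma> - 1) * E (k + 2) \<le> (?f * ?p) * (\<theta> * E k + (1 + C ^ Suc m) * v k)"
            using qq[of k] E0 by (intro mult_mono) auto
          also have "\<dots> = (?f * \<theta>) * (?p * E k) + ?f * ((1 + C ^ Suc m) * (?p * v k))" by (simp add: algebra_simps)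
          also have "\<dots> \<le> \<theta>1 * (?p * E k) + 2 * ((1 + C ^ Suc m) * (?p * v k))"
            using f E0 v0 C0 by (intro add_mono mult_right_mono mult_nonneg_nonneg) auto
          finally show ?thesis by (simp only: mult_ac)
        qed
        have "(\<Sum>k\<le>n. ?q (k + 2) powr (\<sigma> - 1) * E (k + 2)) \<le> (\<Sum>k\<le>n. \<theta>1 * (?q k powr (\<sigma> - 1) * E k) + 2 * (1 + C ^ Suc m) * (?q k powr (\<sigma> - 1) * v k))"
          by (intro sum_mono b3) auto
        also have "\<dots> = \<theta>1 * S n + 2 * (1 + C ^ Suc m) * (\<Sum>k\<le>n. ?q k powr (\<sigma> - 1) * v k)"
          by (simp add: sum.distrib sum_distrib_left S_def del: power_Suc)
        also have "\<dots> \<le> \<theta>1 * S (n + 2) + 2 * (1 + C ^ Suc m) * P"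
        proof (intro add_mono mult_left_mono vP)
          show "S n \<le> S (n + 2)" unfolding S_def using E0 by (intro sum_mono2) auto
        qed (use \<theta>1 C0 in auto)
        finally have "S (n + 2) \<le> 2 * ?q 1 powr (\<sigma> - 1) * Es + \<theta>1 * S (n + 2) + 2 * (1 + C ^ Suc m) * P"
          using S_split b1 b2 by linarith
        then have "(1 - \<theta>1) * S (n + 2) \<le> 2 * ?q 1 powr (\<sigma> - 1) * Es + 2 * P + 2 * P * C ^ Suc m"
          by (simp add: algebra_simps)
        then have "S (n + 2) \<le> (2 * ?q 1 powr (\<sigma> - 1) * Es + 2 * P + 2 * P * C ^ Suc m) / (1 - \<theta>1)"
          using \<theta>1(1) by (simp add: pos_le_divide_eq mult.commute)
        also have "\<dots> = a + A * C ^ Suc m" by (simp add: a_def A_def add_divide_distrib)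
        finally show ?thesis .
      qed
      \<comment> \<open>A nondecreasing majorant of the means up to index n: the initial bound plus
        the total drift.\<close>
      define C where "C n = cs + (\<Sum>i<n. \<bar>c i - c (Suc i)\<bar>)" for n
      have cC: "\<bar>c k\<bar> \<le> C k" for k
      proof (induction k)
        case 0 then show ?case using cs by (simp add: C_def)
      next
        case (Suc k)
        have "\<bar>c (Suc k)\<bar> \<le> \<bar>c k\<bar> + \<bar>c k - c (Suc k)\<bar>" by linarith
        then show ?case using Suc by (simp add: C_def)
      qed
      have Cmono: "C k \<le> C n" if "k \<le> n" for k n
        unfolding C_def using that by (intro add_left_mono sum_mono2) auto
      \<comment> \<open>Hoelder with density \<open>k powr (- \<kappa>)\<close>, \<kappa> = \<sigma>
        / m, converts the total drift into the drifts weighted with exponent \<sigma>, hence into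
        \<open>D\<close> and by Abel summation into \<open>S\<close>; the prefactor is the small
        tail.\<close>
      have Cpow: "C n ^ Suc m \<le> 2 ^ Suc m * cs ^ Suc m + 4 ^ Suc m * (j0 * (4 * B * (Es * real k0 powr \<sigma> + \<sigma> * S (n + 2))))" for n
      proof -
        let ?\<mu> = "\<lambda>i. ?q i powr (- \<kappa>)"
        have sk: "summable (\<lambda>i. ?q i powr (- \<kappa>))" using sm by (subst summable_iff_shift)
        have "(\<Sum>i<n. ?\<mu> i) \<le> (\<Sum>i. ?\<mu> i)" by (intro sum_le_suminf sk) auto
        also have "\<dots> \<le> j0" using ka[OF k00(2)] by simp
        finally have J: "(\<Sum>i<n. ?\<mu> i) \<le> j0" .
        have w: "(1 / ?\<mu> i) ^ m = ?q i powr \<sigma>" for i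
        proof -
          have "1 / ?\<mu> i = ?q i powr \<kappa>" by (simp add: powr_minus_divide)
          moreover have "(?q i powr \<kappa>) ^ m = ?q i powr \<sigma>" using q0[of i] m
            by (subst powr_realpow[symmetric]) (auto simp: powr_powr \<kappa>_def)
          ultimately show ?thesis by simp
        qed
        have "(\<Sum>i<n. \<bar>c i - c (Suc i)\<bar>) ^ Suc m \<le> 2 ^ Suc m * j0 ^ m * (\<Sum>i<n. \<bar>c i - c (Suc i)\<bar> ^ Suc m * (1 / ?\<mu> i) ^ m)"
          using q0 J j0 by (intro sum_Holder) (auto simp: less_imp_neq[THEN not_sym])
        also have "\<dots> \<le> 2 ^ Suc m * j0 * (B * (4 * D (n + 2)))"
        proof (rule mult_mono)
          \<comment> \<open>The power of the tail is reduced to the first power, using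
            \<open>j0\<close> \<le> 1 and m \<ge> 1.\<close>
          show "2 ^ Suc m * j0 ^ m \<le> 2 ^ Suc m * j0"
            using j0 m power_decreasing[of 1 m j0] by simp
          have "(\<Sum>i<n. \<bar>c i - c (Suc i)\<bar> ^ Suc m * (1 / ?\<mu> i) ^ m) \<le>
            (\<Sum>i<n. B * ((E i - E (Suc i)) * ?q i powr \<sigma>) + B * (2 * ((E (i+1) - E (Suc (i+1))) * ?q (i+1) powr \<sigma>)) + B * ((E (i+2) - E (Suc (i+2))) * ?q (i+2) powr \<sigma>))"
          proof (rule sum_mono)
            fix i
            let ?d = "\<lambda>i. E i - E (Suc i)"
            have d0: "0 \<le> ?d i" for i using dec by simp
            \<comment> \<open>The two annuli together span three dyadic steps, the middle one
              counted twice; this gives the factor 4 in front of \<open>D (n + 2)\<close>, and the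
              shift by 2 keeps all terms inside that sum.\<close>
            have e1: "E i - E (i + 2) + (E (i + 1) - E (i + 3)) = ?d i + 2 * ?d (i+1) + ?d (i+2)"
              by (simp add: numeral_2_eq_2 numeral_3_eq_3)
            have "\<bar>c i - c (Suc i)\<bar> ^ Suc m * ?q i powr \<sigma> \<le> (B * (?d i + 2 * ?d (i+1) + ?d (i+2))) * ?q i powr \<sigma>"
              using chain[of i] unfolding e1 by (intro mult_right_mono) auto
            also have "\<dots> = B * (?d i * ?q i powr \<sigma>) + B * (2 * (?d (i+1) * ?q i powr \<sigma>)) + B * (?d (i+2) * ?q i powr \<sigma>)"
              by (simp add: algebra_simps)
            also have "\<dots> \<le> B * (?d i * ?q i powr \<sigma>) + B * (2 * (?d (i+1) * ?q (i+1) powr \<sigma>)) + B * (?d (i+2) * ?q (i+2) powr \<sigma>)"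
              using B d0 \<sigma>1 by (intro add_mono mult_left_mono powr_mono2 order_refl) auto
            finally show "\<bar>c i - c (Suc i)\<bar> ^ Suc m * (1 / ?\<mu> i) ^ m \<le> B * (?d i * ?q i powr \<sigma>) + B * (2 * (?d (i+1) * ?q (i+1) powr \<sigma>)) + B * (?d (i+2) * ?q (i+2) powr \<sigma>)"
              unfolding w .
          qed
          also have "\<dots> = B * ((\<Sum>i<n. (E i - E (Suc i)) * ?q i powr \<sigma>) + 2 * (\<Sum>i<n. (E (i+1) - E (Suc (i+1))) * ?q (i+1) powr \<sigma>) + (\<Sum>i<n. (E (i+2) - E (Suc (i+2))) * ?q (i+2) powr \<sigma>))"
            by (simp add: sum.distrib sum_distrib_left distrib_left mult_ac)
          also have "\<dots> \<le> B * (D (n + 2) + 2 * D (n + 2) + D (n + 2))"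
          proof -
            define h where "h i = (E i - E (Suc i)) * ?q i powr \<sigma>" for i
            have h0: "0 \<le> h i" for i using dec by (simp add: h_def)
            have sh: "(\<Sum>i<n. h (i + j)) \<le> (\<Sum>i<n + 2. h i)" if "j \<le> 2" for j
            proof -
              have "(\<Sum>i<n. h (i + j)) = (\<Sum>i\<in>{j..<n + j}. h i)"
                using sum.shift_bounds_nat_ivl[of h 0 j n] by (simp add: lessThan_atLeast0)
              also have "\<dots> \<le> (\<Sum>i<n + 2. h i)" using that h0 by (intro sum_mono2) auto
              finally show ?thesis .
            qed
            show ?thesis using sh[of 0] sh[of 1] sh[of 2] B unfolding D_def h_def[symmetric]
              by (intro mult_left_mono add_mono) auto
          qed
          finally show "(\<Sum>i<n. \<bar>c i - c (Suc i)\<bar> ^ Suc m * (1 / ?\<mu> i) ^ m) \<le> B * (4 * D (n + 2))" by simp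
        qed (use j0 in \<open>auto intro!: sum_nonneg mult_nonneg_nonneg\<close>)
        also have "\<dots> \<le> 2 ^ Suc m * j0 * (B * (4 * (Es * real k0 powr \<sigma> + \<sigma> * S (n + 2))))"
          using DS[of "n + 2"] B j0 by (intro mult_left_mono) auto
        finally have sb: "(\<Sum>i<n. \<bar>c i - c (Suc i)\<bar>) ^ Suc m \<le> 2 ^ Suc m * (j0 * (4 * B * (Es * real k0 powr \<sigma> + \<sigma> * S (n + 2))))"
          by (simp add: mult_ac)
        have "C n ^ Suc m \<le> 2 ^ Suc m * (cs ^ Suc m + (\<Sum>i<n. \<bar>c i - c (Suc i)\<bar>) ^ Suc m)"
          unfolding C_def using cs0 by (intro power_add_le sum_nonneg) auto
        also have "\<dots> \<le> 2 ^ Suc m * (cs ^ Suc m + 2 ^ Suc m * (j0 * (4 * B * (Es * real k0 powr \<sigma> + \<sigma> * S (n + 2)))))"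
          by (intro mult_left_mono add_left_mono sb) auto
        also have "\<dots> = 2 ^ Suc m * cs ^ Suc m + (2 ^ Suc m * 2 ^ Suc m) * (j0 * (4 * B * (Es * real k0 powr \<sigma> + \<sigma> * S (n + 2))))"
          by (simp only: distrib_left mult.assoc)
        also have "(2::real) ^ Suc m * 2 ^ Suc m = 4 ^ Suc m" by (simp flip: power_mult_distrib)
        finally show ?thesis .
      qed
      \<comment> \<open>Inserting the bound for the means into \<open>S_rec\<close> makes S appear
        on both sides with coefficient at most 1/2 on the right, independently of n.\<close>
      have Sb: "S (n + 2) \<le> 2 * (a + A * (2 ^ Suc m * cs ^ Suc m) + A * (4 ^ Suc m * (4 * B * (Es * real k0 powr \<sigma>))))" for n
      proof -
        have S0: "0 \<le> S k" for k unfolding S_def using E0 by (intro sum_nonneg) auto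
        have "S (n + 2) \<le> a + A * C n ^ Suc m"
          by (rule S_rec) (use cC Cmono order_trans in blast)
        also have "\<dots> \<le> a + A * (2 ^ Suc m * cs ^ Suc m + 4 ^ Suc m * (j0 * (4 * B * (Es * real k0 powr \<sigma> + \<sigma> * S (n + 2)))))"
          using A Cpow[of n] by (intro add_left_mono mult_left_mono) auto
        also have "\<dots> = a + A * (2 ^ Suc m * cs ^ Suc m) + j0 * (A * (4 ^ Suc m * (4 * B * (Es * real k0 powr \<sigma>)))) + (H * j0) * S (n + 2)"
          by (simp add: H_def algebra_simps)
        also have "\<dots> \<le> a + A * (2 ^ Suc m * cs ^ Suc m) + 1 * (A * (4 ^ Suc m * (4 * B * (Es * real k0 powr \<sigma>)))) + 1 / 2 * S (n + 2)"
          using j0 S0 A B Es0 by (intro add_mono mult_right_mono order_refl mult_nonneg_nonneg) auto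
        finally show ?thesis by simp
      qed
      have "D n \<le> D (n + 2)" unfolding D_def using dec by (intro sum_mono2) auto
      also have "\<dots> \<le> Es * real k0 powr \<sigma> + \<sigma> * S (n + 2)" by (rule DS)
      also have "\<dots> \<le> M" unfolding M_def using Sb[of n] \<sigma>1 by (intro add_left_mono mult_left_mono) auto
      finally show ?thesis by (simp add: D_def)
    qed
    note main = this
    show ?thesis
      by (rule exI[of _ M], intro allI impI, elim conjE, rule main; (rule spec, assumption | blast | assumption))
  qed
  then show ?thesis by (intro exI[of _ k1]) (simp add: k1_def)
qed

section \<open>Logarithmic modulus off a null set\<close>

text \<open>The closed annulus and the closed inner cube overlap only in the boundary of the inner
  cube, a null set.\<close>

lemma cube_annulus_split:
  fixes h :: "real^'n::finite \<Rightarrow> ennreal"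
  assumes [measurable]: "h \<in> borel_measurable borel" and r: "0 < r"
  shows "(\<integral>\<^sup>+y\<in>cube x r. h y \<partial>lborel) = (\<integral>\<^sup>+y\<in>annulus x r. h y \<partial>lborel) + (\<integral>\<^sup>+y\<in>cube x (r / 4). h y \<partial>lborel)"
proof -
  let ?lo = "\<chi> k. x $ k - r / 4" and ?hi = "\<chi> k. x $ k + r / 4"
  have am[measurable]: "annulus x r \<in> sets borel" using r by simp
  have "cbox ?lo ?hi - box ?lo ?hi \<in> null_sets lebesgue"
    using negligible_frontier_interval[of ?lo ?hi] by (simp add: negligible_iff_null_sets)
  then have "cbox ?lo ?hi - box ?lo ?hi \<in> null_sets lborel"
    by (subst (asm) null_sets_completion_iff) auto
  then have "AE y in lborel. y \<notin> cbox ?lo ?hi - box ?lo ?hi" by (rule AE_not_in)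
  then have "AE y in lborel. h y * indicator (cube x r) y = h y * indicator (annulus x r) y + h y * indicator (cube x (r / 4)) y"
  proof eventually_elim
    case (elim y)
    have sub: "y \<in> cube x r" if "y \<in> cube x (r / 4)"
      unfolding mem_cube
    proof
      fix k
      have "\<bar>y $ k - x $ k\<bar> \<le> r / 4" using that unfolding mem_cube by blast
      then show "\<bar>y $ k - x $ k\<bar> \<le> r" using r by linarith
    qed
    have disj: "y \<notin> annulus x r" if y: "y \<in> cube x (r / 4)"
    proof -
      have "y \<in> cbox ?lo ?hi" using y by (simp add: cube_def bx_eq_cbox)
      then have "y \<in> box ?lo ?hi" using elim by blast
      then have "x $ k - r / 4 < y $ k \<and> y $ k < x $ k + r / 4" for k by (simp add: mem_box_cart)
      then have "\<bar>y $ k - x $ k\<bar> < r / 4" for k by (smt (verit))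
      then show ?thesis unfolding annulus_def mem_Collect_eq by (meson not_le)
    qed
    have cov: "y \<in> annulus x r" if "y \<in> cube x r" "y \<notin> cube x (r / 4)"
      using that by (auto simp: annulus_def mem_cube not_le intro: less_imp_le)
    have sub2: "y \<in> cube x r" if "y \<in> annulus x r" using that by (simp add: annulus_def)
    show ?case using sub disj cov sub2
      by (cases "y \<in> cube x (r / 4)"; cases "y \<in> annulus x r"; cases "y \<in> cube x r") auto
  qed
  then have "(\<integral>\<^sup>+y\<in>cube x r. h y \<partial>lborel) = (\<integral>\<^sup>+y. h y * indicator (annulus x r) y + h y * indicator (cube x (r / 4)) y \<partial>lborel)"
    by (rule nn_integral_cong_AE)
  also have "\<dots> = (\<integral>\<^sup>+y\<in>annulus x r. h y \<partial>lborel) + (\<integral>\<^sup>+y\<in>cube x (r / 4). h y \<partial>lborel)"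
    by (rule nn_integral_add) auto
  finally show ?thesis .
qed

section \<open>Dyadic cubes against the logarithmic weight\<close>

lemma cube_mono: "r \<le> r' \<Longrightarrow> cube x r \<subseteq> cube x r'"
  unfolding subset_iff mem_cube by (meson order_trans)

text \<open>If K is the last scale whose cube contains y, the sum has at most K + 1 terms, each at
  most the K-th weight, and |y - x| is at most a dimensional multiple of the size of that cube.
  Integrated against V, this makes the masses of the cubes summable with weight
  \<open>k powr (\<sigma> - 1)\<close>.\<close>

lemma dyadic_log_lower:
  fixes x y :: "real^'n::finite"
  assumes \<sigma>: "1 \<le> \<sigma>" and k0: "0 < k0" and "y \<noteq> x"
  shows "(\<Sum>k\<le>n. real (k + k0) powr (\<sigma> - 1) * indicator (cube x (1 / 2 ^ (k + k0))) y)
    \<le> ((1 + ln (real CARD('n))) / ln 2) powr \<sigma> * logw \<sigma> (norm (y - x))"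
proof (cases "{k. k \<le> n \<and> y \<in> cube x (1 / 2 ^ (k + k0))} = {}")
  case True
  then have "(\<Sum>k\<le>n. real (k + k0) powr (\<sigma> - 1) * indicator (cube x (1 / 2 ^ (k + k0))) y) = 0"
    by (intro sum.neutral) auto
  then show ?thesis by (simp add: logw_nonneg)
next
  case False
  let ?A = "{k. k \<le> n \<and> y \<in> cube x (1 / 2 ^ (k + k0))}"
  define K where "K = Max ?A"
  have fin: "finite ?A" by simp
  have KA: "K \<in> ?A" unfolding K_def by (rule Max_in[OF fin False])
  have Kmax: "k \<le> K" if "k \<in> ?A" for k unfolding K_def by (rule Max_ge[OF fin that])
  let ?q = "real (K + k0)"
  have q1: "1 \<le> ?q" using k0 by simp
  have "(\<Sum>k\<le>n. real (k + k0) powr (\<sigma> - 1) * indicator (cube x (1 / 2 ^ (k + k0))) y) \<le> (\<Sum>k\<in>?A. ?q powr (\<sigma> - 1))"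
  proof -
    have "(\<Sum>k\<le>n. real (k + k0) powr (\<sigma> - 1) * indicator (cube x (1 / 2 ^ (k + k0))) y) = (\<Sum>k\<in>?A. real (k + k0) powr (\<sigma> - 1))"
      by (intro sum.mono_neutral_cong_right) auto
    also have "\<dots> \<le> (\<Sum>k\<in>?A. ?q powr (\<sigma> - 1))" using Kmax \<sigma> by (intro sum_mono powr_mono2) auto
    finally show ?thesis .
  qed
  also have "\<dots> = real (card ?A) * ?q powr (\<sigma> - 1)" by simp
  \<comment> \<open>The count K + 1 is at most K + k0 because k0 is positive.\<close>
  also have "\<dots> \<le> ?q * ?q powr (\<sigma> - 1)"
  proof (intro mult_right_mono)
    have "?A \<subseteq> {..K}" using Kmax by blast
    then have "card ?A \<le> card {..K}" by (intro card_mono) auto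
    then show "real (card ?A) \<le> ?q" using k0 by simp
  qed auto
  also have "\<dots> = ?q powr \<sigma>" using q1 by (simp add: powr_mult_base)
  also have "\<dots> \<le> ((1 + ln (real CARD('n))) / ln 2 * (1 + max 0 (ln (1 / norm (y - x))))) powr \<sigma>"
  proof (intro powr_mono2)
    let ?N = "real CARD('n)"
    have N: "1 \<le> ?N" by (simp add: Suc_leI)
    have lnN: "0 \<le> ln ?N" using N by simp
    have "\<bar>y $ k - x $ k\<bar> \<le> 1 / 2 ^ (K + k0)" for k using KA unfolding mem_Collect_eq mem_cube by blast
    then have "(\<Sum>k\<in>UNIV. \<bar>(y - x) $ k\<bar>) \<le> ?N * (1 / 2 ^ (K + k0))" by (intro sum_bounded_above) auto
    then have "norm (y - x) \<le> ?N / 2 ^ (K + k0)" using norm_le_l1_cart[of "y - x"] by simp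
    moreover have p: "0 < norm (y - x)" using \<open>y \<noteq> x\<close> by simp
    ultimately have "2 ^ (K + k0) \<le> ?N * (1 / norm (y - x))" by (simp add: field_simps)
    then have "ln (2 ^ (K + k0)) \<le> ln (?N * (1 / norm (y - x)))" by (subst ln_le_cancel_iff) (use p N in auto)
    moreover have "ln (?N * (1 / norm (y - x))) = ln ?N + ln (1 / norm (y - x))" using p N by (intro ln_mult_pos) auto
    moreover have "ln (2 ^ (K + k0)) = ?q * ln 2" by (simp add: ln_realpow)
    ultimately have "?q * ln 2 \<le> ln ?N + ln (1 / norm (y - x))" by linarith
    also have "\<dots> \<le> (1 + ln ?N) * (1 + max 0 (ln (1 / norm (y - x))))"
    proof -
      let ?M = "max 0 (ln (1 / norm (y - x)))"
      have "0 \<le> ln ?N * ?M" using lnN by simp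
      moreover have "p + q \<le> (1 + p) * (1 + q)" if "0 \<le> p * q" for p q :: real using that by (simp add: algebra_simps)
      ultimately have "ln ?N + ?M \<le> (1 + ln ?N) * (1 + ?M)" by blast
      moreover have "ln (1 / norm (y - x)) \<le> ?M" by simp
      ultimately show ?thesis by linarith
    qed
    finally show "?q \<le> (1 + ln ?N) / ln 2 * (1 + max 0 (ln (1 / norm (y - x))))"
      by (simp add: field_simps)
  qed (use \<sigma> in auto)
  also have "\<dots> = ((1 + ln (real CARD('n))) / ln 2) powr \<sigma> * logw \<sigma> (norm (y - x))"
    unfolding logw_def by (rule powr_mult)
  finally show ?thesis .
qed

text \<open>The opposite comparison, on the dyadic shell between two consecutive cubes. It converts
  the sum of weighted energy losses into an integral with the weight L.\<close>

lemma dyadic_log_upper: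
  fixes x y :: "real^'n::finite"
  assumes \<sigma>: "0 \<le> \<sigma>" and k0: "0 < k0" and "y \<noteq> x" and y: "y \<in> cube x (1 / 2 ^ k0)"
  shows "\<exists>k. y \<in> cube x (1 / 2 ^ (k + k0)) \<and> y \<notin> cube x (1 / 2 ^ (Suc k + k0)) \<and>
    logw \<sigma> (norm (y - x)) \<le> 3 powr \<sigma> * real (k + k0) powr \<sigma>"
proof -
  obtain i where i: "0 < \<bar>y $ i - x $ i\<bar>" using \<open>y \<noteq> x\<close> by (auto simp: vec_eq_iff)
  obtain n0 where n0: "(1 / 2) ^ n0 < \<bar>y $ i - x $ i\<bar>" using real_arch_pow_inv[OF i, of "1/2"] by auto
  define Pn where "Pn n \<longleftrightarrow> y \<notin> cube x (1 / 2 ^ (n + k0))" for n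
  have "Pn n0"
  proof -
    have "1 / 2 ^ (n0 + k0) \<le> (1 / 2 :: real) ^ n0" by (simp add: power_one_over power_add field_simps)
    then have "\<not> \<bar>y $ i - x $ i\<bar> \<le> 1 / 2 ^ (n0 + k0)" using n0 by linarith
    then show ?thesis unfolding Pn_def mem_cube by blast
  qed
  then have PL: "Pn (LEAST n. Pn n)" by (rule LeastI)
  moreover have "\<not> Pn 0" using y by (simp add: Pn_def)
  ultimately obtain k where k: "(LEAST n. Pn n) = Suc k" by (cases "LEAST n. Pn n") auto
  have "\<not> Pn k" using not_less_Least[of k Pn] k by simp
  then have yk: "y \<in> cube x (1 / 2 ^ (k + k0))" by (simp add: Pn_def)
  have nk: "y \<notin> cube x (1 / 2 ^ (Suc k + k0))" using PL[unfolded k] unfolding Pn_def .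
  then obtain j where "1 / 2 ^ (Suc k + k0) < \<bar>y $ j - x $ j\<bar>" unfolding mem_cube by (meson not_le)
  then have nm: "1 / 2 ^ (Suc k + k0) < norm (y - x)" using component_le_norm_cart[of "y - x" j] by simp
  let ?q = "real (k + k0)"
  have q1: "1 \<le> ?q" using k0 by simp
  have p: "0 < norm (y - x)" using \<open>y \<noteq> x\<close> by simp
  have "1 / norm (y - x) \<le> 2 ^ (Suc k + k0)" using nm p by (simp add: field_simps)
  then have "ln (1 / norm (y - x)) \<le> ln (2 ^ (Suc k + k0))" by (subst ln_le_cancel_iff) (use p in auto)
  also have "\<dots> = (1 + ?q) * ln 2" by (simp add: ln_realpow del: power_Suc)
  also have "\<dots> \<le> (1 + ?q) * 1" using ln_2_less_1 by (intro mult_left_mono) auto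
  \<comment> \<open>The logarithm is at most 1 + q, so the left side is at most 2 + q, and q \<ge> 1
    gives the factor 3.\<close>
  finally have "1 + max 0 (ln (1 / norm (y - x))) \<le> 3 * ?q" using q1 by simp
  then have "logw \<sigma> (norm (y - x)) \<le> (3 * ?q) powr \<sigma>" unfolding logw_def using \<sigma> by (intro powr_mono2) auto
  also have "\<dots> = 3 powr \<sigma> * ?q powr \<sigma>" by (rule powr_mult)
  finally show ?thesis using yk nk by blast
qed

text \<open>A weak solution with everything replaced by Borel functions vanishing off \<open>D\<close>. \<open>V\<close> majorises \<open>1\<close> and all six
  functions in the integrability conditions, and \<open>U\<close> is its \<open>n\<close>-th root; \<open>a\<close> and \<open>b\<close> are the compositions \<open>\<A>(y, u, u\<^sub>x)\<close>
  and \<open>\<B>(y, u, u\<^sub>x)\<close>.\<close>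

locale borel_solution =
  fixes D :: "(real^'n::finite) set" and u V U b :: "real^'n \<Rightarrow> real" and G a :: "real^'n \<Rightarrow> real^'n"
    and m :: nat and \<sigma> s Ca :: real
  assumes N: "CARD('n) = Suc m" and m: "0 < m" and \<sigma>: "real m < \<sigma>" "\<sigma> < s" and Ca: "0 \<le> Ca"
    and D: "open D" "bounded D"
    and um[measurable]: "u \<in> borel_measurable borel" and Gm[measurable]: "G \<in> borel_measurable borel"
    and Vm[measurable]: "V \<in> borel_measurable borel"
    and ufin: "(\<integral>\<^sup>+y. \<bar>u y\<bar> ^ Suc m \<partial>lborel) < \<infinity>" and Gfin: "(\<integral>\<^sup>+y. norm (G y) ^ Suc m \<partial>lborel) < \<infinity>"
    and u0: "\<And>y. y \<notin> D \<Longrightarrow> u y = 0" and G0: "\<And>y. y \<notin> D \<Longrightarrow> G y = 0"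
    and weak_grad: "\<And>\<phi> i. \<phi> \<in> test_functions D \<Longrightarrow>
      (\<integral>y. u y * partial_deriv i \<phi> y \<partial>lborel) = - (\<integral>y. G y $ i * \<phi> y \<partial>lborel)"
    and V0: "\<And>y. 0 \<le> V y" and V1: "\<And>y. y \<in> D \<Longrightarrow> 1 \<le> V y"
    and U1: "\<And>y. y \<in> D \<Longrightarrow> 1 \<le> U y" and UV: "\<And>y. U y ^ Suc m = V y"
    and VlogV: "(\<integral>\<^sup>+y\<in>D. ennreal (V y * ln (V y + 1) powr s) \<partial>lborel) < \<infinity>"
    and struct: "AE y in lborel. y \<in> D \<longrightarrow>
       norm (a y) \<le> Ca * (norm (G y) + U y * (\<bar>u y\<bar> + 1)) ^ m \<and>
       \<bar>b y\<bar> \<le> 3 * U y * (norm (G y) + U y * (\<bar>u y\<bar> + 1)) ^ m \<and>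
       norm (G y) ^ Suc m - V y * \<bar>u y\<bar> ^ Suc m - V y \<le> G y \<bullet> a y"
    and weak: "\<And>\<phi>. \<phi> \<in> test_functions D \<Longrightarrow> integrable lborel (\<lambda>y. grad \<phi> y \<bullet> a y + \<phi> y * b y) \<and>
       (\<integral>y. grad \<phi> y \<bullet> a y + \<phi> y * b y \<partial>lborel) = 0"
begin

definition energy :: "(real^'n) set \<Rightarrow> real" where
  "energy S = enn2real (\<integral>\<^sup>+y\<in>S. norm (G y) ^ Suc m \<partial>lborel)"

text \<open>Unlike the energy, this is not known to be finite for every set, and an infinite
  integral would be read as 0. Each estimate that uses it first derives finiteness on the cube from
  the potential bound of V, as L \<ge> 1.\<close>

definition mass :: "(real^'n) set \<Rightarrow> real" where
  "mass S = enn2real (\<integral>\<^sup>+y\<in>S. ennreal (V y) \<partial>lborel)"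

lemma \<sigma>1: "1 < \<sigma>" using m \<sigma> by linarith

lemma energy_eq: "(\<integral>\<^sup>+y\<in>S. norm (G y) ^ Suc m \<partial>lborel) = ennreal (energy S)"
proof -
  have "(\<integral>\<^sup>+y\<in>S. norm (G y) ^ Suc m \<partial>lborel) \<le> (\<integral>\<^sup>+y. norm (G y) ^ Suc m \<partial>lborel)"
    by (intro nn_integral_mono) (auto simp: indicator_def)
  then show ?thesis using Gfin unfolding energy_def by (subst ennreal_enn2real) (auto intro: le_less_trans)
qed

lemma energy_nonneg: "0 \<le> energy S" by (simp add: energy_def)

lemma energy_mono: "S \<subseteq> S' \<Longrightarrow> energy S \<le> energy S'"
proof -
  assume "S \<subseteq> S'"
  then have "(\<integral>\<^sup>+y\<in>S. norm (G y) ^ Suc m \<partial>lborel) \<le> (\<integral>\<^sup>+y\<in>S'. norm (G y) ^ Suc m \<partial>lborel)"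
    by (intro nn_integral_mono mult_left_mono) (auto simp: indicator_def)
  then show ?thesis unfolding energy_eq using energy_nonneg by simp
qed

lemma energy_annulus: "0 < r \<Longrightarrow> energy (annulus x r) = energy (cube x r) - energy (cube x (r / 4))"
proof -
  assume "0 < r"
  from cube_annulus_split[OF _ this, of "\<lambda>y. ennreal (norm (G y) ^ Suc m)" x]
  have "ennreal (energy (cube x r)) = ennreal (energy (annulus x r) + energy (cube x (r / 4)))"
    unfolding energy_eq by (simp add: energy_nonneg)
  then have "energy (cube x r) = energy (annulus x r) + energy (cube x (r / 4))"
    using energy_nonneg by (subst (asm) ennreal_inj) (auto intro: add_nonneg_nonneg)
  then show ?thesis by linarith
qed

lemma closure_cube: "cube x r \<subseteq> D \<Longrightarrow> sobolev_closure (cube x r) u G"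
  by (rule weak_gradient_imp_sobolev_closure[OF D um Gm])
     (use ufin Gfin u0 G0 weak_grad cube_compact in \<open>auto simp: N simp del: power_Suc\<close>)

text \<open>The Caccioppoli inequality with c from \<open>cube_annulus_constant\<close>. The cutoff
  term costs only annulus energy, the terms with |u - c| against V cost w times the full energy, and
  in the zeroth-order terms u is recentred at c, which leaves
  \<open>1 + \<bar>c\<bar> ^ Suc m\<close> times the mass.\<close>

lemma hole_filling:
  "\<exists>A\<ge>1. \<exists>B\<ge>0. \<forall>x r w. 0 < r \<and> cube x r \<subseteq> D \<and> 0 < w \<and>
    (\<forall>y\<in>cube x r. (\<integral>\<^sup>+z\<in>cube x r. ennreal (V z * logw \<sigma> (norm (y - z) / (2 * r * real (Suc m)))) \<partial>lborel) \<le> ennreal w)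
    \<longrightarrow> (\<exists>c. (\<integral>\<^sup>+y\<in>annulus x r. ennreal (\<bar>u y - c\<bar> ^ Suc m) \<partial>lborel) \<le> ennreal (B * r ^ Suc m * energy (annulus x r)) \<and>
      energy (cube x (r / 4)) \<le> A * energy (annulus x r) + A * w * energy (cube x r) + A * ((1 + \<bar>c\<bar> ^ Suc m) * mass (cube x r)))"
proof -
  obtain K where K0: "0 < K" and K': "\<forall>x r (f :: real^'n \<Rightarrow> real) F V w E Ea. 0 < r \<and> sobolev_closure (cube x r) f F
     \<and> V \<in> borel_measurable borel \<and> (\<forall>y. 0 \<le> V y) \<and> 0 < w
     \<and> (\<forall>y\<in>cube x r. (\<integral>\<^sup>+z\<in>cube x r. ennreal (V z * logw \<sigma> (norm (y - z) / (2 * r * real (Suc m)))) \<partial>lborel) \<le> ennreal w)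
     \<and> (\<integral>\<^sup>+y\<in>cube x r. norm (F y) ^ Suc m \<partial>lborel) \<le> ennreal E
     \<and> (\<integral>\<^sup>+y\<in>annulus x r. norm (F y) ^ Suc m \<partial>lborel) \<le> ennreal Ea \<and> 0 \<le> Ea \<and> Ea \<le> E \<longrightarrow>
     (\<exists>c. (\<integral>\<^sup>+y\<in>annulus x r. ennreal (\<bar>f y - c\<bar> ^ Suc m) \<partial>lborel) \<le> ennreal (K * r ^ Suc m * Ea) \<and>
          (\<integral>\<^sup>+y\<in>cube x r. ennreal (V y * \<bar>f y - c\<bar> ^ Suc m) \<partial>lborel) \<le> ennreal (K * w * E))"
    using cube_annulus_constant[OF N m \<sigma>(1)] by (elim exE conjE)
  note K = K'[rule_format]
  obtain Ce where Ce: "0 < Ce" "\<And>(x::real^'n) r. 0 < r \<Longrightarrow> (\<exists>\<eta>. (\<forall>k. Ck k \<eta>) \<and> (\<forall>y. 0 \<le> \<eta> y \<and> \<eta> y \<le> 1)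
     \<and> (\<forall>y\<in>cube x (r / 4). \<eta> y = 1) \<and> (\<forall>y. y \<notin> cube x (7 / 8 * r) \<longrightarrow> \<eta> y = 0)
     \<and> (\<forall>y. norm (grad \<eta> y) \<le> Ce / r) \<and> (\<forall>y. y \<notin> annulus x r \<longrightarrow> grad \<eta> y = 0))"
    using cutoff_exists[where 'n='n] by blast
  let ?n = "Suc m"
  let ?c2 = "2 + 4 ^ ?n :: real" and ?c3 = "3 ^ ?n * (2 * 4 ^ ?n) ^ m :: real" and ?Cc = "(Ce * Ca) ^ ?n"
  \<comment> \<open>The coefficients collected after inserting the bounds: \<open>a1\<close> for the
    annulus energy, \<open>a2\<close> for w times the cube energy, \<open>a3\<close> for the mass.
    In \<open>a1\<close> the power of r from the cutoff gradient cancels the one from the Poincare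
    inequality.\<close>
  define a1 where "a1 = 2 * (4 ^ ?n + ?Cc * K)"
  define a2 where "a2 = 2 * ((?c2 * 2 ^ ?n + ?c3) * K)"
  define a3 where "a3 = 2 * (?c2 * (2 ^ ?n + 1))"
  define A where "A = 1 + a1 + a2 + a3"
  have apos: "0 \<le> a1" "0 \<le> a2" "0 \<le> a3" using K0 Ce(1) Ca by (simp_all add: a1_def a2_def a3_def)
  have Ale: "a1 \<le> A" "a2 \<le> A" "a3 \<le> A" "1 \<le> A" using apos by (simp_all add: A_def)
  have "\<exists>c. (\<integral>\<^sup>+y\<in>annulus x r. ennreal (\<bar>u y - c\<bar> ^ ?n) \<partial>lborel) \<le> ennreal (K * r ^ ?n * energy (annulus x r)) \<and>
      energy (cube x (r / 4)) \<le> A * energy (annulus x r) + A * w * energy (cube x r) + A * ((1 + \<bar>c\<bar> ^ ?n) * mass (cube x r))"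
    if r: "0 < r" and QD: "cube x r \<subseteq> D" and w: "0 < w"
     and W: "\<And>y. y \<in> cube x r \<Longrightarrow> (\<integral>\<^sup>+z\<in>cube x r. ennreal (V z * logw \<sigma> (norm (y - z) / (2 * r * real ?n))) \<partial>lborel) \<le> ennreal w"
    for x r w
  proof -
    let ?E = "energy (cube x r)" and ?Ea = "energy (annulus x r)" and ?v = "mass (cube x r)"
    have sub: "annulus x r \<subseteq> cube x r" by (auto simp: annulus_def)
    note sc = closure_cube[OF QD]
    obtain c where c: "(\<integral>\<^sup>+y\<in>annulus x r. ennreal (\<bar>u y - c\<bar> ^ ?n) \<partial>lborel) \<le> ennreal (K * r ^ ?n * ?Ea)"
      "(\<integral>\<^sup>+y\<in>cube x r. ennreal (V y * \<bar>u y - c\<bar> ^ ?n) \<partial>lborel) \<le> ennreal (K * w * ?E)"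
      using K[of r x u G V w ?E ?Ea] r sc V0 w W energy_eq energy_nonneg energy_mono[OF sub] by auto
    have xin: "x \<in> cube x r" using r by (simp add: mem_cube)
    have "(\<integral>\<^sup>+y\<in>cube x r. ennreal (V y) \<partial>lborel) \<le> (\<integral>\<^sup>+z\<in>cube x r. ennreal (V z * logw \<sigma> (norm (x - z) / (2 * r * real ?n))) \<partial>lborel)"
    proof (intro nn_integral_mono mult_right_mono ennreal_leI)
      show "V z \<le> V z * logw \<sigma> (norm (x - z) / (2 * r * real ?n))" for z
        using mult_left_mono[OF logw_ge_1[of \<sigma> "norm (x - z) / (2 * r * real ?n)"], of "V z"] \<sigma>1 V0 by simp
    qed auto
    also have "\<dots> \<le> ennreal w" using W xin by blast
    finally have "(\<integral>\<^sup>+y\<in>cube x r. ennreal (V y) \<partial>lborel) < \<infinity>" by (rule le_less_trans) simp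
    then have v: "(\<integral>\<^sup>+y\<in>cube x r. ennreal (V y) \<partial>lborel) = ennreal ?v" unfolding mass_def by (subst ennreal_enn2real) auto
    have v0: "0 \<le> ?v" by (simp add: mass_def)
    let ?T = "K * w * ?E" and ?X = "K * r ^ ?n * ?Ea"
    have T0: "0 \<le> ?T" "0 \<le> ?X" using K0 w r energy_nonneg by simp_all
    \<comment> \<open>Bound of the zeroth-order term by passing from u to its deviation from c; the
      last summand is the mass from the constant 1.\<close>
    let ?Y = "2 ^ ?n * (?T + \<bar>c\<bar> ^ ?n * ?v) + ?v"
    have cv0: "0 \<le> \<bar>c\<bar> ^ ?n * ?v" using v0 by (intro mult_nonneg_nonneg) auto
    have Y1: "0 \<le> 2 ^ ?n * (?T + \<bar>c\<bar> ^ ?n * ?v)"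
      by (rule mult_nonneg_nonneg[OF _ add_nonneg_nonneg[OF T0(1) cv0]]) simp
    have Y0: "0 \<le> ?Y" by (rule add_nonneg_nonneg[OF Y1 v0])
    have Y: "(\<integral>\<^sup>+y\<in>cube x r. ennreal (V y * (\<bar>u y\<bar> ^ ?n + 1)) \<partial>lborel) \<le> ennreal ?Y"
    proof -
      have "(\<integral>\<^sup>+y\<in>cube x r. ennreal (V y * (\<bar>u y\<bar> ^ ?n + 1)) \<partial>lborel) = (\<integral>\<^sup>+y. ennreal (V y * \<bar>u y - 0\<bar> ^ ?n) * indicator (cube x r) y + ennreal (V y) * indicator (cube x r) y \<partial>lborel)"
        using V0 by (intro nn_integral_cong) (auto simp: indicator_def distrib_left ennreal_plus simp del: power_Suc)
      also have "\<dots> = (\<integral>\<^sup>+y\<in>cube x r. ennreal (V y * \<bar>u y - 0\<bar> ^ ?n) \<partial>lborel) + ennreal ?v"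
        unfolding v[symmetric] by (rule nn_integral_add) auto
      also have "\<dots> \<le> ennreal (2 ^ ?n * (?T + \<bar>c - 0\<bar> ^ ?n * ?v)) + ennreal ?v"
        by (intro add_right_mono recenter_power_le[OF _ _ _ _ c(2) T0(1) _ v0]) (use V0 v in auto)
      also have "\<dots> = ennreal ?Y" using ennreal_plus[OF Y1 v0] by simp
      finally show ?thesis .
    qed
    obtain \<eta> where eta: "\<And>k. Ck k \<eta>" "\<And>y. 0 \<le> \<eta> y" "\<And>y. \<eta> y \<le> 1" "\<And>y. y \<in> cube x (r / 4) \<Longrightarrow> \<eta> y = 1"
      "\<And>y. y \<notin> cube x (7 / 8 * r) \<Longrightarrow> \<eta> y = 0" "\<And>y. norm (grad \<eta> y) \<le> Ce / r" "\<And>y. y \<notin> annulus x r \<Longrightarrow> grad \<eta> y = 0"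
      using Ce(2)[OF r, of x] by blast
    have "(\<integral>\<^sup>+y\<in>cube x (r / 4). norm (G y) ^ ?n \<partial>lborel) \<le>
      ennreal (2 * (?c2 * ?Y + 4 ^ ?n * ?Ea + (Ce * Ca / r) ^ ?n * ?X + ?c3 * ?T))"
      by (rule caccioppoli[OF N m \<sigma>(1) r QD sc Vm V0 U1 UV W w Ca _ struct weak eta _ _ _ _ c(1) T0(2) Y Y0 c(2) T0(1)])
         (use Ce(1) energy_eq energy_nonneg in \<open>auto simp del: power_Suc\<close>)
    moreover have "0 \<le> 2 * (?c2 * ?Y + 4 ^ ?n * ?Ea + (Ce * Ca / r) ^ ?n * ?X + ?c3 * ?T)"
    proof -
      have p1: "0 \<le> ?c2 * ?Y" by (rule mult_nonneg_nonneg[OF _ Y0]) simp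
      have p2: "0 \<le> 4 ^ ?n * ?Ea" by (rule mult_nonneg_nonneg[OF _ energy_nonneg]) simp
      have p3: "0 \<le> (Ce * Ca / r) ^ ?n * ?X"
        by (rule mult_nonneg_nonneg[OF _ T0(2)]) (use Ce(1) Ca r in \<open>auto intro!: zero_le_power divide_nonneg_nonneg simp del: power_Suc\<close>)
      have p4: "0 \<le> ?c3 * ?T" by (rule mult_nonneg_nonneg[OF _ T0(1)]) simp
      show ?thesis
        by (rule mult_nonneg_nonneg[OF _ add_nonneg_nonneg[OF add_nonneg_nonneg[OF add_nonneg_nonneg[OF p1 p2] p3] p4]]) simp
    qed
    ultimately have "energy (cube x (r / 4)) \<le> 2 * (?c2 * ?Y + 4 ^ ?n * ?Ea + (Ce * Ca / r) ^ ?n * ?X + ?c3 * ?T)"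
      unfolding energy_eq by (subst (asm) ennreal_le_iff)
    also have "(Ce * Ca / r) ^ ?n * ?X = ?Cc * K * ?Ea"
    proof -
      have "(Ce * Ca / r) ^ ?n = ?Cc / r ^ ?n" by (rule power_divide)
      then show ?thesis using r by simp
    qed
    also have "2 * (?c2 * ?Y + 4 ^ ?n * ?Ea + ?Cc * K * ?Ea + ?c3 * ?T) = a1 * ?Ea + a2 * (w * ?E) + 2 * (?c2 * (2 ^ ?n * (\<bar>c\<bar> ^ ?n * ?v) + ?v))"
      unfolding a1_def a2_def by (simp only: distrib_left distrib_right mult.assoc mult.left_commute mult.commute add.assoc add.left_commute add.commute)
    also have "2 * (?c2 * (2 ^ ?n * (\<bar>c\<bar> ^ ?n * ?v) + ?v)) \<le> a3 * ((1 + \<bar>c\<bar> ^ ?n) * ?v)"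
    proof -
      have cv: "0 \<le> \<bar>c\<bar> ^ ?n * ?v" using v0 by simp
      have "2 ^ ?n * (\<bar>c\<bar> ^ ?n * ?v) + ?v \<le> (2 ^ ?n + 1) * ((1 + \<bar>c\<bar> ^ ?n) * ?v)"
      proof -
        have "(2 ^ ?n + 1) * ((1 + \<bar>c\<bar> ^ ?n) * ?v) = 2 ^ ?n * (\<bar>c\<bar> ^ ?n * ?v) + ?v + (2 ^ ?n * ?v + \<bar>c\<bar> ^ ?n * ?v)"
          by (simp add: algebra_simps)
        moreover have "0 \<le> 2 ^ ?n * ?v + \<bar>c\<bar> ^ ?n * ?v" using v0 cv by (intro add_nonneg_nonneg) auto
        ultimately show ?thesis by linarith
      qed
      then have "?c2 * (2 ^ ?n * (\<bar>c\<bar> ^ ?n * ?v) + ?v) \<le> ?c2 * ((2 ^ ?n + 1) * ((1 + \<bar>c\<bar> ^ ?n) * ?v))" by (intro mult_left_mono) auto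
      then show ?thesis unfolding a3_def by (simp only: mult.assoc)
    qed
    finally have "energy (cube x (r / 4)) \<le> a1 * ?Ea + a2 * (w * ?E) + a3 * ((1 + \<bar>c\<bar> ^ ?n) * ?v)" by simp
    also have "\<dots> \<le> A * ?Ea + A * (w * ?E) + A * ((1 + \<bar>c\<bar> ^ ?n) * ?v)"
      using Ale w energy_nonneg v0 by (intro add_mono mult_right_mono mult_nonneg_nonneg) auto
    finally show ?thesis using c(1) by (intro exI[of _ c]) (simp add: mult.assoc)
  qed
  note main = this
  show ?thesis
    by (rule exI[of _ A], rule conjI[OF Ale(4)], rule exI[of _ K], rule conjI, use K0 in simp, intro allI impI, elim conjE, rule main; blast)
qed

lemma energy_Diff:
  assumes [measurable]: "S \<in> sets borel" "S' \<in> sets borel" and "S' \<subseteq> S"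
  shows "energy (S - S') = energy S - energy S'"
proof -
  have "(\<integral>\<^sup>+y\<in>S. norm (G y) ^ Suc m \<partial>lborel) = (\<integral>\<^sup>+y. ennreal (norm (G y) ^ Suc m) * indicator (S - S') y + ennreal (norm (G y) ^ Suc m) * indicator S' y \<partial>lborel)"
    using assms(3) by (intro nn_integral_cong) (auto simp: indicator_def)
  also have "\<dots> = (\<integral>\<^sup>+y\<in>S - S'. norm (G y) ^ Suc m \<partial>lborel) + (\<integral>\<^sup>+y\<in>S'. norm (G y) ^ Suc m \<partial>lborel)"
    by (rule nn_integral_add) auto
  finally have "ennreal (energy S) = ennreal (energy (S - S') + energy S')"
    unfolding energy_eq by (simp add: energy_nonneg)
  then have "energy S = energy (S - S') + energy S'"
    using energy_nonneg by (subst (asm) ennreal_inj) (auto intro: add_nonneg_nonneg)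
  then show ?thesis by linarith
qed

lemma D_borel [measurable]: "D \<in> sets borel" using D by simp

text \<open>For each centre the energies, means and masses on dyadic cubes are fed to
  \<open>discrete_absorption\<close>. Uniformity over K' holds because the first scale, the
  potential bound, the total energy and the bound on the first mean do not depend on the
  centre.\<close>

lemma uniform_weighted_energy:
  assumes K': "compact K'" "K' \<subseteq> D"
  shows "\<exists>R>0. \<exists>M\<ge>0. \<forall>x\<in>K'. (\<integral>\<^sup>+y\<in>cube x R. ennreal (norm (G y) ^ Suc m * logw \<sigma> (norm (y - x))) \<partial>lborel) \<le> ennreal M"
proof -
  let ?n = "Suc m"
  obtain A B where A: "1 \<le> A" and B: "0 \<le> B" and AB: "\<forall>x r w. 0 < r \<and> cube x r \<subseteq> D \<and> 0 < w \<and>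
    (\<forall>y\<in>cube x r. (\<integral>\<^sup>+z\<in>cube x r. ennreal (V z * logw \<sigma> (norm (y - z) / (2 * r * real ?n))) \<partial>lborel) \<le> ennreal w)
    \<longrightarrow> (\<exists>c. (\<integral>\<^sup>+y\<in>annulus x r. ennreal (\<bar>u y - c\<bar> ^ ?n) \<partial>lborel) \<le> ennreal (B * r ^ ?n * energy (annulus x r)) \<and>
      energy (cube x (r / 4)) \<le> A * energy (annulus x r) + A * w * energy (cube x r) + A * ((1 + \<bar>c\<bar> ^ ?n) * mass (cube x r)))"
    using hole_filling by (elim exE conjE)
  note AB = AB[rule_format]
  \<comment> \<open>Then the term A w times the energy of the cube is half of that energy, which
    keeps the factor \<theta> of hole filling below 1.\<close>
  define w where "w = 1 / (2 * A)"
  have w: "0 < w" "A * w = 1 / 2" using A by (simp_all add: w_def)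
  \<comment> \<open>Filling the hole: adding A times the inner energy to both sides of the energy
    inequality gives factor A + 1 on the left and A + 1/2 on the right.\<close>
  define \<theta> where "\<theta> = (A + 1 / 2) / (A + 1)"
  have \<theta>: "0 < \<theta>" "\<theta> < 1" using A by (simp_all add: \<theta>_def add_pos_pos)
  define Bc where "Bc = 2 ^ ?n * 4 ^ ?n * B"
  have Bc: "0 \<le> Bc" using B by (simp add: Bc_def)
  define Cp where "Cp = ((1 + ln (real CARD('n))) / ln 2) powr \<sigma>"
  have Cp: "0 \<le> Cp" by (simp add: Cp_def)
  \<comment> \<open>\<open>Cp\<close> is the constant of \<open>dyadic_log_lower\<close>, and w
    bounds the potential of V near any point; the product bounds the weighted sum of masses at every
    centre and for every first scale considered.\<close>
  define P where "P = Cp * w"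
  have P: "0 \<le> P" using Cp w by (simp add: P_def)
  obtain k1 where k1: "0 < k1" and DA: "\<forall>k0\<ge>k1. \<forall>Es cs. \<exists>M. \<forall>E c v.
    (\<forall>k. 0 \<le> E k) \<and> (\<forall>k. E (Suc k) \<le> E k) \<and> E 0 \<le> Es \<and> \<bar>c 0\<bar> \<le> cs \<and> (\<forall>k. 0 \<le> v k) \<and>
    (\<forall>k. E (k + 2) \<le> \<theta> * E k + (1 + \<bar>c k\<bar> ^ ?n) * v k) \<and>
    (\<forall>k. \<bar>c k - c (Suc k)\<bar> ^ ?n \<le> Bc * (E k - E (k + 2) + (E (k + 1) - E (k + 3)))) \<and>
    (\<forall>n. (\<Sum>k\<le>n. real (k + k0) powr (\<sigma> - 1) * v k) \<le> P) \<longrightarrow>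
    (\<forall>n. (\<Sum>k<n. (E k - E (Suc k)) * real (k + k0) powr \<sigma>) \<le> M)"
    using discrete_absorption[OF \<theta> Bc P m \<sigma>(1)] by (elim exE conjE)
  have \<sigma>0: "0 < \<sigma>" using \<sigma>1 by simp
  obtain \<rho> where \<rho>: "0 < \<rho>" "\<rho> < 1" "\<And>y. (\<integral>\<^sup>+x\<in>D \<inter> cball y \<rho>. ennreal (V x * logw \<sigma> (norm (y - x))) \<partial>lborel) \<le> ennreal w"
    using LlogL_kernel_small[OF Vm D_borel V1 \<sigma>0 \<sigma>(2) VlogV w(1)] by blast
  obtain \<delta> where \<delta>: "0 < \<delta>" "(\<Union>x\<in>K'. cball x \<delta>) \<subseteq> D"
    using compact_subset_open_imp_cball_epsilon_subset[OF K'(1) D(1) K'(2)] by metis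
  have "0 < min \<rho> \<delta> / (2 * real ?n)" using \<rho> \<delta> by simp
  then obtain n0 where n0: "(1 / 2) ^ n0 < min \<rho> \<delta> / (2 * real ?n)" using real_arch_pow_inv[of _ "1/2::real"] by auto
  \<comment> \<open>Beyond \<open>k1\<close> the absorption works; beyond \<open>n0\<close> the
    cubes have diameter at most both \<rho>, where the potential is small, and \<delta>, so that
    they stay in D.\<close>
  define k0 where "k0 = max k1 n0"
  have k0: "k1 \<le> k0" "0 < k0" using k1 by (auto simp: k0_def)
  define r where "r k = 1 / (2::real) ^ (k + k0)" for k
  have r0: "0 < r k" for k by (simp add: r_def)
  \<comment> \<open>The inner cube of hole filling is two dyadic steps down, whence the index k +
    2.\<close>
  have r4: "r k / 4 = r (k + 2)" and r2: "r k / 2 = r (k + 1)" for k by (simp_all add: r_def)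
  have rmono: "r k \<le> r 0" for k by (simp add: r_def power_increasing field_simps)
  have rs: "2 * r k * real ?n \<le> min \<rho> \<delta>" for k
  proof -
    have "r 0 \<le> (1 / 2) ^ n0" unfolding r_def k0_def by (simp add: power_one_over power_increasing field_simps)
    then have "r k \<le> min \<rho> \<delta> / (2 * real ?n)" using rmono[of k] n0 by linarith
    then show ?thesis by (simp add: field_simps)
  qed
  have cubeD: "cube x (r k) \<subseteq> D" and cube\<rho>: "y \<in> cube x (r k) \<Longrightarrow> cube x (r k) \<subseteq> cball y \<rho>" if "x \<in> K'" for x y k
  proof -
    have xin: "x \<in> cube x (r k)" using r0[of k] by (simp add: mem_cube)
    have "norm (y - z) \<le> min \<rho> \<delta>" if "y \<in> cube x (r k)" "z \<in> cube x (r k)" for y z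
      using cube_norm_le[OF that] rs[of k] by (simp add: N)
    note nm = this
    have "cube x (r k) \<subseteq> cball x \<delta>" using nm[OF xin] by (auto simp: dist_norm)
    then show "cube x (r k) \<subseteq> D" using \<delta>(2) \<open>x \<in> K'\<close> by blast
    show "cube x (r k) \<subseteq> cball y \<rho>" if "y \<in> cube x (r k)" using nm[OF that] by (auto simp: dist_norm)
  qed
  \<comment> \<open>The potential bound is available for the unscaled weight. Since the diameter is
    at most 1, dividing the distance by it only decreases L.\<close>
  have W: "(\<integral>\<^sup>+z\<in>cube x (r k). ennreal (V z * logw \<sigma> (norm (y - z) / (2 * r k * real ?n))) \<partial>lborel) \<le> ennreal w"
    if x: "x \<in> K'" and y: "y \<in> cube x (r k)" for x y k
  proof -
    let ?d = "2 * r k * real ?n"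
    have d: "0 < ?d" "?d \<le> 1" using r0[of k] rs[of k] \<rho> by auto
    have "(\<integral>\<^sup>+z\<in>cube x (r k). ennreal (V z * logw \<sigma> (norm (y - z) / ?d)) \<partial>lborel) \<le> (\<integral>\<^sup>+z\<in>D \<inter> cball y \<rho>. ennreal (V z * logw \<sigma> (norm (y - z))) \<partial>lborel)"
    proof (rule nn_integral_mono)
      fix z
      have le: "logw \<sigma> (norm (y - z) / ?d) \<le> logw \<sigma> (norm (y - z))"
      proof (cases "y = z")
        case False
        then have p: "0 < norm (y - z)" by simp
        have "norm (y - z) * ?d \<le> norm (y - z) * 1" using d by (intro mult_left_mono) auto
        then have "norm (y - z) \<le> norm (y - z) / ?d" using d by (simp add: pos_le_divide_eq)
        then show ?thesis using p \<sigma>0 by (intro logw_antimono) auto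
      qed simp
      show "ennreal (V z * logw \<sigma> (norm (y - z) / ?d)) * indicator (cube x (r k)) z \<le> ennreal (V z * logw \<sigma> (norm (y - z))) * indicator (D \<inter> cball y \<rho>) z"
      proof (cases "z \<in> cube x (r k)")
        case True
        then have "z \<in> D \<inter> cball y \<rho>" using cubeD[OF x] cube\<rho>[OF x y] by blast
        then show ?thesis using True V0 le by (auto intro!: ennreal_leI mult_left_mono)
      qed simp
    qed
    then show ?thesis using \<rho>(3)[of y] by (rule order_trans)
  qed
  define Es where "Es = energy UNIV"
  define Iu where "Iu = enn2real (\<integral>\<^sup>+y. \<bar>u y\<bar> ^ ?n \<partial>lborel)"
  have Iu: "(\<integral>\<^sup>+y. \<bar>u y\<bar> ^ ?n \<partial>lborel) = ennreal Iu" "0 \<le> Iu" using ufin by (auto simp: Iu_def)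
  \<comment> \<open>Comes from comparing the first mean with the constant 0 on the first annulus,
    through the norm of u over the whole space. It depends on the first scale, so it matters that
    \<open>discrete_absorption\<close> fixes \<open>k1\<close> before \<open>Es\<close> and
    \<open>cs\<close>.\<close>
  define cs where "cs = 1 + 2 ^ ?n * (B * r 0 ^ ?n * Es + Iu) / (r 0 / 4) ^ ?n"
  obtain M where M: "\<forall>E c v.
    (\<forall>k. 0 \<le> E k) \<and> (\<forall>k. E (Suc k) \<le> E k) \<and> E 0 \<le> Es \<and> \<bar>c 0\<bar> \<le> cs \<and> (\<forall>k. 0 \<le> v k) \<and>
    (\<forall>k. E (k + 2) \<le> \<theta> * E k + (1 + \<bar>c k\<bar> ^ ?n) * v k) \<and>
    (\<forall>k. \<bar>c k - c (Suc k)\<bar> ^ ?n \<le> Bc * (E k - E (k + 2) + (E (k + 1) - E (k + 3)))) \<and>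
    (\<forall>n. (\<Sum>k\<le>n. real (k + k0) powr (\<sigma> - 1) * v k) \<le> P) \<longrightarrow>
    (\<forall>n. (\<Sum>k<n. (E k - E (Suc k)) * real (k + k0) powr \<sigma>) \<le> M)"
    using spec[OF spec[OF mp[OF spec[OF DA, of k0] k0(1)], of Es], of cs] by (elim exE)
  have "(\<integral>\<^sup>+y\<in>cube x (r 0). ennreal (norm (G y) ^ ?n * logw \<sigma> (norm (y - x))) \<partial>lborel) \<le> ennreal (3 powr \<sigma> * max 0 M)"
    if x: "x \<in> K'" for x
  proof -
    define E where "E k = energy (cube x (r k))" for k
    define v where "v k = mass (cube x (r k))" for k
    have "\<exists>c. \<forall>k. (\<integral>\<^sup>+y\<in>annulus x (r k). ennreal (\<bar>u y - c k\<bar> ^ ?n) \<partial>lborel) \<le> ennreal (B * r k ^ ?n * energy (annulus x (r k))) \<and>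
      energy (cube x (r k / 4)) \<le> A * energy (annulus x (r k)) + A * w * energy (cube x (r k)) + A * ((1 + \<bar>c k\<bar> ^ ?n) * mass (cube x (r k)))"
      by (intro choice allI AB) (use r0 cubeD[OF x] w W[OF x] in blast)
    then obtain c where c1: "\<And>k. (\<integral>\<^sup>+y\<in>annulus x (r k). ennreal (\<bar>u y - c k\<bar> ^ ?n) \<partial>lborel) \<le> ennreal (B * r k ^ ?n * energy (annulus x (r k)))"
      and c2: "\<And>k. energy (cube x (r k / 4)) \<le> A * energy (annulus x (r k)) + A * w * energy (cube x (r k)) + A * ((1 + \<bar>c k\<bar> ^ ?n) * mass (cube x (r k)))"
      by blast
    have Ea: "energy (annulus x (r k)) = E k - E (k + 2)" for k
      using energy_annulus[OF r0[of k], of x] unfolding E_def r4 .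
    have E0: "0 \<le> E k" for k by (simp add: E_def energy_nonneg)
    have v0: "0 \<le> v k" for k by (simp add: v_def mass_def)
    have csub: "cube x (r (Suc k)) \<subseteq> cube x (r k)" for k
      by (rule cube_mono) (simp add: r_def field_simps)
    have dec: "E (Suc k) \<le> E k" for k unfolding E_def by (rule energy_mono[OF csub])
    have hole: "E (k + 2) \<le> \<theta> * E k + (1 + \<bar>c k\<bar> ^ ?n) * v k" for k
    proof -
      let ?z = "(1 + \<bar>c k\<bar> ^ ?n) * v k"
      have z0: "0 \<le> ?z" using v0[of k] by (intro mult_nonneg_nonneg) auto
      have "E (k + 2) \<le> A * (E k - E (k + 2)) + 1 / 2 * E k + A * ?z"
        using c2[of k] unfolding r4 Ea w(2) E_def[symmetric] v_def[symmetric] .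
      then have "(A + 1) * E (k + 2) \<le> (A + 1 / 2) * E k + A * ?z" by (simp add: algebra_simps del: power_Suc)
      also have "\<dots> \<le> (A + 1 / 2) * E k + (A + 1) * ?z" using z0 by (intro add_left_mono mult_right_mono) auto
      also have "\<dots> = (A + 1) * (\<theta> * E k + ?z)"
      proof -
        have "(A + 1) * \<theta> = A + 1 / 2" using A by (simp add: \<theta>_def)
        then show ?thesis by (simp only: distrib_left mult.assoc[symmetric])
      qed
      finally show ?thesis using A by simp
    qed
    have chain: "\<bar>c k - c (Suc k)\<bar> ^ ?n \<le> Bc * (E k - E (k + 2) + (E (k + 1) - E (k + 3)))" for k
    proof -
      obtain P where P: "P \<in> sets borel" "P \<subseteq> annulus x (r k)" "P \<subseteq> annulus x (r (Suc k))" "ennreal ((r k / 4) ^ CARD('n)) \<le> emeasure lborel P"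
        using annulus_overlap[OF r0[of k], of x] unfolding r2 by auto
      have am: "annulus x (r k) \<in> sets lborel" "annulus x (r (Suc k)) \<in> sets lborel" using r0[of k] r0[of "Suc k"] by auto
      have R: "0 \<le> r k ^ ?n" "0 < (r k / 4) ^ ?n" using r0[of k] by auto
      have "\<bar>c k - c (Suc k)\<bar> ^ ?n \<le> 2 ^ ?n * (B * r k ^ ?n * energy (annulus x (r k)) + B * r (Suc k) ^ ?n * energy (annulus x (r (Suc k)))) / (r k / 4) ^ ?n"
        using P am R B energy_nonneg r0[of k] r0[of "Suc k"] by (intro const_power_le[OF _ _ _ _ P(2,3) _ _ c1 _ c1]) (auto simp: N)
      also have "\<dots> \<le> 2 ^ ?n * (B * r k ^ ?n * energy (annulus x (r k)) + B * r k ^ ?n * energy (annulus x (r (Suc k)))) / (r k / 4) ^ ?n"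
      proof (intro divide_right_mono mult_left_mono add_left_mono mult_right_mono power_mono)
        show "r (Suc k) \<le> r k" by (simp add: r_def field_simps)
      qed (use B energy_nonneg R r0 in \<open>auto intro: less_imp_le\<close>)
      also have "\<dots> = Bc * (energy (annulus x (r k)) + energy (annulus x (r (Suc k))))"
      proof -
        have "(r k / 4) ^ ?n = r k ^ ?n / 4 ^ ?n" by (rule power_divide)
        moreover have "2 ^ ?n * (B * q * e1 + B * q * e2) / (q / 4 ^ ?n) = Bc * (e1 + e2)" if "0 < q" for q e1 e2
          using that by (simp add: Bc_def field_simps)
        moreover have "0 < r k ^ ?n" using r0[of k] by (rule zero_less_power)
        ultimately show ?thesis by simp
      qed
      finally show ?thesis unfolding Ea by (simp add: numeral_3_eq_3 numeral_2_eq_2)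
    qed
    \<comment> \<open>Passing from the power to the value itself uses t \<le>
      \<open>t ^ Suc m + 1\<close> for t \<ge> 0, the origin of the summand 1 in
      \<open>cs\<close>.\<close>
    have c0: "\<bar>c 0\<bar> \<le> cs"
    proof -
      obtain i :: 'n where True by simp
      have am: "annulus x (r 0) \<in> sets lborel" using r0[of 0] by auto
      have R: "0 < r 0 ^ ?n" "0 < (r 0 / 4) ^ ?n" using r0[of 0] by auto
      have ae: "ennreal ((r 0 / 4) ^ ?n) \<le> emeasure lborel (annulus x (r 0))"
        using emeasure_slab_ge[OF r0[of 0], of x i True] emeasure_mono[OF slab_subset_annulus[of "r 0" x i True], of lborel] am r0[of 0]
        by (auto simp: N intro: order_trans)
      have u0: "(\<integral>\<^sup>+y\<in>UNIV. ennreal (\<bar>u y - 0\<bar> ^ ?n) \<partial>lborel) \<le> ennreal Iu" using Iu by simp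
      have "\<bar>c 0 - 0\<bar> ^ ?n \<le> 2 ^ ?n * (B * r 0 ^ ?n * energy (annulus x (r 0)) + Iu) / (r 0 / 4) ^ ?n"
        using am R B energy_nonneg Iu by (intro const_power_le[OF _ _ _ _ subset_refl subset_UNIV ae _ c1 _ u0]) auto
      also have "\<dots> \<le> 2 ^ ?n * (B * r 0 ^ ?n * Es + Iu) / (r 0 / 4) ^ ?n"
        using B R energy_mono[OF subset_UNIV] unfolding Es_def by (intro divide_right_mono mult_left_mono add_right_mono) auto
      finally have "\<bar>c 0\<bar> ^ ?n + 1 \<le> cs" by (simp add: cs_def)
      moreover have "\<bar>c 0\<bar> \<le> \<bar>c 0\<bar> ^ ?n + 1" using power_Young[of "\<bar>c 0\<bar>" 1 1 m] by simp
      ultimately show ?thesis by linarith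
    qed
    have veq: "ennreal (v k) = (\<integral>\<^sup>+y\<in>cube x (r k). ennreal (V y) \<partial>lborel)" for k
    proof -
      have xin: "x \<in> cube x (r k)" using r0[of k] by (simp add: mem_cube)
      have "(\<integral>\<^sup>+y\<in>cube x (r k). ennreal (V y) \<partial>lborel) \<le> (\<integral>\<^sup>+z\<in>cube x (r k). ennreal (V z * logw \<sigma> (norm (x - z) / (2 * r k * real ?n))) \<partial>lborel)"
      proof (intro nn_integral_mono mult_right_mono ennreal_leI)
        show "V z \<le> V z * logw \<sigma> (norm (x - z) / (2 * r k * real ?n))" for z
          using mult_left_mono[OF logw_ge_1[of \<sigma> "norm (x - z) / (2 * r k * real ?n)"], of "V z"] \<sigma>1 V0 by simp
      qed auto
      also have "\<dots> \<le> ennreal w" by (rule W[OF x xin])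
      finally have "(\<integral>\<^sup>+y\<in>cube x (r k). ennreal (V y) \<partial>lborel) < \<infinity>" by (rule le_less_trans) simp
      then show ?thesis unfolding v_def mass_def by (subst ennreal_enn2real) auto
    qed
    have AEx: "AE y in lborel. y \<noteq> x" by (rule AE_lborel_singleton)
    \<comment> \<open>The weighted sum of masses is the integral of V against a weighted sum of
      indicators of cubes, which \<open>dyadic_log_lower\<close> bounds by L.\<close>
    have vP: "(\<Sum>k\<le>n. real (k + k0) powr (\<sigma> - 1) * v k) \<le> P" for n
    proof -
      have "ennreal (\<Sum>k\<le>n. real (k + k0) powr (\<sigma> - 1) * v k) = (\<Sum>k\<le>n. ennreal (real (k + k0) powr (\<sigma> - 1)) * ennreal (v k))"
        using v0 by (subst sum_ennreal[symmetric]) (auto simp: ennreal_mult)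
      also have "\<dots> = (\<integral>\<^sup>+y. (\<Sum>k\<le>n. ennreal (real (k + k0) powr (\<sigma> - 1)) * (ennreal (V y) * indicator (cube x (r k)) y)) \<partial>lborel)"
        unfolding veq by (subst nn_integral_sum) (auto simp: nn_integral_cmult)
      also have "\<dots> \<le> (\<integral>\<^sup>+y. ennreal Cp * (ennreal (V y * logw \<sigma> (norm (x - y))) * indicator (D \<inter> cball x \<rho>) y) \<partial>lborel)"
      proof (rule nn_integral_mono_AE)
        show "AE y in lborel. (\<Sum>k\<le>n. ennreal (real (k + k0) powr (\<sigma> - 1)) * (ennreal (V y) * indicator (cube x (r k)) y)) \<le>
          ennreal Cp * (ennreal (V y * logw \<sigma> (norm (x - y))) * indicator (D \<inter> cball x \<rho>) y)"
          using AEx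
        proof eventually_elim
          case (elim y)
          have eq: "(\<Sum>k\<le>n. ennreal (real (k + k0) powr (\<sigma> - 1)) * (ennreal (V y) * indicator (cube x (r k)) y))
            = ennreal (V y * (\<Sum>k\<le>n. real (k + k0) powr (\<sigma> - 1) * indicator (cube x (r k)) y))"
            using V0[of y] unfolding sum_distrib_left
            by (subst sum_ennreal[symmetric]) (auto intro!: sum.cong simp: indicator_def ennreal_mult mult.commute)
          show ?case
          proof (cases "y \<in> cube x (r 0)")
            case True
            have "x \<in> cube x (r 0)" using r0[of 0] by (simp add: mem_cube)
            then have yin: "y \<in> D \<inter> cball x \<rho>" using True cubeD[OF x] cube\<rho>[OF x] by blast
            have "V y * (\<Sum>k\<le>n. real (k + k0) powr (\<sigma> - 1) * indicator (cube x (r k)) y) \<le> V y * (Cp * logw \<sigma> (norm (y - x)))"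
              unfolding r_def Cp_def using dyadic_log_lower[OF _ k0(2) elim, of \<sigma> n] \<sigma>1 V0 by (intro mult_left_mono) auto
            also have "\<dots> = Cp * (V y * logw \<sigma> (norm (x - y)))" by (simp add: norm_minus_commute)
            finally show ?thesis unfolding eq using yin Cp V0[of y] logw_nonneg[of \<sigma>]
              by (simp add: ennreal_mult[symmetric] ennreal_leI)
          next
            case False
            then have "y \<notin> cube x (r k)" for k using cube_mono[OF rmono[of k], of x] by blast
            then show ?thesis by simp
          qed
        qed
      qed
      also have "\<dots> = ennreal Cp * (\<integral>\<^sup>+y\<in>D \<inter> cball x \<rho>. ennreal (V y * logw \<sigma> (norm (x - y))) \<partial>lborel)"
        by (rule nn_integral_cmult) measurable
      also have "\<dots> \<le> ennreal Cp * ennreal w" by (intro mult_left_mono \<rho>) auto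
      also have "\<dots> = ennreal P" using Cp w by (simp add: P_def ennreal_mult)
      finally show ?thesis using P by (simp add: ennreal_le_iff)
    qed
    have "E 0 \<le> Es" unfolding E_def Es_def by (rule energy_mono) simp
    then have SM: "(\<Sum>k<n. (E k - E (Suc k)) * real (k + k0) powr \<sigma>) \<le> M" for n
      using spec[OF spec[OF spec[OF M, of E], of c], of v] E0 dec c0 v0 hole chain vP by blast
    \<comment> \<open>The energy density on the k-th dyadic shell with the constant value that
      dominates L there. The shells cover the cube up to its centre, and their energies are the
      differences of consecutive E.\<close>
    define h where "h k y = ennreal (3 powr \<sigma> * real (k + k0) powr \<sigma>) * (ennreal (norm (G y) ^ ?n) * indicator (cube x (r k) - cube x (r (Suc k))) y)" for k y
    have hm[measurable]: "h k \<in> borel_measurable borel" for k unfolding h_def by measurable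
    have "(\<integral>\<^sup>+y\<in>cube x (r 0). ennreal (norm (G y) ^ ?n * logw \<sigma> (norm (y - x))) \<partial>lborel) \<le> (\<integral>\<^sup>+y. (\<Sum>k. h k y) \<partial>lborel)"
    proof (rule nn_integral_mono_AE)
      show "AE y in lborel. ennreal (norm (G y) ^ ?n * logw \<sigma> (norm (y - x))) * indicator (cube x (r 0)) y \<le> (\<Sum>k. h k y)"
        using AEx
      proof eventually_elim
        case (elim y)
        show ?case
        proof (cases "y \<in> cube x (r 0)")
          case True
          then have "y \<in> cube x (1 / 2 ^ k0)" by (simp add: r_def)
          from dyadic_log_upper[OF less_imp_le[OF \<sigma>0] k0(2) elim this]
          obtain k where k: "y \<in> cube x (r k)" "y \<notin> cube x (r (Suc k))" "logw \<sigma> (norm (y - x)) \<le> 3 powr \<sigma> * real (k + k0) powr \<sigma>"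
            unfolding r_def by auto
          have "norm (G y) ^ ?n * logw \<sigma> (norm (y - x)) \<le> norm (G y) ^ ?n * (3 powr \<sigma> * real (k + k0) powr \<sigma>)"
            using k(3) by (intro mult_left_mono) auto
          then have "ennreal (norm (G y) ^ ?n * logw \<sigma> (norm (y - x))) \<le> ennreal (norm (G y) ^ ?n * (3 powr \<sigma> * real (k + k0) powr \<sigma>))"
            by (rule ennreal_leI)
          also have "\<dots> = h k y" using k by (simp add: h_def ennreal_mult mult.commute del: power_Suc)
          also have "\<dots> \<le> (\<Sum>k. h k y)" using sum_le_suminf[of "\<lambda>k. h k y" "{k}"] by simp
          finally show ?thesis using True by simp
        qed simp
      qed
    qed
    also have "\<dots> = (\<Sum>k. \<integral>\<^sup>+y. h k y \<partial>lborel)" by (rule nn_integral_suminf) measurable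
    also have "\<dots> \<le> ennreal (3 powr \<sigma> * max 0 M)"
    proof (rule suminf_le_const[OF summableI])
      fix n
      have "(\<integral>\<^sup>+y. h k y \<partial>lborel) = ennreal (3 powr \<sigma> * ((E k - E (Suc k)) * real (k + k0) powr \<sigma>))" for k
      proof -
        have "(\<integral>\<^sup>+y. h k y \<partial>lborel) = ennreal (3 powr \<sigma> * real (k + k0) powr \<sigma>) * ennreal (energy (cube x (r k) - cube x (r (Suc k))))"
          unfolding h_def energy_eq[symmetric] by (rule nn_integral_cmult) measurable
        also have "energy (cube x (r k) - cube x (r (Suc k))) = E k - E (Suc k)"
          unfolding E_def by (intro energy_Diff csub) auto
        finally show ?thesis using dec[of k] by (simp add: ennreal_mult[symmetric] mult_ac)
      qed
      then have "(\<Sum>k<n. \<integral>\<^sup>+y. h k y \<partial>lborel) = ennreal (\<Sum>k<n. 3 powr \<sigma> * ((E k - E (Suc k)) * real (k + k0) powr \<sigma>))"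
        using dec by (simp add: sum_ennreal)
      also have "(\<Sum>k<n. 3 powr \<sigma> * ((E k - E (Suc k)) * real (k + k0) powr \<sigma>)) = 3 powr \<sigma> * (\<Sum>k<n. (E k - E (Suc k)) * real (k + k0) powr \<sigma>)"
        by (simp add: sum_distrib_left)
      also have "ennreal \<dots> \<le> ennreal (3 powr \<sigma> * max 0 M)"
        using SM[of n] by (intro ennreal_leI mult_left_mono) auto
      finally show "(\<Sum>k<n. \<integral>\<^sup>+y. h k y \<partial>lborel) \<le> ennreal (3 powr \<sigma> * max 0 M)" .
    qed
    finally show ?thesis .
  qed
  then show ?thesis using r0[of 0] by (intro exI[of _ "r 0"] conjI exI[of _ "3 powr \<sigma> * max 0 M"] ballI) auto
qed

end

text \<open>The decrease of L removes the scaling by d, and lowering the exponent gains a negative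
  power of the logarithm of 1 / t, which for t \<le> d is at most the one at d. This gain is the
  modulus of continuity.\<close>

lemma logw_scale_le:
  assumes t: "0 < t" "t \<le> d" "d \<le> 1" and \<sigma>: "0 \<le> \<sigma>'" "\<sigma>' \<le> \<sigma>"
  shows "logw \<sigma>' (t / d) \<le> (1 + ln (1 / d)) powr (- (\<sigma> - \<sigma>')) * logw \<sigma> t"
proof -
  have d: "0 < d" using t by linarith
  have lt: "0 \<le> ln (1 / t)" and ld: "0 \<le> ln (1 / d)" using t d by auto
  have "logw \<sigma>' (t / d) \<le> logw \<sigma>' t"
    using t d \<sigma> by (intro logw_antimono) (auto simp: pos_le_divide_eq mult_le_cancel_left1)
  also have "\<dots> = (1 + ln (1 / t)) powr (- (\<sigma> - \<sigma>')) * logw \<sigma> t"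
    using lt by (simp add: logw_def powr_add[symmetric])
  also have "\<dots> \<le> (1 + ln (1 / d)) powr (- (\<sigma> - \<sigma>')) * logw \<sigma> t"
  proof (intro mult_right_mono powr_mono2')
    show "1 + ln (1 / d) \<le> 1 + ln (1 / t)" using t d by (simp add: ln_div)
  qed (use \<sigma> ld logw_nonneg in auto)
  finally show ?thesis .
qed

section \<open>Oscillation of the solution on small cubes\<close>

context borel_solution
begin

text \<open>Any exponent strictly between m and \<sigma> would do: above m for the kernel
  inequality, below \<sigma> to leave a gain.\<close>

definition \<sigma>' :: real where "\<sigma>' = (real m + \<sigma>) / 2"

lemma \<sigma>': "real m < \<sigma>'" "\<sigma>' < \<sigma>" "0 < \<sigma>'"
  using \<sigma> m by (auto simp: \<sigma>'_def)

lemma compact_neighbourhood: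
  assumes "compact K" "K \<subseteq> D"
  shows "\<exists>\<delta>>0. compact (\<Union>x\<in>K. cball x \<delta>) \<and> (\<Union>x\<in>K. cball x \<delta>) \<subseteq> D"
proof -
  obtain \<delta> where \<delta>: "0 < \<delta>" "(\<Union>x\<in>K. cball x \<delta>) \<subseteq> D"
    using compact_subset_open_imp_cball_epsilon_subset[OF assms(1) D(1) assms(2)] by metis
  then show ?thesis using compact_minkowski_sum_cball[OF assms(1), of \<delta>] by blast
qed

text \<open>The kernel inequality at a single point x would bound the mean deviation
  \<open>h x\<close> of u from u x, but for Sobolev functions it is available only after integration
  in x against a density. It is therefore used with the indicator of the set \<open>E\<close> where
  the expected bound fails; the bound integrated over E forces E to be a null set.\<close>

lemma ae_oscillation:
  assumes K': "compact K'" "K' \<subseteq> D"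
  shows "\<exists>C\<ge>0. \<exists>\<rho>0>0. \<forall>z\<in>K'. \<forall>\<rho>. 0 < \<rho> \<and> \<rho> < \<rho>0 \<longrightarrow> 2 * \<rho> * real (Suc m) \<le> 1 \<and>
    (\<exists>Nul\<in>null_sets lborel. \<forall>x x'. x \<in> cube z \<rho> - Nul \<and> x' \<in> cube z \<rho> - Nul \<longrightarrow>
      \<bar>u x - u x'\<bar> ^ Suc m \<le> C * (1 + ln (1 / (2 * \<rho> * real (Suc m)))) powr (- (\<sigma> - \<sigma>')))"
proof -
  let ?n = "Suc m"
  obtain \<delta> where \<delta>: "0 < \<delta>" "compact (\<Union>x\<in>K'. cball x \<delta>)" "(\<Union>x\<in>K'. cball x \<delta>) \<subseteq> D"
    using compact_neighbourhood[OF K'] by blast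
  let ?K1 = "\<Union>x\<in>K'. cball x \<delta>"
  obtain R M where R: "0 < R" and M: "0 \<le> M"
    "\<And>x. x \<in> ?K1 \<Longrightarrow> (\<integral>\<^sup>+y\<in>cube x R. ennreal (norm (G y) ^ ?n * logw \<sigma> (norm (y - x))) \<partial>lborel) \<le> ennreal M"
    using uniform_weighted_energy[OF \<delta>(2,3)] by blast
  obtain b where b: "0 < b" "\<And>d y. 0 < d \<Longrightarrow>
    (\<integral>\<^sup>+x\<in>cball (y::real^'n) d. ennreal (logw \<sigma>' (norm (y - x) / d)) \<partial>lborel) \<le> ennreal (b * d ^ ?n)"
    using nn_integral_logw_ball[OF \<sigma>'(3), where 'a="real^'n"] by (auto simp: N)
  define C0 where "C0 = kernel_const m \<sigma>'"
  have C0: "0 < C0" unfolding C0_def by (rule kernel_const_pos[OF m \<sigma>'(1)])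
  define C where "C = 2 ^ ?n * 2 * (C0 * real ?n ^ ?n * M)"
  have Cnn: "0 \<le> C" using C0 M by (simp add: C_def)
  \<comment> \<open>Keeps the diameter of the cubes at most 1 and at most \<delta>, and each such
    cube inside \<open>cube x R\<close> for every x in it.\<close>
  define \<rho>0 where "\<rho>0 = min (R / 2) (min 1 \<delta> / (2 * real ?n))"
  have \<rho>0: "0 < \<rho>0" using R \<delta> by (simp add: \<rho>0_def)
  have main: "2 * \<rho> * real ?n \<le> 1 \<and>
    (\<exists>Nul\<in>null_sets lborel. \<forall>x x'. x \<in> cube z \<rho> - Nul \<and> x' \<in> cube z \<rho> - Nul \<longrightarrow>
      \<bar>u x - u x'\<bar> ^ ?n \<le> C * (1 + ln (1 / (2 * \<rho> * real ?n))) powr (- (\<sigma> - \<sigma>')))"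
    if z: "z \<in> K'" and \<rho>: "0 < \<rho>" "\<rho> < \<rho>0" for z \<rho>
  proof -
    let ?Q = "cube z \<rho>"
    define d where "d = 2 * \<rho> * real ?n"
    have "\<rho> < min 1 \<delta> / (2 * real ?n)" using \<rho> by (simp add: \<rho>0_def)
    then have d: "d \<le> 1" "d \<le> \<delta>" and R2: "2 * \<rho> \<le> R"
      using \<rho> by (auto simp: d_def field_simps \<rho>0_def)
    have "0 < d" unfolding d_def using \<rho> by (intro mult_pos_pos) auto
    note d = this d
    have zin: "z \<in> ?Q" using \<rho> by (simp add: mem_cube)
    have dQ: "norm (x - y) \<le> d" if "x \<in> ?Q" "y \<in> ?Q" for x y
      using cube_norm_le[OF that] by (simp add: d_def N)
    have QK1: "?Q \<subseteq> ?K1"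
    proof
      fix x assume "x \<in> ?Q"
      then have "x \<in> cball z \<delta>" using dQ[OF zin] d by (auto simp: dist_norm intro: order_trans)
      then show "x \<in> ?K1" using z by blast
    qed
    then have QD: "?Q \<subseteq> D" using \<delta>(3) by blast
    note sc = closure_cube[OF QD]
    have QR: "?Q \<subseteq> cube x R" if x: "x \<in> ?Q" for x
    proof
      fix y assume y: "y \<in> ?Q"
      show "y \<in> cube x R" unfolding mem_cube
      proof
        fix k
        have "\<bar>y $ k - z $ k\<bar> \<le> \<rho>" "\<bar>x $ k - z $ k\<bar> \<le> \<rho>" using x y unfolding mem_cube by blast+
        then show "\<bar>y $ k - x $ k\<bar> \<le> R" using R2 by linarith
      qed
    qed
    \<comment> \<open>The logarithmic gain of \<open>logw_scale_le\<close> at the diameter d of the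
      cube.\<close>
    define \<Lambda> where "\<Lambda> = (1 + ln (1 / d)) powr (- (\<sigma> - \<sigma>'))"
    have \<Lambda>: "0 \<le> \<Lambda>" by (simp add: \<Lambda>_def)
    define h where "h x = (\<integral>\<^sup>+y\<in>?Q. ennreal (\<bar>u y - u x\<bar> ^ ?n) \<partial>lborel)" for x
    have hm[measurable]: "h \<in> borel_measurable borel" unfolding h_def by measurable
    define \<kappa> where "\<kappa> = C0 * d ^ ?n * (\<Lambda> * M)"
    have \<kappa>: "0 \<le> \<kappa>" using C0 d \<Lambda> M by (simp add: \<kappa>_def)
    \<comment> \<open>The bad set, for the bound \<kappa> that a pointwise kernel inequality would
      give. If E had positive measure, the integrated inequality would give a point of E with
      \<open>h x\<close> \<le> \<kappa>.\<close>
    define E where "E = {x \<in> ?Q. ennreal \<kappa> < h x}"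
    have Em[measurable]: "E \<in> sets borel"
    proof -
      have "E = ?Q \<inter> {x \<in> space borel. ennreal \<kappa> < h x}" by (auto simp: E_def)
      also have "\<dots> \<in> sets borel" by measurable
      finally show ?thesis .
    qed
    have EQ: "E \<subseteq> ?Q" by (auto simp: E_def)
    define W where "W y = (\<integral>\<^sup>+x\<in>?Q. ennreal (indicator E x * logw \<sigma>' (norm (y - x) / d)) \<partial>lborel)" for y
    have Wb: "W y \<le> ennreal (b * d ^ ?n)" if y: "y \<in> ?Q" for y
    proof -
      have "?Q \<subseteq> cball y d" using dQ[OF y] by (auto simp: dist_norm)
      then have "W y \<le> (\<integral>\<^sup>+x\<in>cball y d. ennreal (logw \<sigma>' (norm (y - x) / d)) \<partial>lborel)"
        unfolding W_def by (intro nn_integral_mono) (auto simp: indicator_def)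
      then show ?thesis using b(2)[OF d(1), of y] by (rule order_trans)
    qed
    have "(\<integral>\<^sup>+x\<in>E. h x \<partial>lborel) = (\<integral>\<^sup>+x\<in>?Q. (\<integral>\<^sup>+y\<in>?Q. ennreal (indicator E x * \<bar>u y - u x\<bar> ^ ?n) \<partial>lborel) \<partial>lborel)"
    proof (rule nn_integral_cong)
      fix x
      show "h x * indicator E x = (\<integral>\<^sup>+y\<in>?Q. ennreal (indicator E x * \<bar>u y - u x\<bar> ^ ?n) \<partial>lborel) * indicator ?Q x"
        using EQ by (cases "x \<in> E") (auto simp: h_def)
    qed
    also have "\<dots> \<le> ennreal (C0 * d ^ ?n) * (\<integral>\<^sup>+y\<in>?Q. norm (G y) ^ ?n * W y \<partial>lborel)"
      unfolding C0_def using b d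
      by (intro sobolev_kernel_bound[OF sc N m \<sigma>'(1) cube_convex cube_in_borel d(1) dQ _ _ W_def Wb]) auto
    also have "(\<integral>\<^sup>+y\<in>?Q. norm (G y) ^ ?n * W y \<partial>lborel) = (\<integral>\<^sup>+y. (\<integral>\<^sup>+x. ennreal (norm (G y) ^ ?n * logw \<sigma>' (norm (y - x) / d)) * indicator ?Q y * indicator E x \<partial>lborel) \<partial>lborel)"
    proof (rule nn_integral_cong)
      fix y
      have "ennreal (norm (G y) ^ ?n * logw \<sigma>' (norm (y - x) / d)) * indicator ?Q y * indicator E x
        = ennreal (norm (G y) ^ ?n) * indicator ?Q y * (ennreal (indicator E x * logw \<sigma>' (norm (y - x) / d)) * indicator ?Q x)" for x
        using subsetD[OF EQ, of x] logw_nonneg[of \<sigma>'] by (cases "x \<in> E") (auto simp: ennreal_mult mult_ac simp del: power_Suc)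
      then show "ennreal (norm (G y) ^ ?n) * W y * indicator ?Q y = (\<integral>\<^sup>+x. ennreal (norm (G y) ^ ?n * logw \<sigma>' (norm (y - x) / d)) * indicator ?Q y * indicator E x \<partial>lborel)"
        by (simp only:) (subst nn_integral_cmult, measurable, simp only: W_def mult_ac)
    qed
    also have "\<dots> = (\<integral>\<^sup>+x. (\<integral>\<^sup>+y. ennreal (norm (G y) ^ ?n * logw \<sigma>' (norm (y - x) / d)) * indicator ?Q y * indicator E x \<partial>lborel) \<partial>lborel)"
      by (rule lborel_pair.Fubini') measurable
    also have "\<dots> \<le> (\<integral>\<^sup>+x\<in>E. ennreal (\<Lambda> * M) \<partial>lborel)"
    proof (rule nn_integral_mono)
      fix x
      show "(\<integral>\<^sup>+y. ennreal (norm (G y) ^ ?n * logw \<sigma>' (norm (y - x) / d)) * indicator ?Q y * indicator E x \<partial>lborel) \<le> ennreal (\<Lambda> * M) * indicator E x"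
      proof (cases "x \<in> E")
        case True
        then have xQ: "x \<in> ?Q" using EQ by blast
        have "(\<integral>\<^sup>+y. ennreal (norm (G y) ^ ?n * logw \<sigma>' (norm (y - x) / d)) * indicator ?Q y * indicator E x \<partial>lborel)
          \<le> (\<integral>\<^sup>+y. ennreal \<Lambda> * (ennreal (norm (G y) ^ ?n * logw \<sigma> (norm (y - x))) * indicator (cube x R) y) \<partial>lborel)"
        proof (rule nn_integral_mono_AE)
          have "AE y in lborel. y \<noteq> x" by (rule AE_lborel_singleton)
          then show "AE y in lborel. ennreal (norm (G y) ^ ?n * logw \<sigma>' (norm (y - x) / d)) * indicator ?Q y * indicator E x \<le> ennreal \<Lambda> * (ennreal (norm (G y) ^ ?n * logw \<sigma> (norm (y - x))) * indicator (cube x R) y)"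
          proof eventually_elim
            case (elim y)
            show ?case
            proof (cases "y \<in> ?Q")
              case yQ: True
              have "logw \<sigma>' (norm (y - x) / d) \<le> \<Lambda> * logw \<sigma> (norm (y - x))"
                unfolding \<Lambda>_def using elim dQ[OF yQ xQ] d \<sigma>' by (intro logw_scale_le) auto
              then have "norm (G y) ^ ?n * logw \<sigma>' (norm (y - x) / d) \<le> norm (G y) ^ ?n * (\<Lambda> * logw \<sigma> (norm (y - x)))"
                by (intro mult_left_mono) auto
              then have "ennreal (norm (G y) ^ ?n * logw \<sigma>' (norm (y - x) / d)) \<le> ennreal (norm (G y) ^ ?n * (\<Lambda> * logw \<sigma> (norm (y - x))))"
                by (rule ennreal_leI)
              also have "\<dots> = ennreal \<Lambda> * ennreal (norm (G y) ^ ?n * logw \<sigma> (norm (y - x)))"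
                using \<Lambda> logw_nonneg[of \<sigma> "norm (y - x)"] by (subst ennreal_mult[symmetric]) (auto simp: mult_ac)
              finally show ?thesis using yQ True QR[OF xQ] by (auto simp: subset_iff)
            qed simp
          qed
        qed
        also have "\<dots> = ennreal \<Lambda> * (\<integral>\<^sup>+y\<in>cube x R. ennreal (norm (G y) ^ ?n * logw \<sigma> (norm (y - x))) \<partial>lborel)"
          by (rule nn_integral_cmult) measurable
        also have "\<dots> \<le> ennreal \<Lambda> * ennreal M" by (intro mult_left_mono M(2)[OF subsetD[OF QK1 xQ]]) auto
        also have "\<dots> = ennreal (\<Lambda> * M)" using \<Lambda> M by (simp add: ennreal_mult)
        finally show ?thesis using True by simp
      qed simp
    qed
    also have "\<dots> = ennreal (\<Lambda> * M) * emeasure lborel E" by (rule nn_integral_cmult_indicator) simp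
    finally have hE: "(\<integral>\<^sup>+x\<in>E. h x \<partial>lborel) \<le> ennreal (C0 * d ^ ?n) * (ennreal (\<Lambda> * M) * emeasure lborel E)"
      by (simp add: mult_left_mono del: power_Suc)
    have "emeasure lborel E \<le> ennreal ((2 * \<rho>) ^ CARD('n))" by (rule emeasure_le_cube[OF EQ]) (use \<rho> in simp)
    then have "emeasure lborel E < \<infinity>" by (rule le_less_trans) simp
    then obtain q where q: "emeasure lborel E = ennreal q" "0 \<le> q"
      by (metis less_top_ennreal infinity_ennreal_def)
    have Enull: "E \<in> null_sets lborel"
    proof (cases "q = 0")
      case True then show ?thesis using q by (simp add: null_sets_def)
    next
      case False
      have "ennreal (C0 * d ^ ?n) * (ennreal (\<Lambda> * M) * ennreal q) = ennreal (\<kappa> * q)"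
        using C0 d \<Lambda> M q unfolding \<kappa>_def
        by (simp add: ennreal_mult[symmetric] mult_ac mult_nonneg_nonneg del: power_Suc)
      then have "(\<integral>\<^sup>+x\<in>E. h x \<partial>lborel) \<le> ennreal (\<kappa> * q)" using hE q by simp
      then have "\<exists>x\<in>E. h x \<le> ennreal (\<kappa> * q / q)"
        using q False \<kappa> by (intro nn_integral_first_moment) auto
      then obtain x where "x \<in> E" "h x \<le> ennreal \<kappa>" using False by auto
      then show ?thesis by (auto simp: E_def not_less[symmetric])
    qed
    \<comment> \<open>Outside E both values u x and u x' are close to u in the mean over the cube.
      Comparing them as constants divides by the volume, which cancels the power of d in
      \<kappa>.\<close>
    have "\<bar>u x - u x'\<bar> ^ ?n \<le> C * \<Lambda>" if x: "x \<in> ?Q - E" "x' \<in> ?Q - E" for x x'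
    proof -
      have hx: "(\<integral>\<^sup>+y\<in>?Q. ennreal (\<bar>u y - u x\<bar> ^ ?n) \<partial>lborel) \<le> ennreal \<kappa>"
        "(\<integral>\<^sup>+y\<in>?Q. ennreal (\<bar>u y - u x'\<bar> ^ ?n) \<partial>lborel) \<le> ennreal \<kappa>"
      proof -
        have "h x \<le> ennreal \<kappa>" "h x' \<le> ennreal \<kappa>" using x by (auto simp: E_def not_less)
        then show "(\<integral>\<^sup>+y\<in>?Q. ennreal (\<bar>u y - u x\<bar> ^ ?n) \<partial>lborel) \<le> ennreal \<kappa>"
          "(\<integral>\<^sup>+y\<in>?Q. ennreal (\<bar>u y - u x'\<bar> ^ ?n) \<partial>lborel) \<le> ennreal \<kappa>" unfolding h_def .
      qed
      have q: "ennreal ((2 * \<rho>) ^ ?n) \<le> emeasure lborel ?Q" using emeasure_cube[of \<rho> z] \<rho> by (simp add: N)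
      have "\<bar>u x - u x'\<bar> ^ ?n \<le> 2 ^ ?n * (\<kappa> + \<kappa>) / (2 * \<rho>) ^ ?n"
        using \<rho> \<kappa> by (intro const_power_le[OF _ _ _ _ subset_refl subset_refl q _ hx(1) _ hx(2)]) auto
      also have "\<dots> = C * \<Lambda>"
      proof -
        have "d ^ ?n = (2 * \<rho>) ^ ?n * real ?n ^ ?n" unfolding d_def by (rule power_mult_distrib)
        moreover have "2 ^ ?n * (C0 * (p * e) * (\<Lambda> * M) + C0 * (p * e) * (\<Lambda> * M)) / p = 2 ^ ?n * 2 * (C0 * e * M) * \<Lambda>" if "0 < p" for p e
          using that by (simp add: field_simps)
        moreover have "0 < (2 * \<rho>) ^ ?n" using \<rho> by simp
        ultimately show ?thesis unfolding \<kappa>_def C_def by (simp only:)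
      qed
      finally show ?thesis .
    qed
    then show ?thesis using Enull d unfolding \<Lambda>_def d_def by blast
  qed
  show ?thesis by (rule exI[of _ C], rule conjI[OF Cnn], rule exI[of _ \<rho>0], rule conjI[OF \<rho>0]) (use main in blast)
qed

text \<open>The exceptional set of \<open>ae_oscillation\<close> depends on the cube. Countably many
  cubes, with centres in a dense set and rational radii, suffice to enclose any two close points, so
  a single null set works for all pairs.\<close>

lemma ae_modulus:
  assumes K': "compact K'" "K' \<subseteq> D"
  shows "\<exists>\<gamma>>0. \<exists>C>0. \<exists>t0>0. \<exists>Nul\<in>null_sets lborel. t0 < 1 \<and> (\<forall>x x'. x \<in> K' - Nul \<and> x' \<notin> Nul \<and> 0 < norm (x - x') \<and> norm (x - x') < t0
     \<longrightarrow> \<bar>u x - u x'\<bar> \<le> C * \<bar>ln (norm (x - x'))\<bar> powr (- \<gamma>))"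
proof -
  let ?n = "real (Suc m)" and ?\<beta> = "\<sigma> - \<sigma>'"
  have \<beta>: "0 < ?\<beta>" using \<sigma>' by simp
  obtain \<delta> where \<delta>: "0 < \<delta>" "compact (\<Union>x\<in>K'. cball x \<delta>)" "(\<Union>x\<in>K'. cball x \<delta>) \<subseteq> D"
    using compact_neighbourhood[OF K'] by blast
  let ?K1 = "\<Union>x\<in>K'. cball x \<delta>"
  obtain C \<rho>0 where C: "0 \<le> C" and \<rho>0: "0 < \<rho>0" and osc: "\<forall>z\<in>?K1. \<forall>\<rho>. 0 < \<rho> \<and> \<rho> < \<rho>0 \<longrightarrow> 2 * \<rho> * ?n \<le> 1 \<and>
    (\<exists>Nul\<in>null_sets lborel. \<forall>x x'. x \<in> cube z \<rho> - Nul \<and> x' \<in> cube z \<rho> - Nul \<longrightarrow>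
      \<bar>u x - u x'\<bar> ^ Suc m \<le> C * (1 + ln (1 / (2 * \<rho> * ?n))) powr (- ?\<beta>))"
    using ae_oscillation[OF \<delta>(2,3)] by blast
  obtain T :: "(real^'n) set" where T: "countable T" "\<And>X. open X \<Longrightarrow> X \<noteq> {} \<Longrightarrow> \<exists>d\<in>T. d \<in> X"
    by (rule countable_dense_setE) blast
  define Idx where "Idx = (T \<inter> ?K1) \<times> (\<rat> \<inter> {0<..<\<rho>0})"
  have cI: "countable Idx" unfolding Idx_def using T(1) countable_rat by (intro countable_SIGMA) (auto intro: countable_subset)
  have "\<forall>p\<in>Idx. \<exists>Nul. Nul \<in> null_sets lborel \<and> (\<forall>x x'. x \<in> cube (fst p) (snd p) - Nul \<and> x' \<in> cube (fst p) (snd p) - Nul \<longrightarrow>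
      \<bar>u x - u x'\<bar> ^ Suc m \<le> C * (1 + ln (1 / (2 * snd p * ?n))) powr (- ?\<beta>))"
    using osc by (fastforce simp: Idx_def)
  then obtain Nl where Nl: "\<And>p. p \<in> Idx \<Longrightarrow> Nl p \<in> null_sets lborel"
    "\<And>p x x'. p \<in> Idx \<Longrightarrow> x \<in> cube (fst p) (snd p) - Nl p \<Longrightarrow> x' \<in> cube (fst p) (snd p) - Nl p \<Longrightarrow>
      \<bar>u x - u x'\<bar> ^ Suc m \<le> C * (1 + ln (1 / (2 * snd p * ?n))) powr (- ?\<beta>)"
    by (metis bchoice)
  define Nul where "Nul = (\<Union>p\<in>Idx. Nl p)"
  have Nul: "Nul \<in> null_sets lborel" unfolding Nul_def using cI Nl(1) by (intro null_sets_UN') auto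
  \<comment> \<open>The first two bounds keep the enclosing cube admissible. The third gives ln (8n)
    at most half of ln (1 / t), so that passing from the distance t to the diameter of the cube
    costs at most half of the logarithm.\<close>
  define t0 where "t0 = min (\<rho>0 / 4) (min \<delta> (1 / (8 * ?n) ^ 2))"
  have n8: "1 < 8 * ?n" by simp
  have t0: "0 < t0" "t0 < 1"
  proof -
    show "0 < t0" using \<rho>0 \<delta> by (simp add: t0_def)
    have "1 < (8 * ?n) ^ 2" using n8 by (intro one_less_power) auto
    then have "1 / (8 * ?n) ^ 2 < 1" by (simp add: divide_less_eq_1)
    then show "t0 < 1" unfolding t0_def by linarith
  qed
  \<comment> \<open>The oscillation is bounded to the power n; taking the root divides the exponent
    of the logarithm by n.\<close>
  define \<gamma> where "\<gamma> = ?\<beta> / ?n"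
  have \<gamma>: "0 < \<gamma>" using \<beta> by (simp add: \<gamma>_def)
  define C' where "C' = (C * (1 / 2) powr (- ?\<beta>)) powr (1 / ?n) + 1"
  have C': "0 < C'" by (simp add: C'_def add_nonneg_pos)
  have "\<bar>u x - u x'\<bar> \<le> C' * \<bar>ln (norm (x - x'))\<bar> powr (- \<gamma>)"
    if x: "x \<in> K' - Nul" "x' \<notin> Nul" "0 < norm (x - x')" "norm (x - x') < t0" for x x'
  proof -
    let ?t = "norm (x - x')"
    obtain z where z: "z \<in> T" "z \<in> ball x ?t" using T(2)[of "ball x ?t"] x(3) by auto
    \<comment> \<open>With the centre z closer than t to x, a radius above 2t encloses both points,
      and one below 4t keeps the cube comparable to their distance.\<close>
    obtain \<rho> where \<rho>: "\<rho> \<in> \<rat>" "2 * ?t < \<rho>" "\<rho> < 4 * ?t"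
      using Rats_dense_in_real[of "2 * ?t" "4 * ?t"] x(3) by auto
    have tb: "4 * ?t < \<rho>0" "?t < \<delta>" "?t < 1 / (8 * ?n) ^ 2" using x(4) by (auto simp: t0_def)
    have zK: "z \<in> ?K1" using x(1) z(2) tb by (auto simp: intro!: bexI[of _ x])
    have p: "(z, \<rho>) \<in> Idx" unfolding Idx_def using z(1) zK \<rho> x(3) tb by auto
    have xz: "norm (x - z) < ?t" using z(2) by (simp add: dist_norm)
    have xc: "x \<in> cube z \<rho>"
      unfolding mem_cube
    proof
      fix k show "\<bar>x $ k - z $ k\<bar> \<le> \<rho>"
        using component_le_norm_cart[of "x - z" k] xz \<rho>(2) x(3) by simp
    qed
    have "norm (x' - z) \<le> norm (x' - x) + norm (x - z)" using norm_triangle_ineq[of "x' - x" "x - z"] by simp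
    then have x'z: "norm (x' - z) \<le> \<rho>" using xz \<rho>(2) by (simp add: norm_minus_commute)
    have xc': "x' \<in> cube z \<rho>"
      unfolding mem_cube
    proof
      fix k show "\<bar>x' $ k - z $ k\<bar> \<le> \<rho>" using component_le_norm_cart[of "x' - z" k] x'z by simp
    qed
    have "x \<notin> Nl (z, \<rho>)" "x' \<notin> Nl (z, \<rho>)" using x p by (auto simp: Nul_def)
    then have o: "\<bar>u x - u x'\<bar> ^ Suc m \<le> C * (1 + ln (1 / (2 * \<rho> * ?n))) powr (- ?\<beta>)"
      using Nl(2)[OF p, of x x'] xc xc' by simp
    have lt: "0 < ln (1 / ?t)" using x(3,4) t0 by simp
    have "ln (1 / ?t) / 2 \<le> 1 + ln (1 / (2 * \<rho> * ?n))"
    proof -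
      have "(8 * ?n) ^ 2 < 1 / ?t" using tb(3) x(3) n8 by (simp add: field_simps)
      then have "ln ((8 * ?n) ^ 2) \<le> ln (1 / ?t)" by (subst ln_le_cancel_iff) (use n8 x(3) in auto)
      then have l1: "2 * ln (8 * ?n) \<le> ln (1 / ?t)" using n8 by (simp add: ln_realpow)
      have "\<rho> * (2 * ?n) \<le> (4 * ?t) * (2 * ?n)" using \<rho>(3) by (intro mult_right_mono) auto
      moreover have "\<rho> * (2 * k) = 2 * \<rho> * k" "(4 * ?t) * (2 * k) = 8 * k * ?t" for k :: real by simp_all
      ultimately have "2 * \<rho> * ?n \<le> 8 * ?n * ?t" by metis
      moreover have r0: "0 < \<rho>" using \<rho>(2) x(3) by linarith
      have rp: "0 < 2 * \<rho> * ?n" by (intro mult_pos_pos r0) auto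
      ultimately have "ln (2 * \<rho> * ?n) \<le> ln (8 * ?n * ?t)" by (subst ln_le_cancel_iff) auto
      also have "\<dots> = ln (8 * ?n) + ln ?t" using n8 x(3) by (intro ln_mult_pos) auto
      finally have "ln (2 * \<rho> * ?n) \<le> ln (8 * ?n) + ln ?t" .
      moreover have "ln (1 / (2 * \<rho> * ?n)) = - ln (2 * \<rho> * ?n)"       proof -
        have "ln (1 / y) = - ln y" if "0 < y" for y :: real using that by (simp add: ln_div)
        then show ?thesis using rp by blast
      qed
      moreover have "ln (1 / ?t) = - ln ?t" using x(3) by (simp add: ln_div)
      ultimately show ?thesis using l1 by linarith
    qed
    then have "(1 + ln (1 / (2 * \<rho> * ?n))) powr (- ?\<beta>) \<le> (ln (1 / ?t) / 2) powr (- ?\<beta>)"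
      using lt \<beta> by (intro powr_mono2') auto
    also have "\<dots> = (1 / 2) powr (- ?\<beta>) * ln (1 / ?t) powr (- ?\<beta>)"
      by (simp add: powr_mult[symmetric])
    finally have "C * (1 + ln (1 / (2 * \<rho> * ?n))) powr (- ?\<beta>) \<le> C * ((1 / 2) powr (- ?\<beta>) * ln (1 / ?t) powr (- ?\<beta>))"
      using C by (intro mult_left_mono) auto
    with o have o2: "\<bar>u x - u x'\<bar> ^ Suc m \<le> (C * (1 / 2) powr (- ?\<beta>)) * ln (1 / ?t) powr (- ?\<beta>)" by linarith
    have "\<bar>u x - u x'\<bar> = (\<bar>u x - u x'\<bar> ^ Suc m) powr (1 / ?n)"
    proof (cases "u x = u x'")
      case False
      then show ?thesis by (subst powr_realpow[symmetric]) (auto simp: powr_powr simp del: of_nat_Suc)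
    qed simp
    also have "\<dots> \<le> ((C * (1 / 2) powr (- ?\<beta>)) * ln (1 / ?t) powr (- ?\<beta>)) powr (1 / ?n)"
      using o2 by (intro powr_mono2) auto
    also have "\<dots> = (C * (1 / 2) powr (- ?\<beta>)) powr (1 / ?n) * ln (1 / ?t) powr (- \<gamma>)"
    proof -
      have "- ?\<beta> * (1 / ?n) = - \<gamma>" by (simp only: \<gamma>_def times_divide_eq_right mult_1_right minus_divide_left)
      then have "(ln (1 / ?t) powr (- ?\<beta>)) powr (1 / ?n) = ln (1 / ?t) powr (- \<gamma>)" by (simp only: powr_powr)
      then show ?thesis by (simp only: powr_mult[of "C * (1 / 2) powr (- ?\<beta>)"])
    qed
    also have "\<dots> \<le> C' * ln (1 / ?t) powr (- \<gamma>)" by (intro mult_right_mono) (auto simp: C'_def)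
    also have "ln (1 / ?t) = \<bar>ln ?t\<bar>" using lt x(3) by (simp add: ln_div)
    finally show ?thesis .
  qed
  then show ?thesis using \<gamma> C' t0 Nul by blast
qed

end

section \<open>The continuous representative\<close>

lemma log_modulus_tendsto_0:
  assumes "0 < \<gamma>"
  shows "((\<lambda>t. C * \<bar>ln t\<bar> powr (- \<gamma>)) \<longlongrightarrow> 0) (at_right (0::real))"
proof -
  have "filterlim (\<lambda>t::real. - ln t) at_top (at_right 0)"
    by (rule filterlim_compose[OF filterlim_uminus_at_top_at_bot ln_at_0])
  then have "filterlim (\<lambda>t::real. \<bar>ln t\<bar>) at_top (at_right 0)"
    by (rule filterlim_at_top_mono) (auto intro!: always_eventually)
  then have "((\<lambda>t. \<bar>ln t\<bar> powr (- \<gamma>)) \<longlongrightarrow> 0) (at_right (0::real))"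
    using assms by (intro tendsto_neg_powr) auto
  then show ?thesis by (rule tendsto_mult_right_zero)
qed

lemma log_modulus_small:
  fixes C \<gamma> e :: real
  assumes "0 < \<gamma>" "0 < e"
  obtains \<tau> :: real where "0 < \<tau>" "\<forall>t. 0 < t \<longrightarrow> t < \<tau> \<longrightarrow> C * \<bar>ln t\<bar> powr (- \<gamma>) < e"
proof -
  have "eventually (\<lambda>t::real. C * \<bar>ln t\<bar> powr (- \<gamma>) < e) (at_right 0)"
    using assms(2) by (intro order_tendstoD(2)[OF log_modulus_tendsto_0[OF assms(1)]]) auto
  then obtain \<tau> where "0 < \<tau> \<and> (\<forall>t>0. t < \<tau> \<longrightarrow> C * \<bar>ln t\<bar> powr (- \<gamma>) < e)"
    unfolding eventually_at_right_field by auto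
  then show ?thesis by (intro that[of \<tau>]) auto
qed

text \<open>Two sets, because only the first point is confined to a compact set, while the second
  may be any nearby point of the domain. The bound t0 < 1 keeps the logarithm away from 0.\<close>

definition log_modulus :: "'a::real_normed_vector set \<Rightarrow> 'a set \<Rightarrow> ('a \<Rightarrow> real) \<Rightarrow> bool" where
  "log_modulus K S u \<longleftrightarrow> (\<exists>\<gamma> C t0. 0 < \<gamma> \<and> 0 < C \<and> 0 < t0 \<and> t0 < 1 \<and>
     (\<forall>x\<in>K. \<forall>x'\<in>S. 0 < norm (x - x') \<and> norm (x - x') < t0 \<longrightarrow> \<bar>u x - u x'\<bar> \<le> C * \<bar>ln (norm (x - x'))\<bar> powr (- \<gamma>)))"

lemma log_modulusI:
  assumes "0 < \<gamma>" "0 < C" "0 < t0" "t0 < 1"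
    "\<And>x x'. x \<in> K \<Longrightarrow> x' \<in> S \<Longrightarrow> 0 < norm (x - x') \<Longrightarrow> norm (x - x') < t0 \<Longrightarrow> \<bar>u x - u x'\<bar> \<le> C * \<bar>ln (norm (x - x'))\<bar> powr (- \<gamma>)"
  shows "log_modulus K S u"
  unfolding log_modulus_def by (rule exI[of _ \<gamma>], rule exI[of _ C], rule exI[of _ t0]) (use assms in auto)

lemma log_modulusE:
  assumes "log_modulus K S u"
  obtains \<gamma> C t0 where "0 < \<gamma>" "0 < C" "0 < t0" "t0 < 1"
    "\<forall>x\<in>K. \<forall>x'\<in>S. 0 < norm (x - x') \<longrightarrow> norm (x - x') < t0 \<longrightarrow> \<bar>u x - u x'\<bar> \<le> C * \<bar>ln (norm (x - x'))\<bar> powr (- \<gamma>)"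
proof -
  from assms[unfolded log_modulus_def] obtain \<gamma> C t0 where h: "0 < \<gamma> \<and> 0 < C \<and> 0 < t0 \<and> t0 < 1 \<and>
     (\<forall>x\<in>K. \<forall>x'\<in>S. 0 < norm (x - x') \<and> norm (x - x') < t0 \<longrightarrow> \<bar>u x - u x'\<bar> \<le> C * \<bar>ln (norm (x - x'))\<bar> powr (- \<gamma>))"
    by (elim exE)
  show ?thesis by (rule that[of \<gamma> C t0]) (use h in auto)
qed

lemma log_modulus_mono:
  assumes "log_modulus K S u" "K' \<subseteq> K" "S' \<subseteq> S"
  shows "log_modulus K' S' u"
  using assms(1)
proof (rule log_modulusE)
  fix \<gamma> C t0 :: real
  assume h: "0 < \<gamma>" "0 < C" "0 < t0" "t0 < 1"
    "\<forall>x\<in>K. \<forall>x'\<in>S. 0 < norm (x - x') \<longrightarrow> norm (x - x') < t0 \<longrightarrow> \<bar>u x - u x'\<bar> \<le> C * \<bar>ln (norm (x - x'))\<bar> powr (- \<gamma>)"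
  show ?thesis by (rule log_modulusI[OF h(1-4)]) (use h(5) assms(2,3) in auto)
qed

text \<open>The modulus makes u uniformly continuous on S near every point of D, so limits along
  points of S exist; the same inequality then passes to the limit.\<close>

lemma extend_log_modulus:
  fixes u :: "'a::euclidean_space \<Rightarrow> real"
  assumes D: "open D"
    and dense: "\<And>x e. 0 < e \<Longrightarrow> \<exists>y\<in>S. norm (y - x) < e"
    and modulus: "\<And>K. compact K \<Longrightarrow> K \<subseteq> D \<Longrightarrow> log_modulus (K \<inter> S) S u"
  shows "\<exists>v. (\<forall>x\<in>S. v x = u x) \<and> (\<forall>K. compact K \<and> K \<subseteq> D \<longrightarrow> log_modulus K D v)"
proof -
  \<comment> \<open>Approximating sequences are fixed once and for all, constant at points of S, so
    that the limit leaves u unchanged there.\<close>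
  define s where "s x n = (if x \<in> S then x else (SOME y. y \<in> S \<and> norm (y - x) < inverse (real (Suc n))))" for x and n :: nat
  have s: "s x n \<in> S \<and> norm (s x n - x) < inverse (real (Suc n))" for x n
  proof (cases "x \<in> S")
    case False
    have "\<exists>y. y \<in> S \<and> norm (y - x) < inverse (real (Suc n))" using dense[of "inverse (real (Suc n))" x] by auto
    from someI_ex[OF this] show ?thesis using False unfolding s_def by simp
  qed (simp add: s_def)
  have slim: "s x \<longlonglongrightarrow> x" for x
  proof -
    have "(\<lambda>n. norm (s x n - x)) \<longlonglongrightarrow> 0"
    proof (rule tendsto_sandwich[OF _ _ tendsto_const LIMSEQ_inverse_real_of_nat])
      show "eventually (\<lambda>n. norm (s x n - x) \<le> inverse (real (Suc n))) sequentially"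
        using s less_imp_le by (intro always_eventually allI) blast
    qed simp
    then show ?thesis by (simp add: tendsto_norm_zero_iff LIM_zero_iff)
  qed
  define v where "v x = lim (\<lambda>n. u (s x n))" for x
  have vS: "v x = u x" if "x \<in> S" for x
    using that by (simp add: v_def s_def)
  have vlim: "(\<lambda>n. u (s x n)) \<longlonglongrightarrow> v x" if x: "x \<in> D" for x
  proof -
    obtain \<epsilon> where \<epsilon>: "0 < \<epsilon>" "cball x \<epsilon> \<subseteq> D" using D x open_contains_cball by blast
    obtain \<gamma> C t0 where g: "0 < \<gamma>" "0 < C" "0 < t0" "t0 < 1"
        and mo: "\<forall>x\<in>(cball x \<epsilon> \<inter> S). \<forall>x'\<in>S. 0 < norm (x - x') \<longrightarrow> norm (x - x') < t0 \<longrightarrow> \<bar>u x - u x'\<bar> \<le> C * \<bar>ln (norm (x - x'))\<bar> powr (- \<gamma>)"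
      using modulus[OF compact_cball \<epsilon>(2)] by (rule log_modulusE)
    have "Cauchy (\<lambda>n. u (s x n))"
    proof (rule metric_CauchyI)
      fix e :: real assume "0 < e"
      obtain \<tau> where \<tau>: "0 < \<tau>" "\<forall>t. 0 < t \<longrightarrow> t < \<tau> \<longrightarrow> C * \<bar>ln t\<bar> powr (- \<gamma>) < e"
        by (rule log_modulus_small[where C = C, OF g(1) \<open>0 < e\<close>])
      define \<eta> where "\<eta> = min \<epsilon> (min (t0 / 2) (\<tau> / 2))"
      have "0 < \<eta>" using \<epsilon> g \<tau> by (simp add: \<eta>_def)
      then have "eventually (\<lambda>n. dist (s x n) x < \<eta>) sequentially" using slim[of x] by (simp add: tendsto_iff)
      then obtain M where M: "\<And>n. M \<le> n \<Longrightarrow> norm (s x n - x) < \<eta>" by (auto simp: eventually_sequentially dist_norm)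
      show "\<exists>M. \<forall>m\<ge>M. \<forall>n\<ge>M. dist (u (s x m)) (u (s x n)) < e"
      proof (intro exI[of _ M] allI impI)
        fix m n assume mn: "M \<le> m" "M \<le> n"
        show "dist (u (s x m)) (u (s x n)) < e"
        proof (cases "s x m = s x n")
          case False
          have "norm (s x m - s x n) \<le> norm (s x m - x) + norm (s x n - x)" by (metis dist_norm dist_triangle2)
          then have nm: "norm (s x m - s x n) < 2 * \<eta>" using M[OF mn(1)] M[OF mn(2)] by linarith
          have "s x m \<in> cball x \<epsilon>" using M[OF mn(1)] by (auto simp: \<eta>_def dist_norm norm_minus_commute)
          then have "\<bar>u (s x m) - u (s x n)\<bar> \<le> C * \<bar>ln (norm (s x m - s x n))\<bar> powr (- \<gamma>)"
            using s False nm by (intro mo[rule_format]) (auto simp: \<eta>_def)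
          also have "\<dots> < e" using False nm by (intro \<tau>(2)[rule_format]) (auto simp: \<eta>_def)
          finally show ?thesis by (simp add: dist_real_def)
        qed (use \<open>0 < e\<close> in simp)
      qed
    qed
    then show ?thesis unfolding v_def by (simp add: Cauchy_convergent_iff convergent_LIMSEQ_iff)
  qed
  have "log_modulus K D v" if K: "compact K" "K \<subseteq> D" for K
  proof -
    obtain \<delta> where \<delta>: "0 < \<delta>" "(\<Union>x\<in>K. cball x \<delta>) \<subseteq> D"
      using compact_subset_open_imp_cball_epsilon_subset[OF K(1) D K(2)] by metis
    \<comment> \<open>The approximating points of a point of K need not lie in K, so the modulus is
      taken on a compact neighbourhood inside D.\<close>
    obtain \<gamma> C t0 where g: "0 < \<gamma>" "0 < C" "0 < t0" "t0 < 1"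
        and mo: "\<forall>x\<in>((\<Union>x\<in>K. cball x \<delta>) \<inter> S). \<forall>x'\<in>S. 0 < norm (x - x') \<longrightarrow> norm (x - x') < t0 \<longrightarrow> \<bar>u x - u x'\<bar> \<le> C * \<bar>ln (norm (x - x'))\<bar> powr (- \<gamma>)"
      using modulus[OF compact_minkowski_sum_cball[OF K(1)] \<delta>(2)] by (rule log_modulusE)
    have "\<bar>v x - v x'\<bar> \<le> C * \<bar>ln (norm (x - x'))\<bar> powr (- \<gamma>)"
      if x: "x \<in> K" "x' \<in> D" "0 < norm (x - x')" "norm (x - x') < t0" for x x'
    proof -
      have nl: "(\<lambda>n. norm (s x n - s x' n)) \<longlonglongrightarrow> norm (x - x')" by (intro tendsto_intros slim)
      \<comment> \<open>A nonzero logarithm is what makes the negative power continuous at this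
        distance.\<close>
      have "ln (norm (x - x')) \<noteq> 0" using x g by simp
      then have R: "(\<lambda>n. C * \<bar>ln (norm (s x n - s x' n))\<bar> powr (- \<gamma>)) \<longlonglongrightarrow> C * \<bar>ln (norm (x - x'))\<bar> powr (- \<gamma>)"
        using x(3) by (intro tendsto_intros nl) auto
      have L: "(\<lambda>n. \<bar>u (s x n) - u (s x' n)\<bar>) \<longlonglongrightarrow> \<bar>v x - v x'\<bar>"
        using x K by (intro tendsto_intros vlim) auto
      have "eventually (\<lambda>n. dist (s x n) x < \<delta>) sequentially" using slim[of x] \<delta>(1) by (simp add: tendsto_iff)
      moreover have "eventually (\<lambda>n. 0 < norm (s x n - s x' n)) sequentially" by (rule order_tendstoD(1)[OF nl x(3)])
      moreover have "eventually (\<lambda>n. norm (s x n - s x' n) < t0) sequentially" by (rule order_tendstoD(2)[OF nl x(4)])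
      ultimately have "eventually (\<lambda>n. \<bar>u (s x n) - u (s x' n)\<bar> \<le> C * \<bar>ln (norm (s x n - s x' n))\<bar> powr (- \<gamma>)) sequentially"
      proof eventually_elim
        case (elim n)
        have "s x n \<in> cball x \<delta>" using elim(1) by (simp add: dist_commute)
        then have "s x n \<in> (\<Union>x\<in>K. cball x \<delta>) \<inter> S" using x(1) s by blast
        then show ?case using elim s by (intro mo[rule_format]) auto
      qed
      then show ?thesis by (rule tendsto_le[OF sequentially_bot R L])
    qed
    then show ?thesis by (rule log_modulusI[OF g])
  qed
  then show ?thesis using vS by (intro exI[of _ v]) auto
qed

section \<open>Passage from Lebesgue measurable data on D to Borel functions\<close>

lemma borel_representative:
  fixes h :: "real^'n::finite \<Rightarrow> real"
  assumes D: "open D" and h: "h \<in> borel_measurable (lebesgue_on D)"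
  shows "\<exists>h'\<in>borel_measurable borel. (\<forall>x. x \<notin> D \<longrightarrow> h' x = 0) \<and> (AE x in lborel. x \<in> D \<longrightarrow> h' x = h x)"
proof -
  have DL: "D \<in> sets lebesgue" using D by simp
  have "(\<lambda>x. if x \<in> D then h x else 0) \<in> borel_measurable lebesgue"
    using h DL by (simp add: borel_measurable_if)
  from completion_ex_borel_measurable_real[OF this]
  obtain g where g: "g \<in> borel_measurable lborel" "AE x in lborel. (if x \<in> D then h x else 0) = g x" by blast
  have [measurable]: "g \<in> borel_measurable borel" "D \<in> sets borel" using g D by auto
  show ?thesis
  proof (intro bexI[of _ "\<lambda>x. g x * indicator D x"] conjI allI impI)
    show "(\<lambda>x. g x * indicator D x) \<in> borel_measurable borel" by measurable
    show "AE x in lborel. x \<in> D \<longrightarrow> g x * indicator D x = h x" using g(2) by eventually_elim auto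
  qed auto
qed

lemma lebesgue_on_transfer:
  fixes f f' :: "real^'n::finite \<Rightarrow> real"
  assumes D: "open D" and f: "f \<in> borel_measurable (lebesgue_on D)" and f': "f' \<in> borel_measurable borel"
    and f0: "\<And>x. x \<notin> D \<Longrightarrow> f' x = 0" and eq: "AE x in lborel. x \<in> D \<longrightarrow> f' x = f x"
  shows "integrable (lebesgue_on D) f \<longleftrightarrow> integrable lborel f'"
    and "(LINT x|lebesgue_on D. f x) = (\<integral>x. f' x \<partial>lborel)"
proof -
  have DL: "D \<inter> space lebesgue \<in> sets lebesgue" "D \<in> sets lebesgue" using D by auto
  let ?g = "\<lambda>x. indicator D x *\<^sub>R f x"
  have gm: "?g \<in> borel_measurable lebesgue"
    using f DL by (simp add: borel_measurable_restrict_space_iff)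
  have fm: "f' \<in> borel_measurable lebesgue" using f' by (intro measurable_completion) simp
  have "AE x in lborel. ?g x = f' x" using eq by eventually_elim (auto simp: f0 indicator_def)
  then have ae: "AE x in lebesgue. ?g x = f' x" by (simp only: AE_completion_iff)
  have "integrable (lebesgue_on D) f \<longleftrightarrow> integrable lebesgue ?g"
    by (rule integrable_restrict_space[OF DL(1)])
  also have "\<dots> \<longleftrightarrow> integrable lebesgue f'" by (rule integrable_cong_AE[OF gm fm ae])
  also have "\<dots> \<longleftrightarrow> integrable lborel f'" using f' by (intro integrable_completion) simp
  finally show "integrable (lebesgue_on D) f \<longleftrightarrow> integrable lborel f'" .
  have "(LINT x|lebesgue_on D. f x) = (LINT x|lebesgue. ?g x)" by (rule integral_restrict_space[OF DL(1)])
  also have "\<dots> = (LINT x|lebesgue. f' x)" by (rule integral_cong_AE[OF gm fm ae])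
  also have "\<dots> = (\<integral>x. f' x \<partial>lborel)" using f' by (intro integral_completion) simp
  finally show "(LINT x|lebesgue_on D. f x) = (\<integral>x. f' x \<partial>lborel)" .
qed

lemma powr_le_imp_le_power:
  fixes x U :: real
  assumes "0 \<le> x" "0 \<le> U" "0 < m" "x powr (real (Suc m) / real m) \<le> U ^ Suc m"
  shows "x \<le> U ^ m"
proof (rule ccontr)
  assume "\<not> x \<le> U ^ m"
  then have "U ^ m < x" by simp
  then have "(U ^ m) powr (real (Suc m) / real m) < x powr (real (Suc m) / real m)"
    using assms by (intro powr_less_mono2) auto
  moreover have "(U ^ m) powr (real (Suc m) / real m) = U ^ Suc m"
  proof (cases "U = 0")
    case True then show ?thesis using assms(3) by simp
  next
    case False
    then have U: "0 < U" using assms(2) by simp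
    have "(U ^ m) powr (real (Suc m) / real m) = (U powr real m) powr (real (Suc m) / real m)"
      using U by (simp add: powr_realpow)
    also have "\<dots> = U powr real (Suc m)" using assms(3) by (simp add: powr_powr del: of_nat_Suc)
    also have "\<dots> = U ^ Suc m" using U by (rule powr_realpow)
    finally show ?thesis .
  qed
  ultimately show False using assms(4) by linarith
qed

text \<open>A majorant of the coefficients gives b, e \<le> \<open>U ^ m\<close>, c \<le> U and d,
  f, g \<le> \<open>U ^ Suc m\<close>. Each term is then of degree m in Z, with an additional factor
  U in the bound for Y, and the structure conditions become homogeneous in Z.\<close>

lemma structure_bounds:
  fixes p X :: "'a::real_inner" and u b c d e f g a Y U :: real
  defines "Z \<equiv> norm p + U * (\<bar>u\<bar> + 1)"
  assumes m: "0 < m" and U: "1 \<le> U" and nonneg: "0 \<le> a" "0 \<le> b" "0 \<le> c" "0 \<le> d" "0 \<le> e" "0 \<le> f" "0 \<le> g"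
    and bounds: "b powr (real (Suc m) / real m) \<le> U ^ Suc m" "c powr real (Suc m) \<le> U ^ Suc m" "d \<le> U ^ Suc m"
      "e powr (real (Suc m) / real m) \<le> U ^ Suc m" "f \<le> U ^ Suc m" "g \<le> U ^ Suc m"
    and X: "norm X \<le> a * norm p ^ m + b * \<bar>u\<bar> ^ m + e" and Y: "\<bar>Y\<bar> \<le> c * norm p ^ m + d * \<bar>u\<bar> ^ m + f"
    and pX: "norm p ^ Suc m - d * \<bar>u\<bar> ^ Suc m - g \<le> p \<bullet> X"
  shows "norm X \<le> (a + 2) * Z ^ m" "\<bar>Y\<bar> \<le> 3 * U * Z ^ m"
    "norm p ^ Suc m - U ^ Suc m * \<bar>u\<bar> ^ Suc m - U ^ Suc m \<le> p \<bullet> X"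
proof -
  have U0: "0 \<le> U" using U by simp
  have Zb: "norm p ^ m \<le> Z ^ m" "U ^ m * \<bar>u\<bar> ^ m \<le> Z ^ m" "U ^ m \<le> Z ^ m"
  proof -
    have uu: "0 \<le> U * \<bar>u\<bar>" using U0 by simp
    have z: "norm p \<le> Z" "U * \<bar>u\<bar> \<le> Z" "U \<le> Z" using uu U0 by (simp_all add: Z_def distrib_left)
    show "norm p ^ m \<le> Z ^ m" "U ^ m \<le> Z ^ m" using z U0 by (auto intro: power_mono)
    show "U ^ m * \<bar>u\<bar> ^ m \<le> Z ^ m" using power_mono[OF z(2) uu, of m] by (simp add: power_mult_distrib)
  qed
  have b: "b \<le> U ^ m" and e: "e \<le> U ^ m" using bounds nonneg U0 m by (auto intro: powr_le_imp_le_power)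
  have c: "c \<le> U"
  proof (cases "c = 0")
    case False
    then have "c ^ Suc m \<le> U ^ Suc m" using bounds(2) nonneg by (simp only: powr_realpow)
    then show ?thesis using U0 by (rule power_le_imp_le_base)
  qed (use U0 in simp)
  have "a * norm p ^ m + b * \<bar>u\<bar> ^ m + e \<le> a * Z ^ m + U ^ m * \<bar>u\<bar> ^ m + U ^ m"
    using Zb nonneg b e by (intro add_mono mult_left_mono mult_right_mono) auto
  also have "\<dots> \<le> a * Z ^ m + Z ^ m + Z ^ m" using Zb by linarith
  also have "\<dots> = (a + 2) * Z ^ m" by (simp add: distrib_right)
  finally show "norm X \<le> (a + 2) * Z ^ m" using X by linarith
  have "c * norm p ^ m + d * \<bar>u\<bar> ^ m + f \<le> U * Z ^ m + U ^ Suc m * \<bar>u\<bar> ^ m + U ^ Suc m"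
    using Zb nonneg c bounds U0 by (intro add_mono mult_mono mult_right_mono) auto
  also have "\<dots> = U * (Z ^ m + U ^ m * \<bar>u\<bar> ^ m + U ^ m)" by (simp add: algebra_simps)
  also have "\<dots> \<le> U * (Z ^ m + Z ^ m + Z ^ m)" using Zb U0 by (intro mult_left_mono add_mono) auto
  also have "\<dots> = 3 * U * Z ^ m" by simp
  finally show "\<bar>Y\<bar> \<le> 3 * U * Z ^ m" using Y by linarith
  have "d * \<bar>u\<bar> ^ Suc m \<le> U ^ Suc m * \<bar>u\<bar> ^ Suc m" using bounds(3) by (intro mult_right_mono) auto
  then show "norm p ^ Suc m - U ^ Suc m * \<bar>u\<bar> ^ Suc m - U ^ Suc m \<le> p \<bullet> X" using pX bounds(6) by linarith
qed

lemma borel_representative_vec: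
  fixes h :: "real^'n::finite \<Rightarrow> real^'n"
  assumes D: "open D" and h: "h \<in> borel_measurable (lebesgue_on D)"
  shows "\<exists>h'\<in>borel_measurable borel. (\<forall>x. x \<notin> D \<longrightarrow> h' x = 0) \<and> (AE x in lborel. x \<in> D \<longrightarrow> h' x = h x)"
proof -
  have hi: "(\<lambda>x. h x $ i) \<in> borel_measurable (lebesgue_on D)" for i
    by (rule measurable_compose[OF h borel_measurable_continuous_onI]) (intro continuous_intros)
  have "\<forall>i. \<exists>g. g \<in> borel_measurable borel \<and> (\<forall>x. x \<notin> D \<longrightarrow> g x = 0) \<and> (AE x in lborel. x \<in> D \<longrightarrow> g x = h x $ i)"
    using borel_representative[OF D hi] by blast
  then obtain g where g: "\<And>i. g i \<in> borel_measurable borel" "\<And>i x. x \<notin> D \<Longrightarrow> g i x = 0" "\<And>i. AE x in lborel. x \<in> D \<longrightarrow> g i x = h x $ i"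
    by (auto dest!: choice)
  show ?thesis
  proof (intro bexI[of _ "\<lambda>x. \<chi> i. g i x"] conjI allI impI)
    show "(\<lambda>x. \<chi> i. g i x) \<in> borel_measurable borel"
    proof -
      have "(\<lambda>x. \<chi> i. g i x) = (\<lambda>x. \<Sum>i\<in>UNIV. g i x *\<^sub>R axis i 1)"
        by (auto simp: vec_eq_iff axis_def if_distrib cong: if_cong)
      moreover have "(\<lambda>x. \<Sum>i\<in>UNIV. g i x *\<^sub>R (axis i 1 :: real^'n)) \<in> borel_measurable borel"
        using g(1) by measurable
      ultimately show ?thesis by simp
    qed
    show "(\<chi> i. g i x) = 0" if "x \<notin> D" for x using g(2)[OF that] by (simp add: vec_eq_iff)
    have "AE x in lborel. \<forall>i\<in>UNIV. x \<in> D \<longrightarrow> g i x = h x $ i" using g(3) by (intro AE_finite_allI) auto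
    then show "AE x in lborel. x \<in> D \<longrightarrow> (\<chi> i. g i x) = h x" by eventually_elim (auto simp: vec_eq_iff)
  qed
qed

lemma borel_imp_lebesgue_on:
  "f \<in> borel_measurable borel \<Longrightarrow> f \<in> borel_measurable (lebesgue_on D)"
  by (intro measurable_restrict_space1 measurable_completion) simp

section \<open>Reduction to a Borel solution and construction of the continuous
  representative\<close>

theorem theorem1p4:
  fixes D :: "(real^'n::finite) set"
    and A :: "real^'n \<Rightarrow> real \<Rightarrow> real^'n \<Rightarrow> real^'n"
    and B :: "real^'n \<Rightarrow> real \<Rightarrow> real^'n \<Rightarrow> real"
    and a r :: real
    and b c d e f g u :: "real^'n \<Rightarrow> real"
  assumes "CARD('n) \<ge> 2"
    and "bounded D" and "connected D" and "open D"
    and "(real CARD('n) - 1) / real CARD('n) < r" and "r < 1"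
    and "structure_conditions D A B a b c d e f g"
    and "integrability_conditions r D b c d e f g"
    and "weak_solution D A B u"
  shows "\<exists>v :: real^'n \<Rightarrow> real.
           (AE x in lebesgue_on D. v x = u x) \<and> continuous_on D v \<and>
           (\<forall>D'. compact D' \<and> D' \<subseteq> D \<longrightarrow>
              (\<exists>\<gamma> K R :: real. \<gamma> > 0 \<and> K > 0 \<and> R > 0 \<and>
                 (\<forall>x0\<in>D'. \<forall>x\<in>D. 0 < norm (x - x0) \<and> norm (x - x0) < R\<^sup>2 \<longrightarrow>
                    \<bar>v x - v x0\<bar> \<le> K * \<bar>ln (norm (x - x0))\<bar> powr (- \<gamma>))))"
proof -
  define m where "m = CARD('n) - 1"
  have N: "CARD('n) = Suc m" and m: "0 < m" using assms(1) by (auto simp: m_def)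
  have rN: "real CARD('n) = real (Suc m)" "real (Suc m) - 1 = real m" by (simp_all add: N)
  define s where "s = real m / r"
  have "0 < real m / real (Suc m)" using m by simp
  then have "0 < r" using assms(5) unfolding rN by linarith
  then have s: "real m < s" using assms(6) m by (simp add: s_def field_simps)
  \<comment> \<open>Since r < 1, the exponent s = m / r of the integrability conditions exceeds m,
    and \<sigma> can be placed halfway.\<close>
  define \<sigma> where "\<sigma> = (real m + s) / 2"
  have \<sigma>: "real m < \<sigma>" "\<sigma> < s" using s by (auto simp: \<sigma>_def)
  note D = assms(4,2)
  have DB[measurable]: "D \<in> sets borel" using D by simp
  have DL: "D \<inter> space lebesgue \<in> sets lebesgue" using D by auto
  have a0: "0 < a" and nn: "\<And>x. x \<in> D \<Longrightarrow> 0 \<le> b x \<and> 0 \<le> c x \<and> 0 \<le> d x \<and> 0 \<le> e x \<and> 0 \<le> f x \<and> 0 \<le> g x"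
    and strc: "\<And>x u p. x \<in> D \<Longrightarrow> norm (A x u p) \<le> a * norm p ^ m + b x * \<bar>u\<bar> ^ m + e x \<and>
        \<bar>B x u p\<bar> \<le> c x * norm p ^ m + d x * \<bar>u\<bar> ^ m + f x \<and>
        p \<bullet> A x u p \<ge> norm p ^ Suc m - d x * \<bar>u\<bar> ^ Suc m - g x"
    using assms(7) unfolding structure_conditions_def N by auto
  obtain G where sob: "sobolev_with_gradient (real CARD('n)) D u G"
    and Am: "(\<lambda>x. A x (u x) (G x)) \<in> borel_measurable (lebesgue_on D)"
    and Bm: "(\<lambda>x. B x (u x) (G x)) \<in> borel_measurable (lebesgue_on D)"
    and weak: "\<And>\<phi>. \<phi> \<in> test_functions D \<Longrightarrow> integrable (lebesgue_on D)
               (\<lambda>x. grad \<phi> x \<bullet> A x (u x) (G x) + \<phi> x * B x (u x) (G x)) \<and>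
             (LINT x|lebesgue_on D. grad \<phi> x \<bullet> A x (u x) (G x) + \<phi> x * B x (u x) (G x)) = 0"
    using assms(9) unfolding weak_solution_def by blast
  have um: "u \<in> borel_measurable (lebesgue_on D)" and uint: "integrable (lebesgue_on D) (\<lambda>x. norm (u x) powr real CARD('n))"
    and Gm: "G \<in> borel_measurable (lebesgue_on D)" and Gint: "integrable (lebesgue_on D) (\<lambda>x. norm (G x) powr real CARD('n))"
    and wg: "weak_gradient D u G"
    using sob by (auto simp: sobolev_with_gradient_def Lp_on_def)
  obtain u' where u': "u' \<in> borel_measurable borel" "\<And>x. x \<notin> D \<Longrightarrow> u' x = 0" "AE x in lborel. x \<in> D \<longrightarrow> u' x = u x"
    using borel_representative[OF D(1) um] by blast
  obtain G' where G': "G' \<in> borel_measurable borel" "\<And>x. x \<notin> D \<Longrightarrow> G' x = 0" "AE x in lborel. x \<in> D \<longrightarrow> G' x = G x"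
    using borel_representative_vec[OF D(1) Gm] by blast
  obtain a' where a': "a' \<in> borel_measurable borel" "\<And>x. x \<notin> D \<Longrightarrow> a' x = 0" "AE x in lborel. x \<in> D \<longrightarrow> a' x = A x (u x) (G x)"
    using borel_representative_vec[OF D(1) Am] by blast
  obtain b' where b': "b' \<in> borel_measurable borel" "\<And>x. x \<notin> D \<Longrightarrow> b' x = 0" "AE x in lborel. x \<in> D \<longrightarrow> b' x = B x (u x) (G x)"
    using borel_representative[OF D(1) Bm] by blast
  note [measurable] = u'(1) G'(1) a'(1) b'(1)
  define X where "X = LlogL s D"
  have coef: "(\<lambda>x. b x powr (real (Suc m) / real m)) \<in> X" "(\<lambda>x. c x powr real (Suc m)) \<in> X" "d \<in> X"
    "(\<lambda>x. e x powr (real (Suc m) / real m)) \<in> X" "f \<in> X" "g \<in> X"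
    using assms(8) unfolding integrability_conditions_def Let_def rN X_def s_def by auto
  \<comment> \<open>The six functions of the integrability conditions together with the constant 1.
    The constant makes the majorant at least 1 and belongs to the class because D is
    bounded.\<close>
  define W where "W i = (if i = 0 then \<lambda>x. b x powr (real (Suc m) / real m) else if i = 1 then \<lambda>x. c x powr real (Suc m) else if i = 2 then d
     else if i = 3 then \<lambda>x. e x powr (real (Suc m) / real m) else if i = 4 then f else if i = 5 then g else (\<lambda>_. 1))" for i :: nat
  have W1: "W 6 = (\<lambda>_. 1)" by (simp add: W_def)
  have WX: "W i \<in> X" if "i \<le> 6" for i
  proof (cases "i = 6")
    case True
    have "finite_measure (lebesgue_on D)"
      using lmeasurable_open[OF D(2,1)] by (rule finite_measure_lebesgue_on)
    then show ?thesis unfolding True W1 X_def LlogL_def by (auto intro: finite_measure.integrable_const)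
  next
    case False
    then have "i \<in> {0,1,2,3,4,5}" using that by auto
    then show ?thesis using coef by (auto simp: W_def)
  qed
  have Wm: "W i \<in> borel_measurable (lebesgue_on D)" if "i \<le> 6" for i
    using WX[OF that] by (simp add: X_def LlogL_def)
  \<comment> \<open>A pointwise maximum rather than a sum: at each point it equals one of the
    functions, so its logarithmic integrand is at most the sum of theirs.\<close>
  define V0 where "V0 x = Max ((\<lambda>i. W i x) ` {..6})" for x
  have V0m: "V0 \<in> borel_measurable (lebesgue_on D)"
    unfolding V0_def by (intro borel_measurable_Max) (auto intro: Wm)
  have WV: "W i x \<le> V0 x" if "i \<le> 6" for i x unfolding V0_def using that by (intro Max_ge) auto
  have V01: "1 \<le> V0 x" for x using WV[of 6 x] by (simp add: W1)
  obtain V' where V': "V' \<in> borel_measurable borel" "AE x in lborel. x \<in> D \<longrightarrow> V' x = V0 x"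
    using borel_representative[OF D(1) V0m] by blast
  \<comment> \<open>The Borel version agrees with \<open>V0\<close> only almost everywhere; the
    maximum with 1 restores the lower bound at every point of D, and the indicator makes V vanish
    outside.\<close>
  define V where "V x = max 1 (V' x) * indicator D x" for x
  have Vm[measurable]: "V \<in> borel_measurable borel" unfolding V_def using V'(1) by measurable
  have V: "0 \<le> V x" "x \<in> D \<Longrightarrow> 1 \<le> V x" for x by (auto simp: V_def)
  have VV0: "AE x in lborel. x \<in> D \<longrightarrow> V x = V0 x"
    using V'(2)
  proof eventually_elim
    case (elim x) then show ?case using V01[of x] by (auto simp: V_def)
  qed
  define U where "U x = root (Suc m) (V x)" for x
  have UV: "U x ^ Suc m = V x" for x unfolding U_def by (rule real_root_pow_pos2) (use V in auto)
  have U1: "1 \<le> U x" if "x \<in> D" for x unfolding U_def using V(2)[OF that] by simp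
  have powr_eq: "t powr real CARD('n) = t ^ Suc m" if "0 \<le> t" for t :: real
  proof (cases "t = 0")
    case False then show ?thesis unfolding N using that by (intro powr_realpow) auto
  qed (simp add: N)
  have ufin: "(\<integral>\<^sup>+y. \<bar>u' y\<bar> ^ Suc m \<partial>lborel) < \<infinity>"
  proof -
    have "integrable lborel (\<lambda>y. \<bar>u' y\<bar> ^ Suc m)"
      using uint by (subst lebesgue_on_transfer(1)[OF D(1) borel_measurable_integrable[OF uint], symmetric])
        (use u' in \<open>auto simp: powr_eq elim!: eventually_mono simp del: power_Suc\<close>)
    from integrableD(2)[OF this] show ?thesis by (simp add: less_top[symmetric] del: power_Suc)
  qed
  have Gfin: "(\<integral>\<^sup>+y. norm (G' y) ^ Suc m \<partial>lborel) < \<infinity>"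
  proof -
    have "integrable lborel (\<lambda>y. norm (G' y) ^ Suc m)"
      using Gint by (subst lebesgue_on_transfer(1)[OF D(1) borel_measurable_integrable[OF Gint], symmetric])
        (use G' in \<open>auto simp: powr_eq elim!: eventually_mono simp del: power_Suc\<close>)
    from integrableD(2)[OF this] show ?thesis by (simp add: less_top[symmetric] del: power_Suc)
  qed
  have tfm: "\<phi> \<in> borel_measurable borel" "partial_deriv i \<phi> \<in> borel_measurable borel" "grad \<phi> \<in> borel_measurable borel"
    if "\<phi> \<in> test_functions D" for \<phi> i
  proof -
    have ck: "\<And>k. Ck k \<phi>" using that by (simp add: test_functions_def)
    show "\<phi> \<in> borel_measurable borel" by (rule Ck_measurable[OF ck])
    have cp: "\<And>i. continuous_on UNIV (partial_deriv i \<phi>)" using ck[of 1] by simp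
    then show "partial_deriv i \<phi> \<in> borel_measurable borel" by (rule borel_measurable_continuous_onI)
    have "continuous_on UNIV (grad \<phi>)" using cp by (auto simp: grad_def intro!: continuous_on_vec_lambda)
    then show "grad \<phi> \<in> borel_measurable borel" by (rule borel_measurable_continuous_onI)
  qed
  have wgrad: "(\<integral>y. u' y * partial_deriv i \<phi> y \<partial>lborel) = - (\<integral>y. G' y $ i * \<phi> y \<partial>lborel)"
    if \<phi>: "\<phi> \<in> test_functions D" for \<phi> i
  proof -
    have Gi: "(\<lambda>x. G x $ i) \<in> borel_measurable (lebesgue_on D)"
      by (rule measurable_compose[OF Gm borel_measurable_continuous_onI]) (intro continuous_intros)
    have Gi': "(\<lambda>x. G' x $ i) \<in> borel_measurable borel"
      by (rule measurable_compose[OF G'(1) borel_measurable_continuous_onI]) (intro continuous_intros)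
    have "(LINT x|lebesgue_on D. u x * partial_deriv i \<phi> x) = (\<integral>y. u' y * partial_deriv i \<phi> y \<partial>lborel)"
      by (rule lebesgue_on_transfer(2)[OF D(1)])
         (use um u' tfm[OF \<phi>] borel_imp_lebesgue_on in \<open>auto intro!: borel_measurable_times elim!: eventually_mono\<close>)
    moreover have "(LINT x|lebesgue_on D. G x $ i * \<phi> x) = (\<integral>y. G' y $ i * \<phi> y \<partial>lborel)"
      by (rule lebesgue_on_transfer(2)[OF D(1)])
         (use Gi Gi' G' tfm[OF \<phi>] borel_imp_lebesgue_on in \<open>auto intro!: borel_measurable_times elim!: eventually_mono\<close>)
    ultimately show ?thesis using wg \<phi> unfolding weak_gradient_def by auto
  qed
  have weak': "integrable lborel (\<lambda>y. grad \<phi> y \<bullet> a' y + \<phi> y * b' y) \<and> (\<integral>y. grad \<phi> y \<bullet> a' y + \<phi> y * b' y \<partial>lborel) = 0"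
    if \<phi>: "\<phi> \<in> test_functions D" for \<phi>
  proof -
    note [measurable] = tfm[OF \<phi>]
    have m': "(\<lambda>y. grad \<phi> y \<bullet> a' y + \<phi> y * b' y) \<in> borel_measurable borel" by measurable
    have ae: "AE x in lborel. x \<in> D \<longrightarrow> grad \<phi> x \<bullet> a' x + \<phi> x * b' x = grad \<phi> x \<bullet> A x (u x) (G x) + \<phi> x * B x (u x) (G x)"
      using a'(3) b'(3) by eventually_elim auto
    show ?thesis
      using lebesgue_on_transfer[OF D(1) borel_measurable_integrable[OF conjunct1[OF weak[OF \<phi>]]] m' _ ae] weak[OF \<phi>] a'(2) b'(2) by auto
  qed
  have VlogV: "(\<integral>\<^sup>+y\<in>D. ennreal (V y * ln (V y + 1) powr s) \<partial>lborel) < \<infinity>"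
  proof -
    let ?h = "\<lambda>x. \<Sum>i\<le>6. \<bar>W i x\<bar> * ln (\<bar>W i x\<bar> + 1) powr s"
    have int: "integrable (lebesgue_on D) ?h"
      using WX by (intro Bochner_Integration.integrable_sum) (auto simp: X_def LlogL_def)
    obtain h' where h': "h' \<in> borel_measurable borel" "\<And>x. x \<notin> D \<Longrightarrow> h' x = 0" "AE x in lborel. x \<in> D \<longrightarrow> h' x = ?h x"
      using borel_representative[OF D(1) borel_measurable_integrable[OF int]] by blast
    have "integrable lborel h'"
      using int lebesgue_on_transfer(1)[OF D(1) borel_measurable_integrable[OF int] h'] by simp
    have "(\<integral>\<^sup>+y\<in>D. ennreal (V y * ln (V y + 1) powr s) \<partial>lborel) \<le> (\<integral>\<^sup>+y. ennreal (norm (h' y)) \<partial>lborel)"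
    proof (rule nn_integral_mono_AE)
      show "AE y in lborel. ennreal (V y * ln (V y + 1) powr s) * indicator D y \<le> ennreal (norm (h' y))"
        using VV0 h'(3)
      proof eventually_elim
        case (elim y)
        show ?case
        proof (cases "y \<in> D")
          case True
          have "V0 y \<in> (\<lambda>i. W i y) ` {..6}" unfolding V0_def by (rule Max_in) auto
          then obtain i where i: "i \<le> 6" "V0 y = W i y" by auto
          have "V y * ln (V y + 1) powr s = \<bar>W i y\<bar> * ln (\<bar>W i y\<bar> + 1) powr s"
            using elim True i V01[of y] by simp
          also have "\<dots> \<le> ?h y" using i by (intro member_le_sum) auto
          also have "\<dots> \<le> norm (h' y)" using elim True by simp
          finally show ?thesis using True by (simp add: ennreal_leI)
        qed simp
      qed
    qed
    also have "\<dots> < \<infinity>" using \<open>integrable lborel h'\<close> by (simp only: integrable_iff_bounded)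
    finally show ?thesis .
  qed
  have struct: "AE y in lborel. y \<in> D \<longrightarrow>
       norm (a' y) \<le> (a + 2) * (norm (G' y) + U y * (\<bar>u' y\<bar> + 1)) ^ m \<and>
       \<bar>b' y\<bar> \<le> 3 * U y * (norm (G' y) + U y * (\<bar>u' y\<bar> + 1)) ^ m \<and>
       norm (G' y) ^ Suc m - V y * \<bar>u' y\<bar> ^ Suc m - V y \<le> G' y \<bullet> a' y"
    using VV0 u'(3) G'(3) a'(3) b'(3)
  proof eventually_elim
    case (elim y)
    show ?case
    proof
      assume y: "y \<in> D"
      have eqs: "V y = V0 y" "u' y = u y" "G' y = G y" "a' y = A y (u y) (G y)" "b' y = B y (u y) (G y)"
        using elim y by auto
      have Wb: "W i y \<le> U y ^ Suc m" if "i \<le> 6" for i using WV[OF that, of y] unfolding UV eqs .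
      have bd: "b y powr (real (Suc m) / real m) \<le> U y ^ Suc m" "c y powr real (Suc m) \<le> U y ^ Suc m" "d y \<le> U y ^ Suc m"
        "e y powr (real (Suc m) / real m) \<le> U y ^ Suc m" "f y \<le> U y ^ Suc m" "g y \<le> U y ^ Suc m"
        using Wb[of 0] Wb[of 1] Wb[of 2] Wb[of 3] Wb[of 4] Wb[of 5] by (simp_all add: W_def)
      have nny: "0 \<le> a" "0 \<le> b y" "0 \<le> c y" "0 \<le> d y" "0 \<le> e y" "0 \<le> f y" "0 \<le> g y" using nn[OF y] a0 by auto
      have st: "norm (A y (u y) (G y)) \<le> a * norm (G y) ^ m + b y * \<bar>u y\<bar> ^ m + e y"
        "\<bar>B y (u y) (G y)\<bar> \<le> c y * norm (G y) ^ m + d y * \<bar>u y\<bar> ^ m + f y"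
        "norm (G y) ^ Suc m - d y * \<bar>u y\<bar> ^ Suc m - g y \<le> G y \<bullet> A y (u y) (G y)"
        using strc[OF y, of "u y" "G y"] by blast+
      show "norm (a' y) \<le> (a + 2) * (norm (G' y) + U y * (\<bar>u' y\<bar> + 1)) ^ m \<and>
       \<bar>b' y\<bar> \<le> 3 * U y * (norm (G' y) + U y * (\<bar>u' y\<bar> + 1)) ^ m \<and>
       norm (G' y) ^ Suc m - V y * \<bar>u' y\<bar> ^ Suc m - V y \<le> G' y \<bullet> a' y"
        using structure_bounds[OF m U1[OF y] nny bd st] unfolding eqs(2-5) UV by blast
    qed
  qed
  interpret borel_solution D u' V U b' G' a' m \<sigma> s "a + 2"
    by unfold_locales (fact N m \<sigma> D u'(1,2) G'(1,2) Vm ufin Gfin wgrad V UV U1 VlogV struct weak' | use a0 in simp)+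
  \<comment> \<open>The modulus comes with a null set for each compact set. An exhaustion by
    countably many compact sets leaves a single null set \<open>Z\<close>, whose complement is
    dense.\<close>
  obtain KK :: "nat \<Rightarrow> (real^'n) set" where KK: "\<And>n. compact (KK n)" "\<And>n. KK n \<subseteq> D" "\<And>K. compact K \<Longrightarrow> K \<subseteq> D \<Longrightarrow> \<exists>N. \<forall>n\<ge>N. K \<subseteq> KK n"
    by (rule open_Union_compact_subsets[OF D(1)]) blast
  define P where "P n Nul \<longleftrightarrow> Nul \<in> null_sets lborel \<and> log_modulus (KK n - Nul) (- Nul) u'" for n Nul
  have "\<exists>Nul. P n Nul" for n
  proof -
    have "\<exists>\<gamma> C t0 Nul. 0 < \<gamma> \<and> 0 < C \<and> 0 < t0 \<and> Nul \<in> null_sets lborel \<and> t0 < 1 \<and> (\<forall>x x'. x \<in> KK n - Nul \<and> x' \<notin> Nul \<and> 0 < norm (x - x') \<and> norm (x - x') < t0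
       \<longrightarrow> \<bar>u' x - u' x'\<bar> \<le> C * \<bar>ln (norm (x - x'))\<bar> powr (- \<gamma>))"
      using ae_modulus[OF KK(1,2), of n] by (elim exE bexE conjE) (intro exI conjI)
    then obtain \<gamma> C t0 Nul where h: "0 < \<gamma> \<and> 0 < C \<and> 0 < t0 \<and> Nul \<in> null_sets lborel \<and> t0 < 1 \<and> (\<forall>x x'. x \<in> KK n - Nul \<and> x' \<notin> Nul \<and> 0 < norm (x - x') \<and> norm (x - x') < t0
       \<longrightarrow> \<bar>u' x - u' x'\<bar> \<le> C * \<bar>ln (norm (x - x'))\<bar> powr (- \<gamma>))" by (elim exE)
    have "log_modulus (KK n - Nul) (- Nul) u'"
      by (rule log_modulusI[of \<gamma> C t0]) (use h in auto)
    then show ?thesis using h unfolding P_def by (intro exI[of _ Nul]) simp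
  qed
  then have "\<exists>Nul. \<forall>n. P n (Nul n)" by (intro choice allI)
  then obtain Nul where Nul: "\<And>n. P n (Nul n)" by blast
  define Z where "Z = (\<Union>n. Nul n)"
  have Z: "Z \<in> null_sets lborel" unfolding Z_def using Nul unfolding P_def by (intro null_sets_UN) blast
  have dense: "\<exists>y\<in>- Z. norm (y - x) < \<epsilon>" if \<epsilon>: "0 < \<epsilon>" for x \<epsilon>
  proof (rule ccontr)
    assume "\<not> ?thesis"
    then have "ball x \<epsilon> \<subseteq> Z" by (auto simp: dist_norm norm_minus_commute)
    then have "emeasure lborel (ball x \<epsilon>) \<le> emeasure lborel Z" using Z by (intro emeasure_mono) auto
    then have "emeasure lborel (ball x \<epsilon>) = 0" using Z by (simp add: null_sets_def)
    then show False using content_ball_pos[OF \<epsilon>, of x] by (simp add: measure_def)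
  qed
  have modulus: "log_modulus (K \<inter> - Z) (- Z) u'" if K: "compact K" "K \<subseteq> D" for K
  proof -
    obtain n where n: "K \<subseteq> KK n" using KK(3)[OF K] by blast
    have "log_modulus (KK n - Nul n) (- Nul n) u'" using Nul[of n] by (simp add: P_def)
    then show ?thesis by (rule log_modulus_mono) (use n in \<open>auto simp: Z_def\<close>)
  qed
  have "\<exists>v. (\<forall>x\<in>- Z. v x = u' x) \<and> (\<forall>K. compact K \<and> K \<subseteq> D \<longrightarrow> log_modulus K D v)"
    by (rule extend_log_modulus[OF D(1)]) (simp_all add: dense modulus)
  then obtain v where v: "\<forall>x\<in>- Z. v x = u' x" and vm: "\<forall>K. compact K \<and> K \<subseteq> D \<longrightarrow> log_modulus K D v"
    by (elim exE conjE)
  show ?thesis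
  proof (intro exI[of _ v] conjI allI impI)
    have "AE x in lborel. x \<in> D \<longrightarrow> v x = u x"
      using AE_not_in[OF Z] u'(3) by eventually_elim (auto simp: v)
    then have "AE x in lebesgue. x \<in> D \<longrightarrow> v x = u x" by (simp only: AE_completion_iff)
    then show "AE x in lebesgue_on D. v x = u x" by (subst AE_restrict_space_iff[OF DL])
    show "continuous_on D v"
      unfolding continuous_on_iff
    proof (intro ballI allI impI)
      fix x0 and \<epsilon> :: real assume x0: "x0 \<in> D" and \<epsilon>: "0 < \<epsilon>"
      have "log_modulus {x0} D v" using vm x0 by simp
      then obtain \<gamma> C t0 where g: "0 < \<gamma>" "0 < C" "0 < t0" "t0 < 1"
        and mo: "\<forall>x\<in>{x0}. \<forall>x'\<in>D. 0 < norm (x - x') \<longrightarrow> norm (x - x') < t0 \<longrightarrow> \<bar>v x - v x'\<bar> \<le> C * \<bar>ln (norm (x - x'))\<bar> powr (- \<gamma>)"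
        by (rule log_modulusE)
      obtain \<tau> where \<tau>: "0 < \<tau>" "\<forall>t. 0 < t \<longrightarrow> t < \<tau> \<longrightarrow> C * \<bar>ln t\<bar> powr (- \<gamma>) < \<epsilon>"
        by (rule log_modulus_small[where C = C, OF g(1) \<epsilon>])
      show "\<exists>\<delta>>0. \<forall>x'\<in>D. dist x' x0 < \<delta> \<longrightarrow> dist (v x') (v x0) < \<epsilon>"
      proof (intro exI[of _ "min t0 \<tau>"] conjI ballI impI)
        show "0 < min t0 \<tau>" using g \<tau> by simp
        fix x' assume x': "x' \<in> D" "dist x' x0 < min t0 \<tau>"
        show "dist (v x') (v x0) < \<epsilon>"
        proof (cases "x' = x0")
          case False
          then have p: "0 < norm (x0 - x')" "norm (x0 - x') < t0" "norm (x0 - x') < \<tau>"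
            using x'(2) by (auto simp: dist_norm norm_minus_commute)
          show ?thesis using mo[rule_format, OF singletonI x'(1) p(1,2)] \<tau>(2)[rule_format, OF p(1,3)] by (simp add: dist_real_def abs_minus_commute)
        qed (use \<epsilon> in simp)
      qed
    qed
  next
    fix D' assume "compact D' \<and> D' \<subseteq> D"
    then have "log_modulus D' D v" using vm by simp
    then obtain \<gamma> C t0 where g: "0 < \<gamma>" "0 < C" "0 < t0" "t0 < 1"
        and mo: "\<forall>x\<in>D'. \<forall>x'\<in>D. 0 < norm (x - x') \<longrightarrow> norm (x - x') < t0 \<longrightarrow> \<bar>v x - v x'\<bar> \<le> C * \<bar>ln (norm (x - x'))\<bar> powr (- \<gamma>)"
      by (rule log_modulusE)
    \<comment> \<open>As t0 < 1, the square only shrinks the range of distances, so R = t0 is a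
      valid choice.\<close>
    have "t0\<^sup>2 \<le> t0" using g by (simp add: power2_eq_square mult_left_le)
    have "\<bar>v x - v x0\<bar> \<le> C * \<bar>ln (norm (x - x0))\<bar> powr (- \<gamma>)"
      if "x0 \<in> D'" "x \<in> D" "0 < norm (x - x0) \<and> norm (x - x0) < t0\<^sup>2" for x0 x
      using mo[rule_format, OF that(1,2)] that(3) \<open>t0\<^sup>2 \<le> t0\<close> by (simp add: norm_minus_commute abs_minus_commute)
    then show "\<exists>\<gamma> K R. \<gamma> > 0 \<and> K > 0 \<and> R > 0 \<and>
                 (\<forall>x0\<in>D'. \<forall>x\<in>D. 0 < norm (x - x0) \<and> norm (x - x0) < R\<^sup>2 \<longrightarrow>
                    \<bar>v x - v x0\<bar> \<le> K * \<bar>ln (norm (x - x0))\<bar> powr (- \<gamma>))"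
      using g by (intro exI[of _ \<gamma>] exI[of _ C] exI[of _ t0] conjI ballI impI) auto
  qed
qed

end
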